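(* Let $\Omega\subset\mathbb R^n$ be a bounded open set with Lipschitz boundary and let $u$ be a harmonic function on $\Omega$ such that $$\Big(\sup_\Omega u-\inf_\Omega u\Big)\cdot\sup_\Omega|\nabla u|\le 1 .$$ Then $u$ is a Dirichlet minimizer of the homogeneous Mumford–Shah functional $$F_0(v):=\int_{\Omega}|\nabla v|^2\,dx+\mathcal H^{n-1}(Sv),\qquad v\in SBV(\Omega),$$ that is, $F_0(u)\le F_0(v)$ for every $v\in SBV(\Omega)$ with the same trace as $u$ on $\partial\Omega$.
   Context: For $v\in BV(\Omega)$: $Sv$ is the set of points of $\Omega$ where $v$ has no approximate limit, where $v$ has approximate limit $a$ at $x$ if $\lim_{r\to0}r^{-n}\int_{B(x,r)}|v(y)-a|\,dy=0$; $\nabla v$ is the approximate gradient (density of $Dv$ with respect to Lebesgue measure $\mathcal L^n$). $SBV(\Omega)$ is the space of $v\in BV(\Omega)$ such that $Dv=\nabla v\cdot\mathcal L^n+(v^+-v^-)\nu_v\cdot\mathcal H^{n-1}\llcorner Sv$, with $v^\pm$ the approximate one-sided limits on $Sv$ and $\nu_v$ the approximate unit normal to $Sv$ pointing from the side of $v^-$ to that of $v^+$ (i.e. the Cantor part of $Dv$ vanishes). *)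

theory Defs
  imports "HOL-Analysis.Analysis"
begin

subsection \<open>Hausdorff measure\<close>

text \<open>
  The Hausdorff outer measure carries the factor \<open>\<omega>\<^sub>k / 2^k\<close>, where \<open>\<omega>\<^sub>k\<close> is the volume of the unit
  ball of dimension \<open>k\<close>, so that it agrees with surface area on \<open>k\<close>-dimensional surfaces and is the
  counting measure for \<open>k = 0\<close>. The library's \<^const>\<open>diameter\<close> is only meaningful on bounded sets,
  hence the boundedness condition on the covering sets.
\<close>

definition hausdorff_weight :: "nat \<Rightarrow> 'a::metric_space set \<Rightarrow> ennreal" where
  "hausdorff_weight k C =
     (if C = {} then 0 else ennreal (unit_ball_vol (real k) * (diameter C / 2) ^ k))"

definition hausdorff_pre :: "nat \<Rightarrow> real \<Rightarrow> 'a::metric_space set \<Rightarrow> ennreal" where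
  "hausdorff_pre k \<delta> A =
     (INF C \<in> {C :: nat \<Rightarrow> 'a set.
                 A \<subseteq> (\<Union>i. C i) \<and> (\<forall>i. bounded (C i) \<and> diameter (C i) \<le> \<delta>)}.
        \<Sum>i. hausdorff_weight k (C i))"

definition hausdorff_outer :: "nat \<Rightarrow> 'a::metric_space set \<Rightarrow> ennreal" where
  "hausdorff_outer k A = (SUP \<delta> \<in> {0<..}. hausdorff_pre k \<delta> A)"

text \<open>By Caratheodory's criterion the outer measure is countably additive on the Borel sets.\<close>

definition hausdorff_measure :: "nat \<Rightarrow> 'a::metric_space measure" where
  "hausdorff_measure k = measure_of UNIV (sets borel) (hausdorff_outer k)"

subsection \<open>Differential calculus and harmonic functions\<close>

definition grad :: "('a::euclidean_space \<Rightarrow> real) \<Rightarrow> 'a \<Rightarrow> 'a" where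
  "grad f x = (THE D. GDERIV f x :> D)"

definition divergence :: "('a::euclidean_space \<Rightarrow> 'a) \<Rightarrow> 'a \<Rightarrow> real" where
  "divergence F x = (\<Sum>b\<in>Basis. frechet_derivative F (at x) b \<bullet> b)"

definition C1_on :: "'a::euclidean_space set \<Rightarrow> ('a \<Rightarrow> 'b::real_normed_vector) \<Rightarrow> bool" where
  "C1_on S F \<longleftrightarrow> (\<forall>x\<in>S. F differentiable (at x)) \<and>
     (\<forall>h. continuous_on S (\<lambda>x. frechet_derivative F (at x) h))"

definition harmonic_on :: "'a::euclidean_space set \<Rightarrow> ('a \<Rightarrow> real) \<Rightarrow> bool" where
  "harmonic_on \<Omega> u \<longleftrightarrow> C1_on \<Omega> u \<and> C1_on \<Omega> (grad u) \<and> (\<forall>x\<in>\<Omega>. divergence (grad u) x = 0)"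

subsection \<open>Lipschitz boundary\<close>

text \<open>
  Near each boundary point, \<open>\<Omega>\<close> is the region above the graph, in some direction \<open>e\<close>, of a Lipschitz
  function on the hyperplane orthogonal to \<open>e\<close>.
\<close>

definition lipschitz_boundary :: "'a::euclidean_space set \<Rightarrow> bool" where
  "lipschitz_boundary \<Omega> \<longleftrightarrow>
     (\<forall>x\<in>frontier \<Omega>. \<exists>r>0. \<exists>e \<gamma> L. norm e = 1 \<and> L-lipschitz_on {z. z \<bullet> e = 0} \<gamma> \<and>
        \<Omega> \<inter> ball x r = {y \<in> ball x r. \<gamma> (y - (y \<bullet> e) *\<^sub>R e) < y \<bullet> e})"

subsection \<open>Approximate limits\<close>

text \<open>
  The set \<open>S\<close> is the whole space for the approximate limit, a half-space through \<open>x\<close> for one-sided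
  limits, and the domain \<open>\<Omega>\<close> for the trace at a point of its boundary.
\<close>

definition approx_limit_within ::
    "('a::euclidean_space \<Rightarrow> real) \<Rightarrow> 'a set \<Rightarrow> 'a \<Rightarrow> real \<Rightarrow> bool" where
  "approx_limit_within v S x a \<longleftrightarrow>
     ((\<lambda>r. (\<integral>\<^sup>+ y \<in> ball x r \<inter> S. ennreal \<bar>v y - a\<bar> \<partial>lebesgue) / ennreal (r ^ DIM('a)))
        \<longlongrightarrow> 0) (at_right 0)"

definition approx_limit :: "('a::euclidean_space \<Rightarrow> real) \<Rightarrow> 'a \<Rightarrow> real \<Rightarrow> bool" where
  "approx_limit v x a \<longleftrightarrow> approx_limit_within v UNIV x a"

definition singular_set :: "'a::euclidean_space set \<Rightarrow> ('a \<Rightarrow> real) \<Rightarrow> 'a set" where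
  "singular_set \<Omega> v = {x \<in> \<Omega>. \<not> (\<exists>a. approx_limit v x a)}"

text \<open>
  At a point \<open>x\<close> of the singular set the two one-sided limits necessarily differ, and the triple
  \<open>(p, m, \<nu>)\<close> is unique up to exchanging it with \<open>(m, p, -\<nu>)\<close>, which leaves \<open>(p - m) \<nu>\<close> unchanged.
\<close>

definition one_sided_limits ::
    "('a::euclidean_space \<Rightarrow> real) \<Rightarrow> 'a \<Rightarrow> real \<Rightarrow> real \<Rightarrow> 'a \<Rightarrow> bool" where
  "one_sided_limits v x p m \<nu> \<longleftrightarrow> norm \<nu> = 1 \<and>
     approx_limit_within v {y. (y - x) \<bullet> \<nu> > 0} x p \<and>
     approx_limit_within v {y. (y - x) \<bullet> \<nu> < 0} x m"

definition is_trace :: "'a::euclidean_space set \<Rightarrow> ('a \<Rightarrow> real) \<Rightarrow> ('a \<Rightarrow> real) \<Rightarrow> bool" where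
  "is_trace \<Omega> v g \<longleftrightarrow>
     (AE x in hausdorff_measure (DIM('a) - 1).
        x \<in> frontier \<Omega> \<longrightarrow> approx_limit_within v \<Omega> x (g x))"

definition same_trace :: "'a::euclidean_space set \<Rightarrow> ('a \<Rightarrow> real) \<Rightarrow> ('a \<Rightarrow> real) \<Rightarrow> bool" where
  "same_trace \<Omega> u v \<longleftrightarrow> (\<exists>g. is_trace \<Omega> u g \<and> is_trace \<Omega> v g)"

subsection \<open>Functions of bounded variation\<close>

definition test_field :: "'a::euclidean_space set \<Rightarrow> ('a \<Rightarrow> 'a) \<Rightarrow> bool" where
  "test_field \<Omega> \<phi> \<longleftrightarrow> C1_on UNIV \<phi> \<and> (\<exists>K. compact K \<and> K \<subseteq> \<Omega> \<and> (\<forall>x. x \<notin> K \<longrightarrow> \<phi> x = 0))"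

text \<open>
  \<open>D\<close> is a finite vector measure on the Borel subsets of \<open>\<Omega>\<close>, written as \<open>D = \<sigma> \<mu>\<close> with \<open>\<mu>\<close> a finite
  positive measure, and is the distributional derivative of \<open>v\<close> on \<open>\<Omega>\<close>. These properties determine
  the values of \<open>D\<close> on the Borel subsets of \<open>\<Omega>\<close>.
\<close>

definition is_derivative_measure ::
    "'a::euclidean_space set \<Rightarrow> ('a \<Rightarrow> real) \<Rightarrow> ('a set \<Rightarrow> 'a) \<Rightarrow> bool" where
  "is_derivative_measure \<Omega> v D \<longleftrightarrow>
     (\<exists>\<mu> \<sigma>. sets \<mu> = sets borel \<and> finite_measure \<mu> \<and> set_integrable \<mu> \<Omega> \<sigma> \<and>
        (\<forall>B\<in>sets borel. B \<subseteq> \<Omega> \<longrightarrow> D B = (LINT x:B|\<mu>. \<sigma> x)) \<and>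
        (\<forall>\<phi>. test_field \<Omega> \<phi> \<longrightarrow>
           (LINT x:\<Omega>|lebesgue. v x * divergence \<phi> x) = - (LINT x:\<Omega>|\<mu>. \<phi> x \<bullet> \<sigma> x)))"

definition BV :: "'a::euclidean_space set \<Rightarrow> ('a \<Rightarrow> real) set" where
  "BV \<Omega> = {v. set_integrable lebesgue \<Omega> v \<and> (\<exists>D. is_derivative_measure \<Omega> v D)}"

definition derivative_measure :: "'a::euclidean_space set \<Rightarrow> ('a \<Rightarrow> real) \<Rightarrow> 'a set \<Rightarrow> 'a" where
  "derivative_measure \<Omega> v = (SOME D. is_derivative_measure \<Omega> v D)"

text \<open>
  The density of the absolutely continuous part of \<open>D\<close> in its Lebesgue decomposition; the singular
  part is carried by the null set \<open>N\<close>. The density is unique up to null sets.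
\<close>

definition is_ac_density :: "'a::euclidean_space set \<Rightarrow> ('a set \<Rightarrow> 'a) \<Rightarrow> ('a \<Rightarrow> 'a) \<Rightarrow> bool" where
  "is_ac_density \<Omega> D g \<longleftrightarrow> set_integrable lebesgue \<Omega> g \<and>
     (\<exists>N\<in>null_sets lborel. \<forall>B\<in>sets borel. B \<subseteq> \<Omega> - N \<longrightarrow> D B = (LINT x:B|lebesgue. g x))"

definition approx_grad :: "'a::euclidean_space set \<Rightarrow> ('a \<Rightarrow> real) \<Rightarrow> 'a \<Rightarrow> 'a" where
  "approx_grad \<Omega> v = (SOME g. is_ac_density \<Omega> (derivative_measure \<Omega> v) g)"

text \<open>
  For \<open>v\<close> in BV the one-sided limits and the normal exist at almost every point of the singular set
  with respect to the Hausdorff measure of codimension one; \<open>p\<close>, \<open>m\<close> and \<open>\<nu>\<close> are representatives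
  for which the jump density is measurable.
\<close>

definition SBV :: "'a::euclidean_space set \<Rightarrow> ('a \<Rightarrow> real) set" where
  "SBV \<Omega> = {v \<in> BV \<Omega>. \<exists>p m \<nu>.
     (AE x in hausdorff_measure (DIM('a) - 1).
        x \<in> singular_set \<Omega> v \<longrightarrow> one_sided_limits v x (p x) (m x) (\<nu> x)) \<and>
     set_integrable (hausdorff_measure (DIM('a) - 1)) (singular_set \<Omega> v)
       (\<lambda>x. (p x - m x) *\<^sub>R \<nu> x) \<and>
     (\<forall>B\<in>sets borel. B \<subseteq> \<Omega> \<longrightarrow>
        derivative_measure \<Omega> v B =
          (LINT x:B|lebesgue. approx_grad \<Omega> v x) +
          (LINT x:(B \<inter> singular_set \<Omega> v)|hausdorff_measure (DIM('a) - 1).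
             (p x - m x) *\<^sub>R \<nu> x))}"

subsection \<open>The homogeneous Mumford--Shah functional\<close>

definition mumford_shah0 :: "'a::euclidean_space set \<Rightarrow> ('a \<Rightarrow> real) \<Rightarrow> ennreal" where
  "mumford_shah0 \<Omega> v =
     (\<integral>\<^sup>+ x \<in> \<Omega>. ennreal ((norm (approx_grad \<Omega> v x))\<^sup>2) \<partial>lebesgue) +
     hausdorff_outer (DIM('a) - 1) (singular_set \<Omega> v)"

end

theory Submission
  imports Defs "HOL-Probability.Distribution_Functions"
begin

text \<open>
  Let \<open>m\<close> and \<open>M\<close> be the infimum and supremum of \<open>u\<close>, put \<open>l = (M - m) / 2\<close>, and let \<open>T\<close> be a smooth
  truncation to \<open>[0, l]\<close>, of slope at most 1 and total increase \<open>l + \<delta>\<close>. For a competitor \<open>v\<close> set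
  \<open>w = T (v - (u + m) / 2)\<close>. As \<open>\<nabla>u\<close> is divergence free, the integral of \<open>2 \<nabla>u\<close> against \<open>Dw\<close> is a
  boundary flux and depends only on the trace of \<open>v\<close>; for \<open>v = u\<close> it equals the Dirichlet energy of
  \<open>u\<close>. By the chain rule it is, for general \<open>v\<close>, at most the integral of
  \<open>2 \<nabla>u \<bullet> \<nabla>v - |\<nabla>u|^2 \<le> |\<nabla>v|^2\<close> where \<open>w\<close> is not truncated, plus a jump term bounded by
  \<open>2 (l + \<delta>) sup |\<nabla>u| \<le> 1 + O(\<delta>)\<close> times the area of the jump set.

  The chain rule comes from mollification: at a point with one-sided limits the mollified function is
  asymptotic to a mollified step, along which the average of \<open>T'\<close> times the jump is exactly the
  jump of \<open>T\<close>; no rectifiability of the jump set enters. Likewise the boundary flux is controlled by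
  averaging over the boundary, without a trace operator.
\<close>

subsection \<open>Hausdorff measure\<close>

text \<open>The shift \<open>(u + m) / 2\<close> and the length \<open>l\<close> come from a
  calibration on the product of \<Omega> with a line. Its field is
  \<open>(2 grad u, |grad u|^2)\<close> at heights t between \<open>(u + m) / 2\<close> and
  \<open>(u + M) / 2\<close>, and zero at other heights. Inside this strip it is divergence free,
  since \<open>u\<close> is harmonic and the last component does not depend on t. Both faces of the
  strip have slope \<open>grad u / 2\<close>, so the flux through them vanishes. The part of the
  strip below the graph of \<open>v\<close> has height equal to the truncation of
  \<open>v - (u + m) / 2\<close> to \<open>[0, l]\<close>. Integrating out t therefore leaves an
  argument on \<Omega> alone, in which a jump of \<open>v\<close> crosses at most the height
  \<open>l\<close> of the strip. The sharp truncation has a discontinuous slope, through which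
  mollified functions cannot be followed to their limits; the ramps of width \<delta> repair this
  and disappear at the end. Truncation has a second role. A competitor is merely integrable, but the
  truncated functions differ by a bounded amount, and boundedness is what the averaging over the
  boundary layer needs for dominated convergence.\<close>

lemma hausdorff_weight_empty [simp]: "hausdorff_weight k {} = 0"
  by (simp add: hausdorff_weight_def)

lemma hausdorff_pre_le:
  assumes "A \<subseteq> (\<Union>i. C i)" "\<And>i. bounded (C i)" "\<And>i. diameter (C i) \<le> \<delta>"
  shows "hausdorff_pre k \<delta> A \<le> (\<Sum>i. hausdorff_weight k (C i))"
  unfolding hausdorff_pre_def by (rule INF_lower) (use assms in auto)

lemma hausdorff_pre_close:
  assumes "hausdorff_pre k \<delta> A < c"
  obtains C where "A \<subseteq> (\<Union>i. C i)" "\<And>i. bounded (C i)" "\<And>i. diameter (C i) \<le> \<delta>"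
    "(\<Sum>i. hausdorff_weight k (C i)) < c"
proof -
  have "\<exists>C\<in>{C. A \<subseteq> (\<Union>i. C i) \<and> (\<forall>i. bounded (C i) \<and> diameter (C i) \<le> \<delta>)}.
      (\<Sum>i. hausdorff_weight k (C i)) < c"
    using assms unfolding hausdorff_pre_def INF_less_iff by blast
  then show thesis using that by auto
qed

lemma hausdorff_pre_antimono:
  assumes "A \<subseteq> B" "\<delta> \<le> \<delta>'"
  shows "hausdorff_pre k \<delta>' A \<le> hausdorff_pre k \<delta> B"
  unfolding hausdorff_pre_def
proof (rule INF_superset_mono)
  show "{C. B \<subseteq> (\<Union>i. C i) \<and> (\<forall>i. bounded (C i) \<and> diameter (C i) \<le> \<delta>)}
      \<subseteq> {C. A \<subseteq> (\<Union>i. C i) \<and> (\<forall>i. bounded (C i) \<and> diameter (C i) \<le> \<delta>')}"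
    using assms by (auto intro: order_trans[OF _ \<open>\<delta> \<le> \<delta>'\<close>] subsetD)
qed simp

lemma hausdorff_outer_mono: "A \<subseteq> B \<Longrightarrow> hausdorff_outer k A \<le> hausdorff_outer k B"
  unfolding hausdorff_outer_def by (intro SUP_mono') (simp add: hausdorff_pre_antimono)

lemma hausdorff_outer_empty [simp]: "hausdorff_outer k {} = 0"
proof -
  have "hausdorff_pre k \<delta> {} \<le> 0" if "\<delta> > 0" for \<delta>
    using hausdorff_pre_le[of "{}" "\<lambda>_. {}" \<delta> k] that by simp
  then have "hausdorff_outer k {} \<le> 0"
    unfolding hausdorff_outer_def by (intro SUP_least) auto
  then show ?thesis by simp
qed

text \<open>Near-optimal covers of the \<open>A i\<close> with errors \<open>e / 2 ^ (i + 1)\<close>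
  are merged into one sequence by the pairing of natural numbers. Finiteness of the right-hand side
  makes these covers exist.\<close>

lemma hausdorff_pre_countably_subadditive:
  assumes "\<delta> > 0"
  shows "hausdorff_pre k \<delta> (\<Union>i. A i) \<le> (\<Sum>i. hausdorff_pre k \<delta> (A i))"
proof (rule ennreal_le_epsilon)
  fix e :: real assume e: "0 < e" and fin: "(\<Sum>i. hausdorff_pre k \<delta> (A i)) < top"
  have "\<exists>C. A i \<subseteq> (\<Union>j. C j) \<and> (\<forall>j. bounded (C j) \<and> diameter (C j) \<le> \<delta>) \<and>
      (\<Sum>j. hausdorff_weight k (C j)) < hausdorff_pre k \<delta> (A i) + ennreal (e * (1/2) ^ Suc i)" for i
  proof -
    have "hausdorff_pre k \<delta> (A i) \<noteq> top"
      using fin ennreal_suminf_lessD less_top by blast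
    then have "hausdorff_pre k \<delta> (A i) < hausdorff_pre k \<delta> (A i) + ennreal (e * (1/2) ^ Suc i)"
      using e by (simp add: ennreal_add_left_cancel_less[of _ 0, simplified] less_top)
    from hausdorff_pre_close[OF this] show ?thesis by metis
  qed
  then obtain C where C: "\<And>i. A i \<subseteq> (\<Union>j. C i j)" "\<And>i j. bounded (C i j)" "\<And>i j. diameter (C i j) \<le> \<delta>"
    "\<And>i. (\<Sum>j. hausdorff_weight k (C i j)) < hausdorff_pre k \<delta> (A i) + ennreal (e * (1/2) ^ Suc i)"
    by metis
  define D where "D n = C (fst (prod_decode n)) (snd (prod_decode n))" for n
  have "(\<Union>i. A i) \<subseteq> (\<Union>n. D n)"
  proof
    fix x assume "x \<in> (\<Union>i. A i)"
    then obtain i j where "x \<in> C i j" using C(1) by blast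
    then have "x \<in> D (prod_encode (i, j))" by (simp add: D_def)
    then show "x \<in> (\<Union>n. D n)" by blast
  qed
  then have "hausdorff_pre k \<delta> (\<Union>i. A i) \<le> (\<Sum>n. hausdorff_weight k (D n))"
    by (rule hausdorff_pre_le) (auto simp: D_def C)
  also have "\<dots> = (\<Sum>i. \<Sum>j. hausdorff_weight k (C i j))"
    using suminf_ennreal_2dimen[of "\<lambda>i. \<Sum>j. hausdorff_weight k (C i j)" "\<lambda>(i,j). hausdorff_weight k (C i j)"]
    by (simp add: D_def case_prod_beta comp_def)
  also have "\<dots> \<le> (\<Sum>i. hausdorff_pre k \<delta> (A i) + ennreal (e * (1/2) ^ Suc i))"
    by (intro suminf_le less_imp_le C(4)) auto
  also have "\<dots> = (\<Sum>i. hausdorff_pre k \<delta> (A i)) + (\<Sum>i. ennreal (e * (1/2) ^ Suc i))"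
    by (simp add: suminf_add[symmetric])
  also have "(\<Sum>i. ennreal (e * (1/2) ^ Suc i)) = ennreal e"
    using sums_mult[OF power_half_series, of e] e
    by (intro suminf_ennreal_eq) (auto simp: sums_iff)
  finally show "hausdorff_pre k \<delta> (\<Union>i. A i) \<le> (\<Sum>i. hausdorff_pre k \<delta> (A i)) + ennreal e" .
qed

lemma hausdorff_outer_countably_subadditive:
  "hausdorff_outer k (\<Union>i. A i) \<le> (\<Sum>i. hausdorff_outer k (A i))"
  unfolding hausdorff_outer_def[of k "\<Union>i. A i"]
proof (rule SUP_least)
  fix \<delta> :: real assume d: "\<delta> \<in> {0<..}"
  then have "hausdorff_pre k \<delta> (\<Union>i. A i) \<le> (\<Sum>i. hausdorff_pre k \<delta> (A i))"
    by (intro hausdorff_pre_countably_subadditive) auto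
  also have "\<dots> \<le> (\<Sum>i. hausdorff_outer k (A i))"
    unfolding hausdorff_outer_def by (intro suminf_le SUP_upper d) auto
  finally show "hausdorff_pre k \<delta> (\<Union>i. A i) \<le> (\<Sum>i. hausdorff_outer k (A i))" .
qed

lemma hausdorff_outer_subadditive: "hausdorff_outer k (A \<union> B) \<le> hausdorff_outer k A + hausdorff_outer k B"
proof -
  have "hausdorff_outer k (A \<union> B) \<le> (\<Sum>i. hausdorff_outer k (binaryset A B i))"
    using hausdorff_outer_countably_subadditive[of k "binaryset A B"]
    by (simp add: UN_binaryset_eq)
  also have "\<dots> = hausdorff_outer k A + hausdorff_outer k B"
    by (rule suminf_binaryset_eq) simp
  finally show ?thesis .
qed

text \<open>A covering set of diameter less than \<open>d\<close> cannot meet both \<open>A\<close>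
  and \<open>B\<close>, so a fine cover of the union splits into two covers without using a set
  twice. Since \<open>hausdorff_pre\<close> grows as the mesh shrinks, the scales in the two suprema
  may be replaced by a common one below \<open>d\<close>.\<close>

lemma hausdorff_outer_separated:
  fixes A B :: "'a::metric_space set"
  assumes d: "d > 0" and sep: "\<And>x y. x \<in> A \<Longrightarrow> y \<in> B \<Longrightarrow> d \<le> dist x y"
  shows "hausdorff_outer k A + hausdorff_outer k B \<le> hausdorff_outer k (A \<union> B)"
proof -
  have pre: "hausdorff_pre k \<delta> A + hausdorff_pre k \<delta> B \<le> hausdorff_pre k \<delta> (A \<union> B)"
    if \<delta>: "0 < \<delta>" "\<delta> < d" for \<delta>
    unfolding hausdorff_pre_def[of k \<delta> "A \<union> B"]
  proof (rule INF_greatest)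
    fix C :: "nat \<Rightarrow> 'a set" assume "C \<in> {C. A \<union> B \<subseteq> (\<Union>i. C i) \<and> (\<forall>i. bounded (C i) \<and> diameter (C i) \<le> \<delta>)}"
    then have C: "A \<union> B \<subseteq> (\<Union>i. C i)" "\<And>i. bounded (C i)" "\<And>i. diameter (C i) \<le> \<delta>" by auto
    define P where "P X i = (if C i \<inter> X = {} then {} else C i)" for X and i :: nat
    have P: "hausdorff_pre k \<delta> X \<le> (\<Sum>i. hausdorff_weight k (P X i))" if "X \<subseteq> A \<union> B" for X
    proof (rule hausdorff_pre_le)
      show "X \<subseteq> (\<Union>i. P X i)"
      proof
        fix x assume "x \<in> X"
        then obtain i where "x \<in> C i" using \<open>X \<subseteq> A \<union> B\<close> C(1) by blast
        with \<open>x \<in> X\<close> have "x \<in> P X i" by (auto simp: P_def)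
        then show "x \<in> (\<Union>i. P X i)" by blast
      qed
    qed (use C \<delta> in \<open>auto simp: P_def\<close>)
    have one: "hausdorff_weight k (P A i) + hausdorff_weight k (P B i) \<le> hausdorff_weight k (C i)" for i
    proof (cases "C i \<inter> A = {} \<or> C i \<inter> B = {}")
      case False
      then obtain x y where "x \<in> C i" "x \<in> A" "y \<in> C i" "y \<in> B" by blast
      then have "d \<le> \<delta>"
        using sep C diameter_bounded_bound[of "C i" x y] by (meson order_trans)
      with \<delta> show ?thesis by simp
    qed (auto simp: P_def)
    have "hausdorff_pre k \<delta> A + hausdorff_pre k \<delta> B \<le>
        (\<Sum>i. hausdorff_weight k (P A i)) + (\<Sum>i. hausdorff_weight k (P B i))"
      by (intro add_mono P) auto
    also have "\<dots> = (\<Sum>i. hausdorff_weight k (P A i) + hausdorff_weight k (P B i))"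
      by (simp add: suminf_add)
    also have "\<dots> \<le> (\<Sum>i. hausdorff_weight k (C i))"
      by (intro suminf_le one) auto
    finally show "hausdorff_pre k \<delta> A + hausdorff_pre k \<delta> B \<le> (\<Sum>i. hausdorff_weight k (C i))" .
  qed
  have 1: "hausdorff_pre k a A + hausdorff_pre k b B \<le> hausdorff_outer k (A \<union> B)"
    if "a > 0" "b > 0" for a b
  proof -
    define \<delta> where "\<delta> = min (min a b) (d/2)"
    have "\<delta> > 0" "\<delta> < d" "\<delta> \<le> a" "\<delta> \<le> b" using that d by (auto simp: \<delta>_def min_def)
    then have "hausdorff_pre k a A + hausdorff_pre k b B \<le> hausdorff_pre k \<delta> A + hausdorff_pre k \<delta> B"
      by (intro add_mono hausdorff_pre_antimono) auto
    also have "\<dots> \<le> hausdorff_pre k \<delta> (A \<union> B)" by (intro pre) fact+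
    also have "\<dots> \<le> hausdorff_outer k (A \<union> B)"
      unfolding hausdorff_outer_def by (rule SUP_upper) (use \<open>\<delta> > 0\<close> in auto)
    finally show ?thesis .
  qed
  have "hausdorff_outer k A + hausdorff_pre k b B \<le> hausdorff_outer k (A \<union> B)" if "b > 0" for b
    unfolding hausdorff_outer_def[of k A]
    by (subst ennreal_SUP_add_left[symmetric]) (use that 1 in \<open>auto intro!: SUP_least\<close>)
  then show ?thesis
    unfolding hausdorff_outer_def[of k B]
    by (subst add.commute, subst ennreal_SUP_add_left[symmetric]) (auto intro!: SUP_least simp: add.commute)
qed

text \<open>Caratheodory's criterion for metric outer measures. \<open>X - F\<close> is exhausted by
  the sets \<open>Y n\<close> at positive distance from \<open>F\<close>, where additivity is known;
  the remainder lies in the shells \<open>R i\<close>. Shells of equal parity are separated, so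
  their measures sum to at most that of \<open>X\<close>, and the tail of a convergent series tends
  to zero.\<close>

lemma hausdorff_outer_caratheodory:
  fixes F :: "'a::metric_space set"
  assumes F: "closed F"
  shows "hausdorff_outer k (X \<inter> F) + hausdorff_outer k (X - F) \<le> hausdorff_outer k X"
proof (cases "F = {} \<or> hausdorff_outer k X = \<infinity>")
  case True
  then show ?thesis by auto
next
  case False
  then have ne: "F \<noteq> {}" and fin: "hausdorff_outer k X \<noteq> \<infinity>" by auto
  let ?f = "hausdorff_outer k"
  define Y where "Y n = {x \<in> X. 1 / (real n + 1) \<le> infdist x F}" for n
  define R where "R n = {x \<in> X. 1 / (real n + 2) \<le> infdist x F \<and> infdist x F < 1 / (real n + 1)}" for n
  have infd: "infdist x F \<le> dist x y + infdist y F" for x y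
    using infdist_triangle[of x F y] by (simp add: add.commute)
  have par: "(\<Sum>i<N. ?f (R (2 * i + p))) \<le> ?f (\<Union>i<N. R (2 * i + p))" for N p
  proof (induction N)
    case (Suc N)
    have "(\<Sum>i<Suc N. ?f (R (2 * i + p))) \<le> ?f (\<Union>i<N. R (2 * i + p)) + ?f (R (2 * N + p))"
      using Suc by (simp add: add_mono)
    also have "\<dots> \<le> ?f ((\<Union>i<N. R (2 * i + p)) \<union> R (2 * N + p))"
    proof (cases "N = 0")
      case False
      \<comment> \<open>Earlier shells of this parity stay at distance at least \<open>1 / n\<close>
        from \<open>F\<close>, the new one below \<open>1 / (n + 1)\<close>: the skipped shell is
        the gap. For \<open>N = 0\<close> there is no earlier shell, and \<open>n\<close> could be
        zero.\<close>
      define n where "n = 2 * real N + real p"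
      have n: "n > 0" using False by (simp add: n_def)
      show ?thesis
      proof (rule hausdorff_outer_separated)
        show "0 < 1 / n - 1 / (n + 1)" using n by (simp add: field_simps add_pos_pos)
        fix x y assume x: "x \<in> (\<Union>i<N. R (2 * i + p))" and y: "y \<in> R (2 * N + p)"
        from x obtain i where i: "i < N" "x \<in> R (2 * i + p)" by auto
        then have "real i + 1 \<le> real N" by linarith
        then have "1 / n \<le> 1 / (real (2 * i + p) + 2)"
          using n by (intro divide_left_mono mult_pos_pos) (auto simp: n_def)
        with i have "1 / n \<le> infdist x F" by (auto simp: R_def)
        moreover have "infdist y F \<le> 1 / (n + 1)" using y by (auto simp: R_def n_def)
        ultimately show "1 / n - 1 / (n + 1) \<le> dist x y" using infd[of x y] by linarith
      qed
    qed auto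
    also have "(\<Union>i<N. R (2 * i + p)) \<union> R (2 * N + p) = (\<Union>i<Suc N. R (2 * i + p))"
      by (auto simp: less_Suc_eq)
    finally show ?case .
  qed auto
  have parX: "(\<Sum>i<N. ?f (R (2 * i + p))) \<le> ?f X" for N p
    by (rule order_trans[OF par hausdorff_outer_mono]) (auto simp: R_def)
  have "(\<Sum>i<2 * N. ?f (R i)) = (\<Sum>i<N. ?f (R (2 * i + 0))) + (\<Sum>i<N. ?f (R (2 * i + 1)))" for N
    by (induction N) (auto simp: algebra_simps)
  then have "(\<Sum>i<2 * N. ?f (R i)) \<le> ?f X + ?f X" for N
    using parX[of 0 N] parX[of 1 N] by (simp add: add_mono)
  moreover have "(\<Sum>i<N. ?f (R i)) \<le> (\<Sum>i<2 * N. ?f (R i))" for N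
    by (intro sum_mono2) auto
  ultimately have "(\<Sum>i<N. ?f (R i)) \<le> ?f X + ?f X" for N
    by (meson order_trans)
  then have "(\<Sum>i. ?f (R i)) \<le> ?f X + ?f X"
    unfolding suminf_eq_SUP by (intro SUP_least)
  then have sumfin: "(\<Sum>i. ?f (R i)) \<noteq> \<infinity>"
    using fin by (auto simp: top_unique)
  have step: "?f (X \<inter> F) + ?f (Y n) \<le> ?f X" for n
  proof -
    have "?f (X \<inter> F) + ?f (Y n) \<le> ?f (X \<inter> F \<union> Y n)"
    proof (rule hausdorff_outer_separated)
      show "0 < 1 / (real n + 1)" by simp
      fix x y assume "x \<in> X \<inter> F" "y \<in> Y n"
      then show "1 / (real n + 1) \<le> dist x y"
        using infdist_le[of x F y] by (auto simp: Y_def dist_commute)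
    qed
    also have "\<dots> \<le> ?f X" by (rule hausdorff_outer_mono) (auto simp: Y_def)
    finally show ?thesis .
  qed
  have cover: "X - F \<subseteq> Y n \<union> (\<Union>i. R (i + n))" for n
  proof
    fix x assume x: "x \<in> X - F"
    then have pos: "infdist x F > 0"
      using F ne infdist_nonneg[of x F] in_closed_iff_infdist_zero[of F x] by auto
    show "x \<in> Y n \<union> (\<Union>i. R (i + n))"
    proof (cases "1 / (real n + 1) \<le> infdist x F")
      case False
      define P where "P j \<longleftrightarrow> 1 / (real j + 1) \<le> infdist x F" for j
      obtain j0 where j0: "P j0"
        using reals_Archimedean[OF pos] by (auto simp: P_def inverse_eq_divide add.commute intro: less_imp_le)
      define j where "j = (LEAST j. P j)"
      have Pj: "P j" unfolding j_def by (rule LeastI[of P, OF j0])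
      have jn: "j > n"
      proof (rule ccontr)
        assume "\<not> n < j"
        then have "1 / (real n + 1) \<le> 1 / (real j + 1)"
          by (intro divide_left_mono) auto
        with Pj False show False by (auto simp: P_def)
      qed
      then have "\<not> P (j - 1)" unfolding j_def by (intro not_less_Least) auto
      then have "x \<in> R (j - 1)"
        using x Pj jn by (auto simp: P_def R_def of_nat_diff add.commute)
      then have "x \<in> R ((j - 1 - n) + n)" using jn by simp
      then show ?thesis by blast
    qed (use x in \<open>auto simp: Y_def\<close>)
  qed
  have "?f (X \<inter> F) + ?f (X - F) \<le> ?f X + (\<Sum>i. ?f (R (i + n)))" for n
  proof -
    have "?f (X - F) \<le> ?f (Y n) + ?f (\<Union>i. R (i + n))"
      by (rule order_trans[OF hausdorff_outer_mono[OF cover] hausdorff_outer_subadditive])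
    also have "\<dots> \<le> ?f (Y n) + (\<Sum>i. ?f (R (i + n)))"
      by (intro add_mono hausdorff_outer_countably_subadditive) auto
    finally have "?f (X \<inter> F) + ?f (X - F) \<le> ?f (X \<inter> F) + (?f (Y n) + (\<Sum>i. ?f (R (i + n))))"
      by (intro add_mono) auto
    also have "\<dots> \<le> ?f X + (\<Sum>i. ?f (R (i + n)))"
      unfolding add.assoc[symmetric] by (intro add_mono step) auto
    finally show ?thesis .
  qed
  moreover have "(\<lambda>n. ?f X + (\<Sum>i. ?f (R (i + n)))) \<longlonglongrightarrow> ?f X + 0"
  proof (intro tendsto_add tendsto_const)
    define g where "g i = enn2real (?f (R i))" for i
    have fi: "?f (R i) = ennreal (g i)" for i
      unfolding g_def using sumfin ennreal_suminf_lessD[of "\<lambda>i. ?f (R i)" \<infinity> i]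
      by (simp add: less_top)
    have sg: "summable g"
      using sumfin unfolding fi by (intro summable_suminf_not_top) (auto simp: g_def)
    have "(\<lambda>n. ennreal (\<Sum>i. g (i + n))) \<longlonglongrightarrow> ennreal 0"
      by (intro tendsto_ennrealI suminf_exist_split2[OF sg])
    moreover have "ennreal (\<Sum>i. g (i + n)) = (\<Sum>i. ?f (R (i + n)))" for n
      unfolding fi using summable_ignore_initial_segment[OF sg, of n]
      by (subst suminf_ennreal2) (auto simp: g_def)
    ultimately show "(\<lambda>n. \<Sum>i. ?f (R (i + n))) \<longlonglongrightarrow> 0" by simp
  qed
  ultimately show ?thesis
    by (intro LIMSEQ_le_const[where X="\<lambda>n. ?f X + (\<Sum>i. ?f (R (i + n)))"]) auto
qed

lemma sets_hausdorff_measure [simp, measurable_cong]: "sets (hausdorff_measure k) = sets borel"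
  using sets.sigma_sets_eq[of "borel :: 'a measure"]
  by (simp add: hausdorff_measure_def)

lemma space_hausdorff_measure [simp]: "space (hausdorff_measure k) = UNIV"
  by (simp add: hausdorff_measure_def)

text \<open>\<open>measure_of\<close> yields the zero measure unless the given function is countably
  additive on the sigma-algebra, so this value has to be earned: closed sets belong to the
  Caratheodory sigma-algebra, hence all Borel sets do.\<close>

lemma emeasure_hausdorff_measure:
  fixes A :: "'a::metric_space set"
  assumes A: "A \<in> sets borel"
  shows "emeasure (hausdorff_measure k) A = hausdorff_outer k A"
proof -
  interpret P: sigma_algebra "UNIV :: 'a set" "Pow UNIV" by (rule sigma_algebra_Pow)
  let ?L = "lambda_system UNIV (Pow UNIV) (hausdorff_outer k :: 'a set \<Rightarrow> ennreal)"
  have oms: "outer_measure_space (Pow UNIV) (hausdorff_outer k :: 'a set \<Rightarrow> ennreal)"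
    unfolding outer_measure_space_def positive_def increasing_def countably_subadditive_def
    by (auto simp: hausdorff_outer_mono hausdorff_outer_countably_subadditive)
  have ms: "measure_space UNIV ?L (hausdorff_outer k)"
    by (rule P.caratheodory_lemma[OF oms])
  then interpret L: sigma_algebra UNIV ?L by (simp add: measure_space_def)
  have "closed F \<Longrightarrow> F \<in> ?L" for F
  proof -
    assume "closed F"
    then have "hausdorff_outer k (F \<inter> x) + hausdorff_outer k ((UNIV - F) \<inter> x) \<le> hausdorff_outer k x" for x
      using hausdorff_outer_caratheodory[of F k x] by (simp add: Int_commute Diff_eq)
    moreover have "hausdorff_outer k x \<le> hausdorff_outer k (F \<inter> x) + hausdorff_outer k ((UNIV - F) \<inter> x)" for x
      using hausdorff_outer_subadditive[of k "F \<inter> x" "(UNIV - F) \<inter> x"]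
      by (metis Int_Un_distrib2 Int_UNIV_left Un_Diff_cancel Un_UNIV_right)
    ultimately show ?thesis by (auto simp: lambda_system_def intro!: antisym)
  qed
  then have "sigma_sets UNIV (Collect closed) \<subseteq> ?L"
    by (intro L.sigma_sets_subset) auto
  then have sub: "sets borel \<subseteq> ?L" by (simp add: borel_eq_closed)
  have ms': "measure_space UNIV (sets borel) (hausdorff_outer k :: 'a set \<Rightarrow> ennreal)"
    by (rule measure_down[OF ms _ sub]) (metis sets.sigma_algebra_axioms space_borel)
  show ?thesis
    unfolding hausdorff_measure_def
    by (rule emeasure_measure_of_sigma) (use ms' A in \<open>auto simp: measure_space_def\<close>)
qed

subsection \<open>Lebesgue differentiation\<close>

lemma set_integrable_ball_const:
  "set_integrable lborel (ball (x::'a::euclidean_space) r) (\<lambda>_. c :: real)"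
  using emeasure_lborel_ball_finite[of x r] unfolding set_integrable_def
  by (auto intro!: integrable_real_indicator)

text \<open>Every bad point lies in arbitrarily small balls that carry much more \<open>h\<close>-mass than
  Lebesgue mass, while the set itself carries none; Vitali's theorem turns this into a bound.\<close>

lemma negligible_large_averages:
  fixes h :: "'a::euclidean_space \<Rightarrow> real"
  assumes h: "integrable lborel h" "\<And>x. 0 \<le> h x" and A: "A \<in> sets borel" "\<And>x. x \<in> A \<Longrightarrow> h x = 0"
    and B: "B \<subseteq> A" and \<eta>: "\<eta> > 0"
    and bad: "\<And>x d. x \<in> B \<Longrightarrow> d > 0 \<Longrightarrow>
      \<exists>r. 0 < r \<and> r < d \<and> \<eta> * measure lborel (ball x r) \<le> (LINT y:ball x r|lborel. h y)"
  shows "negligible B"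
proof -
  define \<nu> where "\<nu> = density lborel (\<lambda>x. ennreal (h x))"
  have hm [measurable]: "h \<in> borel_measurable borel" using h(1) by auto
  have [simp]: "sets \<nu> = sets borel" "space \<nu> = UNIV" by (simp_all add: \<nu>_def)
  have \<nu>_set: "emeasure \<nu> X = ennreal (LINT y:X|lborel. h y)" if "X \<in> sets borel" for X
  proof -
    have "emeasure \<nu> X = (\<integral>\<^sup>+ y. ennreal (h y * indicator X y) \<partial>lborel)"
      using that unfolding \<nu>_def
      by (subst emeasure_density) (auto intro!: nn_integral_cong simp: indicator_def)
    also have "\<dots> = ennreal (\<integral>y. h y * indicator X y \<partial>lborel)"
      using that h by (intro nn_integral_eq_integral) (auto intro!: integrable_real_mult_indicator)
    finally show ?thesis by (simp add: set_lebesgue_integral_def mult.commute)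
  qed
  have \<nu>A: "emeasure \<nu> A = 0"
    unfolding \<nu>_def using A by (subst emeasure_density) (auto simp: nn_integral_0_iff_AE indicator_def)
  have "\<exists>T. B \<subseteq> T \<and> T \<in> lmeasurable \<and> measure lebesgue T \<le> e" if e: "e > 0" for e
  proof -
    \<comment> \<open>\<open>\<nu>\<close> is the finite measure with density \<open>h\<close> and
      vanishes on \<open>A\<close>. Outer regularity gives an open set around \<open>A\<close> of
      small \<open>\<nu>\<close>-mass, in which all selected balls will lie.\<close>
    have "(INF U \<in> {U. A \<subseteq> U \<and> open U}. emeasure \<nu> U) < ennreal (e * \<eta>)"
      using outer_regular[of \<nu> A] \<nu>A \<nu>_set[of UNIV] A e \<eta> by simp
    then obtain U where U: "A \<subseteq> U" "open U" "emeasure \<nu> U < ennreal (e * \<eta>)"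
      unfolding INF_less_iff by auto
    define K where "K = {(x, r). x \<in> B \<and> 0 < r \<and> ball x r \<subseteq> U \<and>
      \<eta> * measure lborel (ball x r) \<le> (LINT y:ball x r|lborel. h y)}"
    have "\<exists>i. i \<in> K \<and> x \<in> ball (fst i) (snd i) \<and> snd i < d" if x: "x \<in> B" "0 < d" for x d
    proof -
      obtain d' where d': "d' > 0" "ball x d' \<subseteq> U"
        using U B x openE by blast
      obtain r where r: "0 < r" "r < min d d'" "\<eta> * measure lborel (ball x r) \<le> (LINT y:ball x r|lborel. h y)"
        using bad[of x "min d d'"] x d' by auto
      then have "(x, r) \<in> K" using x d' subset_ball[of r d' x] by (auto simp: K_def)
      then show ?thesis using r by (intro exI[of _ "(x, r)"]) auto
    qed
    then obtain C where C: "countable C" "C \<subseteq> K"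
       "pairwise (\<lambda>i j. disjnt (ball (fst i) (snd i)) (ball (fst j) (snd j))) C"
       "negligible (B - (\<Union>i \<in> C. ball (fst i) (snd i)))"
      by (rule Vitali_covering_theorem_balls[of B K fst snd]) blast
    define W where "W = (\<Union>i \<in> C. ball (fst i) (snd i))"
    have disj: "disjoint_family_on (\<lambda>i. ball (fst i) (snd i)) C"
      using C(3) by (auto simp: disjoint_family_on_def pairwise_def disjnt_def)
    have "ennreal \<eta> * emeasure lborel W = ennreal \<eta> * (\<integral>\<^sup>+i. emeasure lborel (ball (fst i) (snd i)) \<partial>count_space C)"
      unfolding W_def using C disj by (subst emeasure_UN_countable) auto
    also have "\<dots> = (\<integral>\<^sup>+i. ennreal \<eta> * emeasure lborel (ball (fst i) (snd i)) \<partial>count_space C)"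
      by (simp add: nn_integral_cmult)
    also have "\<dots> \<le> (\<integral>\<^sup>+i. emeasure \<nu> (ball (fst i) (snd i)) \<partial>count_space C)"
    proof (rule nn_integral_mono)
      fix i assume "i \<in> space (count_space C)"
      then have "\<eta> * measure lborel (ball (fst i) (snd i)) \<le> (LINT y:ball (fst i) (snd i)|lborel. h y)"
        using C(2) by (auto simp: K_def)
      moreover have "ennreal \<eta> * emeasure lborel (ball (fst i) (snd i)) = ennreal (\<eta> * measure lborel (ball (fst i) (snd i)))"
        using \<eta> emeasure_lborel_ball_finite[of "fst i" "snd i"]
        by (subst emeasure_eq_ennreal_measure) (auto simp: ennreal_mult)
      ultimately show "ennreal \<eta> * emeasure lborel (ball (fst i) (snd i)) \<le> emeasure \<nu> (ball (fst i) (snd i))"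
        by (subst \<nu>_set) (auto intro: ennreal_leI)
    qed
    also have "\<dots> = emeasure \<nu> W"
      unfolding W_def using C disj by (subst emeasure_UN_countable) auto
    also have "\<dots> \<le> emeasure \<nu> U"
      by (rule emeasure_mono) (use U C(2) in \<open>force simp: W_def K_def\<close>)+
    also have "\<dots> \<le> ennreal \<eta> * ennreal e"
      using U(3) \<eta> e by (simp add: ennreal_mult[symmetric] mult.commute)
    finally have W: "emeasure lborel W \<le> ennreal e"
      using \<eta> by (subst (asm) ennreal_mult_le_mult_iff) auto
    have Wb: "W \<in> sets borel" unfolding W_def using C by (intro sets.countable_UN') auto
    have Wm: "W \<in> lmeasurable" "measure lebesgue W \<le> e"
    proof -
      show "W \<in> lmeasurable"
        using W Wb by (auto simp: fmeasurable_def less_top[symmetric] top_unique)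
      show "measure lebesgue W \<le> e"
        using W Wb e unfolding measure_def by (simp add: enn2real_leI)
    qed
    have N: "B - W \<in> lmeasurable" "measure lebesgue (B - W) = 0"
      using C(4) negligible_imp_measurable negligible_imp_measure0 unfolding W_def by blast+
    show ?thesis
    proof (intro exI conjI)
      show "B \<subseteq> (B - W) \<union> W" by auto
      show "(B - W) \<union> W \<in> lmeasurable" using N Wm by (intro fmeasurable.Un)
      show "measure lebesgue ((B - W) \<union> W) \<le> e"
        using measure_Un_le[of "B - W" lebesgue W] N Wm fmeasurableD by fastforce
    qed
  qed
  then show ?thesis by (subst negligible_outer_le) auto
qed

text \<open>For a rational \<open>q\<close> close to \<open>f x\<close>, the average of
  \<open>|f y - f x|\<close> is controlled by that of \<open>|f y - q|\<close>. Points where the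
  latter stays large although \<open>|f x - q|\<close> is small are handled by
  \<open>negligible_large_averages\<close>, and countably many pairs \<open>(q, n)\<close>
  suffice.\<close>

theorem lebesgue_differentiation:
  fixes f :: "'a::euclidean_space \<Rightarrow> real"
  assumes f: "integrable lborel f"
  shows "AE x in lborel.
    ((\<lambda>r. (LINT y:ball x r|lborel. \<bar>f y - f x\<bar>) / measure lborel (ball x r)) \<longlongrightarrow> 0) (at_right 0)"
proof -
  have fm [measurable]: "f \<in> borel_measurable borel" using f by auto
  let ?V = "\<lambda>x r. measure lborel (ball x r :: 'a set)"
  have fb: "set_integrable lborel (ball x r) (\<lambda>y. \<bar>f y - q\<bar>)" for x r q
  proof -
    have "set_integrable lborel (ball x r) f"
      using f unfolding set_integrable_def by (intro integrable_mult_indicator) auto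
    moreover have "set_integrable lborel (ball x r) (\<lambda>_. q)"
      by (rule set_integrable_ball_const)
    ultimately show ?thesis by (intro set_integrable_abs set_integral_diff)
  qed
  \<comment> \<open>The factor 3 leaves room: with \<open>\<eta> = 1 / Suc n\<close>, values of
    \<open>|f - q|\<close> below \<open>\<eta>\<close> contribute at most \<open>\<eta>\<close> to
    an average, so the part \<open>h\<close> above \<open>\<eta>\<close>, which vanishes on
    \<open>A\<close>, still averages at least \<open>\<eta>\<close>.\<close>
  define Bad where "Bad q n = {x. \<bar>f x - q\<bar> < 1 / real (Suc n) \<and>
     (\<forall>d>0. \<exists>r. 0 < r \<and> r < d \<and> 3 / real (Suc n) * ?V x r \<le> (LINT y:ball x r|lborel. \<bar>f y - q\<bar>))}" for q n
  have neg: "negligible (Bad q n)" for q n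
  proof (rule negligible_countable_Union[of "(\<lambda>k. Bad q n \<inter> ball 0 (real k)) ` UNIV", THEN negligible_subset])
    show "Bad q n \<subseteq> \<Union> ((\<lambda>k. Bad q n \<inter> ball 0 (real k)) ` UNIV)"
      using reals_Archimedean2 by auto
    fix S assume "S \<in> (\<lambda>k. Bad q n \<inter> ball 0 (real k)) ` UNIV"
    then obtain k where S: "S = Bad q n \<inter> ball 0 (real k)" by auto
    define \<eta> where "\<eta> = 1 / real (Suc n)"
    have \<eta>: "\<eta> > 0" by (simp add: \<eta>_def)
    define A where "A = {x. \<bar>f x - q\<bar> < \<eta>} \<inter> ball 0 (real k)"
    define h where "h y = indicator (ball 0 (real k)) y * (\<bar>f y - q\<bar> * indicator {y. \<eta> \<le> \<bar>f y - q\<bar>} y)" for y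
    show "negligible S"
    proof (rule negligible_large_averages[where h=h and A=A and \<eta>=\<eta>])
      show "A \<in> sets borel" unfolding A_def by measurable
      show "integrable lborel h"
        by (rule Bochner_Integration.integrable_bound[OF fb[unfolded set_integrable_def, of 0 "real k" q]])
          (auto simp: h_def[abs_def] indicator_def)
      then have hb: "set_integrable lborel (ball x r) h" for x r
        unfolding set_integrable_def by (intro integrable_mult_indicator) auto
      show "0 \<le> h x" for x by (simp add: h_def)
      show "x \<in> A \<Longrightarrow> h x = 0" for x by (auto simp: h_def A_def)
      show "S \<subseteq> A" by (auto simp: S A_def Bad_def \<eta>_def)
      show "\<eta> > 0" by fact
      fix x d :: real and x' :: 'a assume "x' \<in> S" "d > 0"
      then have x: "x' \<in> Bad q n" "norm x' < real k" by (auto simp: S)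
      obtain r where r: "0 < r" "r < min d (real k - norm x')" "3 * \<eta> * ?V x' r \<le> (LINT y:ball x' r|lborel. \<bar>f y - q\<bar>)"
        using x \<open>d > 0\<close> unfolding Bad_def \<eta>_def by (auto dest!: spec[of _ "min d (real k - norm x')"])
      have sub: "y \<in> ball 0 (real k)" if "y \<in> ball x' r" for y
        using that r norm_triangle_ineq[of x' "y - x'"] by (auto simp: dist_norm norm_minus_commute)
      have "(LINT y:ball x' r|lborel. \<bar>f y - q\<bar>) \<le> (LINT y:ball x' r|lborel. h y + \<eta>)"
      proof (rule set_integral_mono)
        show "set_integrable lborel (ball x' r) (\<lambda>y. h y + \<eta>)"
          by (intro set_integral_add hb set_integrable_ball_const)
        show "\<bar>f y - q\<bar> \<le> h y + \<eta>" if "y \<in> ball x' r" for y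
          using sub[OF that] \<eta> by (auto simp: h_def indicator_def)
      qed (rule fb)
      also have "\<dots> = (LINT y:ball x' r|lborel. h y) + (LINT y:ball x' r|lborel. \<eta>)"
        by (intro set_integral_add hb set_integrable_ball_const)
      also have "(LINT y:ball x' r|lborel. \<eta>) = \<eta> * ?V x' r"
        by (simp add: set_lebesgue_integral_def)
      finally have "3 * \<eta> * ?V x' r \<le> (LINT y:ball x' r|lborel. h y) + \<eta> * ?V x' r"
        using r(3) by linarith
      moreover have "0 \<le> \<eta> * ?V x' r" using \<eta> by simp
      ultimately have "\<eta> * ?V x' r \<le> (LINT y:ball x' r|lborel. h y)" by linarith
      with r show "\<exists>r. 0 < r \<and> r < d \<and> \<eta> * ?V x' r \<le> (LINT y:ball x' r|lborel. h y)" by auto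
    qed
  qed auto
  have "negligible (\<Union>(q, n)\<in>\<rat> \<times> UNIV. Bad q n)"
    by (intro negligible_countable_Union countable_image countable_SIGMA countable_rat)
       (auto simp: neg)
  then have "AE x in lebesgue. x \<notin> (\<Union>(q, n)\<in>\<rat> \<times> UNIV. Bad q n)"
    by (intro AE_not_in) (simp add: negligible_iff_null_sets)
  then have "AE x in lborel. x \<notin> (\<Union>(q, n)\<in>\<rat> \<times> UNIV. Bad q n)"
    by (simp add: AE_completion_iff)
  then show ?thesis
  proof (rule AE_mp, intro AE_I2 impI)
    fix x assume x: "x \<notin> (\<Union>(q, n)\<in>\<rat> \<times> UNIV. Bad q n)"
    show "((\<lambda>r. (LINT y:ball x r|lborel. \<bar>f y - f x\<bar>) / ?V x r) \<longlongrightarrow> 0) (at_right 0)"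
    proof (rule tendstoI)
      fix e :: real assume "e > 0"
      \<comment> \<open>Three units come from the average of \<open>|f - q|\<close>, one from
        \<open>|f x - q|\<close>.\<close>
      then obtain n where n: "4 / real (Suc n) < e"
        using reals_Archimedean[of "e / 4"] by (auto simp: inverse_eq_divide field_simps)
      obtain q where q: "q \<in> \<rat>" "f x - 1 / real (Suc n) < q" "q < f x"
        using Rats_dense_in_real[of "f x - 1 / real (Suc n)" "f x"] by auto
      have "x \<notin> Bad q n" using x q(1) by auto
      then obtain d where d: "d > 0"
        "\<And>r. 0 < r \<Longrightarrow> r < d \<Longrightarrow> (LINT y:ball x r|lborel. \<bar>f y - q\<bar>) < 3 / real (Suc n) * ?V x r"
        using q unfolding Bad_def by (auto simp: not_le)
      have "dist ((LINT y:ball x r|lborel. \<bar>f y - f x\<bar>) / ?V x r) 0 < e" if r: "0 < r" "r < d" for r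
      proof -
        have V: "?V x r > 0" using content_ball_pos[OF r(1), of x] by simp
        have "(LINT y:ball x r|lborel. \<bar>f y - f x\<bar>) \<le> (LINT y:ball x r|lborel. \<bar>f y - q\<bar> + 1 / real (Suc n))"
        proof (rule set_integral_mono)
          show "set_integrable lborel (ball x r) (\<lambda>y. \<bar>f y - q\<bar> + 1 / real (Suc n))"
            by (intro set_integral_add fb set_integrable_ball_const)
        qed (use q fb in auto)
        also have "\<dots> = (LINT y:ball x r|lborel. \<bar>f y - q\<bar>) + 1 / real (Suc n) * ?V x r"
          by (subst set_integral_add(2)[OF fb set_integrable_ball_const]) (simp add: set_lebesgue_integral_def)
        also have "\<dots> < 4 / real (Suc n) * ?V x r"
          using d(2)[OF r] by (simp add: add_divide_distrib[symmetric] distrib_right[symmetric] divide_inverse algebra_simps)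
        also have "\<dots> < e * ?V x r" using n V by (intro mult_strict_right_mono)
        finally have "(LINT y:ball x r|lborel. \<bar>f y - f x\<bar>) / ?V x r < e"
          using V by (simp add: field_simps)
        moreover have "0 \<le> (LINT y:ball x r|lborel. \<bar>f y - f x\<bar>)"
          by (auto simp: set_lebesgue_integral_def intro!: Bochner_Integration.integral_nonneg)
        ultimately show ?thesis using V by (simp add: dist_real_def)
      qed
      then show "\<forall>\<^sub>F r in at_right 0. dist ((LINT y:ball x r|lborel. \<bar>f y - f x\<bar>) / ?V x r) 0 < e"
        unfolding eventually_at_right_field using d(1) by blast
    qed
  qed
qed

subsection \<open>Divergence and integration by parts\<close>

text \<open>\<open>grad\<close> is a definite description. The vector assembled from the values of
  the derivative on the basis is its only candidate; later proofs use this lemma in place of the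
  description.\<close>

lemma has_derivative_grad:
  fixes f :: "'a::euclidean_space \<Rightarrow> real"
  assumes "f differentiable (at x)"
  shows "(f has_derivative (\<lambda>h. h \<bullet> grad f x)) (at x)"
proof -
  obtain f' where f': "(f has_derivative f') (at x)" using assms by (auto simp: differentiable_def)
  then interpret f': linear f' by (rule has_derivative_linear)
  define D where "D = (\<Sum>b\<in>Basis. f' b *\<^sub>R b)"
  have "f' h = h \<bullet> D" for h
  proof -
    have "f' h = f' (\<Sum>b\<in>Basis. (h \<bullet> b) *\<^sub>R b)" by (simp add: euclidean_representation)
    also have "\<dots> = h \<bullet> D" by (simp add: f'.sum f'.scaleR D_def inner_sum_right mult.commute)
    finally show ?thesis .
  qed
  then have "f' = (\<lambda>h. h \<bullet> D)" by auto
  then have "GDERIV f x :> D" using f' by (simp add: gderiv_def)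
  moreover have "D' = D" if "GDERIV f x :> D'" for D'
    using has_derivative_unique[of f "\<lambda>h. h \<bullet> D'" x "\<lambda>h. h \<bullet> D"] that \<open>GDERIV f x :> D\<close>
    by (metis gderiv_def vector_eq_ldot)
  ultimately have "GDERIV f x :> grad f x" unfolding grad_def by (rule theI)
  then show ?thesis by (simp add: gderiv_def)
qed

lemma grad_eqI:
  fixes f :: "'a::euclidean_space \<Rightarrow> real"
  assumes "(f has_derivative (\<lambda>h. h \<bullet> D)) (at x)"
  shows "grad f x = D"
  using has_derivative_unique[OF assms has_derivative_grad[OF differentiableI[OF assms]]]
  by (metis vector_eq_ldot)

lemma divergence_eqI: "(F has_derivative F') (at x) \<Longrightarrow> divergence F x = (\<Sum>b\<in>Basis. F' b \<bullet> b)"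
  by (simp add: divergence_def frechet_derivative_at[symmetric])

lemma C1_onD:
  assumes "C1_on S F" "x \<in> S"
  shows "(F has_derivative frechet_derivative F (at x)) (at x)"
  using assms by (simp add: C1_on_def frechet_derivative_works)

lemma C1_on_grad:
  assumes "C1_on S f"
  shows "continuous_on S (grad f)"
proof -
  have "continuous_on S (\<lambda>x. grad f x \<bullet> b)" for b
  proof -
    have "continuous_on S (\<lambda>x. frechet_derivative f (at x) b)" using assms by (simp add: C1_on_def)
    moreover have "frechet_derivative f (at x) b = grad f x \<bullet> b" if "x \<in> S" for x
      using assms that frechet_derivative_at[OF has_derivative_grad[of f x]]
      by (simp add: C1_on_def inner_commute fun_eq_iff)
    ultimately show ?thesis by (simp cong: continuous_on_cong)
  qed
  then show ?thesis by (subst continuous_on_componentwise) auto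
qed

lemma lborel_integral_translation:
  fixes f :: "'a::euclidean_space \<Rightarrow> 'b::{banach, second_countable_topology}"
  assumes "f \<in> borel_measurable borel"
  shows "(\<integral>x. f (x + c) \<partial>lborel) = (\<integral>x. f x \<partial>lborel)"
proof -
  have "(\<integral>x. f x \<partial>lborel) = (\<integral>x. f x \<partial>distr lborel borel ((+) c))"
    by (simp add: lborel_distr_plus)
  also have "\<dots> = (\<integral>x. f (c + x) \<partial>lborel)"
    using assms by (intro integral_distr) auto
  finally show ?thesis by (simp add: add.commute)
qed

lemma continuous_compact_support_bounded:
  fixes f :: "'a::euclidean_space \<Rightarrow> 'b::real_normed_vector"
  assumes "continuous_on UNIV f" "bounded K" "\<And>x. x \<notin> K \<Longrightarrow> f x = 0"
  obtains M where "M \<ge> 0" "\<And>x. norm (f x) \<le> M"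
proof -
  have "compact (f ` closure K)"
    using assms by (intro compact_continuous_image) (auto simp: compact_closure intro: continuous_on_subset)
  then have "bounded (f ` closure K)" by (rule compact_imp_bounded)
  then obtain M where M: "\<And>x. x \<in> closure K \<Longrightarrow> norm (f x) \<le> M"
    by (auto simp: bounded_iff)
  have "norm (f x) \<le> max M 0" for x
    using M[of x] assms(3)[of x] closure_subset[of K] by (cases "x \<in> K") auto
  then show thesis by (intro that[of "max M 0"]) auto
qed

text \<open>Difference quotients integrate to zero by translation invariance. They are uniformly
  bounded and supported in one ball, so dominated convergence carries this to the derivative without
  iterated integrals.\<close>

lemma integral_directional_derivative_zero:
  fixes f :: "'a::euclidean_space \<Rightarrow> real"
  assumes f': "\<And>x. (f has_derivative f' x) (at x)" and cont: "continuous_on UNIV (\<lambda>x. f' x b)"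
    and K: "compact K" "\<And>x. x \<notin> K \<Longrightarrow> f x = 0"
  shows "(\<integral>x. f' x b \<partial>lborel) = 0"
proof -
  have f0: "f' x b = 0" if "x \<notin> K" for x
  proof -
    have "(f has_derivative (\<lambda>_. 0)) (at x)"
      by (rule has_derivative_transform_within_open[where f="\<lambda>_. 0" and s="- K"])
         (use that K in \<open>auto simp: compact_imp_closed open_Compl\<close>)
    with f' have "f' x = (\<lambda>_. 0)" by (rule has_derivative_unique)
    then show ?thesis by simp
  qed
  obtain M where M: "M \<ge> 0" "\<And>x. norm (f' x b) \<le> M"
    using continuous_compact_support_bounded[OF cont compact_imp_bounded[OF K(1)] f0] by metis
  have fc: "continuous_on UNIV f" by (intro continuous_at_imp_continuous_on ballI has_derivative_continuous[OF f'])
  have fm [measurable]: "f \<in> borel_measurable borel" using fc by (rule borel_measurable_continuous_onI)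
  have gm [measurable]: "(\<lambda>x. f' x b) \<in> borel_measurable borel" using cont by (rule borel_measurable_continuous_onI)
  obtain Mf where Mf: "\<And>x. norm (f x) \<le> Mf"
    using continuous_compact_support_bounded[OF fc compact_imp_bounded[OF K(1)] K(2)] by metis
  obtain R where R: "\<And>x. x \<in> K \<Longrightarrow> norm x \<le> R" using compact_imp_bounded[OF K(1)] unfolding bounded_iff by auto
  define q where "q n x = real (Suc n) * (f (x + (1 / real (Suc n)) *\<^sub>R b) - f x)" for n x
  have fint: "integrable lborel f"
  proof (rule Bochner_Integration.integrable_bound[where f="\<lambda>x. Mf * indicator K x"])
    show "integrable lborel (\<lambda>x. Mf * indicator K x)"
      using emeasure_compact_finite[OF K(1)] K(1)
      by (intro integrable_mult_right integrable_real_indicator) (auto simp: compact_imp_closed)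
    have "norm (f x) \<le> norm (Mf * indicator K x)" for x
      using Mf[of x] K(2)[of x] by (auto simp: indicator_def)
    then show "AE x in lborel. norm (f x) \<le> norm (Mf * indicator K x)" by simp
  qed simp
  have q0: "(\<integral>x. q n x \<partial>lborel) = 0" for n
  proof -
    have i: "integrable lborel (\<lambda>x. f (x + (1 / real (Suc n)) *\<^sub>R b))"
      using fint lborel_distr_plus[of "(1 / real (Suc n)) *\<^sub>R b"]
        integrable_distr_eq[of "(+) ((1 / real (Suc n)) *\<^sub>R b)" lborel borel f]
      by (simp add: add.commute)
    show ?thesis unfolding q_def
      using i fint by (simp add: lborel_integral_translation del: of_nat_Suc)
  qed
  have qlim: "(\<lambda>n. q n x) \<longlonglongrightarrow> f' x b" for x
  proof -
    have "((\<lambda>t. f (x + t *\<^sub>R b)) has_vector_derivative f' x b) (at 0)"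
    proof -
      have "((\<lambda>t. f (x + t *\<^sub>R b)) has_derivative (\<lambda>t. f' x (t *\<^sub>R b))) (at 0)"
        by (rule has_derivative_compose[where f="\<lambda>t. x + t *\<^sub>R b" and g=f and f'="\<lambda>t. t *\<^sub>R b"])
           (auto intro!: derivative_eq_intros f'[of x, simplified])
      then show ?thesis
        using linear_scale[OF has_derivative_linear[OF f'[of x]]]
        by (simp add: has_vector_derivative_def)
    qed
    then have "((\<lambda>h. (f (x + h *\<^sub>R b) - f x) / h) \<longlongrightarrow> f' x b) (at 0)"
      by (simp add: has_real_derivative_iff_has_vector_derivative[symmetric] DERIV_def)
    moreover have "filterlim (\<lambda>n. 1 / real (Suc n)) (at 0) sequentially"
      unfolding filterlim_at using LIMSEQ_inverse_real_of_nat by (auto simp: inverse_eq_divide)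
    ultimately have "(\<lambda>n. (f (x + (1 / real (Suc n)) *\<^sub>R b) - f x) / (1 / real (Suc n))) \<longlonglongrightarrow> f' x b"
      by (rule filterlim_compose)
    then show ?thesis unfolding q_def by (simp add: mult.commute)
  qed
  \<comment> \<open>The mean value inequality along the segment gives the bound \<open>M\<close>;
    the enlarged ball contains the support of every shifted copy of \<open>f\<close>.\<close>
  have qb: "norm (q n x) \<le> M * indicator (ball 0 (R + norm b + 1)) x" for n x
  proof -
    let ?t = "1 / real (Suc n)"
    have "\<bar>f (x + ?t *\<^sub>R b) - f x\<bar> \<le> M * ?t"
    proof -
      have "norm (f (x + ?t *\<^sub>R b) - f (x + 0 *\<^sub>R b)) \<le> M * norm (?t - 0)"
      proof (rule differentiable_bound[where S="{0..?t}" and f="\<lambda>t. f (x + t *\<^sub>R b)" and f'="\<lambda>t s. s * f' (x + t *\<^sub>R b) b"])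
        fix t assume "t \<in> {0..?t}"
        have "((\<lambda>t. f (x + t *\<^sub>R b)) has_derivative (\<lambda>s. f' (x + t *\<^sub>R b) (s *\<^sub>R b))) (at t within {0..?t})"
          by (rule has_derivative_compose[where f="\<lambda>t. x + t *\<^sub>R b" and g=f and f'="\<lambda>t. t *\<^sub>R b"])
             (auto intro!: derivative_eq_intros f')
        then show "((\<lambda>t. f (x + t *\<^sub>R b)) has_derivative (\<lambda>s. s * f' (x + t *\<^sub>R b) b)) (at t within {0..?t})"
          using linear_scale[OF has_derivative_linear[OF f']] by simp
        show "onorm (\<lambda>s. s * f' (x + t *\<^sub>R b) b) \<le> M"
          by (rule onorm_le) (use M in \<open>auto simp: abs_mult mult.commute[of M] intro!: mult_left_mono\<close>)
      qed auto
      then show ?thesis by simp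
    qed
    then have 1: "norm (q n x) \<le> M"
      by (simp add: q_def abs_mult mult.commute pos_le_divide_eq del: of_nat_Suc)
    have "q n x = 0" if "x \<notin> ball 0 (R + norm b + 1)"
    proof -
      have "norm (?t *\<^sub>R b) \<le> norm b" by (simp add: field_simps)
      then have "norm (x + ?t *\<^sub>R b) > R" "norm x > R"
        using that norm_triangle_ineq4[of "x + ?t *\<^sub>R b" "?t *\<^sub>R b"] norm_ge_zero[of b]
        unfolding mem_ball dist_norm add_diff_cancel_right' diff_0 norm_minus_cancel by linarith+
      then have "x + ?t *\<^sub>R b \<notin> K" "x \<notin> K" using R by (auto simp: not_less[symmetric])
      then show ?thesis using K by (simp add: q_def)
    qed
    with 1 M show ?thesis by (auto simp: indicator_def)
  qed
  have "(\<lambda>n. \<integral>x. q n x \<partial>lborel) \<longlonglongrightarrow> (\<integral>x. f' x b \<partial>lborel)"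
  proof (rule integral_dominated_convergence)
    show "integrable lborel (\<lambda>x. M * indicator (ball 0 (R + norm b + 1)) x :: real)"
      using set_integrable_ball_const[of 0 "R + norm b + 1" M] by (simp add: set_integrable_def mult.commute)
    show "q n \<in> borel_measurable lborel" for n unfolding q_def[abs_def] by measurable
  qed (use qlim qb in auto)
  then show ?thesis using q0 by (simp add: LIMSEQ_const_iff)
qed

lemma test_fieldE:
  fixes \<phi> :: "'a::euclidean_space \<Rightarrow> 'a"
  assumes "test_field \<Omega> \<phi>"
  obtains K where "compact K" "K \<subseteq> \<Omega>" "\<And>x. x \<notin> K \<Longrightarrow> \<phi> x = 0"
    "\<And>x h. x \<notin> K \<Longrightarrow> frechet_derivative \<phi> (at x) h = 0" "\<And>x. x \<notin> K \<Longrightarrow> divergence \<phi> x = 0"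
    "\<And>x. (\<phi> has_derivative frechet_derivative \<phi> (at x)) (at x)"
    "continuous_on UNIV \<phi>" "\<And>h. continuous_on UNIV (\<lambda>x. frechet_derivative \<phi> (at x) h)"
    "continuous_on UNIV (divergence \<phi>)"
proof -
  from assms obtain K where K: "compact K" "K \<subseteq> \<Omega>" "\<And>x. x \<notin> K \<Longrightarrow> \<phi> x = 0" and C1: "C1_on UNIV \<phi>"
    by (auto simp: test_field_def)
  have D: "(\<phi> has_derivative frechet_derivative \<phi> (at x)) (at x)" for x using C1_onD[OF C1] by simp
  have D0: "frechet_derivative \<phi> (at x) h = 0" if "x \<notin> K" for x h
  proof -
    have "(\<phi> has_derivative (\<lambda>_. 0)) (at x)"
      by (rule has_derivative_transform_within_open[where f="\<lambda>_. 0" and s="- K"])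
         (use that K in \<open>auto simp: compact_imp_closed open_Compl\<close>)
    from frechet_derivative_at[OF this] show ?thesis by metis
  qed
  have cD: "continuous_on UNIV (\<lambda>x. frechet_derivative \<phi> (at x) h)" for h using C1 by (simp add: C1_on_def)
  have c: "continuous_on UNIV \<phi>" by (intro continuous_at_imp_continuous_on ballI has_derivative_continuous[OF D])
  have "continuous_on UNIV (divergence \<phi>)"
    unfolding divergence_def[abs_def] by (intro continuous_intros cD)
  with K D D0 c cD show thesis by (intro that[of K]) (auto simp: divergence_def)
qed

lemma set_integrable_compact_support:
  fixes f :: "'a::euclidean_space \<Rightarrow> 'b::{banach, second_countable_topology}"
  assumes "continuous_on \<Omega> f" "compact K" "K \<subseteq> \<Omega>" "\<And>x. x \<in> \<Omega> \<Longrightarrow> x \<notin> K \<Longrightarrow> f x = 0"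
  shows "set_integrable lborel \<Omega> f"
proof -
  have "integrable lborel (\<lambda>x. indicator K x *\<^sub>R f x)"
    using assms by (intro borel_integrable_compact) (auto intro: continuous_on_subset)
  moreover have "(\<lambda>x. indicator K x *\<^sub>R f x) = (\<lambda>x. indicator \<Omega> x *\<^sub>R f x)"
    by (intro ext) (use assms in \<open>auto simp: indicator_def\<close>)
  ultimately show ?thesis by (simp add: set_integrable_def)
qed

text \<open>The product of \<open>\<zeta>\<close> with a component of \<open>\<phi>\<close> extends
  by zero to a C1 function on the whole space, because \<Omega> and the complement of the compact
  support are open and cover it. Its derivative in the direction of that component integrates to
  zero, and the sum over the basis is the product rule for the divergence.\<close>

lemma integration_by_parts:
  fixes \<phi> :: "'a::euclidean_space \<Rightarrow> 'a"
  assumes \<Omega>: "open \<Omega>" and \<phi>: "test_field \<Omega> \<phi>"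
    and \<zeta>: "\<And>x. x \<in> \<Omega> \<Longrightarrow> (\<zeta> has_derivative (\<lambda>h. h \<bullet> Z x)) (at x)" and Z: "continuous_on \<Omega> Z"
  shows "set_integrable lborel \<Omega> (\<lambda>x. \<zeta> x * divergence \<phi> x)"
    and "set_integrable lborel \<Omega> (\<lambda>x. \<phi> x \<bullet> Z x)"
    and "(LINT x:\<Omega>|lborel. \<zeta> x * divergence \<phi> x) = - (LINT x:\<Omega>|lborel. \<phi> x \<bullet> Z x)"
proof -
  from \<phi> obtain K where K: "compact K" "K \<subseteq> \<Omega>" "\<And>x. x \<notin> K \<Longrightarrow> \<phi> x = 0"
    "\<And>x h. x \<notin> K \<Longrightarrow> frechet_derivative \<phi> (at x) h = 0" "\<And>x. x \<notin> K \<Longrightarrow> divergence \<phi> x = 0"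
    and D: "\<And>x. (\<phi> has_derivative frechet_derivative \<phi> (at x)) (at x)"
    and c: "continuous_on UNIV \<phi>" "\<And>h. continuous_on UNIV (\<lambda>x. frechet_derivative \<phi> (at x) h)"
      "continuous_on UNIV (divergence \<phi>)"
    by (erule test_fieldE)
  have c': "continuous_on \<Omega> \<phi>" "\<And>h. continuous_on \<Omega> (\<lambda>x. frechet_derivative \<phi> (at x) h)"
      "continuous_on \<Omega> (divergence \<phi>)"
    using c continuous_on_subset by blast+
  have c\<zeta>: "continuous_on \<Omega> \<zeta>"
    by (intro continuous_at_imp_continuous_on ballI has_derivative_continuous[OF \<zeta>])
  show i1: "set_integrable lborel \<Omega> (\<lambda>x. \<zeta> x * divergence \<phi> x)"
    using K by (intro set_integrable_compact_support continuous_intros c\<zeta> c') auto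
  show i2: "set_integrable lborel \<Omega> (\<lambda>x. \<phi> x \<bullet> Z x)"
    using K by (intro set_integrable_compact_support[where K=K] continuous_intros Z c') auto
  define f where "f b x = (if x \<in> \<Omega> then \<zeta> x * (\<phi> x \<bullet> b) else 0)" for b x
  define f' where "f' b x h = (if x \<in> \<Omega> then (h \<bullet> Z x) * (\<phi> x \<bullet> b) +
     \<zeta> x * (frechet_derivative \<phi> (at x) h \<bullet> b) else 0)" for b x h
  have zero: "(\<integral>x. f' b x b \<partial>lborel) = 0" for b
  proof (rule integral_directional_derivative_zero[where f="f b" and f'="f' b" and K=K])
    show "compact K" by fact
    show "f b x = 0" if "x \<notin> K" for x using that K by (auto simp: f_def)
    show "(f b has_derivative f' b x) (at x)" for x
    proof (cases "x \<in> \<Omega>")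
      case True
      have "((\<lambda>x. \<zeta> x * (\<phi> x \<bullet> b)) has_derivative
          (\<lambda>h. \<zeta> x * (frechet_derivative \<phi> (at x) h \<bullet> b) + (h \<bullet> Z x) * (\<phi> x \<bullet> b))) (at x)"
        by (intro has_derivative_mult \<zeta> True has_derivative_inner_left D)
      then have "(f b has_derivative
          (\<lambda>h. \<zeta> x * (frechet_derivative \<phi> (at x) h \<bullet> b) + (h \<bullet> Z x) * (\<phi> x \<bullet> b))) (at x)"
        by (rule has_derivative_transform_within_open[OF _ \<Omega> True]) (simp add: f_def)
      moreover have "f' b x = (\<lambda>h. \<zeta> x * (frechet_derivative \<phi> (at x) h \<bullet> b) + (h \<bullet> Z x) * (\<phi> x \<bullet> b))"
        using True by (auto simp: f'_def)
      ultimately show ?thesis by simp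
    next
      case False
      have "(f b has_derivative (\<lambda>_. 0)) (at x)"
        by (rule has_derivative_transform_within_open[where f="\<lambda>_. 0" and s="- K"])
           (use False K in \<open>auto simp: compact_imp_closed open_Compl f_def\<close>)
      moreover have "f' b x = (\<lambda>_. 0)" using False by (auto simp: f'_def)
      ultimately show ?thesis by simp
    qed
    have "continuous_on \<Omega> (\<lambda>x. f' b x b)"
      by (rule continuous_on_eq[where f="\<lambda>x. (b \<bullet> Z x) * (\<phi> x \<bullet> b) + \<zeta> x * (frechet_derivative \<phi> (at x) b \<bullet> b)"])
         (auto simp: f'_def intro!: continuous_intros Z c\<zeta> c')
    moreover have "continuous_on (- K) (\<lambda>x. f' b x b)"
      by (rule continuous_on_eq[where f="\<lambda>_. 0"]) (auto simp: f'_def K)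
    ultimately have "continuous_on (\<Omega> \<union> - K) (\<lambda>x. f' b x b)"
      using K(1) \<Omega> by (intro continuous_on_open_Un) (auto simp: compact_imp_closed open_Compl)
    moreover have "\<Omega> \<union> - K = UNIV" using K by auto
    ultimately show "continuous_on UNIV (\<lambda>x. f' b x b)" by simp
  qed
  have int: "integrable lborel (\<lambda>x. f' b x b)" for b
  proof -
    have "set_integrable lborel \<Omega> (\<lambda>x. (b \<bullet> Z x) * (\<phi> x \<bullet> b) + \<zeta> x * (frechet_derivative \<phi> (at x) b \<bullet> b))"
      using K by (intro set_integrable_compact_support[where K=K] continuous_intros Z c' c\<zeta>) auto
    then show ?thesis unfolding set_integrable_def
      by (rule Bochner_Integration.integrable_cong[THEN iffD1, rotated -1]) (auto simp: f'_def indicator_def)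
  qed
  have sum: "(\<Sum>b\<in>Basis. f' b x b) = indicator \<Omega> x *\<^sub>R (\<zeta> x * divergence \<phi> x) + indicator \<Omega> x *\<^sub>R (\<phi> x \<bullet> Z x)" for x
  proof (cases "x \<in> \<Omega>")
    case True
    have "(\<Sum>b\<in>Basis. f' b x b) = (\<Sum>b\<in>Basis. (b \<bullet> Z x) * (\<phi> x \<bullet> b)) + \<zeta> x * divergence \<phi> x"
      using True by (simp add: f'_def sum.distrib divergence_def sum_distrib_left)
    also have "(\<Sum>b\<in>Basis. (b \<bullet> Z x) * (\<phi> x \<bullet> b)) = \<phi> x \<bullet> Z x"
      by (subst euclidean_inner) (simp add: inner_commute mult.commute)
    finally show ?thesis using True by simp
  qed (simp add: f'_def)
  have "(\<integral>x. (\<Sum>b\<in>Basis. f' b x b) \<partial>lborel) = 0"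
    using zero int by simp
  then show "(LINT x:\<Omega>|lborel. \<zeta> x * divergence \<phi> x) = - (LINT x:\<Omega>|lborel. \<phi> x \<bullet> Z x)"
    unfolding sum using i1 i2 unfolding set_integrable_def set_lebesgue_integral_def
    by (simp add: Bochner_Integration.integral_add)
qed

subsection \<open>Mollification\<close>

text \<open>The square makes the positive part of \<open>1 - |x|^2\<close> continuously
  differentiable. That is enough, since test fields are only required to be C1, and it keeps
  derivatives and bounds explicit.\<close>

definition bump :: "'a::euclidean_space \<Rightarrow> real" where
  "bump x = (max 0 (1 - x \<bullet> x))\<^sup>2"

definition bump_mass :: "'a::euclidean_space itself \<Rightarrow> real" where
  "bump_mass _ = (\<integral>x. bump (x::'a) \<partial>lborel)"

definition moll :: "real \<Rightarrow> 'a::euclidean_space \<Rightarrow> real" where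
  "moll \<epsilon> x = bump ((1 / \<epsilon>) *\<^sub>R x) / (bump_mass TYPE('a) * \<epsilon> ^ DIM('a))"

text \<open>The gradient of \<open>moll\<close>: -4 is the 2 from the square times the -2 from
  \<open>1 - |x|^2\<close>, and the additional power of \<open>\<epsilon>\<close> in the denominator
  comes from the inner scaling.\<close>

definition moll_grad :: "real \<Rightarrow> 'a::euclidean_space \<Rightarrow> 'a" where
  "moll_grad \<epsilon> x = (- 4 * max 0 (1 - ((1 / \<epsilon>) *\<^sub>R x) \<bullet> ((1 / \<epsilon>) *\<^sub>R x)) /
     (bump_mass TYPE('a) * \<epsilon> ^ DIM('a) * \<epsilon>)) *\<^sub>R ((1 / \<epsilon>) *\<^sub>R x)"

lemma DERIV_max_0_squared: "((\<lambda>s. (max 0 s)\<^sup>2) has_real_derivative 2 * max 0 s) (at (s :: real))"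
proof -
  consider "s > 0" | "s < 0" | "s = 0" by linarith
  then show ?thesis
  proof cases
    case 1
    have "((\<lambda>s. s\<^sup>2) has_real_derivative 2 * s) (at s)" by (auto intro!: derivative_eq_intros)
    then have "((\<lambda>s. (max 0 s)\<^sup>2) has_real_derivative 2 * s) (at s)"
      by (rule has_field_derivative_transform_within_open[where S="{0<..}"]) (use 1 in auto)
    then show ?thesis using 1 by simp
  next
    case 2
    have "((\<lambda>s. 0) has_real_derivative 0) (at s)" by simp
    then have "((\<lambda>s. (max 0 s)\<^sup>2) has_real_derivative 0) (at s)"
      by (rule has_field_derivative_transform_within_open[where S="{..<0}"]) (use 2 in auto)
    then show ?thesis using 2 by simp
  next
    case 3
    have "((\<lambda>h::real. (max 0 h)\<^sup>2 / h) \<longlongrightarrow> 0) (at 0)"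
    proof (rule Lim_null_comparison)
      have "norm ((max 0 h)\<^sup>2 / h) \<le> \<bar>h\<bar>" for h :: real
        by (cases "h > 0") (auto simp: power2_eq_square)
      then show "\<forall>\<^sub>F h::real in at 0. norm ((max 0 h)\<^sup>2 / h) \<le> \<bar>h\<bar>" by simp
      show "((\<lambda>h::real. \<bar>h\<bar>) \<longlongrightarrow> 0) (at 0)" by (intro tendsto_rabs_zero) simp
    qed
    then show ?thesis using 3 by (simp add: DERIV_def)
  qed
qed

lemma has_derivative_bump: "(bump has_derivative (\<lambda>h. - 4 * max 0 (1 - x \<bullet> x) * (x \<bullet> h))) (at x)"
proof -
  have "((\<lambda>x. 1 - x \<bullet> x) has_derivative (\<lambda>h. - (2 * (x \<bullet> h)))) (at x)"
    by (auto intro!: derivative_eq_intros simp: inner_commute)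
  from has_derivative_compose[OF this DERIV_max_0_squared[unfolded has_field_derivative_def]]
  show ?thesis unfolding bump_def[abs_def] by (simp add: mult.assoc algebra_simps)
qed

lemma bump_simps:
  "0 \<le> bump x" "bump x \<le> 1" "norm x \<ge> 1 \<Longrightarrow> bump x = 0" "bump (- x) = bump x"
proof -
  show "bump x \<le> 1" unfolding bump_def by (intro power_le_one) auto
  show "norm x \<ge> 1 \<Longrightarrow> bump x = 0" by (simp add: bump_def dot_square_norm)
qed (simp_all add: bump_def)

lemma continuous_bump: "continuous_on S bump"
  by (intro continuous_at_imp_continuous_on ballI has_derivative_continuous[OF has_derivative_bump])

lemma bump_measurable [measurable]: "bump \<in> borel_measurable borel"
  by (intro borel_measurable_continuous_onI continuous_bump)

lemma integrable_bump: "integrable lborel bump"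
proof (rule Bochner_Integration.integrable_bound)
  show "integrable lborel (indicator (ball 0 1) :: 'a \<Rightarrow> real)"
    using set_integrable_ball_const[of 0 1 1] by (simp add: set_integrable_def)
  show "AE x in lborel. norm (bump x) \<le> norm (indicator (ball 0 1) x :: real)"
    by (auto simp: bump_simps indicator_def)
qed simp

lemma bump_mass_pos: "bump_mass TYPE('a::euclidean_space) > 0"
proof -
  have "0 < (9/16) * measure lborel (ball (0::'a) (1/2))"
    using content_ball_pos[of "1/2" "0::'a"] by simp
  also have "\<dots> = (\<integral>x. (9/16) * indicator (ball (0::'a) (1/2)) x \<partial>lborel)" by simp
  also have "\<dots> \<le> bump_mass TYPE('a)"
    unfolding bump_mass_def
  proof (rule integral_mono[OF _ integrable_bump])
    show "integrable lborel (\<lambda>x::'a. (9/16) * indicator (ball (0::'a) (1/2)) x :: real)"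
      using set_integrable_ball_const[of "0::'a" "1/2" "9/16"] by (simp add: set_integrable_def mult.commute)
    fix x :: 'a
    show "(9/16) * indicator (ball (0::'a) (1/2)) x \<le> bump x"
    proof (cases "norm x < 1/2")
      case True
      then have "x \<bullet> x \<le> 1/4" using power_mono[of "norm x" "1/2" 2] by (simp add: dot_square_norm power2_eq_square)
      then have "(3/4)\<^sup>2 \<le> bump x" unfolding bump_def by (intro power_mono) auto
      then show ?thesis using True by (simp add: power2_eq_square)
    qed (simp add: bump_simps)
  qed
  finally show ?thesis .
qed

lemma lborel_integral_affine:
  fixes f :: "'a::euclidean_space \<Rightarrow> 'b::{banach, second_countable_topology}"
  assumes [measurable]: "f \<in> borel_measurable borel" and c: "c > 0"
  shows "(\<integral>x. f x \<partial>lborel) = c ^ DIM('a) *\<^sub>R (\<integral>x. f (t + c *\<^sub>R x) \<partial>lborel)"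
proof -
  have "(\<integral>x. f x \<partial>lborel) = (\<integral>x. f x \<partial>density (distr lborel borel (\<lambda>x. t + c *\<^sub>R x)) (\<lambda>_. \<bar>c\<bar>^DIM('a)))"
    using lborel_affine[of c t] c by simp
  also have "\<dots> = (\<integral>x. c ^ DIM('a) *\<^sub>R f x \<partial>distr lborel borel (\<lambda>x. t + c *\<^sub>R x))"
    using c by (subst integral_density) auto
  also have "\<dots> = c ^ DIM('a) *\<^sub>R (\<integral>x. f (t + c *\<^sub>R x) \<partial>lborel)"
    by (subst integral_distr) auto
  finally show ?thesis .
qed

lemma moll_measurable [measurable]: "moll \<epsilon> \<in> borel_measurable borel"
  unfolding moll_def[abs_def] by measurable

context
  fixes \<epsilon> :: real assumes \<epsilon>: "\<epsilon> > 0"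
begin

lemma moll_nonneg: "0 \<le> moll \<epsilon> (x::'a::euclidean_space)"
  using \<epsilon> bump_mass_pos[where 'a='a] by (simp add: moll_def bump_simps)

lemma moll_le: "moll \<epsilon> (x::'a::euclidean_space) \<le> 1 / (bump_mass TYPE('a) * \<epsilon> ^ DIM('a))"
  using \<epsilon> bump_mass_pos[where 'a='a] by (simp add: moll_def bump_simps divide_right_mono)

lemma moll_eq_0: "norm x \<ge> \<epsilon> \<Longrightarrow> moll \<epsilon> (x::'a::euclidean_space) = 0"
  using \<epsilon> by (simp add: moll_def bump_simps field_simps)

lemma moll_minus: "moll \<epsilon> (- x) = moll \<epsilon> (x::'a::euclidean_space)"
  by (simp add: moll_def bump_simps)

lemma has_derivative_moll: "(moll \<epsilon> has_derivative (\<lambda>h. h \<bullet> moll_grad \<epsilon> x)) (at (x::'a::euclidean_space))"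
proof -
  have 1: "((\<lambda>x. (1 / \<epsilon>) *\<^sub>R x) has_derivative (\<lambda>h. (1 / \<epsilon>) *\<^sub>R h)) (at x)"
    by (auto intro!: derivative_eq_intros)
  have "(moll \<epsilon> has_derivative (\<lambda>h. (- 4 * max 0 (1 - ((1/\<epsilon>) *\<^sub>R x) \<bullet> ((1/\<epsilon>) *\<^sub>R x)) * (((1/\<epsilon>) *\<^sub>R x) \<bullet> ((1/\<epsilon>) *\<^sub>R h)))
      / (bump_mass TYPE('a) * \<epsilon> ^ DIM('a)))) (at x)"
    unfolding moll_def[abs_def]
    using has_derivative_compose[OF 1 has_derivative_bump[of "(1 / \<epsilon>) *\<^sub>R x"]]
    by (rule bounded_linear.has_derivative[OF bounded_linear_divide])
  then show ?thesis
    using \<epsilon> by (simp add: moll_grad_def inner_commute mult_ac)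
qed

lemma continuous_moll_grad: "continuous_on S (moll_grad \<epsilon> :: 'a::euclidean_space \<Rightarrow> 'a)"
  unfolding moll_grad_def by (intro continuous_intros) (use \<epsilon> bump_mass_pos[where 'a='a] in auto)

lemma moll_grad_eq_0: "norm x \<ge> \<epsilon> \<Longrightarrow> moll_grad \<epsilon> (x::'a::euclidean_space) = 0"
proof -
  assume "norm x \<ge> \<epsilon>"
  then have "norm ((1 / \<epsilon>) *\<^sub>R x) \<ge> 1" using \<epsilon> by (simp add: field_simps)
  then have "((1 / \<epsilon>) *\<^sub>R x) \<bullet> ((1 / \<epsilon>) *\<^sub>R x) \<ge> 1" unfolding dot_square_norm by simp
  then show ?thesis by (simp add: moll_grad_def max_def)
qed

text \<open>Blow-up coordinates around \<open>y\<close>: the scale moves from the kernel into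
  \<open>f\<close>, so that limits can be taken under a fixed kernel.\<close>

lemma integral_moll_affine:
  fixes f :: "'a::euclidean_space \<Rightarrow> 'b::{banach, second_countable_topology}"
  assumes [measurable]: "f \<in> borel_measurable borel"
  shows "(\<integral>x. moll \<epsilon> (x - y) *\<^sub>R f x \<partial>lborel) = (\<integral>x. moll 1 x *\<^sub>R f (y + \<epsilon> *\<^sub>R x) \<partial>lborel)"
proof -
  have "(\<integral>x. moll \<epsilon> (x - y) *\<^sub>R f x \<partial>lborel) =
      \<epsilon> ^ DIM('a) *\<^sub>R (\<integral>x. moll \<epsilon> (y + \<epsilon> *\<^sub>R x - y) *\<^sub>R f (y + \<epsilon> *\<^sub>R x) \<partial>lborel)"
    by (rule lborel_integral_affine) (use \<epsilon> in auto)
  also have "\<dots> = (\<integral>x. \<epsilon> ^ DIM('a) *\<^sub>R (moll \<epsilon> (\<epsilon> *\<^sub>R x) *\<^sub>R f (y + \<epsilon> *\<^sub>R x)) \<partial>lborel)"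
    unfolding integral_scaleR_right by simp
  also have "\<dots> = (\<integral>x. moll 1 x *\<^sub>R f (y + \<epsilon> *\<^sub>R x) \<partial>lborel)"
    using \<epsilon> by (intro Bochner_Integration.integral_cong) (auto simp: moll_def)
  finally show ?thesis .
qed

lemma integrable_moll: "integrable lborel (moll \<epsilon> :: 'a::euclidean_space \<Rightarrow> real)"
proof (rule Bochner_Integration.integrable_bound)
  show "integrable lborel (\<lambda>x::'a. indicator (ball 0 \<epsilon>) x *\<^sub>R (1 / (bump_mass TYPE('a) * \<epsilon> ^ DIM('a))))"
    by (rule set_integrable_ball_const[unfolded set_integrable_def])
  show "AE x::'a in lborel. norm (moll \<epsilon> x) \<le> norm (indicator (ball 0 \<epsilon>) x *\<^sub>R (1 / (bump_mass TYPE('a) * \<epsilon> ^ DIM('a))))"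
  proof (intro AE_I2)
    fix x :: 'a
    have "0 \<le> 1 / (bump_mass TYPE('a) * \<epsilon> ^ DIM('a))" using bump_mass_pos[where 'a='a] \<epsilon> by simp
    then show "norm (moll \<epsilon> x) \<le> norm (indicator (ball 0 \<epsilon>) x *\<^sub>R (1 / (bump_mass TYPE('a) * \<epsilon> ^ DIM('a))))"
      using moll_le[of x] moll_nonneg[of x] moll_eq_0[of x] by (cases "norm x < \<epsilon>") auto
  qed
qed simp

lemma integral_moll: "(\<integral>x. moll \<epsilon> (x::'a::euclidean_space) \<partial>lborel) = 1"
proof -
  have "(\<integral>x. moll \<epsilon> (x::'a) \<partial>lborel) = (\<integral>x. moll \<epsilon> (x - 0 :: 'a) *\<^sub>R (1::real) \<partial>lborel)" by simp
  also have "\<dots> = (\<integral>x. moll 1 (x::'a) *\<^sub>R (1::real) \<partial>lborel)" by (rule integral_moll_affine) simp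
  also have "\<dots> = 1"
    using bump_mass_pos[where 'a='a] by (simp add: moll_def[abs_def] bump_mass_def)
  finally show ?thesis .
qed

end

text \<open>Compactness settles pairs in the ball of radius \<open>R + 1\<close>. For points at
  distance less than 1, a pair not contained in that ball lies where \<open>g\<close>
  vanishes.\<close>

lemma uniformly_continuous_compact_support:
  fixes g :: "'a::euclidean_space \<Rightarrow> 'b::real_normed_vector"
  assumes g: "continuous_on UNIV g" and R: "\<And>x. norm x \<ge> R \<Longrightarrow> g x = 0"
  shows "uniformly_continuous_on UNIV g"
proof -
  have u: "uniformly_continuous_on (cball 0 (R + 1)) g"
    by (rule compact_uniformly_continuous) (auto intro: continuous_on_subset[OF g])
  show ?thesis unfolding uniformly_continuous_on_def
  proof (intro allI impI)
    fix e :: real assume e: "e > 0"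
    with u obtain d where d: "d > 0" "\<And>x y. norm x \<le> R + 1 \<Longrightarrow> norm y \<le> R + 1 \<Longrightarrow> dist y x < d \<Longrightarrow> dist (g y) (g x) < e"
      unfolding uniformly_continuous_on_def by (auto simp: Ball_def)
    have "dist (g y) (g x) < e" if xy: "dist y x < min d 1" for x y
    proof (cases "norm x \<le> R + 1 \<and> norm y \<le> R + 1")
      case True
      then show ?thesis using d xy by auto
    next
      case False
      have "\<bar>norm y - norm x\<bar> \<le> dist y x" by (simp add: dist_norm norm_triangle_ineq3)
      then have "norm x \<ge> R" "norm y \<ge> R" using False xy by auto
      then show ?thesis using R e by simp
    qed
    then show "\<exists>d>0. \<forall>x\<in>UNIV. \<forall>y\<in>UNIV. dist y x < d \<longrightarrow> dist (g y) (g x) < e"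
      using d(1) by (intro exI[of _ "min d 1"]) auto
  qed
qed

lemma integrable_mult_bounded:
  fixes f :: "'a \<Rightarrow> real" and g :: "'a \<Rightarrow> 'b::{banach, second_countable_topology}"
  assumes f: "integrable M f" and [measurable]: "g \<in> borel_measurable M" and B: "\<And>x. norm (g x) \<le> B"
  shows "integrable M (\<lambda>x. f x *\<^sub>R g x)"
proof (rule Bochner_Integration.integrable_bound[OF integrable_mult_right[OF f, of B]])
  show "(\<lambda>x. f x *\<^sub>R g x) \<in> borel_measurable M" using f by measurable
  show "AE x in M. norm (f x *\<^sub>R g x) \<le> norm (B * f x)"
  proof (intro AE_I2)
    fix x
    have "0 \<le> B" using B[of x] norm_ge_zero order_trans by blast
    then show "norm (f x *\<^sub>R g x) \<le> norm (B * f x)"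
      using mult_left_mono[OF B[of x], of "\<bar>f x\<bar>"] by (simp add: abs_mult mult.commute)
  qed
qed

lemma continuous_convolution:
  fixes g :: "'a::euclidean_space \<Rightarrow> 'b::euclidean_space"
  assumes g: "continuous_on UNIV g" and R: "\<And>x. norm x \<ge> R \<Longrightarrow> g x = 0" and f: "integrable lborel f"
  shows "integrable lborel (\<lambda>y. f y *\<^sub>R g (x - y))"
    and "continuous_on UNIV (\<lambda>x. \<integral>y. f y *\<^sub>R g (x - y) \<partial>lborel)"
proof -
  obtain B where B: "\<And>x. norm (g x) \<le> B"
    by (rule continuous_compact_support_bounded[OF g bounded_ball[of 0 R]]) (use R in auto)
  have gm [measurable]: "g \<in> borel_measurable borel" by (rule borel_measurable_continuous_onI[OF g])
  show "integrable lborel (\<lambda>y. f y *\<^sub>R g (x - y))" for x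
    by (rule integrable_mult_bounded[OF f _ B]) simp
  show "continuous_on UNIV (\<lambda>x. \<integral>y. f y *\<^sub>R g (x - y) \<partial>lborel)"
    unfolding continuous_on_sequentially
  proof (intro allI ballI impI, elim conjE)
    fix X :: "nat \<Rightarrow> 'a" and x assume X: "X \<longlonglongrightarrow> x"
    show "((\<lambda>x. \<integral>y. f y *\<^sub>R g (x - y) \<partial>lborel) \<circ> X) \<longlonglongrightarrow> (\<integral>y. f y *\<^sub>R g (x - y) \<partial>lborel)"
      unfolding comp_def
    proof (rule integral_dominated_convergence[where w="\<lambda>y. B * \<bar>f y\<bar>"])
      show "AE y in lborel. (\<lambda>i. f y *\<^sub>R g (X i - y)) \<longlonglongrightarrow> f y *\<^sub>R g (x - y)"
        by (intro AE_I2 tendsto_intros continuous_on_tendsto_compose[OF g] X) auto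
      show "AE y in lborel. norm (f y *\<^sub>R g (X i - y)) \<le> B * \<bar>f y\<bar>" for i
        by (intro AE_I2) (use B in \<open>auto simp: mult.commute[of B] intro!: mult_left_mono\<close>)
    qed (use f in \<open>auto intro: integrable_abs\<close>)
  qed
qed

text \<open>Uniform continuity of \<open>g\<close> bounds the linearisation error of
  \<open>k\<close> uniformly in \<open>y\<close>; integrating this bound against \<open>|f|\<close>
  gives the derivative directly.\<close>

lemma has_derivative_convolution:
  fixes k :: "'a::euclidean_space \<Rightarrow> real"
  assumes k: "\<And>x. (k has_derivative (\<lambda>h. h \<bullet> g x)) (at x)" "\<And>x. norm x \<ge> R \<Longrightarrow> k x = 0"
    and g: "continuous_on UNIV g" "\<And>x. norm x \<ge> R \<Longrightarrow> g x = 0" and f: "integrable lborel f"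
  shows "((\<lambda>x. \<integral>y. f y * k (x - y) \<partial>lborel) has_derivative
           (\<lambda>h. h \<bullet> (\<integral>y. f y *\<^sub>R g (x - y) \<partial>lborel))) (at x)"
proof -
  have kc: "continuous_on UNIV k"
    by (intro continuous_at_imp_continuous_on ballI has_derivative_continuous[OF k(1)])
  have ik: "integrable lborel (\<lambda>y. f y * k (x - y))" for x
    using continuous_convolution(1)[OF kc k(2) f] by simp
  have ig: "integrable lborel (\<lambda>y. f y *\<^sub>R g (x - y))" for x
    by (rule continuous_convolution(1)[OF g f])
  \<comment> \<open>The summand 1 keeps the divisor positive when \<open>f\<close> vanishes almost
    everywhere.\<close>
  define N where "N = (\<integral>y. \<bar>f y\<bar> \<partial>lborel) + 1"
  have N: "N > 0" unfolding N_def by (intro add_nonneg_pos Bochner_Integration.integral_nonneg) auto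
  have u: "uniformly_continuous_on UNIV g" by (rule uniformly_continuous_compact_support[OF g])
  show ?thesis unfolding has_derivative_at_alt
  proof (intro conjI allI impI)
    show "bounded_linear (\<lambda>h. h \<bullet> (\<integral>y. f y *\<^sub>R g (x - y) \<partial>lborel))" by (rule bounded_linear_inner_left)
    fix e :: real assume "e > 0"
    then have "e / N > 0" using N by simp
    then obtain d where d: "d > 0" "\<And>x y. dist y x < d \<Longrightarrow> dist (g y) (g x) < e / N"
      using u unfolding uniformly_continuous_on_def by (auto simp: Ball_def)
    have "norm ((\<integral>y. f y * k (x' - y) \<partial>lborel) - (\<integral>y. f y * k (x - y) \<partial>lborel)
            - (x' - x) \<bullet> (\<integral>y. f y *\<^sub>R g (x - y) \<partial>lborel)) \<le> e * norm (x' - x)"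
      if x': "norm (x' - x) < d" for x'
    proof -
      have lin: "\<bar>k (x' - y) - k (x - y) - (x' - x) \<bullet> g (x - y)\<bar> \<le> norm (x' - x) * (e / N)" for y
      proof -
        have "norm (k (x' - y) - k (x - y) - ((x' - y) - (x - y)) \<bullet> g (x - y)) \<le> norm ((x' - y) - (x - y)) * (e / N)"
        proof (rule differentiable_bound_linearization[where S="ball (x - y) d" and f'="\<lambda>x h. h \<bullet> g x"])
          fix t :: real assume t: "t \<in> {0..1}"
          have "\<bar>t\<bar> * norm (x' - x) \<le> 1 * norm (x' - x)" using t by (intro mult_right_mono) auto
          then show "x - y + t *\<^sub>R (x' - y - (x - y)) \<in> ball (x - y) d"
            using x' by (simp add: dist_norm)
        next
          fix z assume z: "z \<in> ball (x - y) d"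
          show "(k has_derivative (\<lambda>h. h \<bullet> g z)) (at z within ball (x - y) d)"
            using k(1) has_derivative_at_withinI by blast
          have "norm (g z - g (x - y)) \<le> e / N"
            using d(2)[of z "x - y"] z by (simp add: dist_norm norm_minus_commute)
          then have "norm (i \<bullet> g z - i \<bullet> g (x - y)) \<le> e / N * norm i" for i
            using Cauchy_Schwarz_ineq2[of i "g z - g (x - y)"]
              mult_left_mono[of "norm (g z - g (x - y))" "e / N" "norm i"]
            by (simp add: inner_diff_right mult.commute)
          then show "onorm ((\<lambda>i. i \<bullet> g z) - (\<lambda>i. i \<bullet> g (x - y))) \<le> e / N"
            unfolding fun_diff_def by (rule onorm_le)
        qed (use d in auto)
        then show ?thesis by simp
      qed
      have "(\<integral>y. f y * k (x' - y) \<partial>lborel) - (\<integral>y. f y * k (x - y) \<partial>lborel)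
            - (x' - x) \<bullet> (\<integral>y. f y *\<^sub>R g (x - y) \<partial>lborel)
          = (\<integral>y. f y * (k (x' - y) - k (x - y) - (x' - x) \<bullet> g (x - y)) \<partial>lborel)"
        using ik ig[of x, THEN integrable_inner_right[of "x' - x"]]
          integral_inner_right[OF ig, of "x' - x" x]
        by (simp add: right_diff_distrib)
      also have "norm \<dots> \<le> (\<integral>y. \<bar>f y\<bar> * (norm (x' - x) * (e / N)) \<partial>lborel)"
      proof (rule Bochner_Integration.integral_norm_bound_integral)
        show "integrable lborel (\<lambda>y. f y * (k (x' - y) - k (x - y) - (x' - x) \<bullet> g (x - y)))"
          using ik ig[of x, THEN integrable_inner_right[of "x' - x"]] by (simp add: right_diff_distrib)
        show "integrable lborel (\<lambda>y. \<bar>f y\<bar> * (norm (x' - x) * (e / N)))"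
          using f by (intro integrable_mult_left integrable_abs)
        show "norm (f y * (k (x' - y) - k (x - y) - (x' - x) \<bullet> g (x - y))) \<le> \<bar>f y\<bar> * (norm (x' - x) * (e / N))" for y
          using mult_left_mono[OF lin[of y], of "\<bar>f y\<bar>"] by (simp add: abs_mult)
      qed
      also have "\<dots> = (\<integral>y. \<bar>f y\<bar> \<partial>lborel) / N * (e * norm (x' - x))"
        by simp
      also have "\<dots> \<le> 1 * (e * norm (x' - x))"
        using N \<open>e > 0\<close> by (intro mult_right_mono) (auto simp: N_def)
      finally show ?thesis by simp
    qed
    with d(1) show "\<exists>d>0. \<forall>x'. norm (x' - x) < d \<longrightarrow>
          norm ((\<integral>y. f y * k (x' - y) \<partial>lborel) - (\<integral>y. f y * k (x - y) \<partial>lborel)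
            - (x' - x) \<bullet> (\<integral>y. f y *\<^sub>R g (x - y) \<partial>lborel)) \<le> e * norm (x' - x)" by blast
  qed
qed

subsection \<open>Mollified jumps\<close>

text \<open>Both measures are determined by their distribution functions. Without atoms
  \<open>cdf M\<close> is continuous, so its sublevel set at a level in \<open>[0, 1)\<close> is a
  closed half-line whose endpoint attains the level, unless it is empty, which forces the level to
  be zero.\<close>

lemma probability_integral_transform:
  assumes "real_distribution M" and atomless: "\<And>x. measure M {x} = 0"
  shows "distr M borel (cdf M) = density lborel (indicator {0..1})"
proof -
  interpret M: real_distribution M by fact
  let ?F = "cdf M" and ?U = "density lborel (indicator {0..1::real})"
  have Fc: "isCont ?F x" for x using M.isCont_cdf atomless by simp
  have Fm [measurable]: "?F \<in> borel_measurable borel"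
    using Fc by (intro borel_measurable_continuous_onI continuous_at_imp_continuous_on) auto
  have U: "real_distribution ?U"
    by (intro real_distribution.intro prob_spaceI real_distribution_axioms.intro)
       (auto simp: emeasure_density)
  have Ucdf: "cdf ?U t = (if t < 0 then 0 else if t < 1 then t else 1)" for t
  proof -
    have "emeasure ?U {..t} = (\<integral>\<^sup>+ x. indicator ({0..1} \<inter> {..t}) x \<partial>lborel)"
      by (subst emeasure_density)
         (auto intro!: nn_integral_cong simp del: nn_integral_indicator split: split_indicator)
    also have "\<dots> = emeasure lborel ({0..1} \<inter> {..t})" by (rule nn_integral_indicator) simp
    also have "{0..1} \<inter> {..t} = {0..min 1 t}" by auto
    finally show ?thesis by (auto simp: cdf_def measure_def)
  qed
  have "real_distribution (distr M borel ?F)"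
    by (rule M.real_distribution_distr) simp
  moreover have "cdf (distr M borel ?F) = cdf ?U"
  proof
    fix t
    define A where "A = {x. ?F x \<le> t}"
    have cd: "cdf (distr M borel ?F) t = measure M A"
      unfolding cdf_def[of "distr M borel ?F"] A_def by (subst measure_distr) (auto simp: vimage_def)
    consider "t < 0" | "t \<ge> 1" | "0 \<le> t" "t < 1" by linarith
    then show "cdf (distr M borel ?F) t = cdf ?U t"
    proof cases
      case 1
      have "\<not> ?F x \<le> t" for x using M.cdf_nonneg[of x] 1 by linarith
      then have "A = {}" unfolding A_def by simp
      then show ?thesis using 1 by (simp add: cd Ucdf)
    next
      case 2
      have "?F x \<le> t" for x using M.cdf_bounded_prob[of x] 2 by linarith
      then have "A = UNIV" unfolding A_def by auto
      then show ?thesis using 2 M.prob_space by (simp add: cd Ucdf)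
    next
      case 3
      obtain z where z: "?F z > t"
      proof -
        have "\<forall>\<^sub>F x in at_top. ?F x > t" using M.cdf_lim_at_top_prob 3(2) by (rule order_tendstoD)
        then show thesis using that by (auto simp: eventually_at_top_linorder)
      qed
      show ?thesis
      proof (cases "A = {}")
        case True
        have "t = 0"
        proof (rule ccontr)
          assume "t \<noteq> 0"
          then have "0 < t" using 3 by simp
          then have "\<forall>\<^sub>F x in at_bot. ?F x < t" using M.cdf_lim_at_bot by (intro order_tendstoD)
          then obtain x where "?F x < t" by (auto simp: eventually_at_bot_linorder)
          then have "x \<in> A" by (simp add: A_def)
          then show False using True by simp
        qed
        then have "cdf ?U t = 0" by (simp add: Ucdf)
        then show ?thesis unfolding cd True by simp
      next
        case False
        have bdd: "bdd_above A"
        proof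
          fix x assume "x \<in> A"
          then show "x \<le> z" using z M.cdf_nondecreasing[of z x] by (cases "x \<le> z") (auto simp: A_def)
        qed
        have cl: "closed A" unfolding A_def
          using Fc by (intro closed_Collect_le continuous_intros continuous_at_imp_continuous_on) auto
        define s where "s = Sup A"
        have sA: "s \<in> A" unfolding s_def by (rule closed_contains_Sup[OF False bdd cl])
        have "A = {..s}"
        proof
          show "A \<subseteq> {..s}" using bdd by (auto simp: s_def intro: cSup_upper)
          show "{..s} \<subseteq> A" using sA order_trans[OF M.cdf_nondecreasing[of _ s]] by (auto simp: A_def)
        qed
        then have mA: "measure M A = ?F s" by (simp add: cdf_def)
        have "?F s = t"
        proof (rule ccontr)
          assume "?F s \<noteq> t"
          then have "?F s < t" using sA by (simp add: A_def)
          then have "\<forall>\<^sub>F x in at_right s. ?F x < t"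
            using Fc[of s] by (intro order_tendstoD(2)[where y="?F s"]) (auto simp: isCont_def filterlim_at_split)
          then have "\<forall>\<^sub>F x in at_right s. ?F x < t \<and> s < x"
            by (intro eventually_conj eventually_at_right_less)
          then obtain x where "?F x < t" "s < x"
            using eventually_happens[of _ "at_right s"] by (auto simp: trivial_limit_at_right_real)
          then have "x \<in> A" by (simp add: A_def)
          then show False using \<open>A = {..s}\<close> \<open>s < x\<close> by simp
        qed
        then show ?thesis using 3 by (simp add: cd mA Ucdf)
      qed
    qed
  qed
  ultimately show ?thesis by (intro cdf_unique[OF _ U])
qed

text \<open>The distribution function of \<open>\<xi> \<bullet> \<nu>\<close> when
  \<open>\<xi>\<close> has density \<open>moll 1\<close>; equivalently, the profile of a mollified
  unit step.\<close>

definition halfspace_mass :: "'a::euclidean_space \<Rightarrow> real \<Rightarrow> real" where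
  "halfspace_mass \<nu> s = (\<integral>\<xi>. moll 1 \<xi> * indicator {\<xi>. \<xi> \<bullet> \<nu> \<le> s} \<xi> \<partial>lborel)"

text \<open>Under the mollifier, \<open>halfspace_mass \<nu> (\<eta> \<bullet> \<nu>)\<close> is uniformly distributed on the unit interval:
  this is why mollifying a jump reproduces exactly the jump of the composition with \<open>T\<close>.\<close>

lemma integral_halfspace_mass:
  fixes \<nu> :: "'a::euclidean_space" and T \<theta> :: "real \<Rightarrow> real"
  assumes \<nu>: "norm \<nu> = 1" and T: "\<And>s. (T has_real_derivative \<theta> s) (at s)" and \<theta>: "continuous_on UNIV \<theta>"
  shows "b * (\<integral>\<eta>. moll 1 \<eta> * \<theta> (a + b * halfspace_mass \<nu> (\<eta> \<bullet> \<nu>)) \<partial>lborel) = T (a + b) - T a"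
proof -
  define P where "P = density lborel (\<lambda>x. ennreal (moll 1 (x::'a)))"
  define M where "M = distr P borel (\<lambda>\<xi>. \<xi> \<bullet> \<nu>)"
  have [simp]: "sets P = sets borel" "space P = UNIV" by (simp_all add: P_def)
  have [measurable_cong]: "sets P = sets borel" by simp
  have emP: "emeasure P A = ennreal (\<integral>\<xi>. moll 1 \<xi> * indicator A \<xi> \<partial>lborel)" if "A \<in> sets borel" for A
  proof -
    have "emeasure P A = (\<integral>\<^sup>+ \<xi>. ennreal (moll 1 \<xi> * indicator A \<xi>) \<partial>lborel)"
      using that unfolding P_def
      by (subst emeasure_density) (auto intro!: nn_integral_cong simp: indicator_def)
    also have "\<dots> = ennreal (\<integral>\<xi>. moll 1 \<xi> * indicator A \<xi> \<partial>lborel)"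
      using that by (intro nn_integral_eq_integral integrable_real_mult_indicator)
        (auto simp: integrable_moll moll_nonneg)
    finally show ?thesis .
  qed
  have mP: "measure P A = (\<integral>\<xi>. moll 1 \<xi> * indicator A \<xi> \<partial>lborel)" if "A \<in> sets borel" for A
    using emP[OF that] by (simp add: measure_def moll_nonneg Bochner_Integration.integral_nonneg)
  interpret P: prob_space P
    by (rule prob_spaceI) (simp add: emP integral_moll)
  interpret M: real_distribution M
    unfolding M_def by (rule P.real_distribution_distr) simp
  have cdfM: "cdf M s = halfspace_mass \<nu> s" for s
  proof -
    have "cdf M s = measure P {\<xi>. \<xi> \<bullet> \<nu> \<le> s}"
      unfolding cdf_def M_def by (subst measure_distr) (auto simp: vimage_def)
    then show ?thesis by (simp add: mP halfspace_mass_def)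
  qed
  have atomless: "measure M {s} = 0" for s
  proof -
    have "measure M {s} = measure P {\<xi>. \<xi> \<bullet> \<nu> = s}"
      unfolding M_def by (subst measure_distr) (auto simp: vimage_def)
    also have "\<dots> = (\<integral>\<xi>. moll 1 \<xi> * indicator {\<xi>. \<xi> \<bullet> \<nu> = s} \<xi> \<partial>lborel)" by (rule mP) simp
    also have "\<dots> = 0"
    proof (rule integral_eq_zero_AE)
      have "negligible {\<xi>. \<nu> \<bullet> \<xi> = s}" using \<nu> by (intro negligible_hyperplane) auto
      then have "AE \<xi> in lebesgue. \<xi> \<notin> {\<xi>. \<xi> \<bullet> \<nu> = s}"
        by (intro AE_not_in) (simp add: negligible_iff_null_sets inner_commute)
      then have "AE \<xi> in lborel. \<xi> \<notin> {\<xi>. \<xi> \<bullet> \<nu> = s}"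
        by (simp add: AE_completion_iff)
      then show "AE \<xi> in lborel. moll 1 \<xi> * indicator {\<xi>. \<xi> \<bullet> \<nu> = s} \<xi> = 0"
        by eventually_elim simp
    qed
    finally show ?thesis .
  qed
  have U: "distr M borel (cdf M) = density lborel (indicator {0..1})"
    by (rule probability_integral_transform[OF M.real_distribution_axioms atomless])
  have Fm [measurable]: "cdf M \<in> borel_measurable borel"
    using M.isCont_cdf atomless by (intro borel_measurable_continuous_onI continuous_at_imp_continuous_on) auto
  have Gm [measurable]: "halfspace_mass \<nu> \<in> borel_measurable borel" 
  proof -
    have "cdf M = halfspace_mass \<nu>" using cdfM by auto
    with Fm show ?thesis by simp
  qed
  have \<theta>m [measurable]: "\<theta> \<in> borel_measurable borel" by (rule borel_measurable_continuous_onI[OF \<theta>])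
  have "(\<integral>\<eta>. moll 1 \<eta> * \<theta> (a + b * halfspace_mass \<nu> (\<eta> \<bullet> \<nu>)) \<partial>lborel)
      = (\<integral>\<eta>. \<theta> (a + b * cdf M (\<eta> \<bullet> \<nu>)) \<partial>P)"
    unfolding P_def cdfM by (subst integral_density) (auto simp: moll_nonneg)
  also have "\<dots> = (\<integral>s. \<theta> (a + b * cdf M s) \<partial>M)"
  proof -
    have "(\<integral>s. \<theta> (a + b * cdf M s) \<partial>distr P borel (\<lambda>\<xi>. \<xi> \<bullet> \<nu>)) = (\<integral>\<eta>. \<theta> (a + b * cdf M (\<eta> \<bullet> \<nu>)) \<partial>P)"
      by (rule integral_distr) auto
    then show ?thesis by (simp add: M_def[symmetric])
  qed
  also have "\<dots> = (\<integral>s. \<theta> (a + b * s) \<partial>distr M borel (cdf M))"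
    by (subst integral_distr) auto
  also have "\<dots> = (\<integral>s. indicator {0..1} s *\<^sub>R \<theta> (a + b * s) \<partial>lborel)"
    unfolding U using integral_density[of "\<lambda>s. \<theta> (a + b * s)" lborel "indicator {0..1}"]
    by (simp add: ennreal_indicator)
  finally have "b * (\<integral>\<eta>. moll 1 \<eta> * \<theta> (a + b * halfspace_mass \<nu> (\<eta> \<bullet> \<nu>)) \<partial>lborel)
      = (\<integral>s. indicator {0..1} s *\<^sub>R (b * \<theta> (a + b * s)) \<partial>lborel)"
    by (simp add: mult.left_commute)
  \<comment> \<open>After the change of variables the slope is averaged uniformly over the segment
    from \<open>a\<close> to \<open>a + b\<close>, so the fundamental theorem returns the increment
    of \<open>T\<close>. The factor \<open>b\<close> in front covers \<open>b = 0\<close> as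
    well.\<close>
  also have "\<dots> = T (a + b * 1) - T (a + b * 0)"
  proof (rule integral_FTC_Icc[where F="\<lambda>s. T (a + b * s)"])
    fix s :: real
    have "((\<lambda>s. T (a + b * s)) has_real_derivative \<theta> (a + b * s) * b) (at s within {0..1})"
      by (rule DERIV_chain2[OF T]) (auto intro!: derivative_eq_intros)
    then show "((\<lambda>s. T (a + b * s)) has_vector_derivative b * \<theta> (a + b * s)) (at s within {0..1})"
      by (simp add: has_real_derivative_iff_has_vector_derivative mult.commute)
    show "continuous_on {0..1} (\<lambda>s. b * \<theta> (a + b * s))"
      by (intro continuous_intros continuous_on_compose2[OF \<theta>]) auto
  qed simp
  finally show ?thesis by simp
qed

subsection \<open>Cutoff functions\<close>

lemma infdist_Compl_pos_imp_mem: "infdist x (- U) > 0 \<Longrightarrow> x \<in> U"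
  using infdist_zero[of x "- U"] by (cases "x \<in> U") auto

text \<open>The indicator of the points at distance at least \<open>\<epsilon> / 2\<close> from the
  complement is mollified at scale \<open>\<epsilon> / 4\<close>. The gradient bound combines the
  factor 4 of \<open>moll_grad\<close> with the inverse scale \<open>4 / \<epsilon>\<close>. The
  boundary layer argument relies on the rate \<open>1 / \<epsilon>\<close> with a constant
  independent of \<open>\<epsilon>\<close>.\<close>

lemma cutoff_function:
  fixes U :: "'a::euclidean_space set"
  assumes U: "open U" "bounded U" and \<epsilon>: "\<epsilon> > 0"
  obtains \<psi> Z where "\<And>x. (\<psi> has_derivative (\<lambda>h. h \<bullet> Z x)) (at x)" "continuous_on UNIV Z"
    "\<And>x. 0 \<le> \<psi> x" "\<And>x. \<psi> x \<le> 1" "\<And>x. infdist x (- U) \<ge> \<epsilon> \<Longrightarrow> \<psi> x = 1"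
    "\<And>x. infdist x (- U) < \<epsilon> / 4 \<Longrightarrow> \<psi> x = 0"
    "\<And>x. norm (Z x) \<le> 16 * measure lborel (ball (0::'a) 1) / bump_mass TYPE('a) / \<epsilon>"
    "\<And>x. infdist x (- U) > \<epsilon> \<Longrightarrow> Z x = 0"
proof -
  define e where "e = \<epsilon> / 4"
  have e: "e > 0" using \<epsilon> by (simp add: e_def)
  define S where "S = {y. infdist y (- U) \<ge> \<epsilon> / 2}"
  have Sc: "closed S" unfolding S_def by (intro closed_Collect_le continuous_intros)
  have SU: "S \<subseteq> U"
    using \<epsilon> by (auto simp: S_def intro!: infdist_Compl_pos_imp_mem[of _ U])
  have Sb: "bounded S" using SU U(2) bounded_subset by blast
  define f :: "'a \<Rightarrow> real" where "f = indicator S"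
  have f: "integrable lborel f"
    unfolding f_def using Sc Sb emeasure_bounded_finite[OF Sb] by (intro integrable_real_indicator) auto
  define \<psi> where "\<psi> x = (\<integral>y. f y * moll e (x - y) \<partial>lborel)" for x
  define Z where "Z x = (\<integral>y. f y *\<^sub>R moll_grad e (x - y) \<partial>lborel)" for x
  have D: "(\<psi> has_derivative (\<lambda>h. h \<bullet> Z x)) (at x)" for x
    unfolding \<psi>_def Z_def
    by (rule has_derivative_convolution[where R=e])
       (use e f in \<open>auto intro: has_derivative_moll moll_eq_0 continuous_moll_grad moll_grad_eq_0\<close>)
  have Zc: "continuous_on UNIV Z"
    unfolding Z_def by (rule continuous_convolution(2)[where R=e])
      (use e f in \<open>auto intro: continuous_moll_grad moll_grad_eq_0\<close>)
  have ik: "integrable lborel (\<lambda>y. f y * moll e (x - y))" for x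
  proof -
    have "continuous_on UNIV (moll e :: 'a \<Rightarrow> real)"
      by (intro continuous_at_imp_continuous_on ballI has_derivative_continuous[OF has_derivative_moll[OF e]])
    from continuous_convolution(1)[OF this moll_eq_0[OF e] f] show ?thesis by simp
  qed
  have mollshift: "integrable lborel (\<lambda>y. moll e (x - y))" "(\<integral>y. moll e (x - y) \<partial>lborel) = 1" for x :: 'a
  proof -
    have eq: "moll e (x - y) = moll e (y - x)" for y using moll_minus[OF e, of "y - x"] by simp
    show "(\<integral>y. moll e (x - y) \<partial>lborel) = 1"
      using integral_moll_affine[OF e, of "\<lambda>_. 1::real" x] integral_moll[of 1, where 'a='a] by (simp add: eq)
    \<comment> \<open>A non-integrable function has integral zero by convention, so the value 1
      already proves integrability.\<close>
    then show "integrable lborel (\<lambda>y. moll e (x - y))"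
      using not_integrable_integral_eq by fastforce
  qed
  have one: "\<psi> x = 1" if "infdist x (- U) \<ge> \<epsilon>" for x
  proof -
    have "f y * moll e (x - y) = moll e (x - y)" for y
    proof (cases "norm (x - y) < e")
      case True
      then have "y \<in> S" using that infdist_triangle[of x "- U" y] e_def \<epsilon> by (auto simp: S_def dist_norm)
      then show ?thesis by (simp add: f_def)
    qed (simp add: moll_eq_0[OF e])
    then have "\<psi> x = (\<integral>y. moll e (x - y) \<partial>lborel)" unfolding \<psi>_def by presburger
    then show ?thesis using mollshift by simp
  qed
  have zero: "\<psi> x = 0" if "infdist x (- U) < \<epsilon> / 4" for x
  proof -
    have "f y * moll e (x - y) = 0" for y
    proof (cases "norm (x - y) < e")
      case True
      then have "y \<notin> S" using that infdist_triangle[of y "- U" x] e_def \<epsilon> by (auto simp: S_def dist_norm norm_minus_commute)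
      then show ?thesis by (simp add: f_def)
    qed (simp add: moll_eq_0[OF e])
    then have "\<psi> x = (\<integral>y. 0 \<partial>(lborel :: 'a measure))" unfolding \<psi>_def by presburger
    then show ?thesis by simp
  qed
  have nn: "0 \<le> \<psi> x" for x unfolding \<psi>_def
    by (intro Bochner_Integration.integral_nonneg mult_nonneg_nonneg moll_nonneg e) (simp add: f_def)
  have le: "\<psi> x \<le> 1" for x
    unfolding \<psi>_def mollshift(2)[of x, symmetric]
    by (intro integral_mono ik mollshift) (auto simp: f_def indicator_def moll_nonneg[OF e])
  \<comment> \<open>The strict inequality provides an open neighbourhood on which
    \<open>\<psi>\<close> is identically 1.\<close>
  have Z0: "Z x = 0" if "infdist x (- U) > \<epsilon>" for x
  proof -
    have "(\<psi> has_derivative (\<lambda>_. 0)) (at x)"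
      by (rule has_derivative_transform_within_open[where f="\<lambda>_. 1" and s="{x. \<epsilon> < infdist x (- U)}"])
         (use that one in \<open>auto intro!: open_Collect_less continuous_intros\<close>)
    from fun_cong[OF has_derivative_unique[OF D this], of "Z x"] show ?thesis by simp
  qed
  have gradle: "norm (moll_grad e z) \<le> 4 / (bump_mass TYPE('a) * e ^ DIM('a) * e) * indicator (ball 0 e) z" for z :: 'a
  proof (cases "norm z < e")
    case True
    let ?y = "(1 / e) *\<^sub>R z"
    have y: "norm ?y \<le> 1" using True e by (simp add: field_simps)
    have c: "0 < bump_mass TYPE('a) * e ^ DIM('a) * e" using bump_mass_pos[where 'a='a] e by simp
    have "norm (moll_grad e z) = 4 / (bump_mass TYPE('a) * e ^ DIM('a) * e) * (\<bar>max 0 (1 - ?y \<bullet> ?y)\<bar> * norm ?y)"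
      unfolding moll_grad_def norm_scaleR[of _ ?y] abs_divide abs_of_pos[OF c]
      by (simp only: abs_mult) simp
    also have "\<dots> \<le> 4 / (bump_mass TYPE('a) * e ^ DIM('a) * e) * (1 * 1)"
      using c y inner_ge_zero[of ?y] by (intro mult_left_mono mult_mono) (auto simp: max_def)
    finally show ?thesis using True by simp
  qed (simp add: moll_grad_eq_0[OF e])
  have "norm (Z x) \<le> 16 * measure lborel (ball (0::'a) 1) / bump_mass TYPE('a) / \<epsilon>" for x
  proof -
    let ?c = "4 / (bump_mass TYPE('a) * e ^ DIM('a) * e)"
    have c: "0 \<le> ?c" using bump_mass_pos[where 'a='a] e by simp
    have "norm (Z x) \<le> (\<integral>y. ?c * indicator (ball x e) y \<partial>lborel)"
      unfolding Z_def
    proof (rule Bochner_Integration.integral_norm_bound_integral)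
      show "integrable lborel (\<lambda>y. f y *\<^sub>R moll_grad e (x - y))"
        by (rule continuous_convolution(1)[where R=e]) (use e f in \<open>auto intro: continuous_moll_grad moll_grad_eq_0\<close>)
      show "integrable lborel (\<lambda>y. ?c * indicator (ball x e) y)"
        using set_integrable_ball_const[of x e ?c] unfolding set_integrable_def by (simp add: mult.commute)
      fix y
      have "norm (f y *\<^sub>R moll_grad e (x - y)) \<le> norm (moll_grad e (x - y))"
        by (auto simp: f_def indicator_def)
      also have "\<dots> \<le> ?c * indicator (ball 0 e) (x - y)" by (rule gradle)
      also have "indicator (ball 0 e) (x - y) = (indicator (ball x e) y :: real)" by (auto simp: indicator_def dist_norm norm_minus_commute)
      finally show "norm (f y *\<^sub>R moll_grad e (x - y)) \<le> ?c * indicator (ball x e) y" .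
    qed
    also have "\<dots> = ?c * measure lborel (ball x e)" by simp
    also have "measure lborel (ball x e) = e ^ DIM('a) * measure lborel (ball (0::'a) 1)"
      using content_ball_conv_unit_ball[of e x] e by simp
    also have "?c * (e ^ DIM('a) * measure lborel (ball (0::'a) 1)) = 16 * measure lborel (ball (0::'a) 1) / bump_mass TYPE('a) / \<epsilon>"
      using e bump_mass_pos[where 'a='a] by (simp add: e_def field_simps)
    finally show ?thesis .
  qed
  with D Zc nn le one zero Z0 show thesis by (intro that[of \<psi> Z])
qed

lemma compact_infdist_ge:
  fixes U :: "'a::euclidean_space set"
  assumes "open U" "bounded U" "\<delta> > 0"
  shows "compact {x. \<delta> \<le> infdist x (- U)}" "{x. \<delta> \<le> infdist x (- U)} \<subseteq> U"
proof -
  show sub: "{x. \<delta> \<le> infdist x (- U)} \<subseteq> U"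
    using assms(3) by (auto intro!: infdist_Compl_pos_imp_mem[of _ U])
  have "closed {x. \<delta> \<le> infdist x (- U)}" by (intro closed_Collect_le continuous_intros)
  moreover have "bounded {x. \<delta> \<le> infdist x (- U)}" using sub assms(2) bounded_subset by blast
  ultimately show "compact {x. \<delta> \<le> infdist x (- U)}" by (simp add: compact_eq_bounded_closed)
qed

lemma C1_on_scaleR:
  fixes f :: "'a::euclidean_space \<Rightarrow> real" and F :: "'a \<Rightarrow> 'b::real_normed_vector"
  assumes f: "\<And>x. x \<in> S \<Longrightarrow> (f has_derivative (\<lambda>h. h \<bullet> Z x)) (at x)" "continuous_on S Z" and F: "C1_on S F"
  shows "C1_on S (\<lambda>x. f x *\<^sub>R F x)"
    and "\<And>x. x \<in> S \<Longrightarrow> ((\<lambda>x. f x *\<^sub>R F x) has_derivative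
           (\<lambda>h. f x *\<^sub>R frechet_derivative F (at x) h + (h \<bullet> Z x) *\<^sub>R F x)) (at x)"
proof -
  show D: "((\<lambda>x. f x *\<^sub>R F x) has_derivative
           (\<lambda>h. f x *\<^sub>R frechet_derivative F (at x) h + (h \<bullet> Z x) *\<^sub>R F x)) (at x)" if "x \<in> S" for x
    by (intro has_derivative_scaleR f(1) C1_onD[OF F] that)
  have cf: "continuous_on S f"
    by (intro continuous_at_imp_continuous_on ballI has_derivative_continuous[OF f(1)])
  have cF: "continuous_on S F"
    by (intro continuous_at_imp_continuous_on ballI has_derivative_continuous[OF C1_onD[OF F]])
  have "continuous_on S (\<lambda>x. frechet_derivative (\<lambda>x. f x *\<^sub>R F x) (at x) h)" for h
  proof (rule continuous_on_eq)
    show "continuous_on S (\<lambda>x. f x *\<^sub>R frechet_derivative F (at x) h + (h \<bullet> Z x) *\<^sub>R F x)"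
      using F by (intro continuous_intros cf cF f(2)) (simp add: C1_on_def)
    show "x \<in> S \<Longrightarrow> f x *\<^sub>R frechet_derivative F (at x) h + (h \<bullet> Z x) *\<^sub>R F x =
        frechet_derivative (\<lambda>x. f x *\<^sub>R F x) (at x) h" for x
      using fun_cong[OF frechet_derivative_at[OF D], of x h] by simp
  qed
  then show "C1_on S (\<lambda>x. f x *\<^sub>R F x)"
    using D by (auto simp: C1_on_def differentiable_def)
qed

text \<open>\<open>F\<close> is controlled only inside \<Omega>. Since the cutoff vanishes off a
  compact subset, the product is C1 on the whole space, as \<open>test_field\<close>
  demands.\<close>

lemma test_field_cutoff:
  fixes F :: "'a::euclidean_space \<Rightarrow> 'a"
  assumes \<Omega>: "open \<Omega>" and F: "C1_on \<Omega> F"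
    and \<psi>: "\<And>x. (\<psi> has_derivative (\<lambda>h. h \<bullet> Z x)) (at x)" "continuous_on UNIV Z"
    and K: "compact K" "K \<subseteq> \<Omega>" "\<And>x. x \<notin> K \<Longrightarrow> \<psi> x = 0"
  shows "test_field \<Omega> (\<lambda>x. \<psi> x *\<^sub>R F x)"
    and "\<And>x. x \<in> \<Omega> \<Longrightarrow> divergence (\<lambda>x. \<psi> x *\<^sub>R F x) x = \<psi> x * divergence F x + Z x \<bullet> F x"
proof -
  let ?G = "\<lambda>x. \<psi> x *\<^sub>R F x"
  have Zc: "continuous_on \<Omega> Z" using \<psi>(2) continuous_on_subset by blast
  note C = C1_on_scaleR[OF \<psi>(1) Zc F]
  show "divergence ?G x = \<psi> x * divergence F x + Z x \<bullet> F x" if "x \<in> \<Omega>" for x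
  proof -
    have "divergence ?G x = (\<Sum>b\<in>Basis. (\<psi> x *\<^sub>R frechet_derivative F (at x) b + (b \<bullet> Z x) *\<^sub>R F x) \<bullet> b)"
      by (rule divergence_eqI[OF C(2)[OF that]])
    also have "\<dots> = \<psi> x * divergence F x + (\<Sum>b\<in>Basis. (Z x \<bullet> b) * (F x \<bullet> b))"
      by (simp add: inner_add_left sum.distrib divergence_def sum_distrib_left inner_commute[of "Z x"])
    also have "(\<Sum>b\<in>Basis. (Z x \<bullet> b) * (F x \<bullet> b)) = Z x \<bullet> F x" by (rule euclidean_inner[symmetric])
    finally show ?thesis .
  qed
  have out: "(?G has_derivative (\<lambda>_. 0)) (at x)" if "x \<notin> K" for x
    by (rule has_derivative_transform_within_open[where f="\<lambda>_. 0" and s="- K"])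
       (use that K in \<open>auto simp: compact_imp_closed open_Compl\<close>)
  have "C1_on UNIV ?G"
    unfolding C1_on_def
  proof (intro conjI ballI allI)
    show "?G differentiable at x" for x
      using differentiableI[OF out, of x] differentiableI[OF C(2), of x] K(2) by (cases "x \<in> K") auto
    fix h
    have 1: "continuous_on \<Omega> (\<lambda>x. frechet_derivative ?G (at x) h)" using C(1) by (simp add: C1_on_def)
    have 2: "continuous_on (- K) (\<lambda>x. frechet_derivative ?G (at x) h)"
      by (rule continuous_on_eq[where f="\<lambda>_. 0"]) (auto simp: frechet_derivative_at[OF out, symmetric])
    have "continuous_on (\<Omega> \<union> - K) (\<lambda>x. frechet_derivative ?G (at x) h)"
      using 1 2 K(1) \<Omega> by (intro continuous_on_open_Un) (auto simp: compact_imp_closed open_Compl)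
    moreover have "\<Omega> \<union> - K = UNIV" using K by auto
    ultimately show "continuous_on UNIV (\<lambda>x. frechet_derivative ?G (at x) h)" by simp
  qed
  then show "test_field \<Omega> ?G" using K by (auto simp: test_field_def)
qed

subsection \<open>Derivative measures\<close>

lemma is_derivative_measureE:
  assumes "is_derivative_measure \<Omega> v D"
  obtains \<mu> \<sigma> where "sets \<mu> = sets borel" "finite_measure \<mu>" "set_integrable \<mu> \<Omega> \<sigma>"
    "\<And>B. B \<in> sets borel \<Longrightarrow> B \<subseteq> \<Omega> \<Longrightarrow> D B = (LINT x:B|\<mu>. \<sigma> x)"
    "\<And>\<phi>. test_field \<Omega> \<phi> \<Longrightarrow> (LINT x:\<Omega>|lebesgue. v x * divergence \<phi> x) = - (LINT x:\<Omega>|\<mu>. \<phi> x \<bullet> \<sigma> x)"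
  using assms unfolding is_derivative_measure_def by (elim exE conjE) (rule that, simp_all)

lemma integral_simple_function_scaleR:
  fixes s :: "'a::topological_space \<Rightarrow> real" and F :: "'a \<Rightarrow> 'b::{banach, second_countable_topology}"
  assumes M: "sets M = sets borel" and s: "simple_function borel s" and F: "integrable M F"
  shows "(\<integral>x. s x *\<^sub>R F x \<partial>M) = (\<Sum>y\<in>range s. y *\<^sub>R (LINT x:s -` {y}|M. F x))"
proof -
  have fin: "finite (range s)" using simple_functionD(1)[OF s] by simp
  have meas: "s -` {y} \<in> sets M" for y using simple_functionD(2)[OF s, of "{y}"] M by simp
  have eq: "s x *\<^sub>R F x = (\<Sum>y\<in>range s. y *\<^sub>R (indicator (s -` {y}) x *\<^sub>R F x))" for x
  proof -
    have "(\<Sum>y\<in>range s. y *\<^sub>R (indicator (s -` {y}) x *\<^sub>R F x)) = (\<Sum>y\<in>{s x}. y *\<^sub>R (indicator (s -` {y}) x *\<^sub>R F x))"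
      by (rule sum.mono_neutral_right) (use fin in \<open>auto simp: indicator_def\<close>)
    then show ?thesis by simp
  qed
  have "(\<integral>x. s x *\<^sub>R F x \<partial>M) = (\<Sum>y\<in>range s. \<integral>x. y *\<^sub>R (indicator (s -` {y}) x *\<^sub>R F x) \<partial>M)"
    unfolding eq
    by (intro Bochner_Integration.integral_sum integrable_scaleR_right integrable_mult_indicator meas F)
  then show ?thesis by (simp only: set_lebesgue_integral_def integral_scaleR_right)
qed

text \<open>Linearity gives the identity for simple multipliers and dominated convergence for
  bounded ones. This allows the splitting of \<open>Dv\<close> into gradient and jump part to be
  tested against fields known only to be bounded and Borel.\<close>

lemma bounded_integral_eq_from_sets:
  fixes F1 F2 F3 :: "'a::topological_space \<Rightarrow> 'b::{banach, second_countable_topology}" and a :: "'a \<Rightarrow> real"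
  assumes M: "sets M1 = sets borel" "sets M2 = sets borel" "sets M3 = sets borel"
    and F: "integrable M1 F1" "integrable M2 F2" "integrable M3 F3"
    and eq: "\<And>B. B \<in> sets borel \<Longrightarrow> (LINT x:B|M1. F1 x) = (LINT x:B|M2. F2 x) + (LINT x:B|M3. F3 x)"
    and a: "a \<in> borel_measurable borel" "\<And>x. \<bar>a x\<bar> \<le> C"
  shows "(\<integral>x. a x *\<^sub>R F1 x \<partial>M1) = (\<integral>x. a x *\<^sub>R F2 x \<partial>M2) + (\<integral>x. a x *\<^sub>R F3 x \<partial>M3)"
proof -
  obtain s where s: "\<And>i. simple_function borel (s i)" "\<And>x. (\<lambda>i. s i x) \<longlonglongrightarrow> a x"
    and s_le: "\<And>i x. \<bar>s i x\<bar> \<le> 2 * \<bar>a x\<bar>"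
    using borel_measurable_implies_sequence_metric[OF a(1), of 0] by (auto simp: dist_real_def)
  have sC: "\<bar>s i x\<bar> \<le> 2 * C" for i x using s_le[of i x] a(2)[of x] by linarith
  have simp: "(\<integral>x. s i x *\<^sub>R F1 x \<partial>M1) = (\<integral>x. s i x *\<^sub>R F2 x \<partial>M2) + (\<integral>x. s i x *\<^sub>R F3 x \<partial>M3)" for i
  proof -
    have "s i -` {y} \<in> sets borel" for y using simple_functionD(2)[OF s(1), of i "{y}"] by simp
    then show ?thesis
      by (simp add: integral_simple_function_scaleR[OF M(1) s(1) F(1)] integral_simple_function_scaleR[OF M(2) s(1) F(2)]
          integral_simple_function_scaleR[OF M(3) s(1) F(3)] eq scaleR_right_distrib sum.distrib)
  qed
  have lim: "(\<lambda>i. \<integral>x. s i x *\<^sub>R F x \<partial>M) \<longlonglongrightarrow> (\<integral>x. a x *\<^sub>R F x \<partial>M)"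
    if M': "sets M = sets borel" and F': "integrable M F" for M :: "'a measure" and F :: "'a \<Rightarrow> 'b"
  proof (rule integral_dominated_convergence[where w="\<lambda>x. 2 * C * norm (F x)"])
    have [measurable]: "a \<in> borel_measurable M" "s i \<in> borel_measurable M" "F \<in> borel_measurable M" for i
      using a borel_measurable_simple_function[OF s(1)] F' measurable_cong_sets[OF M' refl] by auto
    show "(\<lambda>x. a x *\<^sub>R F x) \<in> borel_measurable M" "(\<lambda>x. s i x *\<^sub>R F x) \<in> borel_measurable M" for i by measurable
    show "integrable M (\<lambda>x. 2 * C * norm (F x))" using F' by (intro integrable_mult_right integrable_norm)
    show "AE x in M. (\<lambda>i. s i x *\<^sub>R F x) \<longlonglongrightarrow> a x *\<^sub>R F x" by (intro AE_I2 tendsto_intros s)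
    show "AE x in M. norm (s i x *\<^sub>R F x) \<le> 2 * C * norm (F x)" for i
      by (intro AE_I2) (simp add: mult_right_mono sC)
  qed
  have "(\<lambda>i. \<integral>x. s i x *\<^sub>R F1 x \<partial>M1) \<longlonglongrightarrow> (\<integral>x. a x *\<^sub>R F2 x \<partial>M2) + (\<integral>x. a x *\<^sub>R F3 x \<partial>M3)"
    unfolding simp by (intro tendsto_add lim M F)
  with lim[OF M(1) F(1)] show ?thesis by (rule LIMSEQ_unique)
qed

lemma bounded_field_integral_eq_from_sets:
  fixes F1 F2 F3 A :: "'a::euclidean_space \<Rightarrow> 'a"
  assumes M: "sets M1 = sets borel" "sets M2 = sets borel" "sets M3 = sets borel"
    and F: "integrable M1 F1" "integrable M2 F2" "integrable M3 F3"
    and eq: "\<And>B. B \<in> sets borel \<Longrightarrow> (LINT x:B|M1. F1 x) = (LINT x:B|M2. F2 x) + (LINT x:B|M3. F3 x)"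
    and A: "A \<in> borel_measurable borel" "\<And>x. norm (A x) \<le> C"
  shows "(\<integral>x. A x \<bullet> F1 x \<partial>M1) = (\<integral>x. A x \<bullet> F2 x \<partial>M2) + (\<integral>x. A x \<bullet> F3 x \<partial>M3)"
proof -
  have Ab: "(\<lambda>x. A x \<bullet> b) \<in> borel_measurable borel" for b using A by measurable
  have Ac: "\<bar>A x \<bullet> b\<bar> \<le> C" if "b \<in> Basis" for x b
    using Basis_le_norm[OF that, of "A x"] A(2)[of x] by linarith
  have comp: "(\<integral>x. A x \<bullet> F x \<partial>M) = (\<Sum>b\<in>Basis. (\<integral>x. (A x \<bullet> b) *\<^sub>R F x \<partial>M) \<bullet> b)"
    if M': "sets M = sets borel" and F': "integrable M F" for M :: "'a measure" and F :: "'a \<Rightarrow> 'a"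
  proof -
    have i: "integrable M (\<lambda>x. (A x \<bullet> b) *\<^sub>R F x)" if "b \<in> Basis" for b
    proof (rule Bochner_Integration.integrable_bound[where f="\<lambda>x. C * norm (F x)"])
      have [measurable]: "A \<in> borel_measurable M" "F \<in> borel_measurable M"
        using A F' measurable_cong_sets[OF M' refl] by auto
      show "(\<lambda>x. (A x \<bullet> b) *\<^sub>R F x) \<in> borel_measurable M" by measurable
      have "\<bar>A x \<bullet> b\<bar> \<le> \<bar>C\<bar>" for x using Ac[OF that, of x] by linarith
      then show "AE x in M. norm ((A x \<bullet> b) *\<^sub>R F x) \<le> norm (C * norm (F x))"
        by (intro AE_I2) (simp add: abs_mult mult_right_mono)
      show "integrable M (\<lambda>x. C * norm (F x))" using F' by (intro integrable_mult_right integrable_norm)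
    qed
    have "(\<integral>x. A x \<bullet> F x \<partial>M) = (\<integral>x. (\<Sum>b\<in>Basis. ((A x \<bullet> b) *\<^sub>R F x) \<bullet> b) \<partial>M)"
      by (subst euclidean_inner) simp
    also have "\<dots> = (\<Sum>b\<in>Basis. (\<integral>x. ((A x \<bullet> b) *\<^sub>R F x) \<bullet> b \<partial>M))"
      by (intro Bochner_Integration.integral_sum integrable_inner_left i)
    also have "\<dots> = (\<Sum>b\<in>Basis. (\<integral>x. (A x \<bullet> b) *\<^sub>R F x \<partial>M) \<bullet> b)"
      by (intro sum.cong refl integral_inner_left i)
    finally show ?thesis .
  qed
  have "(\<integral>x. (A x \<bullet> b) *\<^sub>R F1 x \<partial>M1) = (\<integral>x. (A x \<bullet> b) *\<^sub>R F2 x \<partial>M2) + (\<integral>x. (A x \<bullet> b) *\<^sub>R F3 x \<partial>M3)"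
    if "b \<in> Basis" for b
    by (rule bounded_integral_eq_from_sets[OF M F eq Ab Ac]) (use that in auto)
  then show ?thesis
    by (simp add: comp M F inner_add_left sum.distrib)
qed

text \<open>A null set of maximal \<open>\<mu>\<close>-mass carries the singular part.\<close>

lemma ex_ac_density:
  fixes \<Omega> :: "'a::euclidean_space set"
  assumes \<Omega>: "open \<Omega>" and D: "is_derivative_measure \<Omega> v D"
  shows "\<exists>g. is_ac_density \<Omega> D g"
proof -
  obtain \<mu> \<sigma> where \<mu>: "sets \<mu> = sets borel" "finite_measure \<mu>" and \<sigma>: "set_integrable \<mu> \<Omega> \<sigma>"
    and DB: "\<And>B. B \<in> sets borel \<Longrightarrow> B \<subseteq> \<Omega> \<Longrightarrow> D B = (LINT x:B|\<mu>. \<sigma> x)"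
    by (rule is_derivative_measureE[OF D]) (rule that)
  interpret \<mu>: finite_measure \<mu> by fact
  note [measurable_cong] = \<mu>(1)
  have sp: "space \<mu> = UNIV" using sets_eq_imp_space_eq[OF \<mu>(1)] by simp
  define s where "s = (SUP N\<in>null_sets lborel. emeasure \<mu> N)"
  \<comment> \<open>The supremum is attained: the union of a maximising sequence of null sets is
    again null.\<close>
  have "\<exists>N. N \<in> null_sets lborel \<and> emeasure \<mu> N = s"
  proof -
    have "(null_sets lborel :: 'a set set) \<noteq> {}" by blast
    from ennreal_SUP_countable_SUP[OF this, of "emeasure \<mu>"] obtain M where
      M: "range M \<subseteq> emeasure \<mu> ` null_sets lborel" "s = (SUP i::nat. M i)"
      unfolding s_def by blast
    then have "\<forall>i. \<exists>N. N \<in> null_sets lborel \<and> M i = emeasure \<mu> N" by (auto simp: image_def subset_eq)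
    then obtain N where N: "\<And>i. N i \<in> null_sets lborel" "\<And>i. M i = emeasure \<mu> (N i)" by metis
    have UN: "(\<Union>i. N i) \<in> null_sets lborel" by (intro null_sets_UN N(1))
    have Ns: "N i \<in> sets \<mu>" for i using null_setsD2[OF N(1)[of i]] \<mu>(1) by simp
    have "s \<le> emeasure \<mu> (\<Union>i. N i)"
      unfolding M(2) N(2) by (intro SUP_least emeasure_mono sets.countable_UN) (use Ns in auto)
    moreover have "emeasure \<mu> (\<Union>i. N i) \<le> s" unfolding s_def by (intro SUP_upper UN)
    ultimately show ?thesis using UN by (intro exI[of _ "\<Union>i. N i"]) auto
  qed
  then obtain N where N: "N \<in> null_sets lborel" "emeasure \<mu> N = s" by auto
  have Nb [measurable]: "N \<in> sets borel" using N(1) by auto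
  \<comment> \<open>A null set carrying \<open>\<mu>\<close>-mass outside \<open>N\<close> could be
    added to \<open>N\<close>, against maximality; finiteness of \<open>\<mu>\<close> permits the
    cancellation. Hence \<open>\<mu>'\<close> is absolutely continuous and has a Radon-Nikodym
    density.\<close>
  define \<mu>' where "\<mu>' = density \<mu> (\<lambda>x. ennreal (indicator (- N) x))"
  have \<mu>'s: "sets \<mu>' = sets borel" by (simp add: \<mu>'_def \<mu>)
  have ac: "absolutely_continuous lborel \<mu>'"
    unfolding absolutely_continuous_def
  proof
    fix B :: "'a set" assume B: "B \<in> null_sets lborel"
    then have Bb [measurable]: "B \<in> sets borel" by auto
    have "N \<union> B \<in> null_sets lborel" using N B by auto
    then have "emeasure \<mu> (N \<union> B) \<le> emeasure \<mu> N" unfolding N(2) s_def by (intro SUP_upper)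
    moreover have "emeasure \<mu> (N \<union> B) = emeasure \<mu> N + emeasure \<mu> (B - N)"
      using plus_emeasure[of N \<mu> "B - N"] \<mu>(1) by (simp add: Un_Diff_cancel)
    ultimately have "emeasure \<mu> (B - N) = 0"
      using \<mu>.emeasure_finite[of N] by (metis add.right_neutral ennreal_add_left_cancel_le le_zero_eq infinity_ennreal_def)
    moreover have "emeasure \<mu>' B = emeasure \<mu> (B - N)"
    proof -
      have "emeasure \<mu>' B = (\<integral>\<^sup>+ x. ennreal (indicator (- N) x) * indicator B x \<partial>\<mu>)"
        unfolding \<mu>'_def by (subst emeasure_density) auto
      also have "\<dots> = (\<integral>\<^sup>+ x. indicator (B - N) x \<partial>\<mu>)"
        by (intro nn_integral_cong) (auto split: split_indicator)
      finally show ?thesis using Bb Nb \<mu>(1) by simp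
    qed
    ultimately show "B \<in> null_sets \<mu>'" using \<mu>'s Bb by (intro null_setsI) auto
  qed
  have fin: "finite_measure \<mu>'"
  proof
    have "emeasure \<mu>' UNIV = (\<integral>\<^sup>+ x. ennreal (indicator (- N) x) * indicator UNIV x \<partial>\<mu>)"
      unfolding \<mu>'_def by (subst emeasure_density) auto
    also have "\<dots> \<le> (\<integral>\<^sup>+ x. 1 \<partial>\<mu>)" by (intro nn_integral_mono) (auto split: split_indicator)
    also have "\<dots> = emeasure \<mu> (space \<mu>)" by simp
    finally have "emeasure \<mu>' (space \<mu>') \<le> emeasure \<mu> (space \<mu>)"
      using sets_eq_imp_space_eq[OF \<mu>'s] by simp
    then show "emeasure \<mu>' (space \<mu>') \<noteq> \<infinity>"
      using \<mu>.emeasure_finite[of "space \<mu>"] by (auto simp: top_unique)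
  qed
  have s': "sets \<mu>' = sets lborel" using \<mu>'s by simp
  obtain h where h [measurable]: "h \<in> borel_measurable lborel"
    and RN: "AE x in lborel. RN_deriv lborel \<mu>' x = ennreal (h x)" and h0: "\<And>x. 0 \<le> h x"
    by (rule sigma_finite_measure.real_RN_deriv[OF sigma_finite_lborel fin ac s']) (rule that)
  have dens: "density lborel (\<lambda>x. ennreal (h x)) = \<mu>'"
  proof -
    have "density lborel (\<lambda>x. ennreal (h x)) = density lborel (RN_deriv lborel \<mu>')"
      using RN by (intro density_cong) auto
    then show ?thesis using sigma_finite_measure.density_RN_deriv[OF sigma_finite_lborel ac s'] by simp
  qed
  define F where "F x = indicator \<Omega> x *\<^sub>R \<sigma> x" for x
  have F: "integrable \<mu> F" using \<sigma> by (simp add: set_integrable_def F_def[abs_def])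
  have Fm [measurable]: "F \<in> borel_measurable borel" using F measurable_cong_sets[OF \<mu>(1) refl] by auto
  have F\<mu>': "integrable \<mu>' F"
    unfolding \<mu>'_def using F
    by (subst integrable_density) (auto intro!: integrable_mult_indicator simp: \<mu>)
  define g where "g x = h x *\<^sub>R F x" for x
  have gi: "integrable lborel g"
    unfolding g_def[abs_def] using F\<mu>' dens h0 by (subst integrable_density[symmetric]) auto
  have gm [measurable]: "g \<in> borel_measurable borel" using gi by auto
  have "is_ac_density \<Omega> D g"
    unfolding is_ac_density_def
  proof (intro conjI bexI[OF _ N(1)] ballI impI)
    show "set_integrable lebesgue \<Omega> g"
      unfolding set_integrable_def using gi \<Omega>
      by (intro integrable_mult_indicator) (auto simp: integrable_completion)
    fix B :: "'a set" assume B [measurable]: "B \<in> sets borel" and sub: "B \<subseteq> \<Omega> - N"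
    have "D B = (\<integral>x. indicator B x *\<^sub>R \<sigma> x \<partial>\<mu>)" using DB[OF B] sub by (auto simp: set_lebesgue_integral_def)
    also have "\<dots> = (\<integral>x. indicator (- N) x *\<^sub>R (indicator B x *\<^sub>R F x) \<partial>\<mu>)"
      using sub by (intro Bochner_Integration.integral_cong) (auto simp: F_def split: split_indicator)
    also have "\<dots> = (\<integral>x. indicator B x *\<^sub>R F x \<partial>\<mu>')"
      unfolding \<mu>'_def by (subst integral_density) auto
    also have "\<dots> = (\<integral>x. h x *\<^sub>R (indicator B x *\<^sub>R F x) \<partial>lborel)"
      unfolding dens[symmetric] using h0 by (subst integral_density) auto
    also have "\<dots> = (\<integral>x. indicator B x *\<^sub>R g x \<partial>lborel)"
      by (simp add: g_def mult.commute)
    also have "\<dots> = (LINT x:B|lebesgue. g x)"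
      unfolding set_lebesgue_integral_def by (subst integral_completion) auto
    finally show "D B = (LINT x:B|lebesgue. g x)" .
  qed
  then show ?thesis by blast
qed

text \<open>Bounded approximation of the indicator of an open set by C1 cutoffs with compact
  support, made for dominated convergence against an arbitrary vector measure.\<close>

lemma open_indicator_limit:
  fixes U :: "'a::euclidean_space set"
  assumes U: "open U" "bounded U"
  obtains \<psi> Z K where "\<And>n x. (\<psi> n has_derivative (\<lambda>h. h \<bullet> Z n x)) (at x)" "\<And>n. continuous_on UNIV (Z n)"
    "\<And>n x. \<bar>\<psi> n x\<bar> \<le> 1" "\<And>x. (\<lambda>n. \<psi> n x) \<longlonglongrightarrow> indicator U x"
    "\<And>n::nat. compact (K n)" "\<And>n. K n \<subseteq> U" "\<And>n x. x \<notin> K n \<Longrightarrow> \<psi> n x = (0::real)"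
proof -
  define \<epsilon> where "\<epsilon> n = 1 / real (Suc n)" for n
  have \<epsilon>: "\<epsilon> n > 0" for n by (simp add: \<epsilon>_def)
  have "\<exists>\<psi> Z. (\<forall>x. (\<psi> has_derivative (\<lambda>h. h \<bullet> Z x)) (at x)) \<and> continuous_on UNIV Z \<and>
    (\<forall>x. 0 \<le> \<psi> x \<and> \<psi> x \<le> 1 \<and> (infdist x (- U) \<ge> \<epsilon> n \<longrightarrow> \<psi> x = 1) \<and> (infdist x (- U) < \<epsilon> n / 4 \<longrightarrow> \<psi> x = 0))" for n
    by (rule cutoff_function[OF U \<epsilon>[of n]]) blast
  then obtain \<psi> Z where \<psi>: "\<And>n x. (\<psi> n has_derivative (\<lambda>h. h \<bullet> Z n x)) (at x)" "\<And>n. continuous_on UNIV (Z n)"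
    "\<And>n x. 0 \<le> \<psi> n x \<and> \<psi> n x \<le> 1 \<and> (infdist x (- U) \<ge> \<epsilon> n \<longrightarrow> \<psi> n x = 1) \<and> (infdist x (- U) < \<epsilon> n / 4 \<longrightarrow> \<psi> n x = 0)"
    by metis
  define K where "K n = {x. \<epsilon> n / 4 \<le> infdist x (- U)}" for n
  have K: "compact (K n)" "K n \<subseteq> U" for n
    unfolding K_def using compact_infdist_ge[OF U, of "\<epsilon> n / 4"] \<epsilon>[of n] by auto
  have K0: "\<psi> n x = 0" if "x \<notin> K n" for n x using that \<psi>(3)[of n x] by (simp add: K_def)
  have "(\<lambda>n. \<psi> n x) \<longlonglongrightarrow> indicator U x" for x
  proof (cases "x \<in> U")
    case True
    have "- U \<noteq> {}" using U(2) not_bounded_UNIV[where 'a='a] by (metis boolean_algebra.compl_zero double_compl)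
    then have pos: "infdist x (- U) > 0"
      using True U(1) infdist_nonneg[of x "- U"] in_closed_iff_infdist_zero[of "- U" x] by (auto simp: closed_Compl)
    have "\<forall>\<^sub>F n in sequentially. \<epsilon> n < infdist x (- U)"
      using LIMSEQ_inverse_real_of_nat pos unfolding \<epsilon>_def inverse_eq_divide by (rule order_tendstoD)
    then have "\<forall>\<^sub>F n in sequentially. \<psi> n x = 1"
      by eventually_elim (use \<psi>(3) in auto)
    then show ?thesis using True by (simp add: tendsto_eventually)
  next
    case False
    then have "\<psi> n x = 0" for n using K(2) K0 by blast
    then show ?thesis using False by simp
  qed
  with \<psi> K K0 show thesis by (intro that[of \<psi> Z K]) (auto simp: abs_le_iff intro: order_trans[OF _ zero_le_one])
qed

text \<open>\<open>derivative_measure\<close> is chosen by \<open>SOME\<close>, so computing with it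
  requires uniqueness on the Borel subsets of \<Omega>. Cutoffs times basis vectors give equality on
  open subsets, and the open sets are an intersection-stable generator of the Borel sets.\<close>

lemma derivative_measure_unique:
  fixes \<Omega> :: "'a::euclidean_space set"
  assumes \<Omega>: "open \<Omega>" "bounded \<Omega>" and D: "is_derivative_measure \<Omega> v D" and D': "is_derivative_measure \<Omega> v D'"
    and B: "B \<in> sets borel" "B \<subseteq> \<Omega>"
  shows "D B = D' B"
proof -
  obtain \<mu> \<sigma> where \<mu>: "sets \<mu> = sets borel" and \<sigma>: "set_integrable \<mu> \<Omega> \<sigma>"
    and DB: "\<And>B. B \<in> sets borel \<Longrightarrow> B \<subseteq> \<Omega> \<Longrightarrow> D B = (LINT x:B|\<mu>. \<sigma> x)"
    and I: "\<And>\<phi>. test_field \<Omega> \<phi> \<Longrightarrow> (LINT x:\<Omega>|lebesgue. v x * divergence \<phi> x) = - (LINT x:\<Omega>|\<mu>. \<phi> x \<bullet> \<sigma> x)"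
    by (rule is_derivative_measureE[OF D]) (rule that)
  obtain \<mu>' \<sigma>' where \<mu>': "sets \<mu>' = sets borel" and \<sigma>': "set_integrable \<mu>' \<Omega> \<sigma>'"
    and DB': "\<And>B. B \<in> sets borel \<Longrightarrow> B \<subseteq> \<Omega> \<Longrightarrow> D' B = (LINT x:B|\<mu>'. \<sigma>' x)"
    and I': "\<And>\<phi>. test_field \<Omega> \<phi> \<Longrightarrow> (LINT x:\<Omega>|lebesgue. v x * divergence \<phi> x) = - (LINT x:\<Omega>|\<mu>'. \<phi> x \<bullet> \<sigma>' x)"
    by (rule is_derivative_measureE[OF D']) (rule that)
  define F where "F x = indicator \<Omega> x *\<^sub>R \<sigma> x" for x
  define F' where "F' x = indicator \<Omega> x *\<^sub>R \<sigma>' x" for x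
  have F: "integrable \<mu> F" using \<sigma> by (simp add: set_integrable_def F_def[abs_def])
  have F': "integrable \<mu>' F'" using \<sigma>' by (simp add: set_integrable_def F'_def[abs_def])
  have open_eq: "(LINT x:U|\<mu>. F x) = (LINT x:U|\<mu>'. F' x)" if U: "open U" "U \<subseteq> \<Omega>" for U
  proof -
    have Ub: "bounded U" using U(2) \<Omega>(2) bounded_subset by blast
    obtain \<psi> Z K where \<psi>: "\<And>n x. (\<psi> n has_derivative (\<lambda>h. h \<bullet> Z n x)) (at x)" "\<And>n. continuous_on UNIV (Z n)"
      "\<And>n x. \<bar>\<psi> n x\<bar> \<le> 1" "\<And>x. (\<lambda>n. \<psi> n x) \<longlonglongrightarrow> indicator U x"
      "\<And>n::nat. compact (K n)" "\<And>n. K n \<subseteq> U" "\<And>n x. x \<notin> K n \<Longrightarrow> \<psi> n x = (0::real)"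
      by (rule open_indicator_limit[OF U(1) Ub]) (rule that)
    have \<psi>m: "\<psi> n \<in> borel_measurable borel" for n
      by (intro borel_measurable_continuous_onI continuous_at_imp_continuous_on ballI has_derivative_continuous[OF \<psi>(1)])
    have lim: "(\<lambda>n. \<integral>x. \<psi> n x *\<^sub>R G x \<partial>M) \<longlonglongrightarrow> (LINT x:U|M. G x)"
      and int: "\<And>n. integrable M (\<lambda>x. \<psi> n x *\<^sub>R G x)"
      if M: "sets M = sets borel" and G: "integrable M G" for M :: "'a measure" and G :: "'a \<Rightarrow> 'a"
    proof -
      have [measurable]: "\<psi> n \<in> borel_measurable M" "G \<in> borel_measurable M" "U \<in> sets M" for n
        using \<psi>m G M U measurable_cong_sets[OF M refl] by auto
      show "(\<lambda>n. \<integral>x. \<psi> n x *\<^sub>R G x \<partial>M) \<longlonglongrightarrow> (LINT x:U|M. G x)"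
        unfolding set_lebesgue_integral_def
      proof (rule integral_dominated_convergence[where w="\<lambda>x. norm (G x)"])
        show "AE x in M. (\<lambda>n. \<psi> n x *\<^sub>R G x) \<longlonglongrightarrow> indicator U x *\<^sub>R G x"
          by (intro AE_I2 tendsto_intros \<psi>(4))
        show "AE x in M. norm (\<psi> n x *\<^sub>R G x) \<le> norm (G x)" for n
          by (intro AE_I2) (use \<psi>(3) in \<open>auto simp: mult_left_le_one_le\<close>)
      qed (use G in auto)
      show "\<And>n. integrable M (\<lambda>x. \<psi> n x *\<^sub>R G x)"
      proof (rule Bochner_Integration.integrable_bound[OF G])
        show "AE x in M. norm (\<psi> n x *\<^sub>R G x) \<le> norm (G x)" for n
          by (intro AE_I2) (use \<psi>(3) in \<open>auto simp: mult_left_le_one_le\<close>)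
      qed measurable
    qed
    have eqn: "(\<integral>x. \<psi> n x *\<^sub>R F x \<partial>\<mu>) = (\<integral>x. \<psi> n x *\<^sub>R F' x \<partial>\<mu>')" for n
    proof (rule euclidean_eqI)
      fix b :: 'a assume b: "b \<in> Basis"
      have "C1_on \<Omega> (\<lambda>_. b)"
        unfolding C1_on_def by (auto simp: frechet_derivative_const)
      then have tf: "test_field \<Omega> (\<lambda>x. \<psi> n x *\<^sub>R b)"
        by (rule test_field_cutoff(1)[OF \<Omega>(1) _ \<psi>(1) \<psi>(2) \<psi>(5)]) (use \<psi>(6)[of n] \<psi>(7) U in auto)
      have "(LINT x:\<Omega>|\<mu>. (\<psi> n x *\<^sub>R b) \<bullet> \<sigma> x) = (LINT x:\<Omega>|\<mu>'. (\<psi> n x *\<^sub>R b) \<bullet> \<sigma>' x)"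
        using I[OF tf] I'[OF tf] by simp
      then have "(\<integral>x. (\<psi> n x *\<^sub>R F x) \<bullet> b \<partial>\<mu>) = (\<integral>x. (\<psi> n x *\<^sub>R F' x) \<bullet> b \<partial>\<mu>')"
        unfolding set_lebesgue_integral_def F_def F'_def by (simp add: mult_ac inner_commute)
      then show "(\<integral>x. \<psi> n x *\<^sub>R F x \<partial>\<mu>) \<bullet> b = (\<integral>x. \<psi> n x *\<^sub>R F' x \<partial>\<mu>') \<bullet> b"
        by (simp only: integral_inner_left[OF int[OF \<mu> F]] integral_inner_left[OF int[OF \<mu>' F']])
    qed
    show ?thesis using lim[OF \<mu> F] lim[OF \<mu>' F'] unfolding eqn by (rule LIMSEQ_unique)
  qed
  have split: "(LINT x:A|M. G x) + (LINT x:- A|M. G x) = (LINT x|M. G x)"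
    if "sets M = sets borel" "integrable M G" "A \<in> sets borel" for M :: "'a measure" and G :: "'a \<Rightarrow> 'a" and A
  proof -
    have "integrable M (\<lambda>x. indicator A x *\<^sub>R G x)" "integrable M (\<lambda>x. indicator (- A) x *\<^sub>R G x)"
      using that by (simp_all add: integrable_mult_indicator)
    then have "(LINT x:A|M. G x) + (LINT x:- A|M. G x) = (LINT x|M. indicator A x *\<^sub>R G x + indicator (- A) x *\<^sub>R G x)"
      by (simp add: set_lebesgue_integral_def)
    also have "\<dots> = (LINT x|M. G x)"
      by (intro Bochner_Integration.integral_cong) (auto split: split_indicator)
    finally show ?thesis .
  qed
  have un: "(LINT x:(\<Union>i. A i)|M. G x) = (\<Sum>i. LINT x:A i|M. G x)"
    if "sets M = sets borel" "integrable M G" "disjoint_family A" "range A \<subseteq> sets borel"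
    for M :: "'a measure" and G :: "'a \<Rightarrow> 'a" and A :: "nat \<Rightarrow> 'a set"
    using that unfolding set_integrable_def
    by (intro lebesgue_integral_countable_add)
       (auto simp: disjoint_family_on_def set_integrable_def intro!: integrable_mult_indicator)
  have all: "(LINT x|\<mu>. F x) = (LINT x|\<mu>'. F' x)"
  proof -
    have "(LINT x:\<Omega>|\<mu>. F x) = (LINT x|\<mu>. F x)" "(LINT x:\<Omega>|\<mu>'. F' x) = (LINT x|\<mu>'. F' x)"
      unfolding set_lebesgue_integral_def F_def F'_def
      by (auto intro!: Bochner_Integration.integral_cong split: split_indicator)
    then show ?thesis using open_eq[OF \<Omega>(1)] by simp
  qed
  have main: "(LINT x:A|\<mu>. F x) = (LINT x:A|\<mu>'. F' x)" if "A \<in> sets borel" for A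
  proof -
    have "Int_stable {S :: 'a set. open S}" by (auto simp: Int_stable_def)
    moreover have "{S :: 'a set. open S} \<subseteq> Pow UNIV" by simp
    moreover have "A \<in> sigma_sets UNIV {S. open S}" using that by (simp add: sets_borel)
    ultimately show ?thesis
    proof (induction rule: sigma_sets_induct_disjoint)
      case (basic A)
      have "(LINT x:A|\<mu>. F x) = (LINT x:A \<inter> \<Omega>|\<mu>. F x)" "(LINT x:A|\<mu>'. F' x) = (LINT x:A \<inter> \<Omega>|\<mu>'. F' x)"
        by (auto simp: set_lebesgue_integral_def F_def F'_def indicator_def intro!: Bochner_Integration.integral_cong)
      then show ?case using open_eq[of "A \<inter> \<Omega>"] basic \<Omega> by auto
    next
      case (compl A)
      then have "A \<in> sets borel" by (simp add: sets_borel)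
      then show ?case
        using split[OF \<mu> F, of A] split[OF \<mu>' F', of A] compl(2) all
        unfolding Compl_eq_Diff_UNIV by (metis (no_types) add_left_cancel)
    next
      case (union A)
      then have "range A \<subseteq> sets borel" by (simp add: sets_borel)
      then show ?case
        using un[OF \<mu> F union(1)] un[OF \<mu>' F' union(1)] union(3) by simp
    qed (auto simp: set_lebesgue_integral_def)
  qed
  have "D B = (LINT x:B|\<mu>. F x)" "D' B = (LINT x:B|\<mu>'. F' x)"
    unfolding DB[OF B] DB'[OF B] set_lebesgue_integral_def F_def F'_def
    using B(2) by (auto intro!: Bochner_Integration.integral_cong split: split_indicator)
  then show ?thesis using main[OF B(1)] by simp
qed

subsection \<open>Blow-up of mollifications\<close>

definition jump_profile :: "real \<Rightarrow> real \<Rightarrow> 'a::euclidean_space \<Rightarrow> 'a \<Rightarrow> real" where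
  "jump_profile p m \<nu> z = (if z \<bullet> \<nu> \<ge> 0 then p else m)"

text \<open>Both one-sided limits are merged into one L1 condition with real-valued integrals. The
  case \<open>p = m\<close> is included on purpose: Lebesgue points become jump points of height
  zero, and a single blow-up argument serves the Lebesgue part and the jump part of
  \<open>Dv\<close>.\<close>

definition has_jump_profile :: "('a::euclidean_space \<Rightarrow> real) \<Rightarrow> 'a \<Rightarrow> real \<Rightarrow> real \<Rightarrow> 'a \<Rightarrow> bool" where
  "has_jump_profile v y p m \<nu> \<longleftrightarrow> norm \<nu> = 1 \<and>
     ((\<lambda>r. (LINT z:ball y r|lborel. \<bar>v z - jump_profile p m \<nu> (z - y)\<bar>) / r ^ DIM('a)) \<longlongrightarrow> 0) (at_right 0)"

lemma jump_profile_measurable [measurable]: "jump_profile p m \<nu> \<in> borel_measurable borel"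
  unfolding jump_profile_def[abs_def] by measurable

lemma jump_profile_scaleR: "c > 0 \<Longrightarrow> jump_profile p m \<nu> (c *\<^sub>R z) = jump_profile p m \<nu> z"
  by (simp add: jump_profile_def zero_le_mult_iff)

lemma jump_profile_bound: "\<bar>jump_profile p m \<nu> z\<bar> \<le> \<bar>p\<bar> + \<bar>m\<bar>"
  by (simp add: jump_profile_def)

lemma integrable_ball_jump_profile:
  fixes v :: "'a::euclidean_space \<Rightarrow> real"
  assumes v: "integrable lborel v"
  shows "set_integrable lborel (ball y r) (\<lambda>z. \<bar>v z - jump_profile p m \<nu> (z - y)\<bar>)"
proof -
  have "set_integrable lborel (ball y r) v"
    using v unfolding set_integrable_def by (intro integrable_mult_indicator) auto
  moreover have "set_integrable lborel (ball y r) (\<lambda>z. jump_profile p m \<nu> (z - y))"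
    unfolding set_integrable_def
  proof (rule Bochner_Integration.integrable_bound[OF set_integrable_ball_const[unfolded set_integrable_def, of y r "\<bar>p\<bar> + \<bar>m\<bar>"]])
    show "AE x in lborel. norm (indicator (ball y r) x *\<^sub>R jump_profile p m \<nu> (x - y))
        \<le> norm (indicator (ball y r) x *\<^sub>R (\<bar>p\<bar> + \<bar>m\<bar>))"
      using jump_profile_bound[of p m \<nu>] by (intro AE_I2) (auto simp: indicator_def)
    have "(\<lambda>z. jump_profile p m \<nu> (z - y)) \<in> borel_measurable borel"
      by (rule measurable_compose[OF _ jump_profile_measurable]) simp
    then show "(\<lambda>z. indicator (ball y r) z *\<^sub>R jump_profile p m \<nu> (z - y)) \<in> borel_measurable lborel"
      by (intro borel_measurable_scaleR borel_measurable_indicator) auto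
  qed
  ultimately show ?thesis by (intro set_integrable_abs set_integral_diff)
qed

lemma AE_not_hyperplane:
  fixes \<nu> :: "'a::euclidean_space"
  assumes "\<nu> \<noteq> 0"
  shows "AE z in lborel. z \<bullet> \<nu> \<noteq> s"
proof -
  have "negligible {z. \<nu> \<bullet> z = s}" using assms by (intro negligible_hyperplane) auto
  then have "AE z in lebesgue. z \<notin> {z. \<nu> \<bullet> z = s}"
    by (intro AE_not_in) (simp add: negligible_iff_null_sets)
  then show ?thesis by (simp add: AE_completion_iff inner_commute)
qed

text \<open>The hyperplane through \<open>y\<close>, which belongs to neither half-space, is null,
  so the two half-ball integrals add up to the integral over the ball.\<close>

lemma one_sided_limits_imp_has_jump_profile:
  fixes v :: "'a::euclidean_space \<Rightarrow> real"
  assumes v: "integrable lborel v" and lim: "one_sided_limits v y p m \<nu>"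
  shows "has_jump_profile v y p m \<nu>"
proof -
  have [measurable]: "v \<in> borel_measurable borel" using v by auto
  have \<nu>: "norm \<nu> = 1" using lim by (simp add: one_sided_limits_def)
  have [measurable]: "{z. (z - y) \<bullet> \<nu> > 0} \<in> sets borel" "{z. (z - y) \<bullet> \<nu> < 0} \<in> sets borel"
    by (intro borel_open open_Collect_less continuous_intros)+
  have [measurable]: "ball y r \<in> sets borel" for r by simp
  define E where "E r = (LINT z:ball y r|lborel. \<bar>v z - jump_profile p m \<nu> (z - y)\<bar>)" for r
  define P where "P r = (\<integral>\<^sup>+ z \<in> ball y r \<inter> {z. (z - y) \<bullet> \<nu> > 0}. ennreal \<bar>v z - p\<bar> \<partial>lborel)" for r
  define M where "M r = (\<integral>\<^sup>+ z \<in> ball y r \<inter> {z. (z - y) \<bullet> \<nu> < 0}. ennreal \<bar>v z - m\<bar> \<partial>lborel)" for r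
  have "AE z in lborel. z \<bullet> \<nu> \<noteq> y \<bullet> \<nu>" by (rule AE_not_hyperplane) (use \<nu> in auto)
  then have ae: "AE z in lborel. (z - y) \<bullet> \<nu> \<noteq> 0" by (simp add: inner_diff_left)
  have E0: "E r \<ge> 0" for r unfolding E_def set_lebesgue_integral_def by (intro Bochner_Integration.integral_nonneg) auto
  have EPM: "ennreal (E r) = P r + M r" for r
  proof -
    have "ennreal (E r) = (\<integral>\<^sup>+ z. ennreal (indicator (ball y r) z *\<^sub>R \<bar>v z - jump_profile p m \<nu> (z - y)\<bar>) \<partial>lborel)"
      unfolding E_def set_lebesgue_integral_def
      using integrable_ball_jump_profile[OF v, of y r p m \<nu>] unfolding set_integrable_def
      by (intro nn_integral_eq_integral[symmetric]) auto
    also have "\<dots> = (\<integral>\<^sup>+ z. (ennreal \<bar>v z - p\<bar> * indicator (ball y r \<inter> {z. (z - y) \<bullet> \<nu> > 0}) z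
         + ennreal \<bar>v z - m\<bar> * indicator (ball y r \<inter> {z. (z - y) \<bullet> \<nu> < 0}) z) \<partial>lborel)"
      using ae by (intro nn_integral_cong_AE, eventually_elim) (auto simp: jump_profile_def split: split_indicator)
    also have "\<dots> = P r + M r" unfolding P_def M_def by (intro nn_integral_add) measurable
    finally show ?thesis .
  qed
  have "((\<lambda>r. P r / ennreal (r ^ DIM('a))) \<longlongrightarrow> 0) (at_right 0)" "((\<lambda>r. M r / ennreal (r ^ DIM('a))) \<longlongrightarrow> 0) (at_right 0)"
    using lim unfolding one_sided_limits_def approx_limit_within_def P_def M_def nn_integral_completion by auto
  then have "((\<lambda>r. P r / ennreal (r ^ DIM('a)) + M r / ennreal (r ^ DIM('a))) \<longlongrightarrow> 0 + 0) (at_right 0)"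
    by (rule tendsto_add)
  then have "((\<lambda>r. ennreal (E r) / ennreal (r ^ DIM('a))) \<longlongrightarrow> 0) (at_right 0)"
    by (simp add: EPM add_divide_distrib_ennreal)
  then have "((\<lambda>r. ennreal (E r / r ^ DIM('a))) \<longlongrightarrow> 0) (at_right 0)"
    by (rule Lim_transform_eventually)
       (use E0 in \<open>auto simp: eventually_at_right_field divide_ennreal intro!: exI[of _ 1]\<close>)
  moreover have "\<forall>\<^sub>F r in at_right 0. 0 \<le> E r / r ^ DIM('a)"
    using E0 by (auto simp: eventually_at_right_field intro!: exI[of _ 1])
  ultimately have "((\<lambda>r. E r / r ^ DIM('a)) \<longlongrightarrow> 0) (at_right 0)"
    using tendsto_ennrealD[of "\<lambda>r. E r / r ^ DIM('a)" 0 "at_right 0"] by simp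
  then show ?thesis using \<nu> by (simp add: has_jump_profile_def E_def)
qed

lemma AE_has_jump_profile:
  fixes v :: "'a::euclidean_space \<Rightarrow> real"
  assumes v: "integrable lborel v" and \<nu>: "norm \<nu> = 1"
  shows "AE y in lborel. has_jump_profile v y (v y) (v y) \<nu>"
  using lebesgue_differentiation[OF v]
proof eventually_elim
  case (elim y)
  \<comment> \<open>Only the normalisation changes, from the volume of the ball to
    \<open>r ^ DIM('a)\<close>.\<close>
  define c where "c = measure lborel (ball (0::'a) 1)"
  have "((\<lambda>r. c * ((LINT z:ball y r|lborel. \<bar>v z - v y\<bar>) / measure lborel (ball y r))) \<longlongrightarrow> c * 0) (at_right 0)"
    by (intro tendsto_intros elim)
  moreover have "\<forall>\<^sub>F r in at_right 0. c * ((LINT z:ball y r|lborel. \<bar>v z - v y\<bar>) / measure lborel (ball y r))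
      = (LINT z:ball y r|lborel. \<bar>v z - v y\<bar>) / r ^ DIM('a)"
    unfolding eventually_at_right_field
  proof (intro exI[of _ 1] conjI allI impI)
    fix r :: real assume r: "0 < r" "r < 1"
    have c: "c > 0" unfolding c_def using content_ball_pos[of 1 "0::'a"] by simp
    have "measure lborel (ball y r) = r ^ DIM('a) * c"
      unfolding c_def using content_ball_conv_unit_ball[of r y] r by simp
    then show "c * ((LINT z:ball y r|lborel. \<bar>v z - v y\<bar>) / measure lborel (ball y r))
      = (LINT z:ball y r|lborel. \<bar>v z - v y\<bar>) / r ^ DIM('a)"
      using c by simp
  qed simp
  ultimately have "((\<lambda>r. (LINT z:ball y r|lborel. \<bar>v z - v y\<bar>) / r ^ DIM('a)) \<longlongrightarrow> c * 0) (at_right 0)"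
    by (rule Lim_transform_eventually)
  then show ?case using \<nu> by (simp add: has_jump_profile_def jump_profile_def)
qed

lemma lborel_integral_reflect:
  fixes f :: "'a::euclidean_space \<Rightarrow> real"
  assumes [measurable]: "f \<in> borel_measurable borel"
  shows "(\<integral>x. f (- x) \<partial>lborel) = (\<integral>x. f x \<partial>lborel)"
proof -
  have "lborel = distr lborel borel (\<lambda>x::'a. - x)"
    using lborel_affine[of "-1" "0::'a"] by (simp add: density_1)
  then have "(\<integral>x. f x \<partial>lborel) = (\<integral>x. f x \<partial>distr lborel borel (\<lambda>x::'a. - x))" by simp
  also have "\<dots> = (\<integral>x. f (- x) \<partial>lborel)" by (rule integral_distr) auto
  finally show ?thesis by simp
qed

definition mollify :: "real \<Rightarrow> ('a::euclidean_space \<Rightarrow> real) \<Rightarrow> 'a \<Rightarrow> real" where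
  "mollify \<epsilon> v x = (\<integral>z. v z * moll \<epsilon> (x - z) \<partial>lborel)"

lemma integrable_mult_moll:
  fixes v :: "'a::euclidean_space \<Rightarrow> real"
  assumes "\<epsilon> > 0" "integrable lborel v"
  shows "integrable lborel (\<lambda>z. v z * moll \<epsilon> (x - z))"
proof -
  have "continuous_on UNIV (moll \<epsilon> :: 'a \<Rightarrow> real)"
    by (intro continuous_at_imp_continuous_on ballI has_derivative_continuous[OF has_derivative_moll[OF assms(1)]])
  from continuous_convolution(1)[OF this moll_eq_0[OF assms(1)] assms(2)] show ?thesis by simp
qed

text \<open>The profile is invariant under dilations, so blow-up coordinates remove the scale
  \<open>e\<close>. Evenness of the kernel then turns the half-space condition on
  \<open>\<eta> + \<xi>\<close> into
  \<open>\<xi> \<bullet> \<nu> \<le> \<eta> \<bullet> \<nu>\<close>.\<close>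

lemma mollify_jump_profile:
  fixes y \<nu> \<eta> :: "'a::euclidean_space"
  assumes e: "e > 0"
  shows "(\<integral>z. jump_profile p m \<nu> (z - y) * moll e (y + e *\<^sub>R \<eta> - z) \<partial>lborel)
    = m + (p - m) * halfspace_mass \<nu> (\<eta> \<bullet> \<nu>)"
proof -
  let ?x = "y + e *\<^sub>R \<eta>"
  have sym: "moll e (?x - z) = moll e (z - ?x)" for z using moll_minus[OF e, of "z - ?x"] by simp
  have "(\<integral>z. jump_profile p m \<nu> (z - y) * moll e (?x - z) \<partial>lborel)
      = (\<integral>z. moll e (z - ?x) *\<^sub>R jump_profile p m \<nu> (z - y) \<partial>lborel)"
    by (simp add: sym mult.commute)
  also have "\<dots> = (\<integral>\<xi>. moll 1 \<xi> *\<^sub>R jump_profile p m \<nu> (?x + e *\<^sub>R \<xi> - y) \<partial>lborel)"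
    by (rule integral_moll_affine[OF e]) measurable
  also have "\<dots> = (\<integral>\<xi>. moll 1 \<xi> * jump_profile p m \<nu> (\<eta> + \<xi>) \<partial>lborel)"
  proof (intro Bochner_Integration.integral_cong refl)
    fix \<xi> :: 'a
    have "?x + e *\<^sub>R \<xi> - y = e *\<^sub>R (\<eta> + \<xi>)" by (simp add: algebra_simps)
    then show "moll 1 \<xi> *\<^sub>R jump_profile p m \<nu> (?x + e *\<^sub>R \<xi> - y) = moll 1 \<xi> * jump_profile p m \<nu> (\<eta> + \<xi>)"
      by (simp add: jump_profile_scaleR[OF e])
  qed
  also have "\<dots> = (\<integral>\<xi>. moll 1 (- \<xi>) * jump_profile p m \<nu> (\<eta> + - \<xi>) \<partial>lborel)"
    by (rule lborel_integral_reflect[symmetric]) measurable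
  also have "\<dots> = (\<integral>\<xi>. m * moll 1 \<xi> + (p - m) * (moll 1 \<xi> * indicator {\<xi>. \<xi> \<bullet> \<nu> \<le> \<eta> \<bullet> \<nu>} \<xi>) \<partial>lborel)"
    by (intro Bochner_Integration.integral_cong refl)
       (auto simp: moll_minus jump_profile_def inner_diff_left algebra_simps indicator_def)
  also have "\<dots> = m * (\<integral>\<xi>. moll 1 (\<xi>::'a) \<partial>lborel) + (p - m) * halfspace_mass \<nu> (\<eta> \<bullet> \<nu>)"
    unfolding halfspace_mass_def
    by (subst Bochner_Integration.integral_add)
       (auto intro!: integrable_mult_right integrable_real_mult_indicator integrable_moll)
  finally show ?thesis by (simp add: integral_moll)
qed

text \<open>The limit is the mollification of the jump profile itself, the same at every scale. The
  deviation is at most the maximum of the kernel times the L1 distance to the profile on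
  \<open>ball y (2 * r)\<close>. That ball contains the support of the shifted kernel because
  \<open>norm \<eta> \<le> 1\<close>; the doubled radius costs the factor
  \<open>2 ^ DIM('a)\<close>.\<close>

lemma mollify_blowup:
  fixes v :: "'a::euclidean_space \<Rightarrow> real"
  assumes v: "integrable lborel v" and J: "has_jump_profile v y p m \<nu>" and \<eta>: "norm \<eta> \<le> 1"
    and e: "\<And>k. e k > 0" "e \<longlonglongrightarrow> 0"
  shows "(\<lambda>k. mollify (e k) v (y + e k *\<^sub>R \<eta>)) \<longlonglongrightarrow> m + (p - m) * halfspace_mass \<nu> (\<eta> \<bullet> \<nu>)"
proof -
  have [measurable]: "v \<in> borel_measurable borel" using v by auto
  define L where "L = m + (p - m) * halfspace_mass \<nu> (\<eta> \<bullet> \<nu>)"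
  define E where "E r = (LINT z:ball y r|lborel. \<bar>v z - jump_profile p m \<nu> (z - y)\<bar>)" for r
  define C where "C = 1 / bump_mass TYPE('a)"
  have est: "\<bar>mollify r v (y + r *\<^sub>R \<eta>) - L\<bar> \<le> C * 2 ^ DIM('a) * (E (2 * r) / (2 * r) ^ DIM('a))" if r: "r > 0" for r
  proof -
    let ?x = "y + r *\<^sub>R \<eta>"
    define B where "B = 1 / (bump_mass TYPE('a) * r ^ DIM('a))"
    have B: "B \<ge> 0" using r bump_mass_pos[where 'a='a] by (simp add: B_def)
    have iJ: "integrable lborel (\<lambda>z. jump_profile p m \<nu> (z - y) * moll r (?x - z))"
    proof (rule Bochner_Integration.integrable_bound[where f="\<lambda>z. (\<bar>p\<bar> + \<bar>m\<bar>) * moll r (z - ?x)"])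
      have "integrable lborel (\<lambda>z. moll r (z - ?x))"
      proof -
        have "(\<integral>z. moll r (z - ?x) \<partial>lborel) = 1"
          using integral_moll_affine[OF r, of "\<lambda>_. 1::real" ?x] integral_moll[of 1, where 'a='a] by simp
        then show ?thesis using not_integrable_integral_eq by fastforce
      qed
      then show "integrable lborel (\<lambda>z. (\<bar>p\<bar> + \<bar>m\<bar>) * moll r (z - ?x))" by simp
      have "norm (jump_profile p m \<nu> (z - y) * moll r (?x - z)) \<le> norm ((\<bar>p\<bar> + \<bar>m\<bar>) * moll r (z - ?x))" for z
        using jump_profile_bound[of p m \<nu> "z - y"] moll_nonneg[OF r, of "z - ?x"] moll_minus[OF r, of "z - ?x"]
        by (simp add: abs_mult mult_right_mono)
      then show "AE z in lborel. norm (jump_profile p m \<nu> (z - y) * moll r (?x - z)) \<le> norm ((\<bar>p\<bar> + \<bar>m\<bar>) * moll r (z - ?x))"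
        by simp
    qed measurable
    have Leq: "L = (\<integral>z. jump_profile p m \<nu> (z - y) * moll r (?x - z) \<partial>lborel)"
      unfolding L_def by (rule mollify_jump_profile[OF r, symmetric])
    have "mollify r v ?x - L = (\<integral>z. (v z - jump_profile p m \<nu> (z - y)) * moll r (?x - z) \<partial>lborel)"
      unfolding mollify_def Leq
      using integrable_mult_moll[OF r v, of ?x] iJ by (simp add: left_diff_distrib)
    also have "norm \<dots> \<le> (\<integral>z. B * (indicator (ball y (2 * r)) z *\<^sub>R \<bar>v z - jump_profile p m \<nu> (z - y)\<bar>) \<partial>lborel)"
    proof (rule Bochner_Integration.integral_norm_bound_integral)
      show "integrable lborel (\<lambda>z. (v z - jump_profile p m \<nu> (z - y)) * moll r (?x - z))"
        using integrable_mult_moll[OF r v, of ?x] iJ by (simp add: left_diff_distrib)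
      show "integrable lborel (\<lambda>z. B * (indicator (ball y (2 * r)) z *\<^sub>R \<bar>v z - jump_profile p m \<nu> (z - y)\<bar>))"
        using integrable_ball_jump_profile[OF v, of y "2 * r" p m \<nu>] unfolding set_integrable_def
        by (rule integrable_mult_right)
      fix z
      show "norm ((v z - jump_profile p m \<nu> (z - y)) * moll r (?x - z))
          \<le> B * (indicator (ball y (2 * r)) z *\<^sub>R \<bar>v z - jump_profile p m \<nu> (z - y)\<bar>)"
      proof (cases "norm (?x - z) < r")
        case True
        have "norm (r *\<^sub>R \<eta>) \<le> r" using \<eta> r by (simp add: mult_left_le)
        then have "norm (y - z) < 2 * r"
          using True norm_triangle_ineq4[of "?x - z" "r *\<^sub>R \<eta>"] by simp
        then have "z \<in> ball y (2 * r)" by (simp add: dist_norm)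
        moreover have "moll r (?x - z) \<le> B" unfolding B_def by (rule moll_le[OF r])
        ultimately show ?thesis
          using mult_right_mono[of "moll r (?x - z)" B "\<bar>v z - jump_profile p m \<nu> (z - y)\<bar>"] moll_nonneg[OF r, of "?x - z"]
          by (simp add: abs_mult mult.commute)
      qed (use B in \<open>simp add: moll_eq_0[OF r]\<close>)
    qed
    also have "\<dots> = B * E (2 * r)" by (simp add: E_def set_lebesgue_integral_def)
    also have "\<dots> = C * 2 ^ DIM('a) * (E (2 * r) / (2 * r) ^ DIM('a))"
      using r by (simp add: B_def C_def power_mult_distrib field_simps)
    finally show ?thesis by simp
  qed
  have "filterlim (\<lambda>k. 2 * e k) (at_right 0) sequentially"
  proof -
    have "(\<lambda>k. 2 * e k) \<longlonglongrightarrow> 2 * 0" by (intro tendsto_intros e)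
    moreover have "2 * e k \<in> {0<..}" "2 * e k \<noteq> 0" for k using e(1)[of k] by auto
    ultimately show ?thesis by (simp add: filterlim_at)
  qed
  moreover have "((\<lambda>r. E r / r ^ DIM('a)) \<longlongrightarrow> 0) (at_right 0)"
    using J by (simp add: has_jump_profile_def E_def)
  ultimately have "(\<lambda>k. E (2 * e k) / (2 * e k) ^ DIM('a)) \<longlonglongrightarrow> 0"
    by (rule filterlim_compose[rotated])
  then have lim: "(\<lambda>k. C * 2 ^ DIM('a) * (E (2 * e k) / (2 * e k) ^ DIM('a))) \<longlonglongrightarrow> 0"
    by (rule tendsto_mult_right_zero)
  have "(\<lambda>k. mollify (e k) v (y + e k *\<^sub>R \<eta>) - L) \<longlonglongrightarrow> 0"
    by (rule Lim_null_comparison[OF _ lim]) (simp only: real_norm_def est[OF e(1)] eventually_True)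
  then show ?thesis unfolding L_def[symmetric] by (simp add: LIM_zero_cancel)
qed

lemma mollify_has_derivative:
  assumes "integrable lborel v" "\<epsilon> > 0"
  shows "continuous_on UNIV (mollify \<epsilon> (v :: 'a::euclidean_space \<Rightarrow> real))"
    and "(mollify \<epsilon> v has_derivative (\<lambda>h. h \<bullet> (\<integral>z. v z *\<^sub>R moll_grad \<epsilon> (x - z) \<partial>lborel))) (at x)"
proof -
  show D: "(mollify \<epsilon> v has_derivative (\<lambda>h. h \<bullet> (\<integral>z. v z *\<^sub>R moll_grad \<epsilon> (x - z) \<partial>lborel))) (at x)" for x
    unfolding mollify_def[abs_def]
    by (rule has_derivative_convolution[where R=\<epsilon>])
       (use assms in \<open>auto intro: has_derivative_moll moll_eq_0 continuous_moll_grad moll_grad_eq_0\<close>)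
  show "continuous_on UNIV (mollify \<epsilon> v)"
    by (intro continuous_at_imp_continuous_on ballI has_derivative_continuous[OF D])
qed

lemma halfspace_mass_measurable [measurable]: "halfspace_mass \<nu> \<in> borel_measurable borel"
proof (rule borel_measurable_mono)
  show "mono (halfspace_mass \<nu>)"
    unfolding halfspace_mass_def
    by (intro monoI integral_mono integrable_real_mult_indicator integrable_moll mult_left_mono moll_nonneg)
       (auto simp: indicator_def)
qed

text \<open>The field depends on the mollified function and is averaged at the same scale. In
  blow-up coordinates the argument of \<open>\<theta>\<close> converges pointwise on the unit ball
  by \<open>mollify_blowup\<close>; outside it the kernel vanishes. Boundedness of
  \<open>\<theta>\<close> and \<open>\<phi>\<close> gives domination.\<close>

lemma mollified_field_blowup:
  fixes v c :: "'a::euclidean_space \<Rightarrow> real" and \<phi> :: "'a \<Rightarrow> 'a"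
  assumes v: "integrable lborel v" and J: "has_jump_profile v y p m \<nu>"
    and e: "\<And>k. e k > 0" "e \<longlonglongrightarrow> 0"
    and c: "c \<in> borel_measurable borel" "isCont c y"
    and \<theta>: "continuous_on UNIV \<theta>" "\<And>s. \<bar>\<theta> s\<bar> \<le> (1::real)"
    and \<phi>: "continuous_on UNIV \<phi>" "\<And>x. norm (\<phi> x) \<le> B"
  shows "(\<lambda>k. \<integral>x. moll (e k) (x - y) *\<^sub>R (\<theta> (mollify (e k) v x - c x) *\<^sub>R \<phi> x) \<partial>lborel)
    \<longlonglongrightarrow> (\<integral>\<eta>. moll 1 \<eta> * \<theta> (m - c y + (p - m) * halfspace_mass \<nu> (\<eta> \<bullet> \<nu>)) \<partial>lborel) *\<^sub>R \<phi> y"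
proof -
  have [measurable]: "\<theta> \<in> borel_measurable borel" "\<phi> \<in> borel_measurable borel" "c \<in> borel_measurable borel"
      "mollify (e k) v \<in> borel_measurable borel" for k
    using \<theta> \<phi> c mollify_has_derivative(1)[OF v e(1)] by (auto intro: borel_measurable_continuous_onI)
  let ?g = "\<lambda>k x. \<theta> (mollify (e k) v x - c x) *\<^sub>R \<phi> x"
  have gB: "norm (?g k x) \<le> B" for k x
  proof -
    have "norm (?g k x) \<le> 1 * B" unfolding norm_scaleR by (intro mult_mono) (use \<theta>(2) \<phi>(2) in auto)
    then show ?thesis by simp
  qed
  have lim: "(\<lambda>k. ?g k (y + e k *\<^sub>R \<eta>)) \<longlonglongrightarrow> \<theta> (m - c y + (p - m) * halfspace_mass \<nu> (\<eta> \<bullet> \<nu>)) *\<^sub>R \<phi> y"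
    if "norm \<eta> \<le> 1" for \<eta>
  proof -
    have x: "(\<lambda>k. y + e k *\<^sub>R \<eta>) \<longlonglongrightarrow> y + 0 *\<^sub>R \<eta>" by (intro tendsto_intros e)
    then have "(\<lambda>k. c (y + e k *\<^sub>R \<eta>)) \<longlonglongrightarrow> c y" using isCont_tendsto_compose[OF c(2)] by simp
    with mollify_blowup[OF v J that e]
    have "(\<lambda>k. mollify (e k) v (y + e k *\<^sub>R \<eta>) - c (y + e k *\<^sub>R \<eta>)) \<longlonglongrightarrow>
        m + (p - m) * halfspace_mass \<nu> (\<eta> \<bullet> \<nu>) - c y" by (rule tendsto_diff)
    then have "(\<lambda>k. \<theta> (mollify (e k) v (y + e k *\<^sub>R \<eta>) - c (y + e k *\<^sub>R \<eta>))) \<longlonglongrightarrow>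
        \<theta> (m + (p - m) * halfspace_mass \<nu> (\<eta> \<bullet> \<nu>) - c y)"
      by (rule continuous_on_tendsto_compose[OF \<theta>(1)]) auto
    moreover have "(\<lambda>k. \<phi> (y + e k *\<^sub>R \<eta>)) \<longlonglongrightarrow> \<phi> (y + 0 *\<^sub>R \<eta>)"
      by (rule continuous_on_tendsto_compose[OF \<phi>(1) x]) auto
    ultimately show ?thesis by (auto intro!: tendsto_scaleR simp: algebra_simps)
  qed
  have "(\<lambda>k. \<integral>\<eta>. moll 1 \<eta> *\<^sub>R ?g k (y + e k *\<^sub>R \<eta>) \<partial>lborel) \<longlonglongrightarrow>
     (\<integral>\<eta>. moll 1 \<eta> *\<^sub>R (\<theta> (m - c y + (p - m) * halfspace_mass \<nu> (\<eta> \<bullet> \<nu>)) *\<^sub>R \<phi> y) \<partial>lborel)"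
  proof (rule integral_dominated_convergence[where w="\<lambda>\<eta>. B * moll 1 \<eta>"])
    have l: "(\<lambda>k. moll 1 \<eta> *\<^sub>R ?g k (y + e k *\<^sub>R \<eta>)) \<longlonglongrightarrow>
      moll 1 \<eta> *\<^sub>R (\<theta> (m - c y + (p - m) * halfspace_mass \<nu> (\<eta> \<bullet> \<nu>)) *\<^sub>R \<phi> y)" for \<eta>
      using tendsto_scaleR[OF tendsto_const lim[of \<eta>]] moll_eq_0[of 1 \<eta>] by (cases "norm \<eta> \<le> 1") auto
    then show "AE \<eta> in lborel. (\<lambda>k. moll 1 \<eta> *\<^sub>R ?g k (y + e k *\<^sub>R \<eta>)) \<longlonglongrightarrow>
      moll 1 \<eta> *\<^sub>R (\<theta> (m - c y + (p - m) * halfspace_mass \<nu> (\<eta> \<bullet> \<nu>)) *\<^sub>R \<phi> y)" by simp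
    show m: "(\<lambda>\<eta>. moll 1 \<eta> *\<^sub>R ?g k (y + e k *\<^sub>R \<eta>)) \<in> borel_measurable lborel" for k by measurable
    show "(\<lambda>\<eta>. moll 1 \<eta> *\<^sub>R (\<theta> (m - c y + (p - m) * halfspace_mass \<nu> (\<eta> \<bullet> \<nu>)) *\<^sub>R \<phi> y)) \<in> borel_measurable lborel"
      by (rule borel_measurable_LIMSEQ_metric[OF m l])
    show "integrable lborel (\<lambda>\<eta>::'a. B * moll 1 \<eta>)" using integrable_moll[of 1, where 'a='a] by simp
    show "AE \<eta> in lborel. norm (moll 1 \<eta> *\<^sub>R ?g k (y + e k *\<^sub>R \<eta>)) \<le> B * moll 1 \<eta>" for k
    proof (intro AE_I2)
      fix \<eta> :: 'a
      have "norm (moll 1 \<eta> *\<^sub>R ?g k (y + e k *\<^sub>R \<eta>)) = moll 1 \<eta> * norm (?g k (y + e k *\<^sub>R \<eta>))"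
        unfolding norm_scaleR[of "moll 1 \<eta>"] using moll_nonneg[of 1 \<eta>] by simp
      also have "\<dots> \<le> moll 1 \<eta> * B" by (intro mult_left_mono gB moll_nonneg) simp
      finally show "norm (moll 1 \<eta> *\<^sub>R ?g k (y + e k *\<^sub>R \<eta>)) \<le> B * moll 1 \<eta>" by (simp add: mult.commute)
    qed
  qed
  also have "(\<integral>\<eta>. moll 1 \<eta> *\<^sub>R (\<theta> (m - c y + (p - m) * halfspace_mass \<nu> (\<eta> \<bullet> \<nu>)) *\<^sub>R \<phi> y) \<partial>lborel)
      = (\<integral>\<eta>. moll 1 \<eta> * \<theta> (m - c y + (p - m) * halfspace_mass \<nu> (\<eta> \<bullet> \<nu>)) \<partial>lborel) *\<^sub>R \<phi> y"
    unfolding scaleR_scaleR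
  proof (rule integral_scaleR_left)
    show "integrable lborel (\<lambda>\<eta>. moll 1 \<eta> * \<theta> (m - c y + (p - m) * halfspace_mass \<nu> (\<eta> \<bullet> \<nu>)))"
      using integrable_mult_bounded[OF integrable_moll[of 1, where 'a='a], of "\<lambda>\<eta>. \<theta> (m - c y + (p - m) * halfspace_mass \<nu> (\<eta> \<bullet> \<nu>))" 1]
        \<theta>(2) by simp
  qed
  also have "(\<lambda>k. \<integral>\<eta>. moll 1 \<eta> *\<^sub>R ?g k (y + e k *\<^sub>R \<eta>) \<partial>lborel) = (\<lambda>k. \<integral>x. moll (e k) (x - y) *\<^sub>R ?g k x \<partial>lborel)"
    by (intro ext integral_moll_affine[OF e(1), symmetric]) measurable
  finally show ?thesis .
qed

text \<open>The kernel times a basis vector is an admissible test field once its supporting ball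
  lies in \<Omega>. Hence the gradient of the mollification is the mollification of the derivative
  measure.\<close>

lemma mollify_derivative_measure:
  fixes \<Omega> :: "'a::euclidean_space set"
  assumes \<Omega>: "open \<Omega>" and v: "integrable lborel v" "\<And>x. x \<notin> \<Omega> \<Longrightarrow> v x = 0"
    and \<mu>: "sets \<mu> = sets borel" and F: "integrable \<mu> F"
    and rep: "\<And>\<phi>. test_field \<Omega> \<phi> \<Longrightarrow> (LINT x:\<Omega>|lborel. v x * divergence \<phi> x) = - (\<integral>x. \<phi> x \<bullet> F x \<partial>\<mu>)"
    and e: "e > 0" "cball x e \<subseteq> \<Omega>"
  shows "(\<integral>z. v z *\<^sub>R moll_grad e (x - z) \<partial>lborel) = (\<integral>z. moll e (x - z) *\<^sub>R F z \<partial>\<mu>)"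
proof (rule euclidean_eqI)
  fix b :: 'a assume b: "b \<in> Basis"
  let ?\<psi> = "\<lambda>z. moll e (x - z)" and ?Z = "\<lambda>z. - moll_grad e (x - z)"
  have c: "C1_on \<Omega> (\<lambda>_. b)" unfolding C1_on_def by (auto simp: frechet_derivative_const)
  have D: "(?\<psi> has_derivative (\<lambda>h. h \<bullet> ?Z z)) (at z)" for z
  proof -
    have "((\<lambda>z. x - z) has_derivative (\<lambda>h. - h)) (at z)" by (auto intro!: derivative_eq_intros)
    from has_derivative_compose[OF this has_derivative_moll[OF e(1)]] show ?thesis by simp
  qed
  have Zc: "continuous_on UNIV ?Z"
    by (intro continuous_on_minus continuous_on_compose2[OF continuous_moll_grad[OF e(1), of UNIV]] continuous_intros) auto
  have K0: "?\<psi> z = 0" if "z \<notin> cball x e" for z using that moll_eq_0[OF e(1), of "x - z"] by (simp add: dist_norm)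
  have tf: "test_field \<Omega> (\<lambda>z. ?\<psi> z *\<^sub>R b)"
    by (rule test_field_cutoff(1)[OF \<Omega> c D Zc compact_cball e(2)]) (rule K0)
  have div: "divergence (\<lambda>z. ?\<psi> z *\<^sub>R b) z = - (moll_grad e (x - z) \<bullet> b)" if "z \<in> \<Omega>" for z
  proof -
    have "divergence (\<lambda>z. ?\<psi> z *\<^sub>R b) z = ?\<psi> z * divergence (\<lambda>_. b) z + ?Z z \<bullet> b"
      by (rule test_field_cutoff(2)[OF \<Omega> c D Zc compact_cball e(2) K0 that])
    then show ?thesis using divergence_eqI[OF has_derivative_const, of b z] by simp
  qed
  have i1: "integrable lborel (\<lambda>z. v z *\<^sub>R moll_grad e (x - z))"
    by (rule continuous_convolution(1)[where R=e]) (use e v in \<open>auto intro: continuous_moll_grad moll_grad_eq_0\<close>)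
  have i2: "integrable \<mu> (\<lambda>z. moll e (x - z) *\<^sub>R F z)"
  proof (rule Bochner_Integration.integrable_bound[OF integrable_scaleR_right[OF integrable_norm[OF F], of "1 / (bump_mass TYPE('a) * e ^ DIM('a))"]])
    have [measurable]: "F \<in> borel_measurable \<mu>" using F by auto
    have "(\<lambda>z. moll e (x - z)) \<in> borel_measurable \<mu>"
      unfolding measurable_cong_sets[OF \<mu> refl] by measurable
    then show "(\<lambda>z. moll e (x - z) *\<^sub>R F z) \<in> borel_measurable \<mu>" by measurable
    show "AE z in \<mu>. norm (moll e (x - z) *\<^sub>R F z) \<le> norm ((1 / (bump_mass TYPE('a) * e ^ DIM('a))) *\<^sub>R norm (F z))"
      using moll_le[OF e(1), where 'a='a] moll_nonneg[OF e(1), where 'a='a] bump_mass_pos[where 'a='a] e(1)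
      by (intro AE_I2) (auto simp del: times_divide_eq_left intro!: mult_right_mono)
  qed
  have "(\<integral>z. v z *\<^sub>R moll_grad e (x - z) \<partial>lborel) \<bullet> b = (\<integral>z. (v z *\<^sub>R moll_grad e (x - z)) \<bullet> b \<partial>lborel)"
    by (rule integral_inner_left[OF i1, symmetric])
  also have "\<dots> = - (LINT z:\<Omega>|lborel. v z * divergence (\<lambda>z. ?\<psi> z *\<^sub>R b) z)"
    unfolding set_lebesgue_integral_def Bochner_Integration.integral_minus[symmetric]
    by (intro Bochner_Integration.integral_cong refl) (auto simp: indicator_def div v)
  also have "\<dots> = (\<integral>z. (moll e (x - z) *\<^sub>R b) \<bullet> F z \<partial>\<mu>)" by (simp add: rep[OF tf])
  also have "\<dots> = (\<integral>z. (moll e (x - z) *\<^sub>R F z) \<bullet> b \<partial>\<mu>)" by (simp add: inner_commute)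
  also have "\<dots> = (\<integral>z. moll e (x - z) *\<^sub>R F z \<partial>\<mu>) \<bullet> b" by (rule integral_inner_left[OF i2])
  finally show "(\<integral>z. v z *\<^sub>R moll_grad e (x - z) \<partial>lborel) \<bullet> b = (\<integral>z. moll e (x - z) *\<^sub>R F z \<partial>\<mu>) \<bullet> b" .
qed

lemma norm_le_norm_real: "norm x \<le> c \<Longrightarrow> norm x \<le> norm (c :: real)"
  by simp

text \<open>Moves the mollification from the measure to the field, whose averages have pointwise
  limits. The product integrand is dominated because the kernel is bounded, \<open>\<Phi>\<close> is
  bounded with compact support and \<open>F\<close> is integrable.\<close>

lemma mollify_Fubini:
  fixes F \<Phi> :: "'a::euclidean_space \<Rightarrow> 'a"
  assumes \<mu>: "sets \<mu> = sets borel" "finite_measure \<mu>" and F: "integrable \<mu> F"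
    and \<Phi>: "\<Phi> \<in> borel_measurable borel" "\<And>x. norm (\<Phi> x) \<le> B" "\<And>x. x \<notin> K \<Longrightarrow> \<Phi> x = 0" and K: "compact K"
    and e: "e > 0"
  shows "(\<integral>x. \<Phi> x \<bullet> (\<integral>y. moll e (x - y) *\<^sub>R F y \<partial>\<mu>) \<partial>lborel) = (\<integral>y. (\<integral>x. moll e (x - y) *\<^sub>R \<Phi> x \<partial>lborel) \<bullet> F y \<partial>\<mu>)"
proof -
  interpret \<mu>: finite_measure \<mu> by fact
  interpret P: pair_sigma_finite lborel \<mu> ..
  have Fm: "F \<in> borel_measurable borel" 
    using borel_measurable_integrable[OF F] unfolding measurable_cong_sets[OF \<mu>(1) refl] .
  note [measurable] = Fm \<Phi>(1)
  note [measurable_cong] = \<mu>(1)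
  have [measurable]: "K \<in> sets borel" using K by (simp add: borel_closed compact_imp_closed)
  define C where "C = 1 / (bump_mass TYPE('a) * e ^ DIM('a))"
  have C0: "C \<ge> 0" using bump_mass_pos[where 'a='a] e by (simp add: C_def)
  have moll: "\<bar>moll e z\<bar> \<le> C" for z :: 'a using moll_le[OF e, of z] moll_nonneg[OF e, of z] by (simp add: C_def)
  have B0: "B \<ge> 0" using \<Phi>(2)[of 0] norm_ge_zero order_trans by blast
  define f where "f x y = moll e (x - y) * (\<Phi> x \<bullet> F y)" for x y
  have fm [measurable]: "(\<lambda>(x, y). f x y) \<in> borel_measurable (lborel \<Otimes>\<^sub>M \<mu>)" unfolding f_def by measurable
  have fb: "norm (f x y) \<le> C * B * indicator K x * norm (F y)" for x y
  proof (cases "x \<in> K")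
    case True
    have "\<bar>\<Phi> x \<bullet> F y\<bar> \<le> B * norm (F y)"
      using Cauchy_Schwarz_ineq2[of "\<Phi> x" "F y"] mult_right_mono[OF \<Phi>(2)[of x] norm_ge_zero[of "F y"]] by linarith
    then have "norm (f x y) \<le> C * (B * norm (F y))"
      unfolding f_def norm_mult using moll C0 by (intro mult_mono) auto
    then show ?thesis using True by (simp add: mult.assoc)
  qed (simp add: f_def \<Phi>(3))
  have iy: "integrable \<mu> (\<lambda>y. f x y)" for x
  proof (rule Bochner_Integration.integrable_bound[where f="\<lambda>y. C * B * indicator K x * norm (F y)"])
    show "integrable \<mu> (\<lambda>y. C * B * indicator K x * norm (F y))" using F by (intro integrable_mult_right integrable_norm)
    show "(\<lambda>y. f x y) \<in> borel_measurable \<mu>" unfolding f_def by measurable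
    show "AE y in \<mu>. norm (f x y) \<le> norm (C * B * indicator K x * norm (F y))"
      by (intro AE_I2 order_trans[OF fb]) (simp only: real_norm_def abs_ge_self)
  qed
  have int: "integrable (lborel \<Otimes>\<^sub>M \<mu>) (case_prod f)"
  proof (rule P.Fubini_integrable)
    show "case_prod f \<in> borel_measurable (lborel \<Otimes>\<^sub>M \<mu>)" using fm by simp
    show "AE x in lborel. integrable \<mu> (\<lambda>y. case_prod f (x, y))" using iy by simp
    show "integrable lborel (\<lambda>x. \<integral>y. norm (case_prod f (x, y)) \<partial>\<mu>)"
    proof (rule Bochner_Integration.integrable_bound[where f="\<lambda>x. (C * B * (\<integral>y. norm (F y) \<partial>\<mu>)) * indicator K x"])
      show "integrable lborel (\<lambda>x. (C * B * (\<integral>y. norm (F y) \<partial>\<mu>)) * indicator K x)"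
        using emeasure_compact_finite[OF K] by (intro integrable_mult_right integrable_real_indicator) auto
      show "(\<lambda>x. \<integral>y. norm (case_prod f (x, y)) \<partial>\<mu>) \<in> borel_measurable lborel"
        by (intro \<mu>.borel_measurable_lebesgue_integral) (unfold f_def, measurable)
      have "(\<integral>y. norm (f x y) \<partial>\<mu>) \<le> (\<integral>y. C * B * indicator K x * norm (F y) \<partial>\<mu>)" for x
        by (intro integral_mono integrable_norm[OF iy] integrable_mult_right integrable_norm[OF F] fb)
      then have le: "(\<integral>y. norm (f x y) \<partial>\<mu>) \<le> (C * B * (\<integral>y. norm (F y) \<partial>\<mu>)) * indicator K x" for x
        by (simp add: mult_ac)
      have "0 \<le> (\<integral>y. norm (f x y) \<partial>\<mu>)" for x by (intro Bochner_Integration.integral_nonneg) simp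
      then have "norm (\<integral>y. norm (f x y) \<partial>\<mu>) \<le> (C * B * (\<integral>y. norm (F y) \<partial>\<mu>)) * indicator K x" for x
        using le[of x] by simp
      then show "AE x in lborel. norm (\<integral>y. norm (case_prod f (x, y)) \<partial>\<mu>)
          \<le> norm ((C * B * (\<integral>y. norm (F y) \<partial>\<mu>)) * indicator K x)"
        unfolding case_prod_conv by (intro AE_I2 norm_le_norm_real)
    qed
  qed
  have "(\<integral>x. \<Phi> x \<bullet> (\<integral>y. moll e (x - y) *\<^sub>R F y \<partial>\<mu>) \<partial>lborel) = (\<integral>x. \<integral>y. f x y \<partial>\<mu> \<partial>lborel)"
  proof (intro Bochner_Integration.integral_cong refl)
    fix x
    have "integrable \<mu> (\<lambda>y. moll e (x - y) *\<^sub>R F y)"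
    proof (rule Bochner_Integration.integrable_bound[where f="\<lambda>y. C * norm (F y)"])
      show "integrable \<mu> (\<lambda>y. C * norm (F y))" using F by (intro integrable_mult_right integrable_norm)
      show "AE y in \<mu>. norm (moll e (x - y) *\<^sub>R F y) \<le> norm (C * norm (F y))"
        using moll C0 by (intro AE_I2) (auto simp: mult_right_mono)
    qed measurable
    from integral_inner_right[OF this, of "\<Phi> x"] show "\<Phi> x \<bullet> (\<integral>y. moll e (x - y) *\<^sub>R F y \<partial>\<mu>) = (\<integral>y. f x y \<partial>\<mu>)"
      by (simp add: f_def)
  qed
  also have "\<dots> = (\<integral>y. \<integral>x. f x y \<partial>lborel \<partial>\<mu>)" by (rule P.Fubini_integral[OF int, symmetric])
  also have "\<dots> = (\<integral>y. (\<integral>x. moll e (x - y) *\<^sub>R \<Phi> x \<partial>lborel) \<bullet> F y \<partial>\<mu>)"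
  proof (intro Bochner_Integration.integral_cong refl)
    fix y
    have "integrable lborel (\<lambda>x. moll e (x - y) *\<^sub>R \<Phi> x)"
    proof (rule Bochner_Integration.integrable_bound[where f="\<lambda>x. C * B * indicator K x"])
      show "integrable lborel (\<lambda>x. C * B * indicator K x)"
        using emeasure_compact_finite[OF K] by (intro integrable_mult_right integrable_real_indicator) auto
      have "norm (moll e (x - y) *\<^sub>R \<Phi> x) \<le> C * B * indicator K x" for x
        using mult_mono[OF moll[of "x - y"] \<Phi>(2)[of x]] C0 \<Phi>(3)[of x] by (cases "x \<in> K") auto
      then show "AE x in lborel. norm (moll e (x - y) *\<^sub>R \<Phi> x) \<le> norm (C * B * indicator K x)"
        by (intro AE_I2 norm_le_norm_real)
    qed measurable
    from integral_inner_left[OF this, of "F y"] show "(\<integral>x. f x y \<partial>lborel) = (\<integral>x. moll e (x - y) *\<^sub>R \<Phi> x \<partial>lborel) \<bullet> F y"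
      by (simp add: f_def)
  qed
  finally show ?thesis .
qed

lemma norm_integral_moll_le:
  fixes \<Phi> :: "'a::euclidean_space \<Rightarrow> 'a"
  assumes "\<Phi> \<in> borel_measurable borel" "\<And>x. norm (\<Phi> x) \<le> B" "e > 0"
  shows "norm (\<integral>x. moll e (x - y) *\<^sub>R \<Phi> x \<partial>lborel) \<le> B"
    and "(\<lambda>y. \<integral>x. moll e (x - y) *\<^sub>R \<Phi> x \<partial>lborel) \<in> borel_measurable borel"
proof -
  note [measurable] = assms(1)
  have B: "0 \<le> B" using assms(2)[of 0] norm_ge_zero order_trans by blast
  have one: "(\<integral>x. moll e (x - y) \<partial>lborel) = 1"
    using integral_moll_affine[OF assms(3), of "\<lambda>_. 1::real" y] integral_moll[of 1, where 'a='a] by simp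
  then have i: "integrable lborel (\<lambda>x. moll e (x - y))" using not_integrable_integral_eq by fastforce
  have "norm (\<integral>x. moll e (x - y) *\<^sub>R \<Phi> x \<partial>lborel) \<le> (\<integral>x. moll e (x - y) * B \<partial>lborel)"
  proof (rule Bochner_Integration.integral_norm_bound_integral)
    show "integrable lborel (\<lambda>x. moll e (x - y) *\<^sub>R \<Phi> x)" by (rule integrable_mult_bounded[OF i _ assms(2)]) simp
    show "integrable lborel (\<lambda>x. moll e (x - y) * B)" using i by simp
  qed (use assms moll_nonneg[OF assms(3), where 'a='a] in \<open>auto intro!: mult_left_mono\<close>)
  also have "\<dots> = B" using one by simp
  finally show "norm (\<integral>x. moll e (x - y) *\<^sub>R \<Phi> x \<partial>lborel) \<le> B" .
  show "(\<lambda>y. \<integral>x. moll e (x - y) *\<^sub>R \<Phi> x \<partial>lborel) \<in> borel_measurable borel"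
    by (intro lborel.borel_measurable_lebesgue_integral) measurable
qed

subsection \<open>Chain rule for truncations\<close>

text \<open>The composition \<open>T (v - c)\<close> is differentiated on the mollified level; blowing up at almost every
  point, with respect to the Lebesgue measure and to the jump measure, identifies the limit.\<close>

lemma sbv_chain_rule:
  fixes \<Omega> :: "'a::euclidean_space set" and v c T \<theta> :: "_ \<Rightarrow> real" and \<phi> :: "'a \<Rightarrow> 'a"
  assumes \<Omega>: "open \<Omega>" and v: "integrable lborel v" "\<And>x. x \<notin> \<Omega> \<Longrightarrow> v x = 0"
    and \<mu>: "sets \<mu> = sets borel" "finite_measure \<mu>" and F: "integrable \<mu> F"
    and rep: "\<And>\<phi>. test_field \<Omega> \<phi> \<Longrightarrow> (LINT x:\<Omega>|lborel. v x * divergence \<phi> x) = - (\<integral>x. \<phi> x \<bullet> F x \<partial>\<mu>)"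
    and g: "integrable lborel g" "\<And>x. x \<notin> \<Omega> \<Longrightarrow> g x = 0"
    and H: "sets H = sets borel" and J: "integrable H J"
    and eq: "\<And>B. B \<in> sets borel \<Longrightarrow> (LINT x:B|\<mu>. F x) = (LINT x:B|lborel. g x) + (LINT x:B|H. J x)"
    and jump: "AE y in H. J y \<noteq> 0 \<longrightarrow> (\<exists>p m \<nu>. y \<in> \<Omega> \<and> has_jump_profile v y p m \<nu> \<and> J y = (p - m) *\<^sub>R \<nu>)"
    and c: "c \<in> borel_measurable borel" "\<And>x. x \<in> \<Omega> \<Longrightarrow> (c has_derivative (\<lambda>h. h \<bullet> C x)) (at x)" "continuous_on \<Omega> C"
    and T: "\<And>s. (T has_real_derivative \<theta> s) (at s)" "continuous_on UNIV \<theta>" "\<And>s. \<bar>\<theta> s\<bar> \<le> 1" "\<And>a b. \<bar>T b - T a\<bar> \<le> l"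
    and \<phi>: "test_field \<Omega> \<phi>" "\<And>x. norm (\<phi> x) \<le> B"
    and fin: "emeasure H {y. J y \<noteq> 0} \<noteq> \<infinity>"
  shows "\<bar>(LINT x:\<Omega>|lborel. T (v x - c x) * divergence \<phi> x) + (\<integral>x. \<theta> (v x - c x) * (\<phi> x \<bullet> g x) \<partial>lborel)
      - (LINT x:\<Omega>|lborel. \<theta> (v x - c x) * (\<phi> x \<bullet> C x))\<bar> \<le> l * B * measure H {y. J y \<noteq> 0}"
proof -
  from \<phi>(1) obtain K where K: "compact K" "K \<subseteq> \<Omega>" "\<And>x. x \<notin> K \<Longrightarrow> \<phi> x = 0"
    "\<And>x h. x \<notin> K \<Longrightarrow> frechet_derivative \<phi> (at x) h = 0" "\<And>x. x \<notin> K \<Longrightarrow> divergence \<phi> x = 0"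
    and D: "\<And>x. (\<phi> has_derivative frechet_derivative \<phi> (at x)) (at x)"
    and \<phi>c: "continuous_on UNIV \<phi>" "\<And>h. continuous_on UNIV (\<lambda>x. frechet_derivative \<phi> (at x) h)"
      and divc: "continuous_on UNIV (divergence \<phi>)"
    by (erule test_fieldE)
  have vm: "v \<in> borel_measurable borel" using v(1) by auto
  have \<theta>m: "\<theta> \<in> borel_measurable borel" by (rule borel_measurable_continuous_onI[OF T(2)])
  have \<phi>m: "\<phi> \<in> borel_measurable borel" by (rule borel_measurable_continuous_onI[OF \<phi>c(1)])
  have divm: "divergence \<phi> \<in> borel_measurable borel" by (rule borel_measurable_continuous_onI[OF divc])
  have Tc: "continuous_on UNIV T"
    by (intro continuous_at_imp_continuous_on ballI DERIV_isCont[OF T(1)])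
  have Tm: "T \<in> borel_measurable borel" by (rule borel_measurable_continuous_onI[OF Tc])
  have gm: "g \<in> borel_measurable borel" using g(1) by auto
  have \<Omega>m: "\<Omega> \<in> sets borel" using \<Omega> by simp
  note [measurable] = vm \<theta>m \<phi>m divm Tm gm c(1) \<Omega>m
  have B0: "B \<ge> 0" using \<phi>(2)[of 0] norm_ge_zero order_trans by blast
  have l0: "l \<ge> 0" using T(4)[of 0 0] by simp
  \<comment> \<open>Scales up to \<open>\<delta>\<close> keep every kernel centred in
    \<open>K\<close> inside \<Omega>, where the representation of \<open>Dv\<close> is
    available.\<close>
  obtain \<delta> where \<delta>: "\<delta> > 0" "\<And>x. x \<in> K \<Longrightarrow> cball x \<delta> \<subseteq> \<Omega>"
  proof (cases "K = {}")
    case True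
    then show thesis using that[of 1] by simp
  next
    case False
    from compact_subset_open_imp_cball_epsilon_subset[OF K(1) \<Omega> K(2)]
    obtain \<epsilon> where "\<epsilon> > 0" "(\<Union>x\<in>K. cball x \<epsilon>) \<subseteq> \<Omega>" by blast
    then show thesis using that[of \<epsilon>] by blast
  qed

  \<comment> \<open>Mollification scales and averaged fields\<close>
  define e where "e k = \<delta> * inverse (real (Suc k))" for k
  have e0: "e k > 0" for k using \<delta> by (simp add: e_def)
  have e\<delta>: "e k \<le> \<delta>" for k using \<delta> by (simp add: e_def field_simps)
  have elim: "e \<longlonglongrightarrow> 0"
    unfolding e_def using tendsto_mult_right_zero[OF LIMSEQ_inverse_real_of_nat] by simp
  have vkm: "mollify (e k) v \<in> borel_measurable borel" for k
    by (rule borel_measurable_continuous_onI[OF mollify_has_derivative(1)[OF v(1) e0]])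
  define \<Phi> where "\<Phi> k x = \<theta> (mollify (e k) v x - c x) *\<^sub>R \<phi> x" for k x
  have \<Phi>m: "\<Phi> k \<in> borel_measurable borel" for k unfolding \<Phi>_def[abs_def] using vkm by measurable
  have \<Phi>B: "norm (\<Phi> k x) \<le> B" for k x
  proof -
    have "norm (\<Phi> k x) \<le> 1 * B" unfolding \<Phi>_def norm_scaleR by (intro mult_mono) (use T(3) \<phi>(2) in auto)
    then show ?thesis by simp
  qed
  have \<Phi>K: "x \<notin> K \<Longrightarrow> \<Phi> k x = 0" for k x by (simp add: \<Phi>_def K(3))
  \<comment> \<open>What the measure with density \<open>F\<close> sees of the nonlinear field
    \<open>\<Phi> k\<close> after Fubini.\<close>
  define A where "A k y = (\<integral>x. moll (e k) (x - y) *\<^sub>R \<Phi> k x \<partial>lborel)" for k y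
  have Am: "A k \<in> borel_measurable borel" and AB: "norm (A k y) \<le> B" for k y
    unfolding A_def[abs_def] by (rule norm_integral_moll_le[OF \<Phi>m \<Phi>B e0])+
  have Ainner: "norm (A k y \<bullet> z) \<le> B * norm z" for k y z
    unfolding real_norm_def
    by (rule order_trans[OF Cauchy_Schwarz_ineq2 mult_right_mono[OF AB norm_ge_zero]])
  have cont_c: "isCont c y" if "y \<in> \<Omega>" for y using has_derivative_continuous[OF c(2)[OF that]] .
  \<comment> \<open>At Lebesgue points both sides have the same value, so any unit vector serves as
    normal.\<close>
  have AE_K: "AE x in lborel. x \<in> \<Omega> \<longrightarrow> has_jump_profile v x (v x) (v x) (SOME b. b \<in> Basis)"
  proof -
    have "norm (SOME b::'a. b \<in> Basis) = 1" by (simp add: SOME_Basis)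
    from AE_has_jump_profile[OF v(1) this] show ?thesis by eventually_elim simp
  qed
  let ?b = "SOME b::'a. b \<in> Basis"

  \<comment> \<open>Integration by parts at a fixed scale\<close>
  have key: "(LINT x:\<Omega>|lborel. T (mollify (e k) v x - c x) * divergence \<phi> x) =
      - (\<integral>y. A k y \<bullet> g y \<partial>lborel) - (\<integral>y. A k y \<bullet> J y \<partial>H) + (LINT x:\<Omega>|lborel. \<theta> (mollify (e k) v x - c x) * (\<phi> x \<bullet> C x))" for k
  proof -
    define Z where "Z x = (\<integral>z. v z *\<^sub>R moll_grad (e k) (x - z) \<partial>lborel)" for x
    have Zc: "continuous_on UNIV Z" unfolding Z_def
      by (rule continuous_convolution(2)[where R="e k"]) (use e0 v in \<open>auto intro: continuous_moll_grad moll_grad_eq_0\<close>)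
    let ?w = "\<lambda>x. mollify (e k) v x - c x"
    have Dw: "(?w has_derivative (\<lambda>h. h \<bullet> (Z x - C x))) (at x)" if "x \<in> \<Omega>" for x
      unfolding Z_def inner_diff_right
      by (intro has_derivative_diff mollify_has_derivative(2)[OF v(1) e0] c(2) that)
    have D\<zeta>: "((\<lambda>x. T (?w x)) has_derivative (\<lambda>h. h \<bullet> (\<theta> (?w x) *\<^sub>R (Z x - C x)))) (at x)" if "x \<in> \<Omega>" for x
      using has_derivative_compose[OF Dw[OF that] T(1)[unfolded has_field_derivative_def]] by (simp add: mult.commute)
    have wc: "continuous_on \<Omega> ?w"
      by (intro continuous_at_imp_continuous_on ballI has_derivative_continuous[OF Dw])
    have \<theta>wc: "continuous_on \<Omega> (\<lambda>x. \<theta> (?w x))" by (rule continuous_on_compose2[OF T(2) wc]) auto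
    have Zc': "continuous_on \<Omega> Z" "continuous_on \<Omega> \<phi>" using Zc \<phi>c(1) continuous_on_subset by blast+
    have "(LINT x:\<Omega>|lborel. T (?w x) * divergence \<phi> x) = - (LINT x:\<Omega>|lborel. \<phi> x \<bullet> (\<theta> (?w x) *\<^sub>R (Z x - C x)))"
      by (rule integration_by_parts(3)[OF \<Omega> \<phi>(1)], erule D\<zeta>) (intro continuous_intros \<theta>wc Zc' c(3))
    also have "(LINT x:\<Omega>|lborel. \<phi> x \<bullet> (\<theta> (?w x) *\<^sub>R (Z x - C x))) =
        (LINT x:\<Omega>|lborel. \<Phi> k x \<bullet> Z x) - (LINT x:\<Omega>|lborel. \<theta> (?w x) * (\<phi> x \<bullet> C x))"
    proof -
      have 1: "set_integrable lborel \<Omega> (\<lambda>x. \<Phi> k x \<bullet> Z x)" unfolding \<Phi>_def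
        using K by (intro set_integrable_compact_support[where K=K] continuous_intros \<theta>wc Zc') auto
      have 2: "set_integrable lborel \<Omega> (\<lambda>x. \<theta> (?w x) * (\<phi> x \<bullet> C x))"
        using K by (intro set_integrable_compact_support[where K=K] continuous_intros \<theta>wc Zc' c(3)) auto
      have "(LINT x:\<Omega>|lborel. \<phi> x \<bullet> (\<theta> (?w x) *\<^sub>R (Z x - C x))) =
        (LINT x:\<Omega>|lborel. \<Phi> k x \<bullet> Z x - \<theta> (?w x) * (\<phi> x \<bullet> C x))"
        by (simp add: \<Phi>_def inner_diff_right right_diff_distrib)
      also have "\<dots> = (LINT x:\<Omega>|lborel. \<Phi> k x \<bullet> Z x) - (LINT x:\<Omega>|lborel. \<theta> (?w x) * (\<phi> x \<bullet> C x))"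
        by (rule set_integral_diff(2)[OF 1 2])
      finally show ?thesis .
    qed
    also have "(LINT x:\<Omega>|lborel. \<Phi> k x \<bullet> Z x) = (\<integral>x. \<Phi> k x \<bullet> (\<integral>y. moll (e k) (x - y) *\<^sub>R F y \<partial>\<mu>) \<partial>lborel)"
      unfolding set_lebesgue_integral_def
    proof (intro Bochner_Integration.integral_cong refl)
      fix x
      show "indicator \<Omega> x *\<^sub>R (\<Phi> k x \<bullet> Z x) = \<Phi> k x \<bullet> (\<integral>y. moll (e k) (x - y) *\<^sub>R F y \<partial>\<mu>)"
      proof (cases "x \<in> K")
        case True
        have "cball x (e k) \<subseteq> \<Omega>" using \<delta>(2)[OF True] e\<delta>[of k] subset_cball by blast
        from mollify_derivative_measure[OF \<Omega> v \<mu>(1) F rep e0 this] show ?thesis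
          using True K(2) unfolding Z_def by auto
      qed (simp add: \<Phi>K)
    qed
    also have "\<dots> = (\<integral>y. A k y \<bullet> F y \<partial>\<mu>)"
      unfolding A_def by (rule mollify_Fubini[OF \<mu> F \<Phi>m \<Phi>B \<Phi>K K(1) e0])
    also have "\<dots> = (\<integral>y. A k y \<bullet> g y \<partial>lborel) + (\<integral>y. A k y \<bullet> J y \<partial>H)"
      by (rule bounded_field_integral_eq_from_sets[OF \<mu>(1) _ H F g(1) J eq Am AB]) auto
    finally show ?thesis by simp
  qed

  \<comment> \<open>Limits of the absolutely continuous terms\<close>
  have limvk: "(\<lambda>k. mollify (e k) v x) \<longlonglongrightarrow> v x" if "has_jump_profile v x (v x) (v x) ?b" for x
    using mollify_blowup[OF v(1) that, of 0 e] e0 elim by simp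
  have L1: "(\<lambda>k. LINT x:\<Omega>|lborel. T (mollify (e k) v x - c x) * divergence \<phi> x) \<longlonglongrightarrow>
      (LINT x:\<Omega>|lborel. T (v x - c x) * divergence \<phi> x)"
    unfolding set_lebesgue_integral_def
  proof (rule integral_dominated_convergence[where w="\<lambda>x. (\<bar>T 0\<bar> + l) * \<bar>indicator \<Omega> x *\<^sub>R divergence \<phi> x\<bar>"])
    have "set_integrable lborel \<Omega> (divergence \<phi>)"
      using K by (intro set_integrable_compact_support[where K=K] continuous_on_subset[OF divc]) auto
    then show "integrable lborel (\<lambda>x. (\<bar>T 0\<bar> + l) * \<bar>indicator \<Omega> x *\<^sub>R divergence \<phi> x\<bar>)"
      unfolding set_integrable_def by (intro integrable_mult_right integrable_abs)
    show "AE x in lborel. (\<lambda>k. indicator \<Omega> x *\<^sub>R (T (mollify (e k) v x - c x) * divergence \<phi> x)) \<longlonglongrightarrow>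
        indicator \<Omega> x *\<^sub>R (T (v x - c x) * divergence \<phi> x)"
      using AE_K
    proof eventually_elim
      case (elim x)
      show ?case
      proof (cases "x \<in> \<Omega>")
        case True
        have "(\<lambda>k. T (mollify (e k) v x - c x)) \<longlonglongrightarrow> T (v x - c x)"
          by (rule continuous_on_tendsto_compose[OF Tc]) (use elim True in \<open>auto intro!: tendsto_intros limvk\<close>)
        then show ?thesis by (intro tendsto_intros)
      qed simp
    qed
    have Tb: "\<bar>T s\<bar> \<le> \<bar>T 0\<bar> + l" for s using T(4)[of s 0] by linarith
    show "AE x in lborel. norm (indicator \<Omega> x *\<^sub>R (T (mollify (e k) v x - c x) * divergence \<phi> x))
        \<le> (\<bar>T 0\<bar> + l) * \<bar>indicator \<Omega> x *\<^sub>R divergence \<phi> x\<bar>" for k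
      by (intro AE_I2) (auto simp: abs_mult indicator_def intro!: mult_right_mono Tb)
    show "(\<lambda>x. indicator \<Omega> x *\<^sub>R (T (mollify (e k) v x - c x) * divergence \<phi> x)) \<in> borel_measurable lborel" for k
      using vkm[of k] by measurable
  qed measurable
  have L2: "(\<lambda>k. LINT x:\<Omega>|lborel. \<theta> (mollify (e k) v x - c x) * (\<phi> x \<bullet> C x)) \<longlonglongrightarrow>
      (LINT x:\<Omega>|lborel. \<theta> (v x - c x) * (\<phi> x \<bullet> C x))"
    unfolding set_lebesgue_integral_def
  proof (rule integral_dominated_convergence[where w="\<lambda>x. \<bar>indicator \<Omega> x *\<^sub>R (\<phi> x \<bullet> C x)\<bar>"])
    have i: "set_integrable lborel \<Omega> (\<lambda>x. \<phi> x \<bullet> C x)"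
      using K by (intro set_integrable_compact_support[where K=K] continuous_intros c(3) continuous_on_subset[OF \<phi>c(1)]) auto
    then have m: "(\<lambda>x. indicator \<Omega> x *\<^sub>R (\<phi> x \<bullet> C x)) \<in> borel_measurable borel"
      unfolding set_integrable_def by auto
    show "integrable lborel (\<lambda>x. \<bar>indicator \<Omega> x *\<^sub>R (\<phi> x \<bullet> C x)\<bar>)"
      using i unfolding set_integrable_def by (rule integrable_abs)
    show "AE x in lborel. (\<lambda>k. indicator \<Omega> x *\<^sub>R (\<theta> (mollify (e k) v x - c x) * (\<phi> x \<bullet> C x))) \<longlonglongrightarrow>
        indicator \<Omega> x *\<^sub>R (\<theta> (v x - c x) * (\<phi> x \<bullet> C x))"
      using AE_K
    proof eventually_elim
      case (elim x)
      show ?case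
      proof (cases "x \<in> \<Omega>")
        case True
        have "(\<lambda>k. \<theta> (mollify (e k) v x - c x)) \<longlonglongrightarrow> \<theta> (v x - c x)"
          by (rule continuous_on_tendsto_compose[OF T(2)]) (use elim True in \<open>auto intro!: tendsto_intros limvk\<close>)
        then show ?thesis by (intro tendsto_intros)
      qed simp
    qed
    show "AE x in lborel. norm (indicator \<Omega> x *\<^sub>R (\<theta> (mollify (e k) v x - c x) * (\<phi> x \<bullet> C x)))
        \<le> \<bar>indicator \<Omega> x *\<^sub>R (\<phi> x \<bullet> C x)\<bar>" for k
      by (intro AE_I2) (use T(3) in \<open>auto simp: abs_mult indicator_def intro!: mult_left_le_one_le\<close>)
    have eq: "(\<lambda>x. indicator \<Omega> x *\<^sub>R (w x * (\<phi> x \<bullet> C x))) = (\<lambda>x. w x * (indicator \<Omega> x *\<^sub>R (\<phi> x \<bullet> C x)))" for w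
      by (auto simp: fun_eq_iff)
    show "(\<lambda>x. indicator \<Omega> x *\<^sub>R (\<theta> (mollify (e k) v x - c x) * (\<phi> x \<bullet> C x))) \<in> borel_measurable lborel" for k
      unfolding eq using vkm[of k] m by measurable
    show "(\<lambda>x. indicator \<Omega> x *\<^sub>R (\<theta> (v x - c x) * (\<phi> x \<bullet> C x))) \<in> borel_measurable lborel"
      unfolding eq using m by measurable
  qed
  have blow: "(\<lambda>k. A k y) \<longlonglongrightarrow> (\<integral>\<eta>. moll 1 \<eta> * \<theta> (m - c y + (p - m) * halfspace_mass \<nu> (\<eta> \<bullet> \<nu>)) \<partial>lborel) *\<^sub>R \<phi> y"
    if "has_jump_profile v y p m \<nu>" "y \<in> \<Omega>" for y p m \<nu>
    unfolding A_def \<Phi>_def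
    by (rule mollified_field_blowup[OF v(1) that(1) e0 elim c(1) cont_c[OF that(2)] T(2,3) \<phi>c(1) \<phi>(2)])
  have L3: "(\<lambda>k. \<integral>y. A k y \<bullet> g y \<partial>lborel) \<longlonglongrightarrow> (\<integral>x. \<theta> (v x - c x) * (\<phi> x \<bullet> g x) \<partial>lborel)"
  proof (rule integral_dominated_convergence[where w="\<lambda>x. B * norm (g x)"])
    show "AE y in lborel. (\<lambda>k. A k y \<bullet> g y) \<longlonglongrightarrow> \<theta> (v y - c y) * (\<phi> y \<bullet> g y)"
      using AE_K
    proof eventually_elim
      case (elim y)
      show ?case
      proof (cases "y \<in> \<Omega>")
        case True
        then have "(\<lambda>k. A k y) \<longlonglongrightarrow> (\<integral>\<eta>. moll 1 (\<eta>::'a) * \<theta> (v y - c y) \<partial>lborel) *\<^sub>R \<phi> y"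
          using blow[of y "v y" "v y" ?b] elim by simp
        then have "(\<lambda>k. A k y) \<longlonglongrightarrow> \<theta> (v y - c y) *\<^sub>R \<phi> y" by (simp add: integral_moll)
        then have "(\<lambda>k. A k y \<bullet> g y) \<longlonglongrightarrow> (\<theta> (v y - c y) *\<^sub>R \<phi> y) \<bullet> g y" by (intro tendsto_intros)
        then show ?thesis by simp
      qed (simp add: g(2))
    qed
    show "integrable lborel (\<lambda>x. B * norm (g x))" using g(1) by (intro integrable_mult_right integrable_norm)
    show "AE y in lborel. norm (A k y \<bullet> g y) \<le> B * norm (g y)" for k
      by (intro AE_I2 Ainner)
    show "(\<lambda>y. A k y \<bullet> g y) \<in> borel_measurable lborel" for k using Am[of k] by measurable
  qed measurable

  \<comment> \<open>Limit of the jump term\<close>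
  define f where "f y = lim (\<lambda>k. A k y \<bullet> J y)" for y
  have [measurable_cong]: "sets H = sets borel" by fact
  have spH: "space H = UNIV" using sets_eq_imp_space_eq[OF H] by simp
  have Jm [measurable]: "J \<in> borel_measurable H" using J by auto
  have AJm: "(\<lambda>y. A k y \<bullet> J y) \<in> borel_measurable H" for k using Am[of k] by measurable
  have ae: "AE y in H. (\<lambda>k. A k y \<bullet> J y) \<longlonglongrightarrow> f y \<and> \<bar>f y\<bar> \<le> l * B * indicator {y. J y \<noteq> 0} y"
    using jump
  proof eventually_elim
    case (elim y)
    show ?case
    proof (cases "J y = 0")
      case True
      then have "f y = 0" by (simp add: f_def lim_const)
      with True show ?thesis by simp
    next
      case False
      then obtain p m \<nu> where y: "y \<in> \<Omega>" "has_jump_profile v y p m \<nu>" "J y = (p - m) *\<^sub>R \<nu>" using elim by blast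
      \<comment> \<open>\<open>integral_halfspace_mass\<close> turns \<open>(p - m) * I\<close> into
        the increment of \<open>T\<close> across the jump, a quantity bounded by \<open>l\<close>
        however large the jump is.\<close>
      define I where "I = (\<integral>\<eta>. moll 1 \<eta> * \<theta> (m - c y + (p - m) * halfspace_mass \<nu> (\<eta> \<bullet> \<nu>)) \<partial>lborel)"
      have \<nu>: "norm \<nu> = 1" using y(2) by (simp add: has_jump_profile_def)
      have I: "(p - m) * I = T (m - c y + (p - m)) - T (m - c y)"
        unfolding I_def by (rule integral_halfspace_mass[OF \<nu> T(1,2)])
      have "(\<lambda>k. A k y \<bullet> J y) \<longlonglongrightarrow> (I *\<^sub>R \<phi> y) \<bullet> J y"
        unfolding I_def by (intro tendsto_intros blow y)
      moreover have "(I *\<^sub>R \<phi> y) \<bullet> J y = ((p - m) * I) * (\<phi> y \<bullet> \<nu>)" by (simp add: y(3))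
      ultimately have lim: "(\<lambda>k. A k y \<bullet> J y) \<longlonglongrightarrow> (T (m - c y + (p - m)) - T (m - c y)) * (\<phi> y \<bullet> \<nu>)"
        by (simp add: I)
      then have f: "f y = (T (m - c y + (p - m)) - T (m - c y)) * (\<phi> y \<bullet> \<nu>)" unfolding f_def by (rule limI)
      have "\<bar>\<phi> y \<bullet> \<nu>\<bar> \<le> B" using Cauchy_Schwarz_ineq2[of "\<phi> y" \<nu>] \<phi>(2)[of y] \<nu> by simp
      then have "\<bar>f y\<bar> \<le> l * B" unfolding f abs_mult using T(4) l0 by (intro mult_mono) auto
      with lim f False show ?thesis by simp
    qed
  qed
  \<comment> \<open>Measurability comes from \<open>f\<close> being a limit of measurable functions:
    \<open>p\<close>, \<open>m\<close> and \<open>\<nu>\<close> are only known to exist at each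
    point, without a measurable choice.\<close>
  have fm: "f \<in> borel_measurable H" unfolding f_def[abs_def] by (rule borel_measurable_lim_metric) (rule AJm)
  have L4: "(\<lambda>k. \<integral>y. A k y \<bullet> J y \<partial>H) \<longlonglongrightarrow> (\<integral>y. f y \<partial>H)"
  proof (rule integral_dominated_convergence[where w="\<lambda>y. B * norm (J y)"])
    show "AE y in H. (\<lambda>k. A k y \<bullet> J y) \<longlonglongrightarrow> f y" using ae by eventually_elim simp
    show "integrable H (\<lambda>x. B * norm (J x))" using J by (intro integrable_mult_right integrable_norm)
    show "AE y in H. norm (A k y \<bullet> J y) \<le> B * norm (J y)" for k
      by (intro AE_I2 Ainner)
  qed (use fm AJm in auto)
  have Jset: "{y. J y \<noteq> 0} \<in> sets H" using measurable_sets[OF Jm, of "- {0}"] by (simp add: spH vimage_def Compl_eq)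
  have fbound: "\<bar>\<integral>y. f y \<partial>H\<bar> \<le> l * B * measure H {y. J y \<noteq> 0}"
  proof -
    have iw: "integrable H (\<lambda>y. l * B * indicator {y. J y \<noteq> 0} y)"
      using Jset fin by (intro integrable_mult_right integrable_real_indicator) (auto simp: less_top)
    have if': "integrable H f"
      by (rule Bochner_Integration.integrable_bound[OF iw fm]) (use ae in \<open>eventually_elim, auto\<close>)
    have "\<bar>\<integral>y. f y \<partial>H\<bar> \<le> (\<integral>y. \<bar>f y\<bar> \<partial>H)" using integral_norm_bound[of H f] by simp
    also have "\<dots> \<le> (\<integral>y. l * B * indicator {y. J y \<noteq> 0} y \<partial>H)"
      by (rule integral_mono_AE) (use if' iw ae in auto)
    also have "\<dots> = l * B * measure H {y. J y \<noteq> 0}" using Jset by (simp add: spH)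
    finally show ?thesis .
  qed
  have "(\<lambda>k. LINT x:\<Omega>|lborel. T (mollify (e k) v x - c x) * divergence \<phi> x) \<longlonglongrightarrow>
     - (\<integral>x. \<theta> (v x - c x) * (\<phi> x \<bullet> g x) \<partial>lborel) - (\<integral>y. f y \<partial>H) + (LINT x:\<Omega>|lborel. \<theta> (v x - c x) * (\<phi> x \<bullet> C x))"
    unfolding key by (intro tendsto_intros L2 L3 L4)
  with L1 have "(LINT x:\<Omega>|lborel. T (v x - c x) * divergence \<phi> x) =
     - (\<integral>x. \<theta> (v x - c x) * (\<phi> x \<bullet> g x) \<partial>lborel) - (\<integral>y. f y \<partial>H) + (LINT x:\<Omega>|lborel. \<theta> (v x - c x) * (\<phi> x \<bullet> C x))"
    by (rule LIMSEQ_unique)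
  then show ?thesis using fbound by linarith
qed

subsection \<open>Boundary layers of Lipschitz domains\<close>

definition perp :: "'a::euclidean_space \<Rightarrow> 'a \<Rightarrow> 'a" where
  "perp e y = y - (y \<bullet> e) *\<^sub>R e"

lemma perp_diff: "perp e (x - y) = perp e x - perp e y"
  by (simp add: perp_def inner_diff_left algebra_simps)

lemma perp_inner: "norm e = 1 \<Longrightarrow> perp e y \<bullet> e = 0"
  by (simp add: perp_def inner_diff_left dot_square_norm)

lemma norm_perp_le: "norm e = 1 \<Longrightarrow> norm (perp e y) \<le> norm (y::'a::euclidean_space)"
proof -
  assume e: "norm e = 1"
  have "(norm y)\<^sup>2 = (norm (perp e y))\<^sup>2 + (y \<bullet> e)\<^sup>2"
  proof -
    have ee: "e \<bullet> e = 1" using e by (simp add: dot_square_norm)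
    show ?thesis unfolding power2_norm_eq_inner perp_def
      by (simp add: inner_diff_left inner_diff_right ee inner_commute[of e y] power2_eq_square)
  qed
  then have "(norm (perp e y))\<^sup>2 \<le> (norm y)\<^sup>2" by simp
  then show ?thesis by (rule power2_le_imp_le) simp
qed

lemma norm_le_perp: "norm e = 1 \<Longrightarrow> norm y \<le> norm (perp e y) + \<bar>y \<bullet> e\<bar>"
  using norm_triangle_ineq[of "perp e y" "(y \<bullet> e) *\<^sub>R e"] by (simp add: perp_def)

lemma continuous_perp [continuous_intros]: "continuous_on S f \<Longrightarrow> continuous_on S (\<lambda>x. perp e (f x))"
  unfolding perp_def by (intro continuous_intros)

lemma perp_along: "norm e = 1 \<Longrightarrow> a \<bullet> e = 0 \<Longrightarrow> perp e (a + t *\<^sub>R e) = a"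
  by (simp add: perp_def inner_add_left dot_square_norm)

text \<open>Height one along \<open>e\<close>, so that the Lebesgue measure of the cylinder stands
  for the codimension-one measure of its base.\<close>

definition cylinder :: "'a::euclidean_space \<Rightarrow> 'a \<Rightarrow> real \<Rightarrow> 'a set" where
  "cylinder e a d = {q. norm (perp e q - a) \<le> d \<and> 0 \<le> q \<bullet> e \<and> q \<bullet> e \<le> 1}"

lemma closed_cylinder: "closed (cylinder e a d)"
  unfolding cylinder_def by (intro closed_Collect_conj closed_Collect_le continuous_intros)

lemma emeasure_ball_scale:
  "r \<ge> 0 \<Longrightarrow> emeasure lborel (ball (c::'a::euclidean_space) r) = ennreal (r ^ DIM('a) * measure lborel (ball (0::'a) 1))"
  using content_ball_conv_unit_ball[of r c] emeasure_lborel_ball_finite[of c r]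
  by (subst emeasure_eq_ennreal_measure) auto

text \<open>About \<open>1 / d\<close> balls of radius \<open>3 * d\<close> along the axis cover the
  cylinder, and in dimension \<open>n\<close> this gives
  \<open>(1 / d) * d ^ n = d ^ (n - 1)\<close> up to a constant.\<close>

lemma emeasure_cylinder_le:
  fixes e a :: "'a::euclidean_space"
  assumes e: "norm e = 1" and d: "0 \<le> d" "d \<le> 1"
  shows "emeasure lborel (cylinder e a d) \<le> ennreal (3 ^ (DIM('a) + 1) * measure lborel (ball (0::'a) 1) * d ^ (DIM('a) - 1))"
proof -
  define V where "V = measure lborel (ball (0::'a) 1)"
  have V: "V \<ge> 0" by (simp add: V_def)
  have pos: "emeasure lborel (cylinder e a d) \<le> ennreal (3 ^ (DIM('a) + 1) * V * d ^ (DIM('a) - 1))"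
    if d: "0 < d" "d \<le> 1" for d
  proof -
    define N where "N = nat \<lfloor>1 / d\<rfloor>"
    have N: "real N \<le> 1 / d" using d by (simp add: N_def)
    have "cylinder e a d \<subseteq> (\<Union>k\<in>{..N}. ball (a + (real k * d) *\<^sub>R e) (3 * d))"
    proof
      fix q assume q: "q \<in> cylinder e a d"
      define k where "k = nat \<lfloor>(q \<bullet> e) / d\<rfloor>"
      have q0: "0 \<le> (q \<bullet> e) / d" "(q \<bullet> e) / d \<le> 1 / d" using q d by (auto simp: cylinder_def divide_right_mono)
      have kN: "k \<le> N" unfolding k_def N_def by (intro nat_mono floor_mono q0)
      have "real k \<le> (q \<bullet> e) / d" "(q \<bullet> e) / d < real k + 1" using q0 by (auto simp: k_def)
      then have k: "0 \<le> q \<bullet> e - real k * d" "q \<bullet> e - real k * d < d" using d by (auto simp: field_simps)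
      have eq: "q - (a + (real k * d) *\<^sub>R e) = (perp e q - a) + (q \<bullet> e - real k * d) *\<^sub>R e"
        by (simp add: perp_def algebra_simps)
      have "norm (q - (a + (real k * d) *\<^sub>R e)) \<le> norm (perp e q - a) + \<bar>q \<bullet> e - real k * d\<bar>"
        unfolding eq using norm_triangle_ineq[of "perp e q - a" "(q \<bullet> e - real k * d) *\<^sub>R e"] e by simp
      also have "\<dots> < 3 * d" using k q d by (auto simp: cylinder_def)
      finally show "q \<in> (\<Union>k\<in>{..N}. ball (a + (real k * d) *\<^sub>R e) (3 * d))"
        using kN by (auto simp: dist_norm norm_minus_commute)
    qed
    then have "emeasure lborel (cylinder e a d) \<le> emeasure lborel (\<Union>k\<in>{..N}. ball (a + (real k * d) *\<^sub>R e) (3 * d))"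
      by (intro emeasure_mono) auto
    also have "\<dots> \<le> (\<Sum>k\<in>{..N}. emeasure lborel (ball (a + (real k * d) *\<^sub>R e) (3 * d)))"
      by (intro emeasure_subadditive_finite) auto
    also have "\<dots> = (\<Sum>k\<in>{..N}. ennreal ((3 * d) ^ DIM('a) * V))"
      using d by (simp add: emeasure_ball_scale V_def)
    also have "\<dots> = ennreal (real (N + 1) * ((3 * d) ^ DIM('a) * V))"
      using d V by (simp add: ennreal_mult ennreal_of_nat_eq_real_of_nat)
    also have "\<dots> \<le> ennreal ((3 / d) * ((3 * d) ^ DIM('a) * V))"
    proof (intro ennreal_leI mult_right_mono)
      have "1 \<le> 1 / d" using d by simp
      then show "real (N + 1) \<le> 3 / d" using N by (simp add: field_simps)
    qed (use d V in auto)
    also have "(3 / d) * ((3 * d) ^ DIM('a) * V) = 3 ^ (DIM('a) + 1) * V * d ^ (DIM('a) - 1)"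
      using d DIM_positive[where 'a='a] by (cases "DIM('a)") (auto simp: power_mult_distrib field_simps)
    finally show ?thesis .
  qed
  show ?thesis
  \<comment> \<open>Covering sets may be single points, of diameter zero. This case is a limit of
    positive radii; in dimension one the exponent is zero and \<open>0 ^ 0 = 1\<close>.\<close>
  proof (cases "d = 0")
    case False
    then show ?thesis using pos[of d] d by (simp add: V_def)
  next
    case True
    have le: "emeasure lborel (cylinder e a 0) \<le> ennreal (3 ^ (DIM('a) + 1) * V * (inverse (real (Suc n))) ^ (DIM('a) - 1))" for n
    proof -
      have "emeasure lborel (cylinder e a 0) \<le> emeasure lborel (cylinder e a (inverse (real (Suc n))))"
      proof (rule emeasure_mono)
        have "x \<le> 0 \<Longrightarrow> x \<le> inverse (real (Suc n))" for x by (rule order_trans) auto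
        then show "cylinder e a 0 \<subseteq> cylinder e a (inverse (real (Suc n)))" unfolding cylinder_def by blast
      qed (simp add: closed_cylinder borel_closed)
      also have "\<dots> \<le> ennreal (3 ^ (DIM('a) + 1) * V * (inverse (real (Suc n))) ^ (DIM('a) - 1))"
        by (rule pos) (auto simp: field_simps)
      finally show ?thesis .
    qed
    have "(\<lambda>n. ennreal (3 ^ (DIM('a) + 1) * V * (inverse (real (Suc n))) ^ (DIM('a) - 1)))
        \<longlonglongrightarrow> ennreal (3 ^ (DIM('a) + 1) * V * 0 ^ (DIM('a) - 1))"
      by (intro tendsto_ennrealI tendsto_intros LIMSEQ_inverse_real_of_nat)
    then show ?thesis
      unfolding True V_def[symmetric] by (rule LIMSEQ_le_const) (use le in auto)
  qed
qed

text \<open>Packing instead of covering: about \<open>1 / (2 * d)\<close> disjoint balls of radius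
  \<open>d\<close> on the axis. The bound \<open>d \<le> 1/4\<close> ensures that rounding down
  loses at most half of them.\<close>

lemma emeasure_cylinder_ge:
  fixes e a :: "'a::euclidean_space"
  assumes e: "norm e = 1" and a: "a \<bullet> e = 0" and d: "0 < d" "d \<le> 1/4"
  shows "ennreal (measure lborel (ball (0::'a) 1) / 4 * d ^ (DIM('a) - 1))
     \<le> emeasure lborel {q. norm (perp e q - a) < d \<and> 0 \<le> q \<bullet> e \<and> q \<bullet> e \<le> 1}"
proof -
  define V where "V = measure lborel (ball (0::'a) 1)"
  have V: "V \<ge> 0" by (simp add: V_def)
  define N where "N = nat \<lfloor>1 / (2 * d)\<rfloor>"
  have N: "real N \<le> 1 / (2 * d)" "1 / (2 * d) < real N + 1" using d by (auto simp: N_def)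
  define b where "b k = ball (a + ((2 * real k + 1) * d) *\<^sub>R e) d" for k :: nat
  have inb: "norm (perp e q - a) < d" "\<bar>q \<bullet> e - (2 * real k + 1) * d\<bar> < d" if "q \<in> b k" for q k
  proof -
    let ?x = "q - (a + ((2 * real k + 1) * d) *\<^sub>R e)"
    have x: "norm ?x < d" using that by (simp add: b_def dist_norm norm_minus_commute)
    have "perp e ?x = perp e q - a" using perp_along[OF e a] by (simp add: perp_diff)
    then show "norm (perp e q - a) < d" using norm_perp_le[OF e, of ?x] x by simp
    have "?x \<bullet> e = q \<bullet> e - (2 * real k + 1) * d" using a e by (simp add: inner_diff_left inner_add_left dot_square_norm)
    then show "\<bar>q \<bullet> e - (2 * real k + 1) * d\<bar> < d" using Cauchy_Schwarz_ineq2[of ?x e] x e by simp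
  qed
  have disj: "disjoint_family_on b {..<N}"
    unfolding disjoint_family_on_def
  proof (intro ballI impI)
    have lt: "b i \<inter> b j = {}" if "i < j" for i j :: nat
    proof (rule ccontr)
      assume "b i \<inter> b j \<noteq> {}"
      then obtain q where q: "q \<in> b i" "q \<in> b j" by auto
      have "real i + 1 \<le> real j" using that by simp
      then have "(2 * real i + 2) * d \<le> 2 * real j * d" using d by (intro mult_right_mono) auto
      then show False using inb(2)[OF q(1)] inb(2)[OF q(2)] by (simp add: algebra_simps abs_less_iff)
    qed
    fix i j :: nat assume "i \<noteq> j" then show "b i \<inter> b j = {}" using lt[of i j] lt[of j i] by (auto simp: neq_iff)
  qed
  have "ennreal (V / 4 * d ^ (DIM('a) - 1)) \<le> ennreal (real N * (d ^ DIM('a) * V))"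
  proof (rule ennreal_leI)
    have "1 / (4 * d) \<le> real N"
    proof -
      have "1 / (2 * d) = 1 / (4 * d) + 1 / (4 * d)" using d by (simp add: field_simps)
      moreover have "1 \<le> 1 / (4 * d)" using d by (simp add: field_simps)
      ultimately show ?thesis using N by linarith
    qed
    then have A: "1 / (4 * d) * (d ^ DIM('a) * V) \<le> real N * (d ^ DIM('a) * V)"
      using d V by (intro mult_right_mono) auto
    have B: "1 / (4 * d) * (d ^ DIM('a) * V) = V / 4 * d ^ (DIM('a) - 1)"
      using d DIM_positive[where 'a='a] by (cases "DIM('a)") (auto simp: field_simps)
    show "V / 4 * d ^ (DIM('a) - 1) \<le> real N * (d ^ DIM('a) * V)" using A unfolding B .
  qed
  also have "\<dots> = (\<Sum>k\<in>{..<N}. emeasure lborel (b k))"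
    using d V by (simp add: b_def emeasure_ball_scale V_def[symmetric] ennreal_mult ennreal_of_nat_eq_real_of_nat)
  also have "\<dots> = emeasure lborel (\<Union>k\<in>{..<N}. b k)"
    by (rule sum_emeasure[OF _ disj]) (auto simp: b_def)
  also have "\<dots> \<le> emeasure lborel {q. norm (perp e q - a) < d \<and> 0 \<le> q \<bullet> e \<and> q \<bullet> e \<le> 1}"
  proof (rule emeasure_mono)
    show "(\<Union>k\<in>{..<N}. b k) \<subseteq> {q. norm (perp e q - a) < d \<and> 0 \<le> q \<bullet> e \<and> q \<bullet> e \<le> 1}"
    proof
      fix q assume "q \<in> (\<Union>k\<in>{..<N}. b k)"
      then obtain k where k: "k < N" "q \<in> b k" by auto
      have "real k + 1 \<le> real N" using k by simp
      then have "(2 * real k + 2) * d \<le> 2 * real N * d" using d by (intro mult_right_mono) auto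
      also have "\<dots> \<le> 1" using N d by (simp add: field_simps)
      finally have "(2 * real k + 2) * d \<le> 1" .
      moreover have "0 \<le> 2 * real k * d" using d by simp
      moreover have "2 * real k * d < q \<bullet> e" "q \<bullet> e < (2 * real k + 2) * d"
        using inb(2)[OF k(2)] by (auto simp: algebra_simps abs_less_iff)
      ultimately have "0 \<le> q \<bullet> e" "q \<bullet> e \<le> 1" by linarith+
      then show "q \<in> {q. norm (perp e q - a) < d \<and> 0 \<le> q \<bullet> e \<and> q \<bullet> e \<le> 1}"
        using inb(1)[OF k(2)] by auto
    qed
    show "{q. norm (perp e q - a) < d \<and> 0 \<le> q \<bullet> e \<and> q \<bullet> e \<le> 1} \<in> sets lborel"
    proof -
      have "{q. norm (perp e q - a) < d \<and> 0 \<le> q \<bullet> e \<and> q \<bullet> e \<le> 1} =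
        {q. norm (perp e q - a) < d} \<inter> {q. 0 \<le> q \<bullet> e} \<inter> {q. q \<bullet> e \<le> 1}" by auto
      moreover have "open {q. norm (perp e q - a) < d}" by (intro open_Collect_less continuous_intros)
      moreover have "closed {q. 0 \<le> q \<bullet> e}" "closed {q. q \<bullet> e \<le> 1}" by (intro closed_Collect_le continuous_intros)+
      ultimately show ?thesis by (simp add: borel_open borel_closed)
    qed
  qed
  finally show ?thesis by (simp add: V_def)
qed

text \<open>Working with the cylinder over the projection of \<open>N\<close> avoids Lebesgue measure on hyperplanes.\<close>

lemma hausdorff_null_cylinder_null:
  fixes e :: "'a::euclidean_space"
  assumes e: "norm e = 1" and N: "hausdorff_outer (DIM('a) - 1) N = 0"
  shows "negligible {q. 0 \<le> q \<bullet> e \<and> q \<bullet> e \<le> 1 \<and> (\<exists>z\<in>N. perp e z = perp e q)}" (is "negligible ?S")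
proof -
  define n where "n = DIM('a) - 1"
  define c where "c = 3 ^ (DIM('a) + 1) * measure lborel (ball (0::'a) 1)"
  define u where "u = unit_ball_vol (real n)"
  have u: "u > 0" by (simp add: u_def)
  have c: "c \<ge> 0" by (simp add: c_def)
  \<comment> \<open>Converts the cylinder bound \<open>c * d ^ n\<close> into the Hausdorff weight
    \<open>u * (d / 2) ^ n\<close>.\<close>
  define R where "R = c * 2 ^ n / u"
  have R: "R \<ge> 0" using c u by (simp add: R_def)
  have "\<exists>T. ?S \<subseteq> T \<and> T \<in> lmeasurable \<and> measure lebesgue T \<le> \<epsilon>" if \<epsilon>: "\<epsilon> > 0" for \<epsilon>
  proof -
    have "hausdorff_pre n 1 N \<le> hausdorff_outer n N"
      unfolding hausdorff_outer_def by (rule SUP_upper) simp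
    then have "hausdorff_pre n 1 N < ennreal (\<epsilon> / (R + 1))" using N \<epsilon> R by (simp add: n_def)
    then obtain C where C: "N \<subseteq> (\<Union>i. C i)" "\<And>i. bounded (C i)" "\<And>i. diameter (C i) \<le> 1"
      "(\<Sum>i. hausdorff_weight n (C i)) < ennreal (\<epsilon> / (R + 1))"
      by (rule hausdorff_pre_close) (rule that)
    \<comment> \<open>The projection is 1-Lipschitz, so the shadow of \<open>C i\<close> lies in a
      disc around the shadow of any of its points, with the diameter of \<open>C i\<close> as
      radius.\<close>
    define z where "z i = (SOME x. x \<in> C i)" for i
    define Y where "Y i = (if C i = {} then {} else cylinder e (perp e (z i)) (diameter (C i)))" for i
    have Ym: "Y i \<in> sets borel" for i by (simp add: Y_def closed_cylinder borel_closed)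
    have sub: "?S \<subseteq> (\<Union>i. Y i)"
    proof
      fix q assume "q \<in> ?S"
      then obtain x where x: "x \<in> N" "perp e x = perp e q" "0 \<le> q \<bullet> e" "q \<bullet> e \<le> 1" by auto
      then obtain i where i: "x \<in> C i" using C(1) by auto
      then have zi: "z i \<in> C i" unfolding z_def by (rule someI)
      have "norm (perp e q - perp e (z i)) = norm (perp e (x - z i))" using x by (simp add: perp_diff)
      also have "\<dots> \<le> norm (x - z i)" by (rule norm_perp_le[OF e])
      also have "\<dots> \<le> diameter (C i)" using diameter_bounded_bound[OF C(2) i zi] by (simp add: dist_norm)
      finally have "q \<in> Y i" using x i by (auto simp: Y_def cylinder_def)
      then show "q \<in> (\<Union>i. Y i)" by blast
    qed
    have Yle: "emeasure lborel (Y i) \<le> ennreal R * hausdorff_weight n (C i)" for i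
    proof (cases "C i = {}")
      case False
      have "emeasure lborel (Y i) \<le> ennreal (c * diameter (C i) ^ n)"
        using False emeasure_cylinder_le[OF e diameter_ge_0[OF C(2)] C(3), of "perp e (z i)" i]
        by (simp add: Y_def c_def n_def)
      also have "c * diameter (C i) ^ n = R * (u * (diameter (C i) / 2) ^ n)"
        using u by (simp add: R_def power_divide)
      also have "ennreal \<dots> = ennreal R * ennreal (u * (diameter (C i) / 2) ^ n)"
        using R u diameter_ge_0[OF C(2), of i] by (intro ennreal_mult) auto
      finally show ?thesis using False by (simp add: hausdorff_weight_def u_def)
    qed (simp add: Y_def)
    have "emeasure lborel (\<Union>i. Y i) \<le> (\<Sum>i. emeasure lborel (Y i))"
      by (rule emeasure_subadditive_countably) (use Ym in auto)
    also have "\<dots> \<le> (\<Sum>i. ennreal R * hausdorff_weight n (C i))" by (intro suminf_le Yle) auto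
    also have "\<dots> = ennreal R * (\<Sum>i. hausdorff_weight n (C i))" by simp
    also have "\<dots> \<le> ennreal R * ennreal (\<epsilon> / (R + 1))" using C(4) by (intro mult_left_mono) auto
    also have "\<dots> \<le> ennreal \<epsilon>"
      using R \<epsilon> by (subst ennreal_mult[symmetric]) (auto intro!: ennreal_leI simp: field_simps)
    finally have le: "emeasure lborel (\<Union>i. Y i) \<le> ennreal \<epsilon>" .
    have Um: "(\<Union>i. Y i) \<in> sets borel" using Ym by auto
    have "(\<Union>i. Y i) \<in> lmeasurable" using le Um by (auto simp: fmeasurable_def less_top[symmetric] top_unique)
    moreover have "measure lebesgue (\<Union>i. Y i) \<le> \<epsilon>"
      using le Um \<epsilon> unfolding measure_def by (simp add: enn2real_leI)
    ultimately show ?thesis using sub by blast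
  qed
  then show ?thesis by (subst negligible_outer_le) auto
qed

locale lipschitz_chart =
  fixes \<Omega> :: "'a::euclidean_space set" and x :: 'a and r :: real and e :: 'a and \<gamma> :: "'a \<Rightarrow> real" and L :: real
  assumes \<Omega>: "open \<Omega>" and r: "r > 0" and e: "norm e = 1" and lip: "L-lipschitz_on {z. z \<bullet> e = 0} \<gamma>"
    and chart: "\<Omega> \<inter> ball x r = {y \<in> ball x r. \<gamma> (y - (y \<bullet> e) *\<^sub>R e) < y \<bullet> e}"
begin

text \<open>Projection along \<open>e\<close> onto the graph of \<open>\<gamma>\<close>. It depends
  on \<open>q\<close> only through \<open>perp e q\<close>, so letting \<open>q\<close> range over a
  cylinder parametrises the boundary with one harmless extra variable.\<close>

definition proj :: "'a \<Rightarrow> 'a" where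
  "proj q = perp e q + \<gamma> (perp e q) *\<^sub>R e"

lemma L_nonneg: "0 \<le> L" using lip by (rule lipschitz_on_nonneg)

lemma \<gamma>_lip: "\<bar>\<gamma> (perp e p) - \<gamma> (perp e q)\<bar> \<le> L * norm (perp e p - perp e q)"
  using lipschitz_onD[OF lip, of "perp e p" "perp e q"] perp_inner[OF e] by (simp add: dist_norm)

lemma mem_\<Omega>: "y \<in> ball x r \<Longrightarrow> y \<in> \<Omega> \<longleftrightarrow> \<gamma> (perp e y) < y \<bullet> e"
  using chart unfolding perp_def by blast

lemma continuous_\<gamma>: "continuous_on S (\<lambda>q. \<gamma> (perp e q))"
  by (rule continuous_on_compose2[OF lipschitz_on_continuous_on[OF lip]])
     (auto intro!: continuous_intros simp: perp_inner[OF e])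

lemma continuous_proj: "continuous_on S proj"
  unfolding proj_def by (intro continuous_intros continuous_\<gamma>)

lemma perp_proj: "perp e (proj q) = perp e q"
  unfolding proj_def by (rule perp_along[OF e perp_inner[OF e]])

lemma proj_inner: "proj q \<bullet> e = \<gamma> (perp e q)"
  using perp_inner[OF e, of q] e by (simp add: proj_def inner_add_left dot_square_norm)

lemma proj_dist: "norm (proj p - proj q) \<le> (1 + L) * norm (perp e p - perp e q)"
proof -
  have "norm (proj p - proj q) \<le> norm (perp e (proj p - proj q)) + \<bar>(proj p - proj q) \<bullet> e\<bar>"
    by (rule norm_le_perp[OF e])
  also have "\<dots> = norm (perp e p - perp e q) + \<bar>\<gamma> (perp e p) - \<gamma> (perp e q)\<bar>"
    by (simp add: perp_diff perp_proj inner_diff_left proj_inner)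
  also have "\<dots> \<le> (1 + L) * norm (perp e p - perp e q)" using \<gamma>_lip[of p q] by (simp add: algebra_simps)
  finally show ?thesis .
qed

lemma proj_in_frontier: "proj q \<in> ball x r \<Longrightarrow> proj q \<in> frontier \<Omega>"
proof -
  assume b: "proj q \<in> ball x r"
  have notin: "proj q \<notin> \<Omega>" using mem_\<Omega>[OF b] by (simp add: perp_proj proj_inner)
  have "proj q \<in> closure \<Omega>"
    unfolding closure_approachable
  proof (intro allI impI)
    fix \<epsilon> :: real assume \<epsilon>: "\<epsilon> > 0"
    define t where "t = min \<epsilon> (r - dist x (proj q)) / 2"
    have t: "t > 0" "t < \<epsilon>" "t < r - dist x (proj q)" using \<epsilon> b by (auto simp: t_def)
    let ?y = "proj q + t *\<^sub>R e"
    have d: "dist ?y (proj q) = t" using t e by (simp add: dist_norm)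
    have "dist x ?y \<le> dist x (proj q) + t" using dist_triangle[of x ?y "proj q"] d by (simp add: dist_commute)
    then have yb: "?y \<in> ball x r" using t by simp
    have "perp e ?y = perp e q"
      using perp_along[OF e perp_inner[OF e, of q], of "\<gamma> (perp e q) + t"] by (simp add: proj_def scaleR_add_left add.assoc)
    moreover have "?y \<bullet> e = \<gamma> (perp e q) + t" using e by (simp add: inner_add_left proj_inner dot_square_norm)
    ultimately have "?y \<in> \<Omega>" using mem_\<Omega>[OF yb] t by simp
    then show "\<exists>y\<in>\<Omega>. dist y (proj q) < \<epsilon>" using d t by (intro bexI[of _ ?y]) auto
  qed
  then show ?thesis using notin \<Omega> by (simp add: frontier_def interior_open)
qed

text \<open>Points of the chart ball strictly above the graph belong to the open set \<Omega>, and
  those strictly below have a neighbourhood that misses \<Omega>.\<close>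

lemma frontier_graph: "z \<in> frontier \<Omega> \<Longrightarrow> z \<in> ball x r \<Longrightarrow> z \<bullet> e = \<gamma> (perp e z)"
proof -
  assume z: "z \<in> frontier \<Omega>" "z \<in> ball x r"
  then have "z \<notin> \<Omega>" "z \<in> closure \<Omega>" using \<Omega> by (auto simp: frontier_def interior_open)
  then have ge: "z \<bullet> e \<le> \<gamma> (perp e z)" using mem_\<Omega>[OF z(2)] by simp
  moreover have "\<not> z \<bullet> e < \<gamma> (perp e z)"
  proof
    assume lt: "z \<bullet> e < \<gamma> (perp e z)"
    define U where "U = {y. y \<bullet> e < \<gamma> (perp e y)} \<inter> ball x r"
    have "open U" unfolding U_def by (intro open_Int open_Collect_less continuous_\<gamma> continuous_intros) auto
    moreover have "z \<in> U" using lt z by (simp add: U_def)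
    ultimately have "U \<inter> \<Omega> \<noteq> {}" using \<open>z \<in> closure \<Omega>\<close> by (auto simp: closure_iff_nhds_not_empty)
    then show False using mem_\<Omega> by (force simp: U_def)
  qed
  ultimately show ?thesis by simp
qed

text \<open>A point within \<open>\<epsilon>\<close> of the boundary is within
  \<open>(1 + L) * \<epsilon>\<close> of its own projection, and moving the base point by
  \<open>\<epsilon>\<close> moves the projection by at most as much again. The margins
  \<open>r / 2\<close> and \<open>r / (4 * (1 + L))\<close> keep all points inside the ball where
  the graph describes the boundary.\<close>

lemma near_frontier:
  assumes y: "y \<in> ball x (r / 2)" and z: "z \<in> frontier \<Omega>" "dist y z < \<epsilon>" and \<epsilon>: "\<epsilon> < r / (4 * (1 + L))"
    and q: "norm (perp e q - perp e y) < \<epsilon>"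
  shows "proj q \<in> ball x r" "dist (proj q) y < 2 * (1 + L) * \<epsilon>"
proof -
  have L1: "1 + L \<ge> 1" using L_nonneg by simp
  have \<epsilon>0: "\<epsilon> > 0" using z(2) zero_le_dist[of y z] by linarith
  have \<epsilon>4: "(1 + L) * \<epsilon> < r / 4" using \<epsilon> L1 by (simp add: field_simps)
  have \<epsilon>r: "\<epsilon> < r / 4"
  proof -
    have "1 * \<epsilon> \<le> (1 + L) * \<epsilon>" using L1 \<epsilon>0 by (intro mult_right_mono) auto
    then show ?thesis using \<epsilon>4 by simp
  qed
  have "dist x z \<le> dist x y + dist y z" by (rule dist_triangle)
  then have "z \<in> ball x r" using y z(2) \<epsilon>r r unfolding mem_ball by linarith
  then have ze: "z \<bullet> e = \<gamma> (perp e z)" by (rule frontier_graph[OF z(1)])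
  have yz: "norm (perp e y - perp e z) \<le> dist y z" "\<bar>y \<bullet> e - z \<bullet> e\<bar> \<le> dist y z"
    using norm_perp_le[OF e, of "y - z"] Cauchy_Schwarz_ineq2[of "y - z" e] e
    by (simp_all add: perp_diff dist_norm inner_diff_left)
  have "norm (proj y - y) \<le> norm (perp e (proj y - y)) + \<bar>(proj y - y) \<bullet> e\<bar>" by (rule norm_le_perp[OF e])
  also have "\<dots> = \<bar>\<gamma> (perp e y) - y \<bullet> e\<bar>" by (simp add: perp_diff perp_proj inner_diff_left proj_inner)
  also have "\<dots> \<le> L * norm (perp e y - perp e z) + \<bar>y \<bullet> e - z \<bullet> e\<bar>" using \<gamma>_lip[of y z] ze by linarith
  also have "\<dots> \<le> L * dist y z + dist y z" using yz L_nonneg by (intro add_mono mult_left_mono) auto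
  also have "\<dots> = (1 + L) * dist y z" by (simp add: algebra_simps)
  also have "\<dots> < (1 + L) * \<epsilon>" using z(2) L1 by (intro mult_strict_left_mono) auto
  finally have 1: "norm (proj y - y) < (1 + L) * \<epsilon>" .
  have "norm (proj q - proj y) \<le> (1 + L) * norm (perp e q - perp e y)" by (rule proj_dist)
  also have "\<dots> \<le> (1 + L) * \<epsilon>" using q L1 by (intro mult_left_mono) auto
  finally have 2: "norm (proj q - proj y) \<le> (1 + L) * \<epsilon>" .
  have "dist (proj q) y \<le> norm (proj q - proj y) + norm (proj y - y)"
    unfolding dist_norm using norm_triangle_ineq[of "proj q - proj y" "proj y - y"] by simp
  moreover have "2 * (1 + L) * \<epsilon> = (1 + L) * \<epsilon> + (1 + L) * \<epsilon>" by (simp add: algebra_simps)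
  ultimately show 3: "dist (proj q) y < 2 * (1 + L) * \<epsilon>" using 1 2 by linarith
  have "dist x (proj q) \<le> dist x y + dist (proj q) y" using dist_triangle[of x "proj q" y] by (simp add: dist_commute)
  then show "proj q \<in> ball x r" using 3 \<epsilon>4 y unfolding mem_ball by (simp add: algebra_simps)
qed

text \<open>A double count takes the place of a change of variables. With \<open>n\<close> the
  dimension, each \<open>y\<close> of the layer lies in \<open>ball (proj q) (\<rho> k)\<close> for
  a set of \<open>q\<close> of measure at least a constant times
  \<open>\<epsilon> k ^ (n - 1)\<close>. By Fubini the layer integral divided by
  \<open>\<epsilon> k\<close> is at most a constant times the integral over \<open>Q\<close> of the
  normalised ball integrals. These are bounded and tend to zero for almost every \<open>q\<close>,
  since the base points below \<open>N\<close> form a null set.\<close>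

lemma boundary_layer_in_chart:
  fixes W :: "'a \<Rightarrow> ennreal"
  assumes W: "W \<in> borel_measurable borel" "\<And>y. W y \<le> ennreal M" and M: "M \<ge> 0"
    and N: "hausdorff_outer (DIM('a) - 1) N = 0"
    and lim: "\<And>z. z \<in> frontier \<Omega> - N \<Longrightarrow>
      ((\<lambda>\<rho>. (\<integral>\<^sup>+ y \<in> ball z \<rho>. W y \<partial>lborel) / ennreal (\<rho> ^ DIM('a))) \<longlongrightarrow> 0) (at_right 0)"
    and \<epsilon>: "\<And>k. \<epsilon> k > 0" "\<epsilon> \<longlonglongrightarrow> 0" and ne: "frontier \<Omega> \<noteq> {}"
  shows "(\<lambda>k. (\<integral>\<^sup>+ y \<in> ball x (r/2) \<inter> {y. infdist y (frontier \<Omega>) < \<epsilon> k}. W y \<partial>lborel) / ennreal (\<epsilon> k)) \<longlonglongrightarrow> 0"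
proof -
  note [measurable] = W(1)
  have pm [measurable]: "proj \<in> borel_measurable borel" by (rule borel_measurable_continuous_onI[OF continuous_proj])
  define V where "V = measure lborel (ball (0::'a) 1)"
  have V: "V > 0" unfolding V_def using content_ball_pos[of 1 "0::'a"] by simp
  \<comment> \<open>The factor by which \<open>near_frontier\<close> enlarges the radius.\<close>
  define C where "C = 2 * (1 + L)"
  have C: "C > 0" using L_nonneg by (simp add: C_def)
  define Q where "Q = {q. 0 \<le> q \<bullet> e} \<inter> {q. q \<bullet> e \<le> 1} \<inter> proj -` ball x r"
  have "closed {q. 0 \<le> q \<bullet> e}" "closed {q. q \<bullet> e \<le> 1}" by (intro closed_Collect_le continuous_intros)+
  moreover have "open (proj -` ball x r)" by (rule open_vimage[OF open_ball continuous_proj])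
  ultimately have Qm [measurable]: "Q \<in> sets borel" unfolding Q_def by (simp add: borel_open borel_closed)
  have "bounded Q"
    unfolding bounded_iff
  proof (intro exI ballI)
    fix q assume q: "q \<in> Q"
    have "norm (proj q) \<le> norm x + r"
      using q norm_triangle_ineq2[of "proj q" x] by (auto simp: Q_def dist_norm norm_minus_commute)
    moreover have "norm (perp e q) \<le> norm (proj q)" using norm_perp_le[OF e, of "proj q"] by (simp add: perp_proj)
    moreover have "norm q \<le> norm (perp e q) + \<bar>q \<bullet> e\<bar>" by (rule norm_le_perp[OF e])
    moreover have "\<bar>q \<bullet> e\<bar> \<le> 1" using q by (auto simp: Q_def)
    ultimately show "norm q \<le> norm x + r + 1" by linarith
  qed
  then have Qfin: "emeasure lborel Q < \<infinity>" by (rule emeasure_bounded_finite)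
  define a where "a \<rho> q = (\<integral>\<^sup>+ y. W y * indicator (ball (proj q) \<rho>) y \<partial>lborel)" for \<rho> q
  have prodm: "(\<lambda>(q, y). W y * indicator (ball (proj q) \<rho>) y) \<in> borel_measurable (lborel \<Otimes>\<^sub>M lborel)" for \<rho>
  proof -
    have eq: "(\<lambda>(q, y). W y * indicator (ball (proj q) \<rho>) y) = (\<lambda>(q, y). W y * (if dist (proj q) y < \<rho> then 1 else 0))"
      by (auto simp: fun_eq_iff indicator_def)
    show ?thesis unfolding eq by measurable
  qed
  have am [measurable]: "a \<rho> \<in> borel_measurable borel" for \<rho>
    unfolding a_def using lborel.borel_measurable_nn_integral[OF prodm[of \<rho>]] by simp
  have a_le: "a \<rho> q \<le> ennreal (M * V * \<rho> ^ DIM('a))" if "\<rho> > 0" for \<rho> q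
  proof -
    have "a \<rho> q \<le> (\<integral>\<^sup>+ y. ennreal M * indicator (ball (proj q) \<rho>) y \<partial>lborel)"
      unfolding a_def by (intro nn_integral_mono mult_right_mono W(2)) simp
    also have "\<dots> = ennreal M * emeasure lborel (ball (proj q) \<rho>)" by (simp add: nn_integral_cmult_indicator)
    also have "\<dots> = ennreal (M * V * \<rho> ^ DIM('a))"
      using that M V by (simp add: emeasure_ball_scale V_def[symmetric] ennreal_mult[symmetric] mult_ac)
    finally show ?thesis .
  qed
  define \<rho> where "\<rho> k = C * \<epsilon> k" for k
  have \<rho>: "\<rho> k > 0" for k using C \<epsilon> by (simp add: \<rho>_def)
  have \<rho>lim: "filterlim \<rho> (at_right 0) sequentially"
  proof -
    have "\<rho> \<longlonglongrightarrow> C * 0" unfolding \<rho>_def by (intro tendsto_intros \<epsilon>)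
    moreover have "\<rho> k \<in> {0<..}" "\<rho> k \<noteq> 0" for k using \<rho>[of k] by auto
    ultimately show ?thesis by (simp add: filterlim_at)
  qed
  have DCT: "(\<lambda>k. \<integral>\<^sup>+ q. indicator Q q * (a (\<rho> k) q / ennreal (\<rho> k ^ DIM('a))) \<partial>lborel) \<longlonglongrightarrow> (\<integral>\<^sup>+ q. 0 \<partial>(lborel :: 'a measure))"
  proof (rule nn_integral_dominated_convergence[where w="\<lambda>q. ennreal (M * V) * indicator Q q"])
    show "(\<integral>\<^sup>+ q. ennreal (M * V) * indicator Q q \<partial>lborel) < \<infinity>"
      using Qfin by (simp add: nn_integral_cmult_indicator ennreal_mult_less_top)
    have "a (\<rho> k) q / ennreal (\<rho> k ^ DIM('a)) \<le> ennreal (M * V)" for k q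
    proof -
      have "a (\<rho> k) q / ennreal (\<rho> k ^ DIM('a)) \<le> ennreal (M * V * \<rho> k ^ DIM('a)) / ennreal (\<rho> k ^ DIM('a))"
        by (rule divide_right_mono_ennreal[OF a_le[OF \<rho>]])
      also have "\<dots> = ennreal (M * V)" using \<rho>[of k] M V by (subst divide_ennreal) auto
      finally show ?thesis .
    qed
    then show "AE q in lborel. indicator Q q * (a (\<rho> k) q / ennreal (\<rho> k ^ DIM('a))) \<le> ennreal (M * V) * indicator Q q" for k
      by (intro AE_I2) (auto simp: indicator_def)
    have "AE q in lebesgue. q \<notin> {q. 0 \<le> q \<bullet> e \<and> q \<bullet> e \<le> 1 \<and> (\<exists>z\<in>N. perp e z = perp e q)}"
      using hausdorff_null_cylinder_null[OF e N] by (intro AE_not_in) (simp add: negligible_iff_null_sets)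
    then have "AE q in lborel. q \<notin> {q. 0 \<le> q \<bullet> e \<and> q \<bullet> e \<le> 1 \<and> (\<exists>z\<in>N. perp e z = perp e q)}"
      by (simp add: AE_completion_iff)
    then show "AE q in lborel. (\<lambda>k. indicator Q q * (a (\<rho> k) q / ennreal (\<rho> k ^ DIM('a)))) \<longlonglongrightarrow> 0"
    proof eventually_elim
      case (elim q)
      show ?case
      proof (cases "q \<in> Q")
        case True
        have "proj q \<notin> N" using elim True perp_proj[of q] by (auto simp: Q_def)
        moreover have "proj q \<in> frontier \<Omega>" using True by (intro proj_in_frontier) (auto simp: Q_def)
        ultimately have "((\<lambda>\<rho>. a \<rho> q / ennreal (\<rho> ^ DIM('a))) \<longlongrightarrow> 0) (at_right 0)"
          using lim[of "proj q"] unfolding a_def by blast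
        from filterlim_compose[OF this \<rho>lim] show ?thesis using True by simp
      qed simp
    qed
  qed measurable
  define S where "S k = ball x (r/2) \<inter> {y. infdist y (frontier \<Omega>) < \<epsilon> k}" for k
  have Sm [measurable]: "S k \<in> sets borel" for k
  proof -
    have "open {y. infdist y (frontier \<Omega>) < \<epsilon> k}" by (intro open_Collect_less continuous_intros)
    then show ?thesis unfolding S_def by (simp add: borel_open)
  qed
  \<comment> \<open>The radius factor \<open>C ^ DIM('a)\<close> divided by the packing constant of
    \<open>emeasure_cylinder_ge\<close>.\<close>
  define K where "K = C ^ DIM('a) / (V / 4)"
  have K: "K \<ge> 0" using C V by (simp add: K_def)
  have main: "(\<integral>\<^sup>+ y \<in> S k. W y \<partial>lborel) / ennreal (\<epsilon> k) \<le>
      ennreal K * (\<integral>\<^sup>+ q. indicator Q q * (a (\<rho> k) q / ennreal (\<rho> k ^ DIM('a))) \<partial>lborel)"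
    if k: "\<epsilon> k < r / (4 * (1 + L))" "\<epsilon> k \<le> 1/4" for k
  proof -
    define I where "I = (\<integral>\<^sup>+ q. indicator Q q * (a (\<rho> k) q / ennreal (\<rho> k ^ DIM('a))) \<partial>lborel)"
    let ?c = "V / 4 * \<epsilon> k ^ (DIM('a) - 1)"
    have c: "?c > 0" using V \<epsilon>(1)[of k] by simp
    have low: "ennreal ?c * (W y * indicator (S k) y) \<le> (\<integral>\<^sup>+ q. indicator Q q * (W y * indicator (ball (proj q) (\<rho> k)) y) \<partial>lborel)" for y
    proof (cases "y \<in> S k")
      case True
      obtain z where z: "z \<in> frontier \<Omega>" "dist y z < \<epsilon> k"
      proof (rule infdist_attains_inf[OF frontier_closed ne, of y])
        fix z assume "z \<in> frontier \<Omega>" "infdist y (frontier \<Omega>) = dist y z"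
        with True show thesis by (intro that[of z]) (auto simp: S_def)
      qed
      define E where "E = {q. norm (perp e q - perp e y) < \<epsilon> k \<and> 0 \<le> q \<bullet> e \<and> q \<bullet> e \<le> 1}"
      have Em: "E \<in> sets borel"
      proof -
        have "E = {q. norm (perp e q - perp e y) < \<epsilon> k} \<inter> {q. 0 \<le> q \<bullet> e} \<inter> {q. q \<bullet> e \<le> 1}" by (auto simp: E_def)
        moreover have "open {q. norm (perp e q - perp e y) < \<epsilon> k}" by (intro open_Collect_less continuous_intros)
        moreover have "closed {q. 0 \<le> q \<bullet> e}" "closed {q. q \<bullet> e \<le> 1}" by (intro closed_Collect_le continuous_intros)+
        ultimately show ?thesis by (simp add: borel_open borel_closed)
      qed
      have "ennreal ?c \<le> emeasure lborel E"
        unfolding E_def V_def by (rule emeasure_cylinder_ge[OF e perp_inner[OF e]]) (use \<epsilon>(1) k in auto)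
      then have "ennreal ?c * W y \<le> emeasure lborel E * W y" by (rule mult_right_mono) simp
      also have "\<dots> = (\<integral>\<^sup>+ q. W y * indicator E q \<partial>lborel)" using Em by (simp add: nn_integral_cmult_indicator mult.commute)
      also have "\<dots> \<le> (\<integral>\<^sup>+ q. indicator Q q * (W y * indicator (ball (proj q) (\<rho> k)) y) \<partial>lborel)"
      proof (intro nn_integral_mono)
        fix q
        show "W y * indicator E q \<le> indicator Q q * (W y * indicator (ball (proj q) (\<rho> k)) y)"
        proof (cases "q \<in> E")
          case qE: True
          have yb: "y \<in> ball x (r/2)" using True by (simp add: S_def)
          have qe: "norm (perp e q - perp e y) < \<epsilon> k" using qE by (simp add: E_def)
          have "q \<in> Q" "y \<in> ball (proj q) (\<rho> k)"
            using near_frontier[OF yb z k(1) qe] qE by (auto simp: Q_def E_def \<rho>_def C_def)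
          then show ?thesis using qE by simp
        qed simp
      qed
      finally show ?thesis using True by simp
    qed simp
    have "ennreal ?c * (\<integral>\<^sup>+ y \<in> S k. W y \<partial>lborel) = (\<integral>\<^sup>+ y. ennreal ?c * (W y * indicator (S k) y) \<partial>lborel)"
      by (rule nn_integral_cmult[symmetric]) measurable
    also have "\<dots> \<le> (\<integral>\<^sup>+ y. \<integral>\<^sup>+ q. indicator Q q * (W y * indicator (ball (proj q) (\<rho> k)) y) \<partial>lborel \<partial>lborel)"
      by (intro nn_integral_mono low)
    also have "\<dots> = (\<integral>\<^sup>+ q. \<integral>\<^sup>+ y. indicator Q q * (W y * indicator (ball (proj q) (\<rho> k)) y) \<partial>lborel \<partial>lborel)"
    proof (rule lborel_pair.Fubini')
      show "(\<lambda>(q, y). indicator Q q * (W y * indicator (ball (proj q) (\<rho> k)) y)) \<in> borel_measurable (lborel \<Otimes>\<^sub>M lborel)"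
      proof -
        have eq: "(\<lambda>(q, y). indicator Q q * (W y * indicator (ball (proj q) (\<rho> k)) y)) =
            (\<lambda>p. indicator Q (fst p) * (case p of (q, y) \<Rightarrow> W y * indicator (ball (proj q) (\<rho> k)) y))"
          by (auto simp: fun_eq_iff)
        show ?thesis unfolding eq using prodm[of "\<rho> k"] by measurable
      qed
    qed
    also have "\<dots> = (\<integral>\<^sup>+ q. indicator Q q * a (\<rho> k) q \<partial>lborel)"
      unfolding a_def by (intro nn_integral_cong nn_integral_cmult borel_measurable_times_ennreal borel_measurable_indicator) (use W(1) in auto)
    also have "\<dots> = (\<integral>\<^sup>+ q. ennreal (\<rho> k ^ DIM('a)) * (indicator Q q * (a (\<rho> k) q / ennreal (\<rho> k ^ DIM('a)))) \<partial>lborel)"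
    proof (intro nn_integral_cong)
      fix q
      have "ennreal (\<rho> k ^ DIM('a)) * (a (\<rho> k) q / ennreal (\<rho> k ^ DIM('a))) = a (\<rho> k) q"
        using \<rho>[of k] by (subst ennreal_times_divide, subst mult.commute) (simp add: mult_divide_eq_ennreal)
      then show "indicator Q q * a (\<rho> k) q = ennreal (\<rho> k ^ DIM('a)) * (indicator Q q * (a (\<rho> k) q / ennreal (\<rho> k ^ DIM('a))))"
        by (simp add: mult.left_commute)
    qed
    also have "\<dots> = ennreal (\<rho> k ^ DIM('a)) * I"
      unfolding I_def by (rule nn_integral_cmult) measurable
    also have "\<rho> k ^ DIM('a) = ?c * (K * \<epsilon> k)"
    proof -
      have "\<epsilon> k ^ DIM('a) = \<epsilon> k ^ (DIM('a) - 1) * \<epsilon> k"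
        using DIM_positive[where 'a='a] by (metis power_minus_mult)
      then show ?thesis using V by (simp add: \<rho>_def K_def power_mult_distrib)
    qed
    also have "ennreal (?c * (K * \<epsilon> k)) = ennreal ?c * ennreal (K * \<epsilon> k)"
      by (rule ennreal_mult) (use c K \<epsilon>(1)[of k] in auto)
    finally have "ennreal ?c * (\<integral>\<^sup>+ y \<in> S k. W y \<partial>lborel) \<le> ennreal ?c * (ennreal (K * \<epsilon> k) * I)"
      by (simp only: mult.assoc)
    moreover have "ennreal ?c \<noteq> 0" using c by (simp only: ennreal_eq_0_iff not_le)
    ultimately have "(\<integral>\<^sup>+ y \<in> S k. W y \<partial>lborel) \<le> ennreal (K * \<epsilon> k) * I"
      using ennreal_mult_le_mult_iff[of "ennreal ?c"] by simp
    also have "\<dots> = (ennreal K * I) * ennreal (\<epsilon> k)"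
      using K \<epsilon>(1)[of k] by (simp add: ennreal_mult mult_ac)
    finally show ?thesis using \<epsilon>(1)[of k]
      unfolding I_def[symmetric] by (intro divide_le_posI_ennreal) (auto simp: mult.commute)
  qed
  have bd: "(\<lambda>k. ennreal K * (\<integral>\<^sup>+ q. indicator Q q * (a (\<rho> k) q / ennreal (\<rho> k ^ DIM('a))) \<partial>lborel)) \<longlonglongrightarrow> 0"
    using ennreal_tendsto_cmult[OF _ DCT, of "ennreal K"] by simp
  have "r / (4 * (1 + L)) > 0" using r L_nonneg by simp
  then have "\<forall>\<^sub>F k in sequentially. \<epsilon> k < min (r / (4 * (1 + L))) (1/4)"
    using \<epsilon>(2) by (intro order_tendstoD(2)) auto
  then have "\<forall>\<^sub>F k in sequentially. (\<integral>\<^sup>+ y \<in> S k. W y \<partial>lborel) / ennreal (\<epsilon> k) \<le>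
      ennreal K * (\<integral>\<^sup>+ q. indicator Q q * (a (\<rho> k) q / ennreal (\<rho> k ^ DIM('a))) \<partial>lborel)"
    by eventually_elim (intro main, auto)
  then show ?thesis
    unfolding S_def[symmetric] by (rule tendsto_sandwich[OF _ _ tendsto_const bd, rotated]) simp
qed

end

text \<open>By compactness finitely many chart balls cover the boundary, and then they also cover
  every sufficiently thin layer around it.\<close>

lemma boundary_layer:
  fixes \<Omega> :: "'a::euclidean_space set" and W :: "'a \<Rightarrow> ennreal"
  assumes \<Omega>: "open \<Omega>" "bounded \<Omega>" "lipschitz_boundary \<Omega>"
    and W: "W \<in> borel_measurable borel" "\<And>y. W y \<le> ennreal M" "M \<ge> 0"
    and N: "hausdorff_outer (DIM('a) - 1) N = 0"
    and lim: "\<And>z. z \<in> frontier \<Omega> - N \<Longrightarrow>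
      ((\<lambda>\<rho>. (\<integral>\<^sup>+ y \<in> ball z \<rho>. W y \<partial>lborel) / ennreal (\<rho> ^ DIM('a))) \<longlongrightarrow> 0) (at_right 0)"
    and \<epsilon>: "\<And>k. \<epsilon> k > 0" "\<epsilon> \<longlonglongrightarrow> 0" and ne: "frontier \<Omega> \<noteq> {}"
  shows "(\<lambda>k. (\<integral>\<^sup>+ y \<in> {y. infdist y (frontier \<Omega>) < \<epsilon> k}. W y \<partial>lborel) / ennreal (\<epsilon> k)) \<longlonglongrightarrow> 0"
proof -
  have cf: "compact (frontier \<Omega>)" using \<Omega>(2) by (rule compact_frontier_bounded)
  have "\<forall>x\<in>frontier \<Omega>. \<exists>s>0. (\<lambda>k. (\<integral>\<^sup>+ y \<in> ball x s \<inter> {y. infdist y (frontier \<Omega>) < \<epsilon> k}. W y \<partial>lborel) / ennreal (\<epsilon> k)) \<longlonglongrightarrow> 0"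
  proof
    fix x assume x: "x \<in> frontier \<Omega>"
    obtain r e \<gamma> L where ch: "r > 0" "norm e = 1" "L-lipschitz_on {z. z \<bullet> e = 0} \<gamma>"
      "\<Omega> \<inter> ball x r = {y \<in> ball x r. \<gamma> (y - (y \<bullet> e) *\<^sub>R e) < y \<bullet> e}"
      using \<Omega>(3) x unfolding lipschitz_boundary_def by blast
    interpret lipschitz_chart \<Omega> x r e \<gamma> L by unfold_locales (use \<Omega> ch in auto)
    show "\<exists>s>0. (\<lambda>k. (\<integral>\<^sup>+ y \<in> ball x s \<inter> {y. infdist y (frontier \<Omega>) < \<epsilon> k}. W y \<partial>lborel) / ennreal (\<epsilon> k)) \<longlonglongrightarrow> 0"
      using boundary_layer_in_chart[OF W N lim \<epsilon> ne] r by (intro exI[of _ "r/2"]) auto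
  qed
  from bchoice[OF this] obtain s where s: "\<And>x. x \<in> frontier \<Omega> \<Longrightarrow> s x > 0"
    "\<And>x. x \<in> frontier \<Omega> \<Longrightarrow> (\<lambda>k. (\<integral>\<^sup>+ y \<in> ball x (s x) \<inter> {y. infdist y (frontier \<Omega>) < \<epsilon> k}. W y \<partial>lborel) / ennreal (\<epsilon> k)) \<longlonglongrightarrow> 0"
    by auto
  obtain D where D: "D \<subseteq> frontier \<Omega>" "finite D" "frontier \<Omega> \<subseteq> (\<Union>x\<in>D. ball x (s x))"
  proof (rule compactE_image[OF cf, of "frontier \<Omega>" "\<lambda>x. ball x (s x)"])
    show "frontier \<Omega> \<subseteq> (\<Union>x\<in>frontier \<Omega>. ball x (s x))" using s(1) by auto
  qed auto
  have "open (\<Union>x\<in>D. ball x (s x))" by auto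
  from compact_subset_open_imp_ball_epsilon_subset[OF cf this D(3)]
  obtain \<eta> where \<eta>: "\<eta> > 0" "(\<Union>x\<in>frontier \<Omega>. ball x \<eta>) \<subseteq> (\<Union>x\<in>D. ball x (s x))" by auto
  define I where "I x k = (\<integral>\<^sup>+ y \<in> ball x (s x) \<inter> {y. infdist y (frontier \<Omega>) < \<epsilon> k}. W y \<partial>lborel) / ennreal (\<epsilon> k)" for x k
  have "(\<lambda>k. \<Sum>x\<in>D. I x k) \<longlonglongrightarrow> (\<Sum>x\<in>D. 0)"
    unfolding I_def by (intro tendsto_sum s(2)) (use D in auto)
  then have bd: "(\<lambda>k. \<Sum>x\<in>D. I x k) \<longlonglongrightarrow> 0" by simp
  have Sm: "{y. infdist y (frontier \<Omega>) < \<epsilon> k} \<in> sets borel" for k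
    by (intro borel_open open_Collect_less continuous_intros)
  have le: "(\<integral>\<^sup>+ y \<in> {y. infdist y (frontier \<Omega>) < \<epsilon> k}. W y \<partial>lborel) / ennreal (\<epsilon> k) \<le> (\<Sum>x\<in>D. I x k)" if "\<epsilon> k < \<eta>" for k
  proof -
    let ?S = "{y. infdist y (frontier \<Omega>) < \<epsilon> k}"
    have cov: "?S \<subseteq> (\<Union>x\<in>D. ball x (s x))"
    proof
      fix y assume y: "y \<in> ?S"
      obtain z where "z \<in> frontier \<Omega>" "infdist y (frontier \<Omega>) = dist y z"
        by (rule infdist_attains_inf[OF frontier_closed ne, of y])
      with y that have "y \<in> ball z \<eta>" by (simp add: dist_commute)
      then show "y \<in> (\<Union>x\<in>D. ball x (s x))" using \<eta>(2) \<open>z \<in> frontier \<Omega>\<close> by blast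
    qed
    have "(\<integral>\<^sup>+ y \<in> ?S. W y \<partial>lborel) \<le> (\<integral>\<^sup>+ y. (\<Sum>x\<in>D. W y * indicator (ball x (s x) \<inter> ?S) y) \<partial>lborel)"
    proof (intro nn_integral_mono)
      fix y
      show "W y * indicator ?S y \<le> (\<Sum>x\<in>D. W y * indicator (ball x (s x) \<inter> ?S) y)"
      proof (cases "y \<in> ?S")
        case True
        then obtain x where x: "x \<in> D" "y \<in> ball x (s x)" using cov by auto
        have "W y * indicator ?S y = W y * indicator (ball x (s x) \<inter> ?S) y" using True x by simp
        also have "\<dots> \<le> (\<Sum>x\<in>D. W y * indicator (ball x (s x) \<inter> ?S) y)"
          by (rule member_le_sum[OF x(1) _ D(2)]) simp
        finally show ?thesis .
      qed simp
    qed
    also have "\<dots> = (\<Sum>x\<in>D. \<integral>\<^sup>+ y \<in> ball x (s x) \<inter> ?S. W y \<partial>lborel)"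
      using W(1) Sm[of k]
      by (intro nn_integral_sum borel_measurable_times_ennreal borel_measurable_indicator) (auto intro!: sets.Int)
    finally have "(\<integral>\<^sup>+ y \<in> ?S. W y \<partial>lborel) / ennreal (\<epsilon> k) \<le> (\<Sum>x\<in>D. \<integral>\<^sup>+ y \<in> ball x (s x) \<inter> ?S. W y \<partial>lborel) / ennreal (\<epsilon> k)"
      by (rule divide_right_mono_ennreal)
    also have "\<dots> = (\<Sum>x\<in>D. I x k)" unfolding I_def divide_ennreal_def by (simp add: sum_distrib_right)
    finally show ?thesis .
  qed
  have "\<forall>\<^sub>F k in sequentially. \<epsilon> k < \<eta>" using \<epsilon>(2) \<eta>(1) by (rule order_tendstoD)
  then have "\<forall>\<^sub>F k in sequentially. (\<integral>\<^sup>+ y \<in> {y. infdist y (frontier \<Omega>) < \<epsilon> k}. W y \<partial>lborel) / ennreal (\<epsilon> k) \<le> (\<Sum>x\<in>D. I x k)"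
    by eventually_elim (rule le)
  then show ?thesis by (rule tendsto_sandwich[OF _ _ tendsto_const bd, rotated]) simp
qed

text \<open>Small pieces of a Lipschitz domain are connected through the points above them.\<close>

lemma (in lipschitz_chart) locally_constant_near_boundary:
  fixes u :: "'a \<Rightarrow> real"
  assumes u: "\<And>y. y \<in> \<Omega> \<Longrightarrow> (u has_derivative (\<lambda>h. 0)) (at y)"
  shows "\<exists>s>0. \<forall>y\<in>\<Omega> \<inter> ball x s. \<forall>z\<in>\<Omega> \<inter> ball x s. u y = u z"
proof -
  have const: "u y = u z" if "closed_segment y z \<subseteq> \<Omega>" for y z
  proof -
    have "norm (u z - u y) \<le> 0 * norm (z - y)"
    proof (rule differentiable_bound[where S="closed_segment y z" and f'="\<lambda>_ _. 0"])
      show "w \<in> closed_segment y z \<Longrightarrow> (u has_derivative (\<lambda>_. 0)) (at w within closed_segment y z)" for w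
        using u that has_derivative_at_withinI by blast
    qed (auto simp: onorm_zero)
    then show ?thesis by simp
  qed
  \<comment> \<open>The height \<open>t\<close> must exceed \<open>2 * s * (L + 1)\<close>: two
    points of the small ball differ by at most \<open>2 * s\<close> along \<open>e\<close>, and the
    graph below them by at most \<open>2 * s * L\<close>, so the segment between the lifted points
    stays above the graph. The choice of \<open>s\<close> makes \<open>s + t = r / 2\<close>, inside
    the chart.\<close>
  define s where "s = r / (4 * (L + 2))"
  define t where "t = 2 * s * (L + 1) + s"
  have s: "s > 0" using r L_nonneg by (simp add: s_def)
  have t: "t > 2 * s * (L + 1)" "t > 0" using s L_nonneg by (auto simp: t_def intro!: add_nonneg_pos)
  have st: "s + t < r"
  proof -
    have "s + t = 2 * (L + 2) * s" by (simp add: t_def algebra_simps)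
    also have "\<dots> = r / 2" unfolding s_def using L_nonneg by (simp add: field_simps)
    finally show ?thesis using r by simp
  qed
  have up: "u y = u (y + t *\<^sub>R e)" if y: "y \<in> \<Omega>" "y \<in> ball x s" for y
  proof (rule const)
    show "closed_segment y (y + t *\<^sub>R e) \<subseteq> \<Omega>"
    proof
      fix w assume "w \<in> closed_segment y (y + t *\<^sub>R e)"
      then obtain l where l: "0 \<le> l" "l \<le> 1" "w = (1 - l) *\<^sub>R y + l *\<^sub>R (y + t *\<^sub>R e)" unfolding in_segment by auto
      then have w: "w = y + (l * t) *\<^sub>R e" by (simp add: algebra_simps)
      have lt: "0 \<le> l * t" "l * t \<le> t" using l t by (auto simp: mult_left_le_one_le)
      have "dist x w \<le> dist x y + l * t"
        using dist_triangle[of x w y] w e lt by (simp add: dist_norm)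
      then have wb: "w \<in> ball x r" using y lt st by simp
      have yb: "y \<in> ball x r" using y st t by simp
      have "perp e w = perp e y" using e by (simp add: w perp_def inner_add_left dot_square_norm algebra_simps)
      moreover have "w \<bullet> e = y \<bullet> e + l * t" using e by (simp add: w inner_add_left dot_square_norm)
      ultimately show "w \<in> \<Omega>" using mem_\<Omega>[OF wb] mem_\<Omega>[OF yb] y lt by simp
    qed
  qed
  have across: "u (y + t *\<^sub>R e) = u (z + t *\<^sub>R e)" if y: "y \<in> \<Omega>" "y \<in> ball x s" and z: "z \<in> ball x s" for y z
  proof (rule const)
    show "closed_segment (y + t *\<^sub>R e) (z + t *\<^sub>R e) \<subseteq> \<Omega>"
    proof
      fix w assume "w \<in> closed_segment (y + t *\<^sub>R e) (z + t *\<^sub>R e)"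
      then obtain l where l: "0 \<le> l" "l \<le> 1" "w = (1 - l) *\<^sub>R (y + t *\<^sub>R e) + l *\<^sub>R (z + t *\<^sub>R e)" unfolding in_segment by auto
      define p where "p = (1 - l) *\<^sub>R y + l *\<^sub>R z"
      have w: "w = p + t *\<^sub>R e" using l by (simp add: p_def algebra_simps)
      have pb: "p \<in> ball x s"
        using convexD_alt[OF convex_ball y(2) z l(1,2)] by (simp add: p_def)
      have "dist x w \<le> dist x p + t" using dist_triangle[of x w p] w e t by (simp add: dist_norm)
      then have wb: "w \<in> ball x r" using pb st by simp
      have yb: "y \<in> ball x r" using y st t by simp
      have py: "norm (p - y) < 2 * s"
        using dist_triangle[of p y x] pb y by (simp add: dist_norm[of p y, symmetric] dist_commute)
      have "perp e w = perp e p" using e by (simp add: w perp_def inner_add_left dot_square_norm algebra_simps)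
      moreover have "\<gamma> (perp e p) \<le> \<gamma> (perp e y) + L * (2 * s)"
      proof -
        have "L * norm (perp e p - perp e y) \<le> L * (2 * s)"
          using norm_perp_le[OF e, of "p - y"] py L_nonneg by (intro mult_left_mono) (auto simp: perp_diff)
        then show ?thesis using \<gamma>_lip[of p y] by linarith
      qed
      moreover have "y \<bullet> e - 2 * s \<le> p \<bullet> e"
        using Cauchy_Schwarz_ineq2[of "p - y" e] py e by (simp add: inner_diff_left)
      moreover have "\<gamma> (perp e y) < y \<bullet> e" using mem_\<Omega>[OF yb] y by simp
      moreover have "w \<bullet> e = p \<bullet> e + t" using e by (simp add: w inner_add_left dot_square_norm)
      ultimately show "w \<in> \<Omega>" using mem_\<Omega>[OF wb] t(1) by (simp add: algebra_simps)
    qed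
  qed
  have "u y = u z" if "y \<in> \<Omega> \<inter> ball x s" "z \<in> \<Omega> \<inter> ball x s" for y z
    using up[of y] across[of y z] up[of z] that by simp
  then show ?thesis using s by blast
qed

text \<open>Serves the degenerate case of vanishing gradient, where the product hypothesis says
  nothing about the oscillation. Every point of the compact closure has a neighbourhood on which
  \<open>u\<close> is bounded; at boundary points this uses the Lipschitz condition, since
  components with different values could otherwise accumulate there.\<close>

lemma locally_constant_bounded:
  fixes u :: "'a::euclidean_space \<Rightarrow> real"
  assumes \<Omega>: "open \<Omega>" "bounded \<Omega>" "lipschitz_boundary \<Omega>"
    and u: "\<And>y. y \<in> \<Omega> \<Longrightarrow> (u has_derivative (\<lambda>h. 0)) (at y)"
  obtains B where "\<And>y. y \<in> \<Omega> \<Longrightarrow> \<bar>u y\<bar> \<le> B"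
proof -
  have local: "\<exists>s>0. \<exists>b. \<forall>y\<in>\<Omega> \<inter> ball x s. \<bar>u y\<bar> \<le> b" if x: "x \<in> closure \<Omega>" for x
  proof (cases "x \<in> \<Omega>")
    case True
    have "continuous (at x) u" by (rule has_derivative_continuous[OF u[OF True]])
    then obtain d where "d > 0" "\<And>y. dist y x < d \<Longrightarrow> dist (u y) (u x) < 1"
      unfolding continuous_at_eps_delta using zero_less_one by blast
    have "\<bar>u y\<bar> \<le> \<bar>u x\<bar> + 1" if "y \<in> \<Omega> \<inter> ball x d" for y
      using \<open>\<And>y. dist y x < d \<Longrightarrow> dist (u y) (u x) < 1\<close>[of y] that by (simp add: dist_real_def dist_commute)
    then have "\<forall>y\<in>\<Omega> \<inter> ball x d. \<bar>u y\<bar> \<le> \<bar>u x\<bar> + 1" by blast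
    then show ?thesis using \<open>d > 0\<close> by blast
  next
    case False
    then have "x \<in> frontier \<Omega>" using x \<Omega>(1) by (simp add: frontier_def interior_open)
    then obtain r e \<gamma> L where ch: "r > 0" "norm e = 1" "L-lipschitz_on {z. z \<bullet> e = 0} \<gamma>"
      "\<Omega> \<inter> ball x r = {y \<in> ball x r. \<gamma> (y - (y \<bullet> e) *\<^sub>R e) < y \<bullet> e}"
      using \<Omega>(3) unfolding lipschitz_boundary_def by blast
    interpret lipschitz_chart \<Omega> x r e \<gamma> L by unfold_locales (use \<Omega> ch in auto)
    obtain s where s: "s > 0" "\<forall>y\<in>\<Omega> \<inter> ball x s. \<forall>z\<in>\<Omega> \<inter> ball x s. u y = u z"
      using locally_constant_near_boundary[OF u] by auto
    have "\<exists>b. \<forall>y\<in>\<Omega> \<inter> ball x s. \<bar>u y\<bar> \<le> b"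
    proof (cases "\<Omega> \<inter> ball x s = {}")
      case False
      then obtain z where "z \<in> \<Omega> \<inter> ball x s" by blast
      then have "u y = u z" if "y \<in> \<Omega> \<inter> ball x s" for y using s(2) that by blast
      then have "\<forall>y\<in>\<Omega> \<inter> ball x s. \<bar>u y\<bar> \<le> \<bar>u z\<bar>" by simp
      then show ?thesis by blast
    qed auto
    then show ?thesis using s(1) by blast
  qed
  have "\<forall>x\<in>closure \<Omega>. \<exists>sb. fst sb > 0 \<and> (\<forall>y\<in>\<Omega> \<inter> ball x (fst sb). \<bar>u y\<bar> \<le> snd sb)"
  proof
    fix x assume "x \<in> closure \<Omega>"
    from local[OF this] obtain s b where "s > 0" "\<forall>y\<in>\<Omega> \<inter> ball x s. \<bar>u y\<bar> \<le> b" by blast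
    then show "\<exists>sb. fst sb > 0 \<and> (\<forall>y\<in>\<Omega> \<inter> ball x (fst sb). \<bar>u y\<bar> \<le> snd sb)"
      by (intro exI[of _ "(s, b)"]) simp
  qed
  from bchoice[OF this] obtain sb where
    sb': "\<And>x. x \<in> closure \<Omega> \<Longrightarrow> fst (sb x) > 0 \<and> (\<forall>y\<in>\<Omega> \<inter> ball x (fst (sb x)). \<bar>u y\<bar> \<le> snd (sb x))"
    by auto
  define s b where "s x = fst (sb x)" and "b x = snd (sb x)" for x
  have sb: "\<And>x. x \<in> closure \<Omega> \<Longrightarrow> s x > 0"
    "\<And>x y. x \<in> closure \<Omega> \<Longrightarrow> y \<in> \<Omega> \<Longrightarrow> y \<in> ball x (s x) \<Longrightarrow> \<bar>u y\<bar> \<le> b x"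
    using sb' by (auto simp: s_def b_def)
  have cc: "compact (closure \<Omega>)" using \<Omega>(2) by (simp add: compact_closure)
  obtain D where D: "D \<subseteq> closure \<Omega>" "finite D" "closure \<Omega> \<subseteq> (\<Union>x\<in>D. ball x (s x))"
  proof (rule compactE_image[OF cc, of "closure \<Omega>" "\<lambda>x. ball x (s x)"])
    show "closure \<Omega> \<subseteq> (\<Union>x\<in>closure \<Omega>. ball x (s x))" using sb(1) by auto
  qed auto
  have "\<bar>u y\<bar> \<le> (\<Sum>x\<in>D. \<bar>b x\<bar>)" if y: "y \<in> \<Omega>" for y
  proof -
    obtain x where x: "x \<in> D" "y \<in> ball x (s x)" using D(3) y closure_subset by blast
    then have "\<bar>u y\<bar> \<le> \<bar>b x\<bar>" using sb(2)[OF subsetD[OF D(1) x(1)] y x(2)] by linarith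
    also have "\<dots> \<le> (\<Sum>x\<in>D. \<bar>b x\<bar>)" by (rule member_le_sum[OF x(1) _ D(2)]) simp
    finally show ?thesis .
  qed
  then show thesis by (rule that)
qed

subsection \<open>Classical functions in SBV\<close>

lemma ex_borel_version:
  fixes f :: "'a::euclidean_space \<Rightarrow> 'b::euclidean_space"
  assumes f: "f \<in> borel_measurable lebesgue"
  obtains f' where "f' \<in> borel_measurable borel" "AE x in lborel. f x = f' x"
proof -
  have "\<exists>h\<in>borel_measurable lborel. AE x in lborel. f x \<bullet> b = h x" for b
    using f by (intro completion_ex_borel_measurable_real) auto
  then obtain h where h: "\<And>b. h b \<in> borel_measurable lborel" "\<And>b. AE x in lborel. f x \<bullet> b = h b x" by metis
  define f' where "f' x = (\<Sum>b\<in>Basis. h b x *\<^sub>R b)" for x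
  have "f' \<in> borel_measurable borel" unfolding f'_def[abs_def] using h(1) by auto
  moreover have "AE x in lborel. \<forall>b\<in>Basis. f x \<bullet> b = h b x" using h(2) by (intro AE_finite_allI) auto
  then have "AE x in lborel. f x = f' x"
  proof eventually_elim
    case (elim x)
    have "f x = (\<Sum>b\<in>Basis. (f x \<bullet> b) *\<^sub>R b)" by (rule euclidean_representation[symmetric])
    also have "\<dots> = f' x" unfolding f'_def using elim by (intro sum.cong) auto
    finally show ?case .
  qed
  ultimately show thesis by (rule that)
qed

text \<open>The definitions integrate against the completed measure, whereas mollification and
  Fubini are carried out with Borel functions; this is the bridge between them.\<close>

lemma set_integrable_lebesgue_borel_version:
  fixes f :: "'a::euclidean_space \<Rightarrow> 'b::euclidean_space"
  assumes \<Omega>: "open \<Omega>" and f: "set_integrable lebesgue \<Omega> f"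
  obtains f' where "integrable lborel f'" "\<And>x. x \<notin> \<Omega> \<Longrightarrow> f' x = 0" "AE x in lborel. x \<in> \<Omega> \<longrightarrow> f x = f' x"
    "\<And>B. B \<in> sets borel \<Longrightarrow> B \<subseteq> \<Omega> \<Longrightarrow> (LINT x:B|lebesgue. f x) = (LINT x:B|lborel. f' x)"
proof -
  let ?f = "\<lambda>x. indicator \<Omega> x *\<^sub>R f x"
  have i: "integrable lebesgue ?f" using f by (simp add: set_integrable_def)
  then obtain h where h: "h \<in> borel_measurable borel" "AE x in lborel. ?f x = h x"
    by (rule ex_borel_version[OF borel_measurable_integrable])
  define f' where "f' x = indicator \<Omega> x *\<^sub>R h x" for x
  have f'm [measurable]: "f' \<in> borel_measurable borel"
    unfolding f'_def[abs_def] using h(1) \<Omega> by (intro borel_measurable_scaleR borel_measurable_indicator) auto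
  have eq: "AE x in lborel. ?f x = f' x" using h(2) by eventually_elim (auto simp: f'_def indicator_def split: if_splits)
  have "integrable lebesgue f'"
    using i by (rule integrable_cong_AE_imp)
      (use eq f'm in \<open>auto simp: AE_completion_iff measurable_completion intro: AE_completion\<close>)
  then have 1: "integrable lborel f'" by (simp add: integrable_completion)
  have 2: "f' x = 0" if "x \<notin> \<Omega>" for x using that by (simp add: f'_def)
  have 3: "AE x in lborel. x \<in> \<Omega> \<longrightarrow> f x = f' x" using eq by eventually_elim (auto simp: indicator_def)
  have 4: "(LINT x:B|lebesgue. f x) = (LINT x:B|lborel. f' x)" if B: "B \<in> sets borel" "B \<subseteq> \<Omega>" for B
  proof -
    have "(LINT x:B|lebesgue. f x) = (LINT x|lebesgue. indicator B x *\<^sub>R ?f x)"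
      unfolding set_lebesgue_integral_def
      by (intro Bochner_Integration.integral_cong) (use B in \<open>auto simp: indicator_def\<close>)
    also have "\<dots> = (LINT x|lebesgue. indicator B x *\<^sub>R f' x)"
    proof (rule integral_cong_AE)
      show "AE x in lebesgue. indicator B x *\<^sub>R ?f x = indicator B x *\<^sub>R f' x"
        using AE_completion[OF eq] by eventually_elim simp
      show "(\<lambda>x. indicator B x *\<^sub>R ?f x) \<in> borel_measurable lebesgue"
        using B by (intro borel_measurable_scaleR[OF borel_measurable_indicator borel_measurable_integrable[OF i]]) auto
      show "(\<lambda>x. indicator B x *\<^sub>R f' x) \<in> borel_measurable lebesgue"
        using B f'm by (intro borel_measurable_scaleR borel_measurable_indicator measurable_completion) auto
    qed
    also have "\<dots> = (LINT x:B|lborel. f' x)"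
      unfolding set_lebesgue_integral_def using B by (intro integral_completion) auto
    finally show ?thesis .
  qed
  show thesis by (rule that[OF 1 2 3 4])
qed

text \<open>Only integrals over small balls matter, so a function and its Borel version share
  one-sided limits and traces.\<close>

lemma approx_limit_within_cong_AE:
  fixes v v' :: "'a::euclidean_space \<Rightarrow> real"
  assumes eq: "AE x in lborel. x \<in> \<Omega> \<longrightarrow> v x = v' x" and sub: "\<forall>\<^sub>F r in at_right 0. ball y r \<inter> S \<subseteq> \<Omega>"
  shows "approx_limit_within v S y a \<longleftrightarrow> approx_limit_within v' S y a"
proof -
  have "\<forall>\<^sub>F r in at_right 0. (\<integral>\<^sup>+ z \<in> ball y r \<inter> S. ennreal \<bar>v z - a\<bar> \<partial>lebesgue) / ennreal (r ^ DIM('a))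
      = (\<integral>\<^sup>+ z \<in> ball y r \<inter> S. ennreal \<bar>v' z - a\<bar> \<partial>lebesgue) / ennreal (r ^ DIM('a))"
    using sub
  proof eventually_elim
    case (elim r)
    have "(\<integral>\<^sup>+ z \<in> ball y r \<inter> S. ennreal \<bar>v z - a\<bar> \<partial>lebesgue) = (\<integral>\<^sup>+ z \<in> ball y r \<inter> S. ennreal \<bar>v' z - a\<bar> \<partial>lebesgue)"
      unfolding nn_integral_completion
    proof (rule nn_integral_cong_AE)
      show "AE z in lborel. ennreal \<bar>v z - a\<bar> * indicator (ball y r \<inter> S) z = ennreal \<bar>v' z - a\<bar> * indicator (ball y r \<inter> S) z"
        using eq by eventually_elim (use elim in \<open>auto simp: indicator_def\<close>)
    qed
    then show ?case by simp
  qed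
  then show ?thesis unfolding approx_limit_within_def by (rule tendsto_cong)
qed

lemma eventually_ball_subset:
  assumes "open \<Omega>" "y \<in> \<Omega>"
  shows "\<forall>\<^sub>F r in at_right 0. ball y r \<inter> S \<subseteq> \<Omega>"
proof -
  obtain d where d: "d > 0" "ball y d \<subseteq> \<Omega>" using assms openE by blast
  then show ?thesis unfolding eventually_at_right_field
    by (intro exI[of _ d] conjI allI impI) (use subset_ball[of _ d y] in auto)
qed

lemma approx_limit_isCont:
  fixes u :: "'a::euclidean_space \<Rightarrow> real"
  assumes "isCont u y"
  shows "approx_limit u y (u y)"
  unfolding approx_limit_def approx_limit_within_def nn_integral_completion
proof (rule tendsto_zero_ennreal)
  fix e :: real assume e: "e > 0"
  define V where "V = measure lborel (ball (0::'a) 1)"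
  have V: "V > 0" unfolding V_def using content_ball_pos[of 1 "0::'a"] by simp
  define \<eta> where "\<eta> = e / (2 * V)"
  have \<eta>: "\<eta> > 0" using e V by (simp add: \<eta>_def)
  obtain d where d: "d > 0" "\<And>z. dist z y < d \<Longrightarrow> dist (u z) (u y) < \<eta>"
    using assms \<eta> unfolding continuous_at_eps_delta by blast
  have "(\<integral>\<^sup>+ z \<in> ball y r \<inter> UNIV. ennreal \<bar>u z - u y\<bar> \<partial>lborel) / ennreal (r ^ DIM('a)) < ennreal e" if r: "0 < r" "r < d" for r
  proof -
    have "(\<integral>\<^sup>+ z \<in> ball y r \<inter> UNIV. ennreal \<bar>u z - u y\<bar> \<partial>lborel) \<le> (\<integral>\<^sup>+ z. ennreal \<eta> * indicator (ball y r) z \<partial>lborel)"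
    proof (intro nn_integral_mono)
      fix z
      show "ennreal \<bar>u z - u y\<bar> * indicator (ball y r \<inter> UNIV) z \<le> ennreal \<eta> * indicator (ball y r) z"
        using d(2)[of z] r by (auto simp: indicator_def dist_real_def dist_commute intro!: ennreal_leI)
    qed
    also have "\<dots> = ennreal (\<eta> * V * r ^ DIM('a))"
      using r \<eta> V by (simp add: nn_integral_cmult_indicator emeasure_ball_scale V_def[symmetric] ennreal_mult[symmetric] mult_ac)
    finally have "(\<integral>\<^sup>+ z \<in> ball y r \<inter> UNIV. ennreal \<bar>u z - u y\<bar> \<partial>lborel) / ennreal (r ^ DIM('a))
        \<le> ennreal (\<eta> * V * r ^ DIM('a)) / ennreal (r ^ DIM('a))" by (rule divide_right_mono_ennreal)
    also have "\<dots> = ennreal (\<eta> * V)" using r \<eta> V by (subst divide_ennreal) auto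
    also have "\<dots> < ennreal e" using e V by (simp add: \<eta>_def ennreal_less_iff)
    finally show ?thesis .
  qed
  then show "\<forall>\<^sub>F r in at_right 0. (\<integral>\<^sup>+ z \<in> ball y r \<inter> UNIV. ennreal \<bar>u z - u y\<bar> \<partial>lborel) / ennreal (r ^ DIM('a)) < ennreal e"
    unfolding eventually_at_right_field using d(1) by blast
qed

text \<open>\<open>approx_grad\<close> is selected by \<open>SOME\<close>, so it can be identified
  with an explicit density only almost everywhere. The null set \<open>N\<close> of the
  decomposition is removed before integrals are compared.\<close>

lemma ac_density_unique:
  fixes \<Omega> :: "'a::euclidean_space set"
  assumes \<Omega>: "open \<Omega>" and g: "is_ac_density \<Omega> D g" and h: "integrable lborel h" "\<And>x. x \<notin> \<Omega> \<Longrightarrow> h x = 0"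
    and D: "\<And>B. B \<in> sets borel \<Longrightarrow> B \<subseteq> \<Omega> \<Longrightarrow> D B = (LINT x:B|lborel. h x)"
  shows "AE x in lborel. x \<in> \<Omega> \<longrightarrow> g x = h x"
proof -
  obtain N where gi: "set_integrable lebesgue \<Omega> g" and N: "N \<in> null_sets lborel"
    and gD: "\<And>B. B \<in> sets borel \<Longrightarrow> B \<subseteq> \<Omega> - N \<Longrightarrow> D B = (LINT x:B|lebesgue. g x)"
    using g unfolding is_ac_density_def by blast
  obtain g' where g': "integrable lborel g'" "\<And>x. x \<notin> \<Omega> \<Longrightarrow> g' x = 0" "AE x in lborel. x \<in> \<Omega> \<longrightarrow> g x = g' x"
    "\<And>B. B \<in> sets borel \<Longrightarrow> B \<subseteq> \<Omega> \<Longrightarrow> (LINT x:B|lebesgue. g x) = (LINT x:B|lborel. g' x)"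
    by (rule set_integrable_lebesgue_borel_version[OF \<Omega> gi]) (rule that)
  have "AE x in lborel. g' x = h x"
  proof (rule sigma_finite_measure.density_unique_banach[OF sigma_finite_lborel g'(1) h(1)])
    fix A :: "'a set" assume "A \<in> sets lborel"
    then have A: "A \<in> sets borel" by simp
    have Nb: "N \<in> sets borel" using null_setsD2[OF N] by simp
    define B where "B = A \<inter> \<Omega> - N"
    have B: "B \<in> sets borel" "B \<subseteq> \<Omega> - N" "B \<subseteq> \<Omega>" unfolding B_def using A Nb \<Omega> by auto
    have red: "(LINT x:A|lborel. f x) = (LINT x:B|lborel. f x)"
      if f: "integrable lborel f" "\<And>x. x \<notin> \<Omega> \<Longrightarrow> f x = 0" for f :: "'a \<Rightarrow> 'a"
      unfolding set_lebesgue_integral_def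
    proof (rule integral_cong_AE)
      show "AE x in lborel. indicator A x *\<^sub>R f x = indicator B x *\<^sub>R f x"
        using AE_not_in[OF N] by eventually_elim (auto simp: B_def indicator_def f(2))
      show "(\<lambda>x. indicator A x *\<^sub>R f x) \<in> borel_measurable lborel" "(\<lambda>x. indicator B x *\<^sub>R f x) \<in> borel_measurable lborel"
        using A B borel_measurable_integrable[OF f(1)] by (intro borel_measurable_scaleR borel_measurable_indicator; simp)+
    qed
    show "(LINT x:A|lborel. g' x) = (LINT x:A|lborel. h x)"
      using red[OF g'(1,2)] red[OF h] g'(4)[OF B(1,3)] gD[OF B(1,2)] D[OF B(1,3)] by simp
  qed
  with g'(3) show ?thesis by eventually_elim simp
qed

lemma integrable_bounded_on:
  fixes f :: "'a::euclidean_space \<Rightarrow> 'b::{banach, second_countable_topology}"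
  assumes "\<Omega> \<in> sets borel" "emeasure lborel \<Omega> < \<infinity>" "f \<in> borel_measurable borel" "\<And>x. norm (f x) \<le> c * indicator \<Omega> x"
  shows "integrable lborel f"
proof (rule Bochner_Integration.integrable_bound[where f="\<lambda>x. c * indicator \<Omega> x"])
  show "integrable lborel (\<lambda>x. c * indicator \<Omega> x)" using assms by (intro integrable_mult_right integrable_real_indicator) auto
  show "AE x in lborel. norm (f x) \<le> norm (c * indicator \<Omega> x)" by (intro AE_I2 norm_le_norm_real assms)
qed (use assms in simp)

lemma integral_density_indicator:
  fixes f :: "'a::euclidean_space \<Rightarrow> 'b::{banach, second_countable_topology}"
  assumes "\<Omega> \<in> sets borel" "f \<in> borel_measurable borel"
  shows "(\<integral>x. f x \<partial>density lborel (\<lambda>x. ennreal (indicator \<Omega> x))) = (\<integral>x. indicator \<Omega> x *\<^sub>R f x \<partial>lborel)"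
  using assms by (intro integral_density) auto

text \<open>The classical gradient times Lebesgue measure is a derivative measure, hence by
  uniqueness agrees with the chosen one on the Borel subsets of \<Omega>. Continuity empties the
  singular set, which makes the jump part void.\<close>

lemma sbv_of_C1_bounded:
  fixes \<Omega> :: "'a::euclidean_space set" and u :: "'a \<Rightarrow> real"
  assumes \<Omega>: "open \<Omega>" "bounded \<Omega>" and u: "C1_on \<Omega> u" "\<And>x. x \<in> \<Omega> \<Longrightarrow> \<bar>u x\<bar> \<le> B"
    and G: "\<And>x. x \<in> \<Omega> \<Longrightarrow> norm (grad u x) \<le> G"
  shows "u \<in> SBV \<Omega>" and "mumford_shah0 \<Omega> u = (\<integral>\<^sup>+ x \<in> \<Omega>. ennreal ((norm (grad u x))\<^sup>2) \<partial>lborel)"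
proof -
  have Om [measurable]: "\<Omega> \<in> sets borel" using \<Omega> by simp
  have fin: "emeasure lborel \<Omega> < \<infinity>" using \<Omega>(2) by (rule emeasure_bounded_finite)
  have D: "x \<in> \<Omega> \<Longrightarrow> (u has_derivative (\<lambda>h. h \<bullet> grad u x)) (at x)" for x
    using u(1) by (intro has_derivative_grad) (simp add: C1_on_def)
  have uc: "continuous_on \<Omega> u" by (intro continuous_at_imp_continuous_on ballI has_derivative_continuous[OF D])
  have gc: "continuous_on \<Omega> (grad u)" by (rule C1_on_grad[OF u(1)])
  define U where "U x = indicator \<Omega> x *\<^sub>R u x" for x
  define g where "g x = indicator \<Omega> x *\<^sub>R grad u x" for x
  have Um [measurable]: "U \<in> borel_measurable borel" unfolding U_def by (rule borel_measurable_continuous_on_indicator[OF Om uc])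
  have gm [measurable]: "g \<in> borel_measurable borel" unfolding g_def by (rule borel_measurable_continuous_on_indicator[OF Om gc])
  have Ui: "integrable lborel U" by (rule integrable_bounded_on[OF Om fin, where c=B]) (use u(2) in \<open>auto simp: U_def indicator_def\<close>)
  have gi: "integrable lborel g" by (rule integrable_bounded_on[OF Om fin, where c=G]) (use G in \<open>auto simp: g_def indicator_def\<close>)
  have ui: "set_integrable lebesgue \<Omega> u"
    using Ui unfolding set_integrable_def U_def by (subst integrable_completion) auto
  \<comment> \<open>Lebesgue measure restricted to \<Omega>, because
    \<open>is_derivative_measure\<close> asks for a finite measure on all Borel sets.\<close>
  define \<mu> where "\<mu> = density lborel (\<lambda>x. ennreal (indicator \<Omega> x))"
  have \<mu>s: "sets \<mu> = sets borel" by (simp add: \<mu>_def)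
  note \<mu>int = integral_density_indicator[OF Om, folded \<mu>_def]
  have dm: "is_derivative_measure \<Omega> u (\<lambda>B. LINT x:B|\<mu>. g x)"
    unfolding is_derivative_measure_def
  proof (intro exI[of _ \<mu>] exI[of _ g] conjI ballI allI impI refl)
    show "sets \<mu> = sets borel" by (rule \<mu>s)
    show "finite_measure \<mu>"
    proof
      have "emeasure \<mu> (space \<mu>) = emeasure lborel \<Omega>"
        unfolding \<mu>_def by (subst emeasure_density) (auto simp: ennreal_indicator)
      then show "emeasure \<mu> (space \<mu>) \<noteq> \<infinity>" using fin by simp
    qed
    have gg: "(\<lambda>x. indicator \<Omega> x *\<^sub>R g x) = g" by (auto simp: g_def indicator_def)
    have "integrable \<mu> g" unfolding \<mu>_def by (subst integrable_density) (auto simp: gg gi)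
    then show "set_integrable \<mu> \<Omega> g" by (simp add: set_integrable_def gg)
    fix \<phi> :: "'a \<Rightarrow> 'a" assume tf: "test_field \<Omega> \<phi>"
    have \<phi>c: "continuous_on UNIV \<phi>" using tf by (rule test_fieldE)
    have divc: "continuous_on UNIV (divergence \<phi>)" using tf by (rule test_fieldE)
    have \<phi>m [measurable]: "\<phi> \<in> borel_measurable borel" "divergence \<phi> \<in> borel_measurable borel"
      using \<phi>c divc by (auto intro: borel_measurable_continuous_onI)
    have "(LINT x:\<Omega>|lebesgue. u x * divergence \<phi> x) = (LINT x|lebesgue. U x * divergence \<phi> x)"
      unfolding set_lebesgue_integral_def by (simp add: U_def mult.assoc)
    also have "\<dots> = (LINT x|lborel. U x * divergence \<phi> x)" by (rule integral_completion) simp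
    also have "\<dots> = (LINT x:\<Omega>|lborel. u x * divergence \<phi> x)"
      unfolding set_lebesgue_integral_def by (simp add: U_def mult.assoc)
    also have "\<dots> = - (LINT x:\<Omega>|lborel. \<phi> x \<bullet> grad u x)"
      by (rule integration_by_parts(3)[OF \<Omega>(1) tf], erule D) (rule gc)
    also have "(LINT x:\<Omega>|lborel. \<phi> x \<bullet> grad u x) = (LINT x:\<Omega>|\<mu>. \<phi> x \<bullet> g x)"
    proof -
      have "(LINT x:\<Omega>|\<mu>. \<phi> x \<bullet> g x) = (\<integral>x. indicator \<Omega> x *\<^sub>R (indicator \<Omega> x *\<^sub>R (\<phi> x \<bullet> g x)) \<partial>lborel)"
        unfolding set_lebesgue_integral_def by (rule \<mu>int) simp
      also have "\<dots> = (LINT x:\<Omega>|lborel. \<phi> x \<bullet> grad u x)"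
        unfolding set_lebesgue_integral_def
        by (intro Bochner_Integration.integral_cong) (auto simp: g_def indicator_def)
      finally show ?thesis by simp
    qed
    finally show "(LINT x:\<Omega>|lebesgue. u x * divergence \<phi> x) = - (LINT x:\<Omega>|\<mu>. \<phi> x \<bullet> g x)" .
  qed
  then have bv: "u \<in> BV \<Omega>" using ui unfolding BV_def by blast
  have dm': "is_derivative_measure \<Omega> u (derivative_measure \<Omega> u)"
    unfolding derivative_measure_def by (rule someI[where P="is_derivative_measure \<Omega> u", OF dm])
  have DB: "derivative_measure \<Omega> u B = (LINT x:B|lborel. g x)" if B: "B \<in> sets borel" "B \<subseteq> \<Omega>" for B
  proof -
    have "derivative_measure \<Omega> u B = (LINT x:B|\<mu>. g x)"
      by (rule derivative_measure_unique[OF \<Omega> dm' dm B])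
    also have "\<dots> = (\<integral>x. indicator \<Omega> x *\<^sub>R (indicator B x *\<^sub>R g x) \<partial>lborel)"
      unfolding set_lebesgue_integral_def using B by (intro \<mu>int) auto
    also have "\<dots> = (LINT x:B|lborel. g x)"
      unfolding set_lebesgue_integral_def
      by (intro Bochner_Integration.integral_cong) (auto simp: g_def indicator_def)
    finally show ?thesis .
  qed
  have ac: "is_ac_density \<Omega> (derivative_measure \<Omega> u) (approx_grad \<Omega> u)"
    unfolding approx_grad_def by (rule someI_ex[OF ex_ac_density[OF \<Omega>(1) dm']])
  have ae: "AE x in lborel. x \<in> \<Omega> \<longrightarrow> approx_grad \<Omega> u x = g x"
    by (rule ac_density_unique[OF \<Omega>(1) ac gi _ DB]) (auto simp: g_def)
  have S: "singular_set \<Omega> u = {}"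
    using approx_limit_isCont[OF has_derivative_continuous[OF D]] unfolding singular_set_def by blast
  have DB': "derivative_measure \<Omega> u B = (LINT x:B|lebesgue. approx_grad \<Omega> u x)" if B: "B \<in> sets borel" "B \<subseteq> \<Omega>" for B
  proof -
    have si: "set_integrable lebesgue \<Omega> (approx_grad \<Omega> u)" using ac by (simp add: is_ac_density_def)
    obtain h where h: "integrable lborel h" "\<And>x. x \<notin> \<Omega> \<Longrightarrow> h x = 0" "AE x in lborel. x \<in> \<Omega> \<longrightarrow> approx_grad \<Omega> u x = h x"
      "\<And>B. B \<in> sets borel \<Longrightarrow> B \<subseteq> \<Omega> \<Longrightarrow> (LINT x:B|lebesgue. approx_grad \<Omega> u x) = (LINT x:B|lborel. h x)"
      by (rule set_integrable_lebesgue_borel_version[OF \<Omega>(1) si]) (rule that)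
    have "(LINT x:B|lborel. h x) = (LINT x:B|lborel. g x)"
      unfolding set_lebesgue_integral_def
    proof (rule integral_cong_AE)
      show "AE x in lborel. indicator B x *\<^sub>R h x = indicator B x *\<^sub>R g x"
        using ae h(3) by eventually_elim (use B in \<open>auto simp: indicator_def\<close>)
      show "(\<lambda>x. indicator B x *\<^sub>R h x) \<in> borel_measurable lborel" "(\<lambda>x. indicator B x *\<^sub>R g x) \<in> borel_measurable lborel"
        using B borel_measurable_integrable[OF h(1)] gm by (intro borel_measurable_scaleR borel_measurable_indicator; simp)+
    qed
    then show ?thesis using DB[OF B] h(4)[OF B] by simp
  qed
  show "u \<in> SBV \<Omega>"
    unfolding SBV_def using bv DB' by (auto simp: S set_integrable_def set_lebesgue_integral_def)
  show "mumford_shah0 \<Omega> u = (\<integral>\<^sup>+ x \<in> \<Omega>. ennreal ((norm (grad u x))\<^sup>2) \<partial>lborel)"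
    unfolding mumford_shah0_def S nn_integral_completion hausdorff_outer_empty add_0_right
  proof (rule nn_integral_cong_AE)
    show "AE x in lborel. ennreal ((norm (approx_grad \<Omega> u x))\<^sup>2) * indicator \<Omega> x = ennreal ((norm (grad u x))\<^sup>2) * indicator \<Omega> x"
      using ae by eventually_elim (auto simp: g_def indicator_def)
  qed
qed

subsection \<open>The minimality inequality\<close>

text \<open>The slope \<open>\<theta>\<close> is a trapezoid: 1 on \<open>[0, l]\<close> with linear
  ramps of width \<open>\<delta>\<close> on both sides, hence of area \<open>l + \<delta>\<close>.
  The offset \<open>\<delta> / 2\<close> is the area of the left ramp.\<close>

lemma ex_smooth_truncation:
  fixes l \<delta> :: real
  assumes l: "0 \<le> l" and \<delta>: "0 < \<delta>"
  obtains T \<theta> where "\<And>s. (T has_real_derivative \<theta> s) (at s)" "continuous_on UNIV \<theta>"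
    "\<And>s. 0 \<le> \<theta> s" "\<And>s. \<theta> s \<le> 1" "\<And>a b. \<bar>T b - T a\<bar> \<le> l + \<delta>"
    "\<And>s. 0 \<le> s \<Longrightarrow> s \<le> l \<Longrightarrow> T s = s + \<delta> / 2"
proof -
  \<comment> \<open>An antiderivative of the positive part; four shifted copies of it combine to an
    antiderivative of the trapezoid.\<close>
  define Q where "Q s = (max 0 s)\<^sup>2 / 2" for s :: real
  have Q': "(Q has_real_derivative max 0 s) (at s)" for s
  proof -
    have sq: "((\<lambda>s. (max 0 s)\<^sup>2) has_real_derivative 2 * max 0 s) (at s)" by (rule DERIV_max_0_squared)
    show ?thesis unfolding Q_def using DERIV_cdivide[OF sq, of 2] by simp
  qed
  define T where "T s = (Q (s + \<delta>) - Q s - Q (s - l) + Q (s - l - \<delta>)) / \<delta>" for s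
  define \<theta> where "\<theta> s = (max 0 (s + \<delta>) - max 0 s - max 0 (s - l) + max 0 (s - l - \<delta>)) / \<delta>" for s
  have Qs: "((\<lambda>s. Q (s + c)) has_real_derivative max 0 (s + c)) (at s)" for s c
    using DERIV_shift[of Q "max 0 (s + c)" s c] Q'[of "s + c"] by simp
  have D: "(T has_real_derivative \<theta> s) (at s)" for s
  proof -
    have "((\<lambda>s. (Q (s + \<delta>) - Q (s + 0) - Q (s + (- l)) + Q (s + (- l - \<delta>))) / \<delta>) has_real_derivative
      (max 0 (s + \<delta>) - max 0 (s + 0) - max 0 (s + (- l)) + max 0 (s + (- l - \<delta>))) / \<delta>) (at s)"
      by (intro DERIV_cdivide DERIV_add DERIV_diff Qs)
    then show ?thesis unfolding T_def[abs_def] \<theta>_def by (simp add: algebra_simps)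
  qed
  have \<theta>c: "continuous_on UNIV \<theta>" unfolding \<theta>_def[abs_def] using \<delta> by (intro continuous_intros) auto
  have \<theta>0: "0 \<le> \<theta> s" for s unfolding \<theta>_def using l \<delta> by (intro divide_nonneg_pos) (auto simp: max_def)
  have \<theta>1: "\<theta> s \<le> 1" for s unfolding \<theta>_def using l \<delta> by (subst divide_le_eq_1_pos) (auto simp: max_def)
  have mono: "a \<le> b \<Longrightarrow> T a \<le> T b" for a b
    by (rule DERIV_nonneg_imp_nondecreasing) (use D \<theta>0 in blast)+
  have lo: "T s = 0" if "s \<le> - \<delta>" for s using that l \<delta> by (simp add: T_def Q_def)
  have hi: "T s = l + \<delta>" if "s \<ge> l + \<delta>" for s
  proof -
    have "T s = ((s + \<delta>)\<^sup>2 / 2 - s\<^sup>2 / 2 - (s - l)\<^sup>2 / 2 + (s - l - \<delta>)\<^sup>2 / 2) / \<delta>"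
      using that l \<delta> by (simp add: T_def Q_def)
    also have "\<dots> = l + \<delta>" using \<delta> by (simp add: field_simps power2_eq_square)
    finally show ?thesis .
  qed
  have T0: "0 \<le> T s" for s using mono[of "min s (- \<delta>)" s] lo[of "min s (- \<delta>)"] by simp
  have T1: "T s \<le> l + \<delta>" for s using mono[of s "max s (l + \<delta>)"] hi[of "max s (l + \<delta>)"] by simp
  have Tb: "\<bar>T b - T a\<bar> \<le> l + \<delta>" for a b using T0[of a] T0[of b] T1[of a] T1[of b] by linarith
  have Tm: "T s = s + \<delta> / 2" if "0 \<le> s" "s \<le> l" for s
  proof -
    have "T s = ((s + \<delta>)\<^sup>2 / 2 - s\<^sup>2 / 2) / \<delta>" using that l \<delta> by (simp add: T_def Q_def)
    also have "\<dots> = s + \<delta> / 2" using \<delta> by (simp add: field_simps power2_eq_square)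
    finally show ?thesis .
  qed
  show thesis by (rule that[OF D \<theta>c \<theta>0 \<theta>1 Tb Tm])
qed

text \<open>Brings membership in \<open>SBV\<close> into the form consumed by
  \<open>sbv_chain_rule\<close>. The set where \<open>J\<close> is nonzero is Borel, while nothing
  is proved about measurability of the singular set; the inclusion and monotonicity of the outer
  measure suffice for comparison with the functional.\<close>

lemma sbv_borel_representation:
  fixes \<Omega> :: "'a::euclidean_space set"
  assumes \<Omega>: "open \<Omega>" and v: "v \<in> SBV \<Omega>"
  obtains v' \<mu> F g J where
    "integrable lborel v'" "\<And>x. x \<notin> \<Omega> \<Longrightarrow> v' x = 0" "AE x in lborel. x \<in> \<Omega> \<longrightarrow> v x = v' x"
    "sets \<mu> = sets borel" "finite_measure \<mu>" "integrable \<mu> F"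
    "\<And>\<phi>. test_field \<Omega> \<phi> \<Longrightarrow> (LINT x:\<Omega>|lborel. v' x * divergence \<phi> x) = - (\<integral>x. \<phi> x \<bullet> F x \<partial>\<mu>)"
    "integrable lborel g" "\<And>x. x \<notin> \<Omega> \<Longrightarrow> g x = 0" "AE x in lborel. x \<in> \<Omega> \<longrightarrow> approx_grad \<Omega> v x = g x"
    "integrable (hausdorff_measure (DIM('a) - 1)) J"
    "\<And>B. B \<in> sets borel \<Longrightarrow> (LINT x:B|\<mu>. F x) = (LINT x:B|lborel. g x) + (LINT x:B|hausdorff_measure (DIM('a) - 1). J x)"
    "AE y in hausdorff_measure (DIM('a) - 1). J y \<noteq> 0 \<longrightarrow> (\<exists>p m \<nu>. y \<in> \<Omega> \<and> has_jump_profile v' y p m \<nu> \<and> J y = (p - m) *\<^sub>R \<nu>)"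
    "{y. J y \<noteq> 0} \<subseteq> singular_set \<Omega> v"
proof -
  let ?H = "hausdorff_measure (DIM('a) - 1) :: 'a measure" and ?S = "singular_set \<Omega> v"
  have Om: "\<Omega> \<in> sets borel" using \<Omega> by simp
  have bv: "v \<in> BV \<Omega>" using v by (simp add: SBV_def)
  obtain p m \<nu> where
    lim: "AE x in ?H. x \<in> ?S \<longrightarrow> one_sided_limits v x (p x) (m x) (\<nu> x)" and
    Ji: "set_integrable ?H ?S (\<lambda>x. (p x - m x) *\<^sub>R \<nu> x)" and
    DB: "\<And>B. B \<in> sets borel \<Longrightarrow> B \<subseteq> \<Omega> \<Longrightarrow> derivative_measure \<Omega> v B =
          (LINT x:B|lebesgue. approx_grad \<Omega> v x) + (LINT x:(B \<inter> ?S)|?H. (p x - m x) *\<^sub>R \<nu> x)"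
    using v unfolding SBV_def mem_Collect_eq by (elim conjE exE) (rule that, auto)
  have vi: "set_integrable lebesgue \<Omega> v" and ex: "\<exists>D. is_derivative_measure \<Omega> v D" using bv by (auto simp: BV_def)
  have dm: "is_derivative_measure \<Omega> v (derivative_measure \<Omega> v)"
    unfolding derivative_measure_def by (rule someI_ex[OF ex])
  have ac: "is_ac_density \<Omega> (derivative_measure \<Omega> v) (approx_grad \<Omega> v)"
    unfolding approx_grad_def by (rule someI_ex[OF ex_ac_density[OF \<Omega> dm]])
  obtain v' where v': "integrable lborel v'" "\<And>x. x \<notin> \<Omega> \<Longrightarrow> v' x = 0" "AE x in lborel. x \<in> \<Omega> \<longrightarrow> v x = v' x"
    "\<And>B. B \<in> sets borel \<Longrightarrow> B \<subseteq> \<Omega> \<Longrightarrow> (LINT x:B|lebesgue. v x) = (LINT x:B|lborel. v' x)"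
    by (rule set_integrable_lebesgue_borel_version[OF \<Omega> vi]) (rule that)
  have gsi: "set_integrable lebesgue \<Omega> (approx_grad \<Omega> v)" using ac by (simp add: is_ac_density_def)
  obtain g where g: "integrable lborel g" "\<And>x. x \<notin> \<Omega> \<Longrightarrow> g x = 0" "AE x in lborel. x \<in> \<Omega> \<longrightarrow> approx_grad \<Omega> v x = g x"
    "\<And>B. B \<in> sets borel \<Longrightarrow> B \<subseteq> \<Omega> \<Longrightarrow> (LINT x:B|lebesgue. approx_grad \<Omega> v x) = (LINT x:B|lborel. g x)"
    by (rule set_integrable_lebesgue_borel_version[OF \<Omega> gsi]) (rule that)
  obtain \<mu> \<sigma> where \<mu>: "sets \<mu> = sets borel" "finite_measure \<mu>" and \<sigma>: "set_integrable \<mu> \<Omega> \<sigma>"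
    and DB': "\<And>B. B \<in> sets borel \<Longrightarrow> B \<subseteq> \<Omega> \<Longrightarrow> derivative_measure \<Omega> v B = (LINT x:B|\<mu>. \<sigma> x)"
    and I: "\<And>\<phi>. test_field \<Omega> \<phi> \<Longrightarrow> (LINT x:\<Omega>|lebesgue. v x * divergence \<phi> x) = - (LINT x:\<Omega>|\<mu>. \<phi> x \<bullet> \<sigma> x)"
    by (rule is_derivative_measureE[OF dm]) (rule that)
  define F where "F x = indicator \<Omega> x *\<^sub>R \<sigma> x" for x
  define J where "J x = indicator ?S x *\<^sub>R ((p x - m x) *\<^sub>R \<nu> x)" for x
  have F: "integrable \<mu> F" using \<sigma> by (simp add: set_integrable_def F_def[abs_def])
  have J: "integrable ?H J" using Ji by (simp add: set_integrable_def J_def[abs_def])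
  have SO: "?S \<subseteq> \<Omega>" by (auto simp: singular_set_def)
  have rep: "(LINT x:\<Omega>|lborel. v' x * divergence \<phi> x) = - (\<integral>x. \<phi> x \<bullet> F x \<partial>\<mu>)" if tf: "test_field \<Omega> \<phi>" for \<phi>
  proof -
    have divc: "continuous_on UNIV (divergence \<phi>)" using tf by (rule test_fieldE)
    have divm: "divergence \<phi> \<in> borel_measurable borel" by (rule borel_measurable_continuous_onI[OF divc])
    have v'm: "v' \<in> borel_measurable borel" using v'(1) by auto
    have "(LINT x:\<Omega>|lebesgue. v x * divergence \<phi> x) = (LINT x|lebesgue. (indicator \<Omega> x *\<^sub>R v x) * divergence \<phi> x)"
      unfolding set_lebesgue_integral_def by (simp add: mult.assoc)
    also have "\<dots> = (LINT x|lebesgue. v' x * divergence \<phi> x)"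
    proof (rule integral_cong_AE)
      show "AE x in lebesgue. (indicator \<Omega> x *\<^sub>R v x) * divergence \<phi> x = v' x * divergence \<phi> x"
        using AE_completion[OF v'(3)] by eventually_elim (auto simp: indicator_def v'(2))
      have "(\<lambda>x. indicator \<Omega> x *\<^sub>R v x) \<in> borel_measurable lebesgue"
        using vi unfolding set_integrable_def by (rule borel_measurable_integrable)
      then show "(\<lambda>x. (indicator \<Omega> x *\<^sub>R v x) * divergence \<phi> x) \<in> borel_measurable lebesgue"
        by (rule borel_measurable_times) (use divm in \<open>simp add: measurable_completion\<close>)
      show "(\<lambda>x. v' x * divergence \<phi> x) \<in> borel_measurable lebesgue"
        using v'm divm by (intro measurable_completion) simp
    qed
    also have "\<dots> = (LINT x|lborel. v' x * divergence \<phi> x)" using v'm divm by (intro integral_completion) simp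
    also have "\<dots> = (LINT x:\<Omega>|lborel. v' x * divergence \<phi> x)"
      unfolding set_lebesgue_integral_def
      by (intro Bochner_Integration.integral_cong) (auto simp: indicator_def v'(2))
    finally have "(LINT x:\<Omega>|lborel. v' x * divergence \<phi> x) = - (LINT x:\<Omega>|\<mu>. \<phi> x \<bullet> \<sigma> x)" using I[OF tf] by simp
    also have "(LINT x:\<Omega>|\<mu>. \<phi> x \<bullet> \<sigma> x) = (\<integral>x. \<phi> x \<bullet> F x \<partial>\<mu>)"
      unfolding set_lebesgue_integral_def F_def by simp
    finally show ?thesis .
  qed
  have eq: "(LINT x:B|\<mu>. F x) = (LINT x:B|lborel. g x) + (LINT x:B|?H. J x)" if B: "B \<in> sets borel" for B
  proof -
    have BO: "B \<inter> \<Omega> \<in> sets borel" "B \<inter> \<Omega> \<subseteq> \<Omega>" using B Om by auto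
    have "(LINT x:B|\<mu>. F x) = (LINT x:B \<inter> \<Omega>|\<mu>. \<sigma> x)"
      unfolding set_lebesgue_integral_def F_def by (intro Bochner_Integration.integral_cong) (auto simp: indicator_def)
    also have "\<dots> = (LINT x:B \<inter> \<Omega>|lborel. g x) + (LINT x:(B \<inter> \<Omega> \<inter> ?S)|?H. (p x - m x) *\<^sub>R \<nu> x)"
      using DB'[OF BO] DB[OF BO] g(4)[OF BO] by simp
    also have "(LINT x:B \<inter> \<Omega>|lborel. g x) = (LINT x:B|lborel. g x)"
      unfolding set_lebesgue_integral_def by (intro Bochner_Integration.integral_cong) (use g(2) in \<open>force simp: indicator_def\<close>)+
    also have "(LINT x:(B \<inter> \<Omega> \<inter> ?S)|?H. (p x - m x) *\<^sub>R \<nu> x) = (LINT x:B|?H. J x)"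
      unfolding set_lebesgue_integral_def J_def
      by (intro Bochner_Integration.integral_cong) (use SO in \<open>auto simp: indicator_def\<close>)
    finally show ?thesis .
  qed
  have jump: "AE y in ?H. J y \<noteq> 0 \<longrightarrow> (\<exists>p m \<nu>. y \<in> \<Omega> \<and> has_jump_profile v' y p m \<nu> \<and> J y = (p - m) *\<^sub>R \<nu>)"
    using lim
  proof eventually_elim
    case (elim y)
    show ?case
    proof
      assume "J y \<noteq> 0"
      then have y: "y \<in> ?S" by (auto simp: J_def indicator_def split: if_splits)
      then have yO: "y \<in> \<Omega>" using SO by blast
      have "approx_limit_within v S y a \<longleftrightarrow> approx_limit_within v' S y a" for S a
        by (rule approx_limit_within_cong_AE[OF v'(3) eventually_ball_subset[OF \<Omega> yO]])
      then have "one_sided_limits v' y (p y) (m y) (\<nu> y)"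
        using elim y by (simp add: one_sided_limits_def)
      from one_sided_limits_imp_has_jump_profile[OF v'(1) this] yO y
      show "\<exists>p m \<nu>. y \<in> \<Omega> \<and> has_jump_profile v' y p m \<nu> \<and> J y = (p - m) *\<^sub>R \<nu>"
        by (intro exI[of _ "p y"] exI[of _ "m y"] exI[of _ "\<nu> y"]) (simp add: J_def)
    qed
  qed
  have sub: "{y. J y \<noteq> 0} \<subseteq> ?S" by (auto simp: J_def indicator_def split: if_splits)
  show thesis by (rule that[OF v'(1,2,3) \<mu> F rep g(1,2,3) J eq jump sub])
qed

text \<open>The segment from \<open>x\<close> to a nearest point of the complement crosses the
  boundary.\<close>

lemma infdist_frontier_le_infdist_Compl:
  fixes \<Omega> :: "'a::euclidean_space set"
  assumes "open \<Omega>" "bounded \<Omega>" "x \<in> \<Omega>"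
  shows "infdist x (frontier \<Omega>) \<le> infdist x (- \<Omega>)"
proof -
  have ne: "- \<Omega> \<noteq> {}"
  proof
    assume "- \<Omega> = {}"
    then have "\<Omega> = UNIV" by auto
    then show False using assms(2) not_bounded_UNIV by simp
  qed
  obtain z where z: "z \<in> - \<Omega>" "infdist x (- \<Omega>) = dist x z"
    using assms(1) by (rule infdist_attains_inf[OF closed_Compl ne])
  have "closed_segment x z \<inter> frontier \<Omega> \<noteq> {}"
    by (rule connected_Int_frontier) (use assms z in auto)
  then obtain w where w: "w \<in> closed_segment x z" "w \<in> frontier \<Omega>" by auto
  have "infdist x (frontier \<Omega>) \<le> dist x w" by (rule infdist_le[OF w(2)])
  also have "\<dots> \<le> dist x z" using segment_bound(1)[OF w(1)] by (simp add: dist_norm norm_minus_commute)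
  finally show ?thesis using z by simp
qed

lemma AE_hausdorff_measureE:
  assumes "AE x in hausdorff_measure k. P x"
  obtains N where "hausdorff_outer k N = 0" "\<And>x. x \<notin> N \<Longrightarrow> P x"
proof -
  from AE_E[OF assms] obtain N where N: "{x \<in> space (hausdorff_measure k). \<not> P x} \<subseteq> N"
    "emeasure (hausdorff_measure k) N = 0" "N \<in> sets (hausdorff_measure k)" by blast
  have "hausdorff_outer k N = 0" using N emeasure_hausdorff_measure[of N k] by simp
  then show thesis using N(1) by (intro that[of N]) auto
qed

text \<open>Triangle inequality through the common trace value \<open>a\<close>.\<close>

lemma trace_difference_limit:
  fixes u v :: "'a::euclidean_space \<Rightarrow> real"
  assumes [measurable]: "u \<in> borel_measurable borel" "v \<in> borel_measurable borel" "\<Omega> \<in> sets borel"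
    and lim: "approx_limit_within u \<Omega> z a" "approx_limit_within v \<Omega> z a"
    and W: "\<And>y. y \<in> \<Omega> \<Longrightarrow> W y \<le> ennreal \<bar>v y - u y\<bar>" "\<And>y. y \<notin> \<Omega> \<Longrightarrow> W y = 0"
  shows "((\<lambda>\<rho>. (\<integral>\<^sup>+ y \<in> ball z \<rho>. W y \<partial>lborel) / ennreal (\<rho> ^ DIM('a))) \<longlongrightarrow> 0) (at_right 0)"
proof (rule tendsto_sandwich[OF _ _ tendsto_const])
  let ?I = "\<lambda>w \<rho>. (\<integral>\<^sup>+ y \<in> ball z \<rho> \<inter> \<Omega>. ennreal \<bar>w y - a\<bar> \<partial>lborel)"
  have "((\<lambda>\<rho>. ?I v \<rho> / ennreal (\<rho> ^ DIM('a)) + ?I u \<rho> / ennreal (\<rho> ^ DIM('a))) \<longlongrightarrow> 0 + 0) (at_right 0)"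
    using lim unfolding approx_limit_within_def nn_integral_completion by (intro tendsto_add)
  then show "((\<lambda>\<rho>. ?I v \<rho> / ennreal (\<rho> ^ DIM('a)) + ?I u \<rho> / ennreal (\<rho> ^ DIM('a))) \<longlongrightarrow> 0) (at_right 0)" by simp
  have "(\<integral>\<^sup>+ y \<in> ball z \<rho>. W y \<partial>lborel) / ennreal (\<rho> ^ DIM('a)) \<le> ?I v \<rho> / ennreal (\<rho> ^ DIM('a)) + ?I u \<rho> / ennreal (\<rho> ^ DIM('a))" for \<rho>
  proof -
    have [measurable]: "ball z \<rho> \<in> sets borel" by simp
    have "(\<integral>\<^sup>+ y \<in> ball z \<rho>. W y \<partial>lborel) \<le> (\<integral>\<^sup>+ y. (ennreal \<bar>v y - a\<bar> * indicator (ball z \<rho> \<inter> \<Omega>) y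
        + ennreal \<bar>u y - a\<bar> * indicator (ball z \<rho> \<inter> \<Omega>) y) \<partial>lborel)"
    proof (intro nn_integral_mono)
      fix y
      have "ennreal \<bar>v y - u y\<bar> \<le> ennreal (\<bar>v y - a\<bar> + \<bar>u y - a\<bar>)" by (rule ennreal_leI) linarith
      also have "\<dots> = ennreal \<bar>v y - a\<bar> + ennreal \<bar>u y - a\<bar>" by (rule ennreal_plus) auto
      finally have "ennreal \<bar>v y - u y\<bar> \<le> ennreal \<bar>v y - a\<bar> + ennreal \<bar>u y - a\<bar>" .
      then show "W y * indicator (ball z \<rho>) y \<le> ennreal \<bar>v y - a\<bar> * indicator (ball z \<rho> \<inter> \<Omega>) y
        + ennreal \<bar>u y - a\<bar> * indicator (ball z \<rho> \<inter> \<Omega>) y"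
        using W(1)[of y] W(2)[of y] order_trans by (cases "y \<in> \<Omega>") (auto simp: indicator_def)
    qed
    also have "\<dots> = ?I v \<rho> + ?I u \<rho>" by (rule nn_integral_add) measurable
    finally show ?thesis unfolding add_divide_distrib_ennreal[symmetric] by (rule divide_right_mono_ennreal)
  qed
  then show "\<forall>\<^sub>F \<rho> in at_right 0. (\<integral>\<^sup>+ y \<in> ball z \<rho>. W y \<partial>lborel) / ennreal (\<rho> ^ DIM('a))
      \<le> ?I v \<rho> / ennreal (\<rho> ^ DIM('a)) + ?I u \<rho> / ennreal (\<rho> ^ DIM('a))" by simp
qed simp

text \<open>The calibrating field is \<open>\<psi> (2 \<nabla>u)\<close>, with a cutoff \<open>\<psi>\<close>, tested against the truncation of
  \<open>v - (u + m) / 2\<close> to an interval of length \<open>(M - m) / 2\<close>.\<close>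

lemma dirichlet_energy_le:
  fixes \<Omega> :: "'a::euclidean_space set" and u v :: "'a \<Rightarrow> real"
  assumes \<Omega>: "open \<Omega>" "bounded \<Omega>" "lipschitz_boundary \<Omega>" "\<Omega> \<noteq> {}"
    and u: "harmonic_on \<Omega> u" "\<And>x. x \<in> \<Omega> \<Longrightarrow> m \<le> u x" "\<And>x. x \<in> \<Omega> \<Longrightarrow> u x \<le> M"
    and G: "\<And>x. x \<in> \<Omega> \<Longrightarrow> norm (grad u x) \<le> G" and MG: "(M - m) * G \<le> 1"
    and v: "v \<in> SBV \<Omega>" and tr: "same_trace \<Omega> u v"
  shows "(\<integral>\<^sup>+ x \<in> \<Omega>. ennreal ((norm (grad u x))\<^sup>2) \<partial>lborel) \<le> mumford_shah0 \<Omega> v"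
proof (cases "mumford_shah0 \<Omega> v = \<infinity>")
  case False
  let ?H = "hausdorff_measure (DIM('a) - 1) :: 'a measure"
  obtain x0 where x0: "x0 \<in> \<Omega>" using \<Omega>(4) by auto
  have G0: "G \<ge> 0" using G[OF x0] norm_ge_zero order_trans by blast
  define l where "l = (M - m) / 2"
  have l: "l \<ge> 0" using u(2,3)[OF x0] by (simp add: l_def)
  have Om [measurable]: "\<Omega> \<in> sets borel" using \<Omega> by simp
  have uC1: "C1_on \<Omega> u" and gC1: "C1_on \<Omega> (grad u)" and div0: "\<And>x. x \<in> \<Omega> \<Longrightarrow> divergence (grad u) x = 0"
    using u(1) by (auto simp: harmonic_on_def)
  have Du: "x \<in> \<Omega> \<Longrightarrow> (u has_derivative (\<lambda>h. h \<bullet> grad u x)) (at x)" for x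
    using uC1 by (intro has_derivative_grad) (simp add: C1_on_def)
  have uc: "continuous_on \<Omega> u" by (intro continuous_at_imp_continuous_on ballI has_derivative_continuous[OF Du])
  have gc: "continuous_on \<Omega> (grad u)" by (rule C1_on_grad[OF uC1])
  have Um: "(\<lambda>x. indicator \<Omega> x *\<^sub>R u x) \<in> borel_measurable borel" by (rule borel_measurable_continuous_on_indicator[OF Om uc])
  have gum: "(\<lambda>x. indicator \<Omega> x *\<^sub>R grad u x) \<in> borel_measurable borel" by (rule borel_measurable_continuous_on_indicator[OF Om gc])
  define U where "U x = indicator \<Omega> x *\<^sub>R u x" for x
  define gu where "gu x = indicator \<Omega> x *\<^sub>R grad u x" for x
  have [measurable]: "U \<in> borel_measurable borel" "gu \<in> borel_measurable borel" using Um gum by (simp_all add: U_def[abs_def] gu_def[abs_def])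
  have U_in: "x \<in> \<Omega> \<Longrightarrow> U x = u x" and gu_in: "x \<in> \<Omega> \<Longrightarrow> gu x = grad u x" for x by (simp_all add: U_def gu_def)
  have finO: "emeasure lborel \<Omega> < \<infinity>" using \<Omega>(2) by (rule emeasure_bounded_finite)

  \<comment> \<open>Borel data of the competitor\<close>
  obtain v' \<mu> F g J where
    v': "integrable lborel v'" "\<And>x. x \<notin> \<Omega> \<Longrightarrow> v' x = 0" "AE x in lborel. x \<in> \<Omega> \<longrightarrow> v x = v' x" and
    \<mu>: "sets \<mu> = sets borel" "finite_measure \<mu>" and F: "integrable \<mu> F" and
    rep: "\<And>\<phi>. test_field \<Omega> \<phi> \<Longrightarrow> (LINT x:\<Omega>|lborel. v' x * divergence \<phi> x) = - (\<integral>x. \<phi> x \<bullet> F x \<partial>\<mu>)" and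
    g: "integrable lborel g" "\<And>x. x \<notin> \<Omega> \<Longrightarrow> g x = 0" "AE x in lborel. x \<in> \<Omega> \<longrightarrow> approx_grad \<Omega> v x = g x" and
    J: "integrable ?H J" and
    eq: "\<And>B. B \<in> sets borel \<Longrightarrow> (LINT x:B|\<mu>. F x) = (LINT x:B|lborel. g x) + (LINT x:B|?H. J x)" and
    jump: "AE y in ?H. J y \<noteq> 0 \<longrightarrow> (\<exists>p m \<nu>. y \<in> \<Omega> \<and> has_jump_profile v' y p m \<nu> \<and> J y = (p - m) *\<^sub>R \<nu>)" and
    sub: "{y. J y \<noteq> 0} \<subseteq> singular_set \<Omega> v"
    by (rule sbv_borel_representation[OF \<Omega>(1) v]) (rule that)
  have v'm [measurable]: "v' \<in> borel_measurable borel" and gm [measurable]: "g \<in> borel_measurable borel" using v'(1) g(1) by auto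
  have MS: "mumford_shah0 \<Omega> v = (\<integral>\<^sup>+ x. ennreal ((norm (g x))\<^sup>2) \<partial>lborel) + hausdorff_outer (DIM('a) - 1) (singular_set \<Omega> v)"
    unfolding mumford_shah0_def nn_integral_completion
    by (intro arg_cong2[where f="(+)"] nn_integral_cong_AE refl, use g(3) in eventually_elim) (auto simp: indicator_def g(2))
  have g2: "integrable lborel (\<lambda>x. (norm (g x))\<^sup>2)"
    using False unfolding MS by (intro integrableI_bounded) (auto simp: less_top)
  have Jset: "{y. J y \<noteq> 0} \<in> sets borel"
    using measurable_sets[OF borel_measurable_integrable[OF J], of "- {0}"] by (simp add: vimage_def Compl_eq)
  have Hle: "emeasure ?H {y. J y \<noteq> 0} \<le> hausdorff_outer (DIM('a) - 1) (singular_set \<Omega> v)"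
    unfolding emeasure_hausdorff_measure[OF Jset] by (rule hausdorff_outer_mono[OF sub])
  have Hfin: "emeasure ?H {y. J y \<noteq> 0} \<noteq> \<infinity>"
    using Hle False unfolding MS by (auto simp: top_unique)
  define h where "h = measure ?H {y. J y \<noteq> 0}"
  have h0: "h \<ge> 0" by (simp add: h_def)
  define I where "I = (\<integral>x. (norm (g x))\<^sup>2 \<partial>lborel)"
  define P where "P = (\<integral>x. (norm (gu x))\<^sup>2 \<partial>lborel)"
  have gu2: "integrable lborel (\<lambda>x. (norm (gu x))\<^sup>2)"
  proof (rule integrable_bounded_on[OF Om finO, where c="G\<^sup>2"])
    show "norm ((norm (gu x))\<^sup>2) \<le> G\<^sup>2 * indicator \<Omega> x" for x
      by (auto simp: gu_def indicator_def intro!: power_mono G)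
  qed measurable

  \<comment> \<open>Common boundary values outside a null set\<close>
  obtain gt where gt: "is_trace \<Omega> u gt" "is_trace \<Omega> v gt" using tr by (auto simp: same_trace_def)
  have "AE x in ?H. x \<in> frontier \<Omega> \<longrightarrow> approx_limit_within u \<Omega> x (gt x) \<and> approx_limit_within v \<Omega> x (gt x)"
    using gt unfolding is_trace_def by eventually_elim auto
  then obtain N where N: "hausdorff_outer (DIM('a) - 1) N = 0"
    "\<And>x. x \<notin> N \<Longrightarrow> x \<in> frontier \<Omega> \<longrightarrow> approx_limit_within u \<Omega> x (gt x) \<and> approx_limit_within v \<Omega> x (gt x)"
    by (rule AE_hausdorff_measureE) (rule that)
  have ne: "frontier \<Omega> \<noteq> {}" using \<Omega>(2,4) by (auto simp: frontier_eq_empty)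
  \<comment> \<open>Its gradient \<open>C\<close> is half that of \<open>u\<close>; paired with
    \<open>2 *\<^sub>R grad u\<close> it produces the term \<open>|grad u|^2\<close> of the
    calibration inequality.\<close>
  define c where "c x = indicator \<Omega> x *\<^sub>R ((u x + m) / 2)" for x
  define C where "C x = (1/2) *\<^sub>R grad u x" for x
  have cm [measurable]: "c \<in> borel_measurable borel" unfolding c_def
    by (rule borel_measurable_continuous_on_indicator[OF Om]) (intro continuous_intros uc, simp)
  have Dc: "(c has_derivative (\<lambda>h. h \<bullet> C x)) (at x)" if "x \<in> \<Omega>" for x
  proof -
    have "((\<lambda>x. (u x + m) / 2) has_derivative (\<lambda>h. (h \<bullet> grad u x) / 2)) (at x)"
      using Du[OF that] by (auto intro!: derivative_eq_intros)
    then have "(c has_derivative (\<lambda>h. (h \<bullet> grad u x) / 2)) (at x)"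
      by (rule has_derivative_transform_within_open[OF _ \<Omega>(1) that]) (simp add: c_def)
    then show ?thesis by (simp add: C_def)
  qed
  have Cc: "continuous_on \<Omega> C" unfolding C_def by (intro continuous_intros gc)

  \<comment> \<open>Cutoffs and test fields\<close>
  define \<epsilon> where "\<epsilon> k = inverse (real (Suc k))" for k
  have \<epsilon>: "\<epsilon> k > 0" for k by (simp add: \<epsilon>_def)
  define C0 where "C0 = 16 * measure lborel (ball (0::'a) 1) / bump_mass TYPE('a)"
  have C0: "C0 \<ge> 0" using bump_mass_pos[where 'a='a] by (simp add: C0_def)
  have "\<exists>\<psi> Z. (\<forall>x. (\<psi> has_derivative (\<lambda>h. h \<bullet> Z x)) (at x)) \<and> continuous_on UNIV Z \<and>
    (\<forall>x. 0 \<le> \<psi> x \<and> \<psi> x \<le> 1 \<and> (infdist x (- \<Omega>) \<ge> \<epsilon> n \<longrightarrow> \<psi> x = 1) \<and> (infdist x (- \<Omega>) < \<epsilon> n / 4 \<longrightarrow> \<psi> x = 0) \<and>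
      norm (Z x) \<le> C0 / \<epsilon> n \<and> (infdist x (- \<Omega>) > \<epsilon> n \<longrightarrow> Z x = 0))" for n
    unfolding C0_def by (rule cutoff_function[OF \<Omega>(1,2) \<epsilon>[of n]]) blast
  then obtain \<psi> Z where \<psi>: "\<And>n x. (\<psi> n has_derivative (\<lambda>h. h \<bullet> Z n x)) (at x)" "\<And>n. continuous_on UNIV (Z n)"
    "\<And>n x. 0 \<le> \<psi> n x \<and> \<psi> n x \<le> 1 \<and> (infdist x (- \<Omega>) \<ge> \<epsilon> n \<longrightarrow> \<psi> n x = 1) \<and> (infdist x (- \<Omega>) < \<epsilon> n / 4 \<longrightarrow> \<psi> n x = 0) \<and>
      norm (Z n x) \<le> C0 / \<epsilon> n \<and> (infdist x (- \<Omega>) > \<epsilon> n \<longrightarrow> Z n x = 0)"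
    by metis
  define K where "K n = {x. \<epsilon> n / 4 \<le> infdist x (- \<Omega>)}" for n
  have K: "compact (K n)" "K n \<subseteq> \<Omega>" for n
    unfolding K_def using compact_infdist_ge[OF \<Omega>(1,2), of "\<epsilon> n / 4"] \<epsilon>[of n] by auto
  have K0: "\<psi> n x = 0" if "x \<notin> K n" for n x using that \<psi>(3)[of n x] by (simp add: K_def)
  have \<psi>m [measurable]: "\<psi> n \<in> borel_measurable borel" for n
    by (intro borel_measurable_continuous_onI continuous_at_imp_continuous_on ballI has_derivative_continuous[OF \<psi>(1)])
  define \<phi> where "\<phi> n x = \<psi> n x *\<^sub>R (2 *\<^sub>R grad u x)" for n x
  have F2: "C1_on \<Omega> (\<lambda>x. 2 *\<^sub>R grad u x)"
    by (rule C1_on_scaleR(1)[where f="\<lambda>_. 2" and Z="\<lambda>_. 0"]) (auto intro: gC1)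
  have F2div: "divergence (\<lambda>x. 2 *\<^sub>R grad u x) x = 0" if "x \<in> \<Omega>" for x
  proof -
    have "((\<lambda>x. 2 *\<^sub>R grad u x) has_derivative (\<lambda>h. 2 *\<^sub>R frechet_derivative (grad u) (at x) h)) (at x)"
      by (intro has_derivative_scaleR_right C1_onD[OF gC1 that])
    from divergence_eqI[OF this] show ?thesis using div0[OF that] by (simp add: divergence_def sum_distrib_left[symmetric])
  qed
  have tf: "test_field \<Omega> (\<phi> n)" for n
    unfolding \<phi>_def by (rule test_field_cutoff(1)[OF \<Omega>(1) F2 \<psi>(1) \<psi>(2) K]) (rule K0)
  have div\<phi>: "divergence (\<phi> n) x = Z n x \<bullet> (2 *\<^sub>R grad u x)" if "x \<in> \<Omega>" for n x
  proof -
    have "divergence (\<phi> n) x = \<psi> n x * divergence (\<lambda>x. 2 *\<^sub>R grad u x) x + Z n x \<bullet> (2 *\<^sub>R grad u x)"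
      unfolding \<phi>_def by (rule test_field_cutoff(2)[OF \<Omega>(1) F2 \<psi>(1) \<psi>(2) K K0 that])
    then show ?thesis using F2div[OF that] by simp
  qed
  have \<phi>B: "norm (\<phi> n x) \<le> 2 * G" for n x
  proof (cases "x \<in> \<Omega>")
    case True
    have "norm (\<phi> n x) \<le> 1 * (2 * G)" unfolding \<phi>_def norm_scaleR
      using \<psi>(3)[of n x] G[OF True] by (intro mult_mono) auto
    then show ?thesis by simp
  next
    case False
    then have "\<psi> n x = 0" using K(2) K0 by blast
    then show ?thesis using G0 by (simp add: \<phi>_def)
  qed
  have \<phi>gu: "\<phi> n x = (2 * \<psi> n x) *\<^sub>R gu x" for n x
    using K(2)[of n] K0[of x n] by (cases "x \<in> \<Omega>") (auto simp: \<phi>_def gu_def)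
  define Pn where "Pn n = (\<integral>x. \<psi> n x * (norm (gu x))\<^sup>2 \<partial>lborel)" for n
  have PnP: "Pn \<longlonglongrightarrow> P"
    unfolding Pn_def P_def
  proof (rule integral_dominated_convergence[where w="\<lambda>x. (norm (gu x))\<^sup>2"])
    show "AE x in lborel. (\<lambda>n. \<psi> n x * (norm (gu x))\<^sup>2) \<longlonglongrightarrow> (norm (gu x))\<^sup>2"
    proof (intro AE_I2)
      fix x
      show "(\<lambda>n. \<psi> n x * (norm (gu x))\<^sup>2) \<longlonglongrightarrow> (norm (gu x))\<^sup>2"
      proof (cases "x \<in> \<Omega>")
        case True
        have cl: "closed (- \<Omega>)" using \<Omega>(1) by (simp add: closed_Compl)
        have "- \<Omega> \<noteq> {}"
        proof
          assume "- \<Omega> = {}"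
          then have "\<Omega> = UNIV" by auto
          then show False using \<Omega>(2) not_bounded_UNIV by simp
        qed
        then have pos: "infdist x (- \<Omega>) > 0"
          using True infdist_nonneg[of x "- \<Omega>"] in_closed_iff_infdist_zero[OF cl, of x] by auto
        have "\<forall>\<^sub>F n in sequentially. \<epsilon> n < infdist x (- \<Omega>)"
          using LIMSEQ_inverse_real_of_nat pos unfolding \<epsilon>_def by (rule order_tendstoD)
        then have "\<forall>\<^sub>F n in sequentially. \<psi> n x * (norm (gu x))\<^sup>2 = (norm (gu x))\<^sup>2"
          by eventually_elim (use \<psi>(3) in auto)
        then show ?thesis by (rule tendsto_eventually)
      qed (simp add: gu_def)
    qed
    show "AE x in lborel. norm (\<psi> n x * (norm (gu x))\<^sup>2) \<le> (norm (gu x))\<^sup>2" for n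
      using \<psi>(3)[of n] by (intro AE_I2) (auto simp: abs_mult intro!: mult_left_le_one_le)
  qed (use gu2 in auto)

  \<comment> \<open>The energy inequality for a fixed smoothing parameter\<close>
  have key: "P \<le> (l + \<delta>) * (2 * G) * h + I" if \<delta>: "\<delta> > 0" for \<delta>
  proof -
    obtain T \<theta> where T: "\<And>s. (T has_real_derivative \<theta> s) (at s)" "continuous_on UNIV \<theta>"
      and \<theta>: "\<And>s. 0 \<le> \<theta> s" "\<And>s. \<theta> s \<le> 1" and Tl: "\<And>a b. \<bar>T b - T a\<bar> \<le> l + \<delta>"
      and Tm: "\<And>s. 0 \<le> s \<Longrightarrow> s \<le> l \<Longrightarrow> T s = s + \<delta> / 2"
      by (rule ex_smooth_truncation[OF l \<delta>]) (rule that)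
    have \<theta>abs: "\<bar>\<theta> s\<bar> \<le> 1" for s using \<theta>[of s] by simp
    have Tlip: "\<bar>T b - T a\<bar> \<le> \<bar>b - a\<bar>" for a b
    proof -
      have "norm (T b - T a) \<le> 1 * norm (b - a)"
      proof (rule differentiable_bound[where S=UNIV and f'="\<lambda>s h. h * \<theta> s"])
        show "(T has_derivative (\<lambda>h. h * \<theta> s)) (at s within UNIV)" for s
          using T(1)[of s] unfolding has_field_derivative_def by (simp add: mult_commute_abs)
        show "onorm (\<lambda>h. h * \<theta> s) \<le> 1" for s
          by (rule onorm_le) (use \<theta>abs[of s] in \<open>auto simp: abs_mult intro!: mult_left_le\<close>)
      qed auto
      then show ?thesis by simp
    qed
    have Tc: "continuous_on UNIV T" by (intro continuous_at_imp_continuous_on ballI DERIV_isCont[OF T(1)])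
    have [measurable]: "T \<in> borel_measurable borel" "\<theta> \<in> borel_measurable borel"
      using Tc T(2) by (auto intro: borel_measurable_continuous_onI)
    \<comment> \<open>Truncation makes this difference bounded, as \<open>boundary_layer\<close>
      requires, and the Lipschitz bound on \<open>T\<close> lets it inherit the vanishing trace
      difference of \<open>v'\<close> and \<open>U\<close>. The shift \<open>c\<close> cancels in
      that bound.\<close>
    define W where "W x = ennreal (indicator \<Omega> x * \<bar>T (v' x - c x) - T (U x - c x)\<bar>)" for x
    have Wm: "W \<in> borel_measurable borel" unfolding W_def[abs_def] by measurable
    have Wb: "W x \<le> ennreal (l + \<delta>)" for x unfolding W_def using Tl l \<delta> by (intro ennreal_leI) (auto simp: indicator_def)
    have lim: "((\<lambda>\<rho>. (\<integral>\<^sup>+ y \<in> ball z \<rho>. W y \<partial>lborel) / ennreal (\<rho> ^ DIM('a))) \<longlongrightarrow> 0) (at_right 0)"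
      if z: "z \<in> frontier \<Omega> - N" for z
    proof (rule trace_difference_limit[where u=U and v=v' and \<Omega>=\<Omega> and a="gt z"])
      have tru: "approx_limit_within u \<Omega> z (gt z)" and trv: "approx_limit_within v \<Omega> z (gt z)" using N(2)[of z] z by auto
      have ev: "\<forall>\<^sub>F r in at_right 0. ball z r \<inter> \<Omega> \<subseteq> \<Omega>" by simp
      show "approx_limit_within U \<Omega> z (gt z)"
        using tru approx_limit_within_cong_AE[of \<Omega> u U z \<Omega> "gt z", OF _ ev] by (simp add: U_in)
      show "approx_limit_within v' \<Omega> z (gt z)"
        using trv approx_limit_within_cong_AE[OF v'(3) ev] by simp
      show "W y \<le> ennreal \<bar>v' y - U y\<bar>" for y
        unfolding W_def using Tlip[of "v' y - c y" "U y - c y"] by (intro ennreal_leI) (auto simp: indicator_def)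
      show "y \<notin> \<Omega> \<Longrightarrow> W y = 0" for y by (simp add: W_def)
    qed (use Om in auto)
    \<comment> \<open>The width is doubled because the support of \<open>Z n\<close> is described by
      a weak inequality and the layer of \<open>boundary_layer\<close> by a strict one.\<close>
    define L where "L n = (\<integral>\<^sup>+ y \<in> {y. infdist y (frontier \<Omega>) < 2 * \<epsilon> n}. W y \<partial>lborel) / ennreal (2 * \<epsilon> n)" for n
    have "(\<lambda>n. 2 * \<epsilon> n) \<longlonglongrightarrow> 0"
      unfolding \<epsilon>_def using tendsto_mult_right_zero[OF LIMSEQ_inverse_real_of_nat] by simp
    then have L0: "L \<longlonglongrightarrow> 0" unfolding L_def
      using boundary_layer[OF \<Omega>(1,2,3) Wm Wb _ N(1) lim _ _ ne, of "\<lambda>n. 2 * \<epsilon> n"] \<epsilon> l \<delta> by simp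
    define a where "a n = (LINT x:\<Omega>|lborel. T (v' x - c x) * divergence (\<phi> n) x)" for n
    define b where "b n = (LINT x:\<Omega>|lborel. T (u x - c x) * divergence (\<phi> n) x)" for n
    \<comment> \<open>For \<open>u\<close> itself the shifted values stay in \<open>[0, l]\<close>,
      where \<open>T\<close> is a translation and the truncation is invisible.\<close>
    have TU: "T (u x - c x) = (u x - m) / 2 + \<delta> / 2" if "x \<in> \<Omega>" for x
    proof -
      have e: "u x - c x = (u x - m) / 2" using that by (simp add: c_def field_simps)
      show ?thesis unfolding e using u(2,3)[OF that] by (intro Tm) (auto simp: l_def)
    qed
    have bP: "b n = - Pn n" for n
    proof -
      have "b n = (LINT x:\<Omega>|lborel. ((u x - m) / 2 + \<delta> / 2) * divergence (\<phi> n) x)"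
        unfolding b_def set_lebesgue_integral_def
        by (intro Bochner_Integration.integral_cong) (auto simp: indicator_def TU)
      also have "\<dots> = - (LINT x:\<Omega>|lborel. \<phi> n x \<bullet> C x)"
      proof (rule integration_by_parts(3)[OF \<Omega>(1) tf _ Cc])
        show "x \<in> \<Omega> \<Longrightarrow> ((\<lambda>x. (u x - m) / 2 + \<delta> / 2) has_derivative (\<lambda>h. h \<bullet> C x)) (at x)" for x
          using Du[of x] unfolding C_def by (auto intro!: derivative_eq_intros)
      qed
      also have "(LINT x:\<Omega>|lborel. \<phi> n x \<bullet> C x) = Pn n"
        unfolding set_lebesgue_integral_def Pn_def
        by (intro Bochner_Integration.integral_cong) (auto simp: indicator_def \<phi>gu gu_def C_def power2_norm_eq_inner)
      finally show ?thesis .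
    qed
    have divint: "set_integrable lborel \<Omega> (divergence (\<phi> n))" for n
      using integration_by_parts(1)[OF \<Omega>(1) tf, of "\<lambda>_. 1" "\<lambda>_. 0" n] by simp
    have divm: "divergence (\<phi> n) \<in> borel_measurable borel" for n
    proof -
      have "continuous_on UNIV (divergence (\<phi> n))" using tf by (rule test_fieldE)
      then show ?thesis by (rule borel_measurable_continuous_onI)
    qed
    have Tb: "\<bar>T s\<bar> \<le> \<bar>T 0\<bar> + (l + \<delta>)" for s using Tl[of s 0] by linarith
    have Tint: "integrable lborel (\<lambda>x. (indicator \<Omega> x *\<^sub>R divergence (\<phi> n) x) *\<^sub>R T (w x))"
      if "w \<in> borel_measurable borel" for w n
    proof (rule integrable_mult_bounded[where f="\<lambda>x. indicator \<Omega> x *\<^sub>R divergence (\<phi> n) x" and g="\<lambda>x. T (w x)"])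
      show "integrable lborel (\<lambda>x. indicator \<Omega> x *\<^sub>R divergence (\<phi> n) x)"
        using divint[of n] by (simp only: set_integrable_def)
      show "(\<lambda>x. T (w x)) \<in> borel_measurable lborel" using that by measurable
      show "norm (T (w x)) \<le> \<bar>T 0\<bar> + (l + \<delta>)" for x using Tb by simp
    qed
    \<comment> \<open>The gradient of the cutoff costs \<open>1 / \<epsilon> n\<close>, which is
      exactly the normalisation under which the layer integral of \<open>W\<close> tends to
      zero.\<close>
    have ab: "ennreal \<bar>a n - b n\<bar> \<le> ennreal (4 * G * C0) * L n" for n
    proof -
      have eqab: "a n - b n = (\<integral>x. (indicator \<Omega> x *\<^sub>R divergence (\<phi> n) x) * (T (v' x - c x) - T (U x - c x)) \<partial>lborel)"
      proof -
        have "a n = (\<integral>x. (indicator \<Omega> x *\<^sub>R divergence (\<phi> n) x) *\<^sub>R T (v' x - c x) \<partial>lborel)"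
          unfolding a_def set_lebesgue_integral_def by (intro Bochner_Integration.integral_cong) auto
        moreover have "b n = (\<integral>x. (indicator \<Omega> x *\<^sub>R divergence (\<phi> n) x) *\<^sub>R T (U x - c x) \<partial>lborel)"
          unfolding b_def set_lebesgue_integral_def by (intro Bochner_Integration.integral_cong) (auto simp: indicator_def U_in)
        ultimately show ?thesis
          using Tint[of "\<lambda>x. v' x - c x" n] Tint[of "\<lambda>x. U x - c x" n] by (simp add: right_diff_distrib)
      qed
      have "integrable lborel (\<lambda>x. (indicator \<Omega> x *\<^sub>R divergence (\<phi> n) x) * (T (v' x - c x) - T (U x - c x)))"
        using Tint[of "\<lambda>x. v' x - c x" n] Tint[of "\<lambda>x. U x - c x" n] by (simp add: right_diff_distrib)
      from integral_norm_bound_ennreal[OF this]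
      have "ennreal \<bar>a n - b n\<bar> \<le> (\<integral>\<^sup>+ x. ennreal (norm ((indicator \<Omega> x *\<^sub>R divergence (\<phi> n) x) * (T (v' x - c x) - T (U x - c x)))) \<partial>lborel)"
        unfolding eqab real_norm_def .
      also have "\<dots> \<le> (\<integral>\<^sup>+ x. ennreal (2 * G * C0 / \<epsilon> n) * (W x * indicator {y. infdist y (frontier \<Omega>) < 2 * \<epsilon> n} x) \<partial>lborel)"
      proof (intro nn_integral_mono)
        fix x
        let ?t = "\<bar>T (v' x - c x) - T (U x - c x)\<bar>"
        show "ennreal (norm ((indicator \<Omega> x *\<^sub>R divergence (\<phi> n) x) * (T (v' x - c x) - T (U x - c x))))
          \<le> ennreal (2 * G * C0 / \<epsilon> n) * (W x * indicator {y. infdist y (frontier \<Omega>) < 2 * \<epsilon> n} x)"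
        proof (cases "x \<in> \<Omega> \<and> infdist x (- \<Omega>) \<le> \<epsilon> n")
          case True
          then have xO: "x \<in> \<Omega>" by simp
          have "infdist x (frontier \<Omega>) < 2 * \<epsilon> n"
            using infdist_frontier_le_infdist_Compl[OF \<Omega>(1,2) xO] True \<epsilon>[of n] by linarith
          moreover have "norm (divergence (\<phi> n) x * (T (v' x - c x) - T (U x - c x))) \<le> (2 * G * C0 / \<epsilon> n) * ?t"
          proof -
            have "\<bar>divergence (\<phi> n) x\<bar> \<le> norm (Z n x) * norm (2 *\<^sub>R grad u x)"
              unfolding div\<phi>[OF xO] by (rule Cauchy_Schwarz_ineq2)
            also have "\<dots> \<le> (C0 / \<epsilon> n) * (2 * G)" using \<psi>(3)[of n x] G[OF xO] C0 \<epsilon>[of n] by (intro mult_mono) auto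
            finally have "\<bar>divergence (\<phi> n) x\<bar> \<le> 2 * G * C0 / \<epsilon> n" by (simp add: mult_ac)
            then show ?thesis unfolding real_norm_def abs_mult by (rule mult_right_mono) simp
          qed
          moreover have "0 \<le> 2 * G * C0 / \<epsilon> n" using G0 C0 \<epsilon>[of n] by simp
          ultimately show ?thesis using xO by (simp add: W_def ennreal_mult[symmetric] ennreal_leI)
        next
          case False
          then have "x \<in> \<Omega> \<Longrightarrow> divergence (\<phi> n) x = 0" using div\<phi>[of x n] \<psi>(3)[of n x] by auto
          then show ?thesis by (cases "x \<in> \<Omega>") auto
        qed
      qed
      also have "\<dots> = ennreal (2 * G * C0 / \<epsilon> n) * (\<integral>\<^sup>+ y \<in> {y. infdist y (frontier \<Omega>) < 2 * \<epsilon> n}. W y \<partial>lborel)"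
      proof (rule nn_integral_cmult)
        have "{y. infdist y (frontier \<Omega>) < 2 * \<epsilon> n} \<in> sets borel"
          by (intro borel_open open_Collect_less continuous_intros)
        then show "(\<lambda>x. W x * indicator {y. infdist y (frontier \<Omega>) < 2 * \<epsilon> n} x) \<in> borel_measurable lborel"
          using Wm by (intro borel_measurable_times_ennreal borel_measurable_indicator) auto
      qed
      also have "\<dots> = ennreal (4 * G * C0) * L n"
      proof -
        have "ennreal (2 * G * C0 / \<epsilon> n) = ennreal (4 * G * C0) * inverse (ennreal (2 * \<epsilon> n))"
        proof -
          have "2 * G * C0 / \<epsilon> n = (4 * G * C0) * inverse (2 * \<epsilon> n)" using \<epsilon>[of n] by (simp add: field_simps)
          also have "ennreal \<dots> = ennreal (4 * G * C0) * ennreal (inverse (2 * \<epsilon> n))"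
            using G0 C0 \<epsilon>[of n] by (intro ennreal_mult) auto
          finally show ?thesis using \<epsilon>[of n] by (simp add: inverse_ennreal)
        qed
        then show ?thesis unfolding L_def divide_ennreal_def by (simp only: mult_ac)
      qed
      finally show ?thesis .
    qed
    have r0: "(\<lambda>n. \<bar>a n - b n\<bar>) \<longlonglongrightarrow> 0"
    proof -
      have "(\<lambda>n. ennreal (4 * G * C0) * L n) \<longlonglongrightarrow> 0" using ennreal_tendsto_cmult[OF _ L0, of "ennreal (4 * G * C0)"] by simp
      then have "(\<lambda>n. ennreal \<bar>a n - b n\<bar>) \<longlonglongrightarrow> 0"
        by (rule tendsto_sandwich[OF _ _ tendsto_const, rotated 2]) (use ab in auto)
      then show ?thesis using tendsto_ennrealD[of "\<lambda>n. \<bar>a n - b n\<bar>" 0 sequentially] by simp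
    qed
    \<comment> \<open>\<open>b n\<close> is minus the cutoff energy of \<open>u\<close>, and
      \<open>a n\<close> is its counterpart for the competitor. The chain rule bounds
      \<open>- a n\<close> by \<open>X - Y\<close> plus the jump term, and \<open>X - Y\<close> is
      bounded by the energy \<open>I\<close>.\<close>
    have step: "Pn n \<le> \<bar>a n - b n\<bar> + ((l + \<delta>) * (2 * G) * h + I)" for n
    proof -
      define X where "X = (\<integral>x. \<theta> (v' x - c x) * (\<phi> n x \<bullet> g x) \<partial>lborel)"
      define Y where "Y = (LINT x:\<Omega>|lborel. \<theta> (v' x - c x) * (\<phi> n x \<bullet> C x))"
      have chain: "\<bar>a n + X - Y\<bar> \<le> (l + \<delta>) * (2 * G) * h"
        unfolding a_def X_def Y_def h_def
        by (rule sbv_chain_rule[OF \<Omega>(1) v'(1,2) \<mu> F rep g(1,2) sets_hausdorff_measure J eq jump cm Dc Cc T \<theta>abs Tl tf \<phi>B Hfin])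
      have \<phi>m: "\<phi> n \<in> borel_measurable borel" unfolding \<phi>gu[abs_def] by measurable
      have iX: "integrable lborel (\<lambda>x. \<theta> (v' x - c x) * (\<phi> n x \<bullet> g x))"
      proof (rule Bochner_Integration.integrable_bound[where f="\<lambda>x. (2 * G) * norm (g x)"])
        show "integrable lborel (\<lambda>x. (2 * G) * norm (g x))" using g(1) by (intro integrable_mult_right integrable_norm)
        show "(\<lambda>x. \<theta> (v' x - c x) * (\<phi> n x \<bullet> g x)) \<in> borel_measurable lborel" using \<phi>m by measurable
        have "norm (\<theta> (v' x - c x) * (\<phi> n x \<bullet> g x)) \<le> (2 * G) * norm (g x)" for x
        proof -
          have "\<bar>\<phi> n x \<bullet> g x\<bar> \<le> (2 * G) * norm (g x)"
            by (rule order_trans[OF Cauchy_Schwarz_ineq2 mult_right_mono[OF \<phi>B norm_ge_zero]])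
          then have "\<bar>\<theta> (v' x - c x)\<bar> * \<bar>\<phi> n x \<bullet> g x\<bar> \<le> 1 * ((2 * G) * norm (g x))"
            by (intro mult_mono \<theta>abs) auto
          then show ?thesis by (simp add: abs_mult)
        qed
        then show "AE x in lborel. norm (\<theta> (v' x - c x) * (\<phi> n x \<bullet> g x)) \<le> norm ((2 * G) * norm (g x))"
          by (intro AE_I2 norm_le_norm_real)
      qed
      have Yeq: "Y = (\<integral>x. \<theta> (v' x - c x) * (\<psi> n x * (norm (gu x))\<^sup>2) \<partial>lborel)"
        unfolding Y_def set_lebesgue_integral_def
        by (intro Bochner_Integration.integral_cong) (auto simp: indicator_def \<phi>gu gu_def C_def power2_norm_eq_inner)
      have iY: "integrable lborel (\<lambda>x. \<theta> (v' x - c x) * (\<psi> n x * (norm (gu x))\<^sup>2))"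
      proof (rule Bochner_Integration.integrable_bound[OF gu2])
        have "norm (\<theta> (v' x - c x) * (\<psi> n x * (norm (gu x))\<^sup>2)) \<le> (norm (gu x))\<^sup>2" for x
        proof -
          have "\<bar>\<theta> (v' x - c x)\<bar> * (\<bar>\<psi> n x\<bar> * (norm (gu x))\<^sup>2) \<le> 1 * (1 * (norm (gu x))\<^sup>2)"
            using \<psi>(3)[of n x] by (intro mult_mono \<theta>abs) auto
          then show ?thesis by (simp add: abs_mult)
        qed
        then show "AE x in lborel. norm (\<theta> (v' x - c x) * (\<psi> n x * (norm (gu x))\<^sup>2)) \<le> norm ((norm (gu x))\<^sup>2)"
          by (intro AE_I2 norm_le_norm_real)
      qed measurable
      have "X - Y = (\<integral>x. \<theta> (v' x - c x) * (\<phi> n x \<bullet> g x) - \<theta> (v' x - c x) * (\<psi> n x * (norm (gu x))\<^sup>2) \<partial>lborel)"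
        unfolding X_def Yeq using iX iY by simp
      also have "\<dots> \<le> I"
        unfolding I_def
      proof (rule integral_mono[OF Bochner_Integration.integrable_diff[OF iX iY] g2])
        fix x
        \<comment> \<open>Nonnegativity of \<open>|g - gu|^2\<close>. The weight \<open>?s\<close>
          in \<open>[0, 1]\<close> then does no harm, because \<open>|g|^2\<close> is nonnegative
          too.\<close>
        have sq: "2 * (gu x \<bullet> g x) - (norm (gu x))\<^sup>2 \<le> (norm (g x))\<^sup>2"
        proof -
          have "0 \<le> (norm (g x - gu x))\<^sup>2" by simp
          then show ?thesis unfolding power2_norm_eq_inner by (simp add: inner_diff_left inner_diff_right inner_commute)
        qed
        let ?s = "\<theta> (v' x - c x) * \<psi> n x"
        have s: "0 \<le> ?s" "?s \<le> 1" using \<theta>[of "v' x - c x"] \<psi>(3)[of n x] by (auto intro: mult_le_one)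
        have "\<theta> (v' x - c x) * (\<phi> n x \<bullet> g x) - \<theta> (v' x - c x) * (\<psi> n x * (norm (gu x))\<^sup>2)
            = ?s * (2 * (gu x \<bullet> g x) - (norm (gu x))\<^sup>2)"
          by (simp add: \<phi>gu algebra_simps)
        also have "\<dots> \<le> ?s * (norm (g x))\<^sup>2" using s(1) sq by (rule mult_left_mono[rotated])
        also have "\<dots> \<le> 1 * (norm (g x))\<^sup>2" using s(2) by (rule mult_right_mono) simp
        finally show "\<theta> (v' x - c x) * (\<phi> n x \<bullet> g x) - \<theta> (v' x - c x) * (\<psi> n x * (norm (gu x))\<^sup>2) \<le> (norm (g x))\<^sup>2" by simp
      qed
      finally have XY: "X - Y \<le> I" .
      show ?thesis using chain XY bP[of n] by linarith
    qed
    have "(\<lambda>n. \<bar>a n - b n\<bar> + ((l + \<delta>) * (2 * G) * h + I)) \<longlonglongrightarrow> 0 + ((l + \<delta>) * (2 * G) * h + I)"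
      by (intro tendsto_add r0 tendsto_const)
    from LIMSEQ_le[OF PnP this] step show ?thesis by simp
  qed
  \<comment> \<open>As \<open>\<delta>\<close> tends to zero, the jump coefficient
    \<open>2 * G * (l + \<delta>)\<close> tends to \<open>(M - m) * G\<close>, which the hypothesis
    bounds by 1.\<close>
  have "P \<le> h + I"
  proof (rule field_le_epsilon)
    fix e :: real assume e: "e > 0"
    \<comment> \<open>The summand 1 avoids division by zero when there is no jump or no
      gradient.\<close>
    define \<delta> where "\<delta> = e / (2 * G * h + 1)"
    have d: "2 * G * h + 1 > 0" using G0 h0 by (simp add: add_nonneg_pos)
    then have \<delta>: "\<delta> > 0" using e by (simp add: \<delta>_def)
    have "P \<le> (l + \<delta>) * (2 * G) * h + I" by (rule key[OF \<delta>])
    also have "(l + \<delta>) * (2 * G) * h = ((M - m) * G) * h + \<delta> * (2 * G * h)" by (simp add: l_def field_simps)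
    also have "((M - m) * G) * h \<le> 1 * h" using MG h0 by (rule mult_right_mono)
    also have "\<delta> * (2 * G * h) \<le> e" unfolding \<delta>_def using d e by (simp add: field_simps)
    finally show "P \<le> h + I + e" by simp
  qed
  have "(\<integral>\<^sup>+ x \<in> \<Omega>. ennreal ((norm (grad u x))\<^sup>2) \<partial>lborel) = (\<integral>\<^sup>+ x. ennreal ((norm (gu x))\<^sup>2) \<partial>lborel)"
    by (intro nn_integral_cong) (auto simp: gu_def indicator_def)
  also have "\<dots> = ennreal P" unfolding P_def using gu2 by (intro nn_integral_eq_integral) auto
  also have "\<dots> \<le> ennreal (h + I)" using \<open>P \<le> h + I\<close> by (rule ennreal_leI)
  also have "\<dots> = ennreal I + ennreal h" using h0 by (subst ennreal_plus[symmetric]) (auto simp: I_def add.commute)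
  also have "ennreal I = (\<integral>\<^sup>+ x. ennreal ((norm (g x))\<^sup>2) \<partial>lborel)" unfolding I_def using g2 by (intro nn_integral_eq_integral[symmetric]) auto
  also have "ennreal h = emeasure ?H {y. J y \<noteq> 0}" unfolding h_def using Hfin by (intro emeasure_eq_ennreal_measure[symmetric]) auto
  also have "(\<integral>\<^sup>+ x. ennreal ((norm (g x))\<^sup>2) \<partial>lborel) + emeasure ?H {y. J y \<noteq> 0} \<le> mumford_shah0 \<Omega> v"
    unfolding MS by (intro add_left_mono Hle)
  finally show ?thesis .
qed simp

theorem mainTheorem4:
  fixes \<Omega> :: "'a::euclidean_space set" and u :: "'a \<Rightarrow> real"
  assumes "open \<Omega>" and "bounded \<Omega>" and "lipschitz_boundary \<Omega>"
    and "harmonic_on \<Omega> u"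
    and "((SUP x\<in>\<Omega>. ereal (u x)) - (INF x\<in>\<Omega>. ereal (u x))) *
           (SUP x\<in>\<Omega>. ereal (norm (grad u x))) \<le> 1"
  shows "u \<in> SBV \<Omega> \<and>
    (\<forall>v\<in>SBV \<Omega>. same_trace \<Omega> u v \<longrightarrow> mumford_shah0 \<Omega> u \<le> mumford_shah0 \<Omega> v)"
proof -
  note \<Omega> = assms(1-3) and prod = assms(5)
  define S where "S = (SUP x\<in>\<Omega>. ereal (u x))"
  define R where "R = (INF x\<in>\<Omega>. ereal (u x))"
  define E where "E = (SUP x\<in>\<Omega>. ereal (norm (grad u x)))"
  have le: "(S - R) * E \<le> 1" using prod by (simp only: S_def R_def E_def)
  \<comment> \<open>On the empty set the supremum is \<open>- \<infinity>\<close> and the infimum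
    \<open>\<infinity>\<close>, so the product in the hypothesis is \<open>\<infinity>\<close> and
    the hypothesis fails.\<close>
  have ne: "\<Omega> \<noteq> {}"
  proof
    assume "\<Omega> = {}"
    then have "S = - \<infinity>" "R = \<infinity>" "E = - \<infinity>" by (simp_all add: S_def R_def E_def bot_ereal_def top_ereal_def)
    with le show False by simp
  qed
  then obtain x0 where x0: "x0 \<in> \<Omega>" by auto
  have uS: "ereal (u x) \<le> S" and Ru: "R \<le> ereal (u x)" and gE: "ereal (norm (grad u x)) \<le> E" if "x \<in> \<Omega>" for x
    using that by (auto simp: S_def R_def E_def intro: SUP_upper INF_lower)
  have E0: "0 \<le> E" using gE[OF x0] order_trans[of 0 "ereal (norm (grad u x0))"] by simp
  have C1: "C1_on \<Omega> u" using assms(4) by (simp add: harmonic_on_def)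
  have Du: "x \<in> \<Omega> \<Longrightarrow> (u has_derivative (\<lambda>h. h \<bullet> grad u x)) (at x)" for x
    using C1 by (intro has_derivative_grad) (simp add: C1_on_def)
  show ?thesis
  proof (cases "E = 0")
    \<comment> \<open>With \<open>\<infinity> * 0 = 0\<close> the hypothesis gives no bound on
      \<open>u\<close> here. The function is locally constant, its energy is zero, and integrability
      comes from \<open>locally_constant_bounded\<close>.\<close>
    case True
    then have g0: "grad u x = 0" if "x \<in> \<Omega>" for x using gE[OF that] by simp
    have D0: "(u has_derivative (\<lambda>h. 0)) (at x)" if "x \<in> \<Omega>" for x using Du[OF that] g0[OF that] by simp
    obtain B where B: "\<And>x. x \<in> \<Omega> \<Longrightarrow> \<bar>u x\<bar> \<le> B"
      by (rule locally_constant_bounded[OF \<Omega> D0]) (auto intro: that)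
    have G: "norm (grad u x) \<le> 0" if "x \<in> \<Omega>" for x using g0[OF that] by simp
    have "mumford_shah0 \<Omega> u = (\<integral>\<^sup>+ x \<in> \<Omega>. ennreal ((norm (grad u x))\<^sup>2) \<partial>lborel)"
      by (rule sbv_of_C1_bounded(2)[OF \<Omega>(1,2) C1 B G])
    also have "\<dots> = (\<integral>\<^sup>+ x. 0 \<partial>(lborel :: 'a measure))"
      by (intro nn_integral_cong) (auto simp: indicator_def g0)
    finally have "mumford_shah0 \<Omega> u = 0" by simp
    then show ?thesis using sbv_of_C1_bounded(1)[OF \<Omega>(1,2) C1 B G] by simp
  next
    case False
    then have Epos: "0 < E" using E0 by simp
    have SR: "S \<noteq> - \<infinity>" "R \<noteq> \<infinity>" using uS[OF x0] Ru[OF x0] by auto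
    have "S \<noteq> \<infinity> \<and> R \<noteq> - \<infinity>"
    proof (rule ccontr)
      assume "\<not> (S \<noteq> \<infinity> \<and> R \<noteq> - \<infinity>)"
      then have "S - R = \<infinity>" using SR by (cases S; cases R) auto
      then show False using le Epos False by simp
    qed
    then obtain M m where MR: "S = ereal M" "R = ereal m" using SR by (cases S; cases R) auto
    have um: "m \<le> u x" and uM: "u x \<le> M" if "x \<in> \<Omega>" for x using uS[OF that] Ru[OF that] by (simp_all add: MR)
    \<comment> \<open>An infinite gradient bound would force zero oscillation, hence a constant
      \<open>u\<close> and a vanishing gradient.\<close>
    have "E \<noteq> \<infinity>"
    proof
      assume Einf: "E = \<infinity>"
      have "M - m = 0"
      proof (rule ccontr)
        assume "M - m \<noteq> 0"
        then have "M - m > 0" using um[OF x0] uM[OF x0] by linarith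
        then show False using le by (simp add: MR Einf)
      qed
      then have const: "u x = m" if "x \<in> \<Omega>" for x using um[OF that] uM[OF that] by simp
      have "grad u x = 0" if "x \<in> \<Omega>" for x
      proof (rule grad_eqI)
        have "(u has_derivative (\<lambda>h. 0)) (at x)"
          by (rule has_derivative_transform_within_open[OF has_derivative_const \<Omega>(1) that]) (simp add: const)
        then show "(u has_derivative (\<lambda>h. h \<bullet> 0)) (at x)" by simp
      qed
      then have "E = (SUP x\<in>\<Omega>. ereal 0)" unfolding E_def by (intro SUP_cong) auto
      then show False using False ne by simp
    qed
    then obtain G where EG: "E = ereal G" using Epos by (cases E) auto
    have G: "norm (grad u x) \<le> G" if "x \<in> \<Omega>" for x using gE[OF that] by (simp add: EG)
    have MG: "(M - m) * G \<le> 1" using le by (simp add: MR EG)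
    have B: "\<bar>u x\<bar> \<le> \<bar>M\<bar> + \<bar>m\<bar>" if "x \<in> \<Omega>" for x using um[OF that] uM[OF that] by linarith
    show ?thesis
      using sbv_of_C1_bounded[OF \<Omega>(1,2) C1 B G] dirichlet_energy_le[OF \<Omega> ne assms(4) um uM G MG] by auto
  qed
qed

end
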